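(* Let $\Theta:[0,\infty)\to[0,\infty)$ be a function which decreases to zero as $\lambda\to\infty$ and satisfies $\int_1^\infty \Theta(t)\,t^{-1}\,dt=\infty$. Let $f$ be an integrable function on the Heisenberg group $\mathbb{H}^n$ for which there is a constant $C>0$ such that the group Fourier transform $\widehat f$ satisfies $$\widehat f(\lambda)^{*}\,\widehat f(\lambda)\le C\,e^{-2\,\Theta(\sqrt{H(\lambda)})\,\sqrt{H(\lambda)}}\qquad\text{for all }\lambda\in\mathbb{R}\setminus\{0\}.$$ If for every $\lambda\neq0$ there exists a nonempty open set $U_\lambda\subset\mathbb{C}^n$ on which $f^\lambda$ vanishes, then $f=0$.
   Context: The Heisenberg group is $\mathbb{H}^n=\mathbb{C}^n\times\mathbb{R}$ with group law $(z,t)(w,s)=\big(z+w,\;t+s+\tfrac12\Im(z\cdot\bar w)\big)$ and Haar measure the Lebesgue measure $dz\,dt$. For $\lambda\in\mathbb{R}\setminus\{0\}$ the Schr\"odinger representation $\pi_\lambda$ of $\mathbb{H}^n$ on $L^2(\mathbb{R}^n)$ is $$\pi_\lambda(z,t)\varphi(\xi)=e^{i\lambda t}e^{i\lambda(x\cdot\xi+\frac12 x\cdot y)}\varphi(\xi+y),\qquad z=x+iy .$$ For $f\in L^1(\mathbb{H}^n)$ the group Fourier transform is the operator-valued function $\widehat f(\lambda)=\int_{\mathbb{H}^n}f(z,t)\,\pi_\lambda(z,t)\,dz\,dt$, a bounded operator on $L^2(\mathbb{R}^n)$ for each $\lambda\ne0$. The function $f^\lambda$ on $\mathbb{C}^n$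 is the inverse Fourier transform of $f$ in the central variable, $f^\lambda(z)=\int_{-\infty}^\infty e^{i\lambda t}f(z,t)\,dt$. $H(\lambda)=-\Delta_{\mathbb{R}^n}+\lambda^2|x|^2$ is the scaled Hermite operator on $L^2(\mathbb{R}^n)$; it has an orthonormal eigenbasis (the scaled Hermite functions $\Phi_\alpha^\lambda$, $\alpha\in\mathbb{N}^n$, with $0\in\mathbb{N}$) with eigenvalues $(2|\alpha|+n)|\lambda|$, and functions of $H(\lambda)$ are defined by the spectral theorem. The inequality $A\le B$ between bounded self-adjoint operators means $\langle A\varphi,\varphi\rangle\le\langle B\varphi,\varphi\rangle$ for all $\varphi\in L^2(\mathbb{R}^n)$. Elements of $L^1(\mathbb{H}^n)$ are identified when equal almost everywhere. *)

theory Defs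
  imports "HOL-Analysis.Analysis" "HOL-Computational_Algebra.Polynomial"
begin

unbundle no fps_syntax

section \<open>The Heisenberg group and its Schroedinger representations\<close>

text \<open>
  The Haar measure is \<open>lborel\<close> on the product type, i.e. \<open>dx dy dt\<close> for \<open>z = x + iy\<close>.
\<close>

type_synonym 'n heis = "(complex ^ 'n) \<times> real"

definition re_vec :: "complex ^ 'n \<Rightarrow> real ^ 'n" where
  "re_vec z = (\<chi> j. Re (z $ j))"

definition im_vec :: "complex ^ 'n \<Rightarrow> real ^ 'n" where
  "im_vec z = (\<chi> j. Im (z $ j))"

definition heis_mult :: "'n::finite heis \<Rightarrow> 'n heis \<Rightarrow> 'n heis" where
  "heis_mult = (\<lambda>(z, t) (w, s). (z + w, t + s + Im (\<Sum>j\<in>UNIV. z $ j * cnj (w $ j)) / 2))"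

definition schroedinger ::
    "real \<Rightarrow> 'n::finite heis \<Rightarrow> (real ^ 'n \<Rightarrow> complex) \<Rightarrow> real ^ 'n \<Rightarrow> complex" where
  "schroedinger lam = (\<lambda>(z, t) \<phi> \<xi>.
     exp (\<i> * of_real (lam * t))
     * exp (\<i> * of_real (lam * (re_vec z \<bullet> \<xi> + (re_vec z \<bullet> im_vec z) / 2)))
     * \<phi> (\<xi> + im_vec z))"

lemma schroedinger_heis_mult:
  "schroedinger lam (heis_mult g h) \<phi> = schroedinger lam g (schroedinger lam h \<phi>)"
proof -
  obtain z t w s where gh: "g = (z, t)" "h = (w, s)" by (metis prod.collapse)
  have re: "re_vec (z + w) = re_vec z + re_vec w" and im: "im_vec (z + w) = im_vec z + im_vec w"
    by (simp_all add: re_vec_def im_vec_def vec_eq_iff)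
  have tw: "Im (\<Sum>j\<in>UNIV. z $ j * cnj (w $ j)) = re_vec w \<bullet> im_vec z - re_vec z \<bullet> im_vec w"
    by (simp add: re_vec_def im_vec_def inner_vec_def sum_subtractf[symmetric] algebra_simps)
  show ?thesis
    unfolding gh schroedinger_def heis_mult_def prod.case re im tw
    by (rule ext) (simp add: exp_add[symmetric] algebra_simps inner_add_left inner_add_right
        add_divide_distrib diff_divide_distrib)
qed

section \<open>The Hilbert space of square-integrable functions\<close>

text \<open>
  Elements of \<open>L\<^sup>2(\<real>\<^sup>n)\<close> are represented by Borel functions; an operator is a map on
  representatives, its values being meaningful up to null sets.  Every notion below in which
  such values are used is invariant under changes on null sets.
\<close>

definition L2 :: "('a::euclidean_space \<Rightarrow> complex) set" where
  "L2 = {\<phi>. \<phi> \<in> borel_measurable lborel \<and> integrable lborel (\<lambda>x. (cmod (\<phi> x))\<^sup>2)}"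

definition l2_inner ::
    "('a::euclidean_space \<Rightarrow> complex) \<Rightarrow> ('a \<Rightarrow> complex) \<Rightarrow> complex" where
  "l2_inner \<phi> \<psi> = (LINT x|lborel. \<phi> x * cnj (\<psi> x))"

definition l2_norm :: "('a::euclidean_space \<Rightarrow> complex) \<Rightarrow> real" where
  "l2_norm \<phi> = sqrt (LINT x|lborel. (cmod (\<phi> x))\<^sup>2)"

definition l2_has_sum ::
    "('i \<Rightarrow> 'a::euclidean_space \<Rightarrow> complex) \<Rightarrow> ('a \<Rightarrow> complex) \<Rightarrow> bool" where
  "l2_has_sum g \<psi> \<longleftrightarrow> \<psi> \<in> L2 \<and>
     ((\<lambda>F. l2_norm (\<lambda>x. \<psi> x - (\<Sum>a\<in>F. g a x))) \<longlongrightarrow> 0) (finite_subsets_at_top UNIV)"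

type_synonym 'a l2_op = "('a \<Rightarrow> complex) \<Rightarrow> 'a \<Rightarrow> complex"

text \<open>
  For a bounded operator the adjoint exists by the Riesz representation theorem and its values
  are unique up to null sets.
\<close>

definition l2_adjoint :: "'a::euclidean_space l2_op \<Rightarrow> 'a l2_op" where
  "l2_adjoint T = (SOME S. (\<forall>\<psi>\<in>L2. S \<psi> \<in> L2) \<and>
     (\<forall>\<phi>\<in>L2. \<forall>\<psi>\<in>L2. l2_inner (T \<phi>) \<psi> = l2_inner \<phi> (S \<psi>)))"

text \<open>
  The inner products compared here are real when the operators are self-adjoint; \<open>Re\<close> only
  changes the type.
\<close>

definition l2_op_le :: "'a::euclidean_space l2_op \<Rightarrow> 'a l2_op \<Rightarrow> bool" where
  "l2_op_le A B \<longleftrightarrow> (\<forall>\<phi>\<in>L2. Re (l2_inner (A \<phi>) \<phi>) \<le> Re (l2_inner (B \<phi>) \<phi>))"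

section \<open>Fourier transforms\<close>

text \<open>
  The operator-valued integral is evaluated pointwise: for integrable \<open>f\<close> and \<open>\<phi>\<close> in \<open>L2\<close> the
  integral converges absolutely for almost every \<open>\<xi>\<close>.
\<close>

definition group_fourier ::
    "('n::finite heis \<Rightarrow> complex) \<Rightarrow> real \<Rightarrow> (real ^ 'n) l2_op" where
  "group_fourier f lam \<phi> \<xi> = (LINT g|lborel. f g * schroedinger lam g \<phi> \<xi>)"

definition central_fourier ::
    "('n::finite heis \<Rightarrow> complex) \<Rightarrow> real \<Rightarrow> complex ^ 'n \<Rightarrow> complex" where
  "central_fourier f lam z = (LINT t|lborel. exp (\<i> * of_real (lam * t)) * f (z, t))"

section \<open>The scaled Hermite operator and its functional calculus\<close>

definition laplacian :: "(real ^ 'n::finite \<Rightarrow> complex) \<Rightarrow> real ^ 'n \<Rightarrow> complex" where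
  "laplacian \<phi> x = (\<Sum>j\<in>UNIV.
     vector_derivative
       (\<lambda>s. vector_derivative (\<lambda>r. \<phi> (x + r *\<^sub>R axis j 1)) (at s)) (at 0))"

definition hermite_operator :: "real \<Rightarrow> (real ^ 'n::finite) l2_op" where
  "hermite_operator lam \<phi> x = - laplacian \<phi> x + of_real (lam\<^sup>2 * (norm x)\<^sup>2) * \<phi> x"

text \<open>
  The recursion is Rodrigues' formula \<open>H\<^sub>k(x) = (-1)\<^sup>k exp(x\<^sup>2) (d/dx)\<^sup>k exp(-x\<^sup>2)\<close>
  (physicists' convention) differentiated once.
\<close>

primrec hermite_poly :: "nat \<Rightarrow> real poly" where
  "hermite_poly 0 = 1"
| "hermite_poly (Suc k) = [:0, 2:] * hermite_poly k - pderiv (hermite_poly k)"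

definition hermite_function :: "nat \<Rightarrow> real \<Rightarrow> real" where
  "hermite_function k x =
     poly (hermite_poly k) x * exp (- (x\<^sup>2) / 2) / sqrt (2 ^ k * fact k * sqrt pi)"

definition scaled_hermite :: "real \<Rightarrow> nat ^ 'n::finite \<Rightarrow> real ^ 'n \<Rightarrow> complex" where
  "scaled_hermite lam \<alpha> x = of_real (\<bar>lam\<bar> powr (real CARD('n) / 4) *
     (\<Prod>j\<in>UNIV. hermite_function (\<alpha> $ j) (sqrt \<bar>lam\<bar> * x $ j)))"

definition hermite_eigenvalue :: "real \<Rightarrow> nat ^ 'n::finite \<Rightarrow> real" where
  "hermite_eigenvalue lam \<alpha> = real (2 * (\<Sum>j\<in>UNIV. \<alpha> $ j) + CARD('n)) * \<bar>lam\<bar>"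

lemma hermite_poly_ode:
  "pderiv (pderiv (hermite_poly k)) =
     [:0, 2:] * pderiv (hermite_poly k) - of_nat (2 * k) * hermite_poly k"
proof (induction k)
  case 0
  show ?case by simp
next
  case (Suc k)
  have d: "pderiv (hermite_poly (Suc k)) = of_nat (2 * Suc k) * hermite_poly k"
  proof -
    have "pderiv (hermite_poly (Suc k)) =
        2 * hermite_poly k + [:0, 2:] * pderiv (hermite_poly k) - pderiv (pderiv (hermite_poly k))"
      by (simp add: pderiv_diff pderiv_mult pderiv_pCons pderiv_smult numeral_poly)
    then show ?thesis by (simp add: Suc.IH algebra_simps)
  qed
  have "pderiv (pderiv (hermite_poly (Suc k))) = of_nat (2 * Suc k) * pderiv (hermite_poly k)"
    unfolding d pderiv_mult pderiv_of_nat by simp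
  then show ?case unfolding d by (simp add: algebra_simps)
qed

lemma hermite_function_has_derivatives:
  fixes k :: nat
  defines "h' \<equiv> \<lambda>u. (poly (pderiv (hermite_poly k)) u - u * poly (hermite_poly k) u)
      * exp (- (u\<^sup>2) / 2) / sqrt (2 ^ k * fact k * sqrt pi)"
  shows "(hermite_function k has_real_derivative h' u) (at u)"
    and "(h' has_real_derivative (u\<^sup>2 - 1 - 2 * real k) * hermite_function k u) (at u)"
proof -
  define N where "N = sqrt (2 ^ k * fact k * sqrt pi)"
  have N: "N > 0" unfolding N_def by simp
  have P: "poly (pderiv (pderiv (hermite_poly k))) u =
      2 * u * poly (pderiv (hermite_poly k)) u - 2 * real k * poly (hermite_poly k) u"
    by (subst hermite_poly_ode) (simp add: algebra_simps)
  show "(hermite_function k has_real_derivative h' u) (at u)"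
    unfolding hermite_function_def[abs_def] h'_def N_def[symmetric]
    using N by (auto intro!: derivative_eq_intros poly_DERIV simp: field_simps)
  show "(h' has_real_derivative (u\<^sup>2 - 1 - 2 * real k) * hermite_function k u) (at u)"
    unfolding hermite_function_def[abs_def] h'_def N_def[symmetric]
    using N
    by (auto intro!: derivative_eq_intros poly_DERIV
        simp: P field_simps power2_eq_square)
qed

lemma hermite_operator_scaled_hermite:
  fixes \<alpha> :: "nat ^ 'n::finite"
  shows "hermite_operator lam (scaled_hermite lam \<alpha>) x =
    of_real (hermite_eigenvalue lam \<alpha>) * scaled_hermite lam \<alpha> x"
proof -
  define c where "c = sqrt \<bar>lam\<bar>"
  have c2: "c\<^sup>2 = \<bar>lam\<bar>" by (simp add: c_def)
  have line: "vector_derivative (\<lambda>s. vector_derivative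
        (\<lambda>r. scaled_hermite lam \<alpha> (x + r *\<^sub>R axis j 1)) (at s)) (at 0) =
      of_real (\<bar>lam\<bar> * (\<bar>lam\<bar> * (x $ j)\<^sup>2 - 1 - 2 * real (\<alpha> $ j))) * scaled_hermite lam \<alpha> x"
    for j
  proof -
    define h where "h = hermite_function (\<alpha> $ j)"
    obtain h' where h': "\<And>u. (h has_real_derivative h' u) (at u)"
      "\<And>u. (h' has_real_derivative (u\<^sup>2 - 1 - 2 * real (\<alpha> $ j)) * h u) (at u)"
    proof -
      have "\<exists>h'. (\<forall>u. (h has_real_derivative h' u) (at u)) \<and>
          (\<forall>u. (h' has_real_derivative (u\<^sup>2 - 1 - 2 * real (\<alpha> $ j)) * h u) (at u))"
        unfolding h_def
        by (intro exI conjI allI) (rule hermite_function_has_derivatives)+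
      then show thesis using that by blast
    qed
    define K where "K = \<bar>lam\<bar> powr (real CARD('n) / 4) *
      (\<Prod>i\<in>UNIV - {j}. hermite_function (\<alpha> $ i) (c * x $ i))"
    have eq: "scaled_hermite lam \<alpha> (x + r *\<^sub>R axis j 1) = of_real (K * h (c * (x $ j + r)))" for r
    proof -
      have "(\<Prod>i\<in>UNIV. hermite_function (\<alpha> $ i) (c * (x + r *\<^sub>R axis j 1) $ i)) =
          h (c * (x $ j + r)) * (\<Prod>i\<in>UNIV - {j}. hermite_function (\<alpha> $ i) (c * x $ i))"
        by (subst prod.remove[of UNIV j]) (auto simp: h_def axis_def intro!: prod.cong)
      then show ?thesis unfolding scaled_hermite_def c_def[symmetric] K_def by simp
    qed
    have "((\<lambda>r. K * h (c * (x $ j + r))) has_real_derivative K * (h' (c * (x $ j + s)) * c)) (at s)"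
      for s
      by (rule DERIV_cmult, rule DERIV_chain2[OF h'(1)]) (auto intro!: derivative_eq_intros)
    then have 1: "vector_derivative (\<lambda>r. scaled_hermite lam \<alpha> (x + r *\<^sub>R axis j 1)) (at s) =
        of_real (K * (h' (c * (x $ j + s)) * c))" for s
      unfolding eq
      by (intro vector_derivative_at has_vector_derivative_of_real)
        (simp add: has_real_derivative_iff_has_vector_derivative)
    have "((\<lambda>s. K * (h' (c * (x $ j + s)) * c)) has_real_derivative
        K * ((((c * (x $ j + 0))\<^sup>2 - 1 - 2 * real (\<alpha> $ j)) * h (c * (x $ j + 0))) * c * c)) (at 0)"
      by (rule DERIV_cmult, rule DERIV_cmult_right, rule DERIV_chain2[OF h'(2)])
        (auto intro!: derivative_eq_intros)
    then have "vector_derivative (\<lambda>s. complex_of_real (K * (h' (c * (x $ j + s)) * c))) (at 0) =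
        of_real (K * ((((c * (x $ j + 0))\<^sup>2 - 1 - 2 * real (\<alpha> $ j)) * h (c * (x $ j + 0))) * c * c))"
      by (intro vector_derivative_at has_vector_derivative_of_real)
        (simp add: has_real_derivative_iff_has_vector_derivative)
    also have "\<dots> = of_real ((c\<^sup>2 * (c\<^sup>2 * (x $ j)\<^sup>2 - 1 - 2 * real (\<alpha> $ j))) * (K * h (c * (x $ j + 0))))"
      by (rule arg_cong[of _ _ of_real]) (simp add: power2_eq_square algebra_simps)
    finally show ?thesis unfolding 1 c2 using eq[of 0] by simp
  qed
  have "(norm x)\<^sup>2 = (\<Sum>j\<in>UNIV. (x $ j)\<^sup>2)"
    by (simp add: norm_vec_def L2_set_def sum_nonneg)
  moreover have "(\<Sum>j\<in>UNIV. \<bar>lam\<bar> * (\<bar>lam\<bar> * (x $ j)\<^sup>2 - 1 - 2 * real (\<alpha> $ j))) =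
      lam\<^sup>2 * (\<Sum>j\<in>UNIV. (x $ j)\<^sup>2) - hermite_eigenvalue lam \<alpha>"
  proof -
    have "(\<Sum>j\<in>UNIV. \<bar>lam\<bar> * (\<bar>lam\<bar> * (x $ j)\<^sup>2 - 1 - 2 * real (\<alpha> $ j))) =
        \<bar>lam\<bar> * (\<bar>lam\<bar> * (\<Sum>j\<in>UNIV. (x $ j)\<^sup>2) - real CARD('n) - 2 * (\<Sum>j\<in>UNIV. real (\<alpha> $ j)))"
      by (simp add: sum_distrib_left[symmetric] sum_subtractf)
    also have "\<dots> = \<bar>lam\<bar> * \<bar>lam\<bar> * (\<Sum>j\<in>UNIV. (x $ j)\<^sup>2) -
        (2 * (\<Sum>j\<in>UNIV. real (\<alpha> $ j)) + real CARD('n)) * \<bar>lam\<bar>"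
      by (simp only: algebra_simps)
    finally show ?thesis by (simp add: hermite_eigenvalue_def power2_eq_square)
  qed
  ultimately have lap: "laplacian (scaled_hermite lam \<alpha>) x =
      of_real (lam\<^sup>2 * (norm x)\<^sup>2 - hermite_eigenvalue lam \<alpha>) * scaled_hermite lam \<alpha> x"
    unfolding laplacian_def line
    by (simp only: sum_distrib_right[symmetric] of_real_sum[symmetric])
  show ?thesis unfolding hermite_operator_def lap by (simp add: algebra_simps)
qed

text \<open>
  The operator \<open>m(H(\<lambda>))\<close> of the spectral theorem, \<open>H(\<lambda>)\<close> being diagonal in the orthonormal
  basis of scaled Hermite functions.  For bounded \<open>m\<close> the series converges in \<open>L\<^sup>2\<close>, so the
  choice below is determined up to null sets.
\<close>

definition hermite_calculus ::
    "(real \<Rightarrow> complex) \<Rightarrow> real \<Rightarrow> (real ^ 'n::finite) l2_op" where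
  "hermite_calculus m lam \<phi> = (SOME \<psi>. l2_has_sum
     (\<lambda>\<alpha> x. m (hermite_eigenvalue lam \<alpha>) * l2_inner \<phi> (scaled_hermite lam \<alpha>)
        * scaled_hermite lam \<alpha> x) \<psi>)"

end

theory Submission
  imports Defs "HOL-Probability.Probability" "HOL-Complex_Analysis.Complex_Analysis" "HOL-Real_Asymp.Real_Asymp"
begin

text \<open>
  Fix \<open>\<lambda> \<noteq> 0\<close>, let \<open>F = f\<^sup>\<lambda>\<close>, and let \<open>W\<close> denote the Weyl transform, so that the Fourier transform of
  \<open>f\<close> at \<open>\<lambda>\<close> is \<open>W(F)\<close> and the hypothesis becomes
  \<open>\<parallel>W(F) \<Phi>\<^sub>\<alpha>\<parallel>\<^sup>2 \<le> C exp(-2 \<Theta>(\<surd>\<mu>) \<surd>\<mu>)\<close> for the scaled Hermite function \<open>\<Phi>\<^sub>\<alpha>\<close> with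
  eigenvalue \<open>\<mu> = \<mu>\<^sub>\<alpha>\<close>.  The argument pairs \<open>F\<close> with a test function \<open>\<rho>\<close> supported inside the open
  set where \<open>F\<close> vanishes, and studies the numbers \<open>a\<^sub>\<alpha> = \<langle>W(F) \<Phi>\<^sub>\<alpha>, W(\<rho>) \<Phi>\<^sub>\<alpha>\<rangle>\<close>.

  The Abel sums of \<open>a\<^sub>\<alpha>\<close> can be computed: Mehler's formula turns \<open>\<Sum> r\<^bsup>|\<alpha>|\<^esup> a\<^sub>\<alpha>\<close> into the integral of
  \<open>F(z)\<close> times the conjugate of \<open>\<rho>(w)\<close> against a twisted Gaussian kernel of width \<open>\<surd>(1 - r)\<close>
  (\<open>abel_sum_l2_inner_weyl\<close>).  The supports of \<open>F\<close> and \<open>\<rho>\<close> have positive distance, so the sum is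
  \<open>O(exp(-c/(1 - r)))\<close> as \<open>r\<close> tends to \<open>1\<close>.  In other words the Laplace transform
  \<open>\<Sum> a\<^sub>\<alpha> exp(-\<tau> \<mu>\<^sub>\<alpha>)\<close> is flat at \<open>\<tau> = 0\<close>, and hence all moments \<open>\<Sum> a\<^sub>\<alpha> \<mu>\<^sub>\<alpha>\<^sup>k\<close> vanish.

  The divergence of \<open>\<integral> \<Theta>(t)/t dt\<close> is what makes this moment problem determinate.  Since \<open>\<Theta>\<close> is only
  monotone, \<open>exp(-\<Theta>(t) t)\<close> alone does not control the absolute moments: \<open>\<Theta>(t) t\<close> may fail to grow.
  The test function is therefore taken of Gevrey class, which supplies an independent decay of \<open>a\<^sub>\<alpha>\<close>
  at very high energies, and the two estimates together give Carleman's condition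
  (\<open>flat_laplace_transform_vanishes\<close>).  Bang's argument for the Denjoy-Carleman theorem
  (\<open>bang_quasianalytic\<close>) then shows that \<open>\<Sum> a\<^sub>\<alpha> exp(-\<tau> \<mu>\<^sub>\<alpha>)\<close> vanishes for all \<open>\<tau> > 0\<close>.

  Letting \<open>\<rho>\<close> shrink to a point, the twisted convolution of \<open>F\<close> with a Gaussian vanishes on an open
  set (\<open>heat_transform_vanishes\<close>).  That convolution extends to an entire function, whose values at
  suitable complex points are the Fourier transform of \<open>F\<close> times a Gaussian; so \<open>F = 0\<close>
  (\<open>AE_zero_if_heat_transform_vanishes\<close>).  As this holds for all \<open>\<lambda> \<noteq> 0\<close>, the Fourier transform of
  \<open>f\<close> vanishes off a hyperplane, hence everywhere, and \<open>f = 0\<close>.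
\<close>

section \<open>Quasianalyticity and the Stieltjes moment problem\<close>

lemma norm_integral_le_integral:
  fixes f :: "'a \<Rightarrow> 'b::{banach, second_countable_topology}"
  assumes "integrable M g" "f \<in> borel_measurable M" "\<And>w. norm (f w) \<le> g w"
  shows "norm (LINT w|M. f w) \<le> (LINT w|M. g w)"
proof -
  have "integrable M f"
    using assms by (intro Bochner_Integration.integrable_bound[OF assms(1)]) (auto intro: order_trans[OF _ abs_ge_self])
  then show ?thesis
    using assms by (intro order_trans[OF integral_norm_bound] integral_mono integrable_norm)
qed

text \<open>
  The induction step of Bang's proof.  The sequence \<open>G k\<close> plays the role of the successive derivatives
  of one function.  Expanding \<open>G k\<close> at \<open>x\<close> up to order \<open>Suc N - k\<close>, the terms are controlled by the
  smallness at \<open>x\<close> and the remainder by \<open>M (Suc N)\<close>; a step of length \<open>M N / (e M (Suc N))\<close> costs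
  only one factor \<open>e\<close>.
\<close>

lemma bang_step:
  fixes G :: "nat \<Rightarrow> real \<Rightarrow> complex" and M :: "nat \<Rightarrow> real"
  assumes pos: "\<And>k. M k > 0"
    and logconvex: "\<And>k. M (Suc k) * M (Suc k) \<le> M k * M (Suc (Suc k))"
    and taylor: "\<And>k n x h. cmod (G k (x + h) - (\<Sum>i<n. G (k + i) x * of_real (h ^ i / fact i)))
      \<le> M (k + n) * \<bar>h\<bar> ^ n / fact n"
    and small: "\<And>k. cmod (G k x) \<le> exp (real k - real (Suc N)) * M k"
    and h: "\<bar>h\<bar> \<le> M N / (exp 1 * M (Suc N))"
  shows "cmod (G k (x + h)) \<le> exp (real k - real N) * M k"
proof -
  define r where "r = M (Suc N) / M N"
  have rpos: "r > 0" using pos by (simp add: r_def)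
  have ratio_mono: "M (Suc i) / M i \<le> M (Suc j) / M j" if "i \<le> j" for i j
    using that
  proof (induction j rule: dec_induct)
    case (step j)
    have "M (Suc j) / M j \<le> M (Suc (Suc j)) / M (Suc j)"
      using logconvex[of j] pos[of j] pos[of "Suc j"] by (simp add: field_simps)
    then show ?case using step by linarith
  qed simp
  have grow: "M (k + i) \<le> M k * r ^ i" if "k + i \<le> Suc N" for i
    using that
  proof (induction i)
    case (Suc i)
    have "M (k + Suc i) \<le> M (k + i) * r"
      using ratio_mono[of "k + i" N] Suc.prems pos[of "k + i"] by (simp add: r_def field_simps)
    also have "\<dots> \<le> (M k * r ^ i) * r"
      using Suc rpos by (intro mult_right_mono) auto
    finally show ?case by (simp add: mult_ac)
  qed simp
  show ?thesis
  proof (cases "k \<le> Suc N")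
    case True
    define n where "n = Suc N - k"
    have kn: "k + n = Suc N" using True by (simp add: n_def)
    define y where "y = exp 1 * r * \<bar>h\<bar>"
    have y1: "y \<le> 1" and y0: "y \<ge> 0"
      using h rpos pos[of N] pos[of "Suc N"] by (auto simp: y_def r_def field_simps)
    define c where "c = exp (real k - real (Suc N)) * M k"
    have c0: "c > 0" using pos by (simp add: c_def)
    have summand: "cmod (G (k + i) x * of_real (h ^ i / fact i)) \<le> c * (y ^ i / fact i)" if "i < n" for i
    proof -
      have "M (k + i) \<le> M k * r ^ i" using that kn by (intro grow) simp
      then have "exp (real (k + i) - real (Suc N)) * M (k + i) \<le> exp (real (k + i) - real (Suc N)) * (M k * r ^ i)"
        by (intro mult_left_mono) auto
      then have "cmod (G (k + i) x) \<le> exp (real (k + i) - real (Suc N)) * (M k * r ^ i)"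
        using small[of "k + i"] by linarith
      then have "cmod (G (k + i) x) * (\<bar>h\<bar> ^ i / fact i)
          \<le> exp (real (k + i) - real (Suc N)) * (M k * r ^ i) * (\<bar>h\<bar> ^ i / fact i)"
        by (intro mult_right_mono) auto
      also have "exp (real (k + i) - real (Suc N)) = exp (real k - real (Suc N)) * exp 1 ^ i"
        by (simp add: exp_add[symmetric] exp_of_nat_mult[symmetric] algebra_simps)
      finally show ?thesis
        by (simp add: norm_mult norm_divide norm_power c_def y_def power_mult_distrib mult_ac)
    qed
    have rest: "M (k + n) * \<bar>h\<bar> ^ n / fact n \<le> c * (y ^ n / fact n)"
    proof -
      have "M (k + n) * \<bar>h\<bar> ^ n \<le> (M k * r ^ n) * \<bar>h\<bar> ^ n"
        using grow[of n] kn by (intro mult_right_mono) auto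
      also have "\<dots> = c * y ^ n"
      proof -
        have "exp (real k - real (Suc N)) * exp 1 ^ n = 1"
          using kn by (simp add: exp_of_nat_mult[symmetric] exp_add[symmetric])
        then have "M k * r ^ n * \<bar>h\<bar> ^ n = (exp (real k - real (Suc N)) * exp 1 ^ n) * (M k * r ^ n * \<bar>h\<bar> ^ n)"
          by simp
        then show ?thesis unfolding c_def y_def power_mult_distrib by (simp only: mult_ac)
      qed
      finally show ?thesis by (simp add: divide_right_mono)
    qed
    have "cmod (G k (x + h)) \<le> cmod (\<Sum>i<n. G (k + i) x * of_real (h ^ i / fact i))
        + M (k + n) * \<bar>h\<bar> ^ n / fact n"
      using taylor[of k x h n]
        norm_triangle_sub[of "G k (x + h)" "\<Sum>i<n. G (k + i) x * of_real (h ^ i / fact i)"] by linarith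
    also have "\<dots> \<le> (\<Sum>i<n. c * (y ^ i / fact i)) + c * (y ^ n / fact n)"
      using summand rest by (intro add_mono order_trans[OF norm_sum] sum_mono) auto
    also have "\<dots> = c * (\<Sum>i<Suc n. y ^ i / fact i)"
      by (simp add: sum_distrib_left algebra_simps)
    also have "(\<Sum>i<Suc n. y ^ i / fact i) = (\<Sum>i<Suc n. y ^ i /\<^sub>R fact i)"
      by (simp add: divide_inverse mult.commute)
    also have "c * \<dots> \<le> c * exp y"
      unfolding exp_def using c0 y0 summable_exp_generic[of y]
      by (intro mult_left_mono sum_le_suminf) auto
    also have "\<dots> \<le> c * exp 1" using c0 y1 by simp
    also have "\<dots> = exp (real k - real N) * M k"
      unfolding c_def by (simp add: mult.commute mult.left_commute flip: exp_add)
    finally show ?thesis .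
  next
    case False
    have "cmod (G k (x + h)) \<le> M k" using taylor[of k x h 0] by simp
    also have "\<dots> \<le> exp (real k - real N) * M k" using False pos[of k] by simp
    finally show ?thesis .
  qed
qed

text \<open>
  The sufficiency half of the Denjoy-Carleman theorem.  At a point where all derivatives vanish the
  bounds of \<open>bang_step\<close> hold for every \<open>N\<close>.  Starting with a large \<open>N\<close> and descending to a fixed
  \<open>p\<close>, the admissible steps add up to a partial sum of the divergent series, so that any \<open>x\<close> is
  reached, with a bound at \<open>x\<close> that tends to \<open>0\<close> as \<open>p\<close> grows.
\<close>

theorem bang_quasianalytic:
  fixes G :: "nat \<Rightarrow> real \<Rightarrow> complex" and M :: "nat \<Rightarrow> real"
  assumes pos: "\<And>k. M k > 0"
    and logconvex: "\<And>k. M (Suc k) * M (Suc k) \<le> M k * M (Suc (Suc k))"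
    and diverge: "\<not> summable (\<lambda>k. M k / M (Suc k))"
    and taylor: "\<And>k n x h. cmod (G k (x + h) - (\<Sum>i<n. G (k + i) x * of_real (h ^ i / fact i)))
      \<le> M (k + n) * \<bar>h\<bar> ^ n / fact n"
    and flat: "\<And>k. G k 0 = 0"
  shows "G k x = 0"
proof -
  have reach: "cmod (G k x) \<le> exp (real k - real p) * M k"
    if "\<bar>x\<bar> \<le> (\<Sum>j<m. M (p + j) / (exp 1 * M (Suc (p + j))))" for p m k x
    using that
  proof (induction m arbitrary: p k x)
    case 0
    then show ?case using flat pos[of k] by simp
  next
    case (Suc m)
    define d where "d = M p / (exp 1 * M (Suc p))"
    have d0: "d > 0" using pos by (simp add: d_def)
    define h where "h = (if \<bar>x\<bar> \<le> d then x else sgn x * d)"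
    have hd: "\<bar>h\<bar> \<le> d" and xh: "\<bar>x - h\<bar> = (if \<bar>x\<bar> \<le> d then 0 else \<bar>x\<bar> - d)"
      using d0 by (auto simp: h_def abs_mult sgn_if)
    have "(\<Sum>j<Suc m. M (p + j) / (exp 1 * M (Suc (p + j)))) =
        d + (\<Sum>j<m. M (Suc p + j) / (exp 1 * M (Suc (Suc p + j))))"
      unfolding sum.lessThan_Suc_shift d_def by simp
    moreover have "0 \<le> (\<Sum>j<m. M (Suc p + j) / (exp 1 * M (Suc (Suc p + j))))"
      using pos by (intro sum_nonneg divide_nonneg_nonneg mult_nonneg_nonneg) (auto intro: less_imp_le)
    ultimately have "\<bar>x - h\<bar> \<le> (\<Sum>j<m. M (Suc p + j) / (exp 1 * M (Suc (Suc p + j))))"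
      using Suc.prems xh by (cases "\<bar>x\<bar> \<le> d") auto
    from Suc.IH[OF this] have "\<And>k. cmod (G k (x - h)) \<le> exp (real k - real (Suc p)) * M k" .
    then have "cmod (G k ((x - h) + h)) \<le> exp (real k - real p) * M k"
      using hd[unfolded d_def] by (intro bang_step[where G = G and M = M, OF pos logconvex taylor])
    then show ?case by simp
  qed
  have bound: "cmod (G k x) \<le> exp (real k - real p) * M k" for p
  proof -
    have "\<not> summable (\<lambda>j. M (j + p) / M (Suc (j + p)))"
      using diverge summable_iff_shift[of "\<lambda>k. M k / M (Suc k)" p] by simp
    then obtain m where m: "\<not> (\<Sum>j<m. M (j + p) / M (Suc (j + p))) \<le> \<bar>x\<bar> * exp 1"
      using summableI_nonneg_bounded[of "\<lambda>j. M (j + p) / M (Suc (j + p))" "\<bar>x\<bar> * exp 1"] pos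
      by (meson divide_nonneg_nonneg less_imp_le)
    have "(\<Sum>j<m. M (p + j) / (exp 1 * M (Suc (p + j)))) = (\<Sum>j<m. M (j + p) / M (Suc (j + p))) / exp 1"
      by (simp add: sum_divide_distrib add.commute mult.commute)
    moreover have "\<bar>x\<bar> \<le> (\<Sum>j<m. M (j + p) / M (Suc (j + p))) / exp 1"
      using m by (simp add: pos_le_divide_eq)
    ultimately show ?thesis by (intro reach[of x p m]) simp
  qed
  have "(\<lambda>p. exp (real k) * M k * exp (- 1) ^ p) \<longlonglongrightarrow> 0"
    by (intro tendsto_mult_right_zero LIMSEQ_realpow_zero) auto
  moreover have "exp (real k) * M k * exp (- 1) ^ p = exp (real k - real p) * M k" for p
    by (simp add: exp_diff exp_minus power_inverse exp_of_nat_mult[symmetric] field_simps)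
  ultimately have "(\<lambda>p. exp (real k - real p) * M k) \<longlonglongrightarrow> 0" by simp
  then have "cmod (G k x) \<le> 0" using bound by (intro LIMSEQ_le_const) auto
  then show ?thesis by simp
qed

text \<open>
  Multiply \<open>a j\<close> by weights \<open>c j\<close> whose products up to \<open>k\<close> are perfect powers, apply the inequality
  between arithmetic and geometric means, and sum over \<open>k\<close> first; the weights satisfy
  \<open>c j \<le> e (j + 1)\<close>.
\<close>

theorem carleman_inequality:
  fixes a :: "nat \<Rightarrow> real"
  assumes nonneg: "\<And>k. a k \<ge> 0" and summable: "summable a"
  shows "(\<Sum>k<n. root (Suc k) (\<Prod>j\<le>k. a j)) \<le> exp 1 * suminf a"
proof -
  define c where "c j = (real j + 2) ^ Suc j / (real j + 1) ^ j" for j :: nat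
  have c_pos: "c j > 0" for j by (simp add: c_def)
  have prod_c: "(\<Prod>j\<le>k. c j) = (real k + 2) ^ Suc k" for k
  proof (induction k)
    case (Suc k)
    have "(\<Prod>j\<le>Suc k. c j) = (real k + 2) ^ Suc k * ((real k + 3) ^ Suc (Suc k) / (real k + 2) ^ Suc k)"
      by (simp only: prod.atMost_Suc Suc) (simp add: c_def add.commute add.left_commute)
    then show ?case by (simp add: add.commute)
  qed (simp add: c_def)
  have term_le: "root (Suc k) (\<Prod>j\<le>k. a j) \<le> (\<Sum>j\<le>k. a j * c j) / ((real k + 1) * (real k + 2))" for k
  proof -
    have "root (Suc k) (\<Prod>j\<le>k. a j * c j) \<le> (\<Sum>j\<le>k. a j * c j) / real (Suc k)"
    proof -
      have nn: "a j * c j \<ge> 0" for j using nonneg[of j] c_pos[of j] by simp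
      have "(\<Prod>j\<le>k. a j * c j) powr (1 / real (card {..k})) \<le> (\<Sum>j\<le>k. a j * c j / real (card {..k}))"
        using nn by (intro arith_geom_mean) auto
      moreover have "root (Suc k) (\<Prod>j\<le>k. a j * c j) = (\<Prod>j\<le>k. a j * c j) powr (1 / real (card {..k}))"
        using nn by (cases "(\<Prod>j\<le>k. a j * c j) = 0")
          (auto simp: root_powr_inverse prod_nonneg order_less_le intro!: root_powr_inverse)
      ultimately show ?thesis by (simp add: sum_divide_distrib)
    qed
    moreover have "root (Suc k) (\<Prod>j\<le>k. a j * c j) = root (Suc k) (\<Prod>j\<le>k. a j) * (real k + 2)"
      unfolding prod.distrib prod_c real_root_mult
      by (subst real_root_power_cancel) auto
    ultimately have "root (Suc k) (\<Prod>j\<le>k. a j) * (real k + 2) * (real k + 1) \<le> (\<Sum>j\<le>k. a j * c j)"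
      by (simp add: pos_le_divide_eq add.commute)
    then show ?thesis by (subst pos_le_divide_eq) (simp_all add: mult_ac)
  qed
  have c_le: "c j \<le> exp 1 * (real j + 1)" for j
  proof -
    have "1 + 1 / real (Suc j) = (real j + 2) / (real j + 1)" by (simp add: field_simps)
    then have "c j = (1 + 1 / real (Suc j)) ^ Suc j * (real j + 1)"
      by (simp add: c_def power_divide)
    also have "(1 + 1 / real (Suc j)) ^ Suc j \<le> exp (1 / real (Suc j)) ^ Suc j"
      using exp_ge_add_one_self[of "1 / real (Suc j)"] by (intro power_mono) auto
    also have "\<dots> = exp 1" by (simp only: exp_of_nat_mult[symmetric]) simp
    finally show ?thesis by (simp add: mult_right_mono)
  qed
  have tail: "(\<Sum>k\<in>{j..<n}. 1 / ((real k + 1) * (real k + 2))) \<le> 1 / (real j + 1)" for j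
  proof (cases "j \<le> n")
    case True
    have "(\<Sum>k\<in>{j..<n}. 1 / ((real k + 1) * (real k + 2))) = 1 / (real j + 1) - 1 / (real n + 1)"
      using True
    proof (induction n rule: dec_induct)
      case (step m)
      have "1 / ((real m + 1) * (real m + 2)) = 1 / (real m + 1) - 1 / (real m + 2)"
        by (simp add: field_simps)
      then show ?case using step by (simp add: add.commute)
    qed simp
    then show ?thesis by simp
  qed simp
  have "(\<Sum>k<n. root (Suc k) (\<Prod>j\<le>k. a j)) \<le> (\<Sum>k<n. \<Sum>j\<le>k. a j * c j / ((real k + 1) * (real k + 2)))"
    using term_le by (intro sum_mono) (simp add: sum_divide_distrib)
  also have "\<dots> = (\<Sum>j<n. \<Sum>k\<in>{j..<n}. a j * c j / ((real k + 1) * (real k + 2)))"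
  proof -
    let ?g = "\<lambda>k j. a j * c j / ((real k + 1) * (real k + 2))"
    have "(\<Sum>k<n. \<Sum>j\<le>k. ?g k j) = (\<Sum>k<n. \<Sum>j\<in>{j\<in>{..<n}. j \<le> k}. ?g k j)"
      by (intro sum.cong refl) auto
    also have "\<dots> = (\<Sum>j<n. \<Sum>k\<in>{k\<in>{..<n}. j \<le> k}. ?g k j)"
      by (rule sum.swap_restrict) auto
    also have "\<dots> = (\<Sum>j<n. \<Sum>k\<in>{j..<n}. ?g k j)"
      by (intro sum.cong refl) auto
    finally show ?thesis .
  qed
  also have "\<dots> = (\<Sum>j<n. a j * c j * (\<Sum>k\<in>{j..<n}. 1 / ((real k + 1) * (real k + 2))))"
    by (simp add: sum_distrib_left)
  also have "\<dots> \<le> (\<Sum>j<n. a j * (exp 1 * (real j + 1)) * (1 / (real j + 1)))"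
  proof (intro sum_mono mult_mono mult_left_mono c_le tail nonneg order_refl)
    show "0 \<le> c j" for j using c_pos[of j] by simp
    show "0 \<le> a j * (exp 1 * (real j + 1))" for j using nonneg[of j] by simp
    show "0 \<le> (\<Sum>k = j..<n. 1 / ((real k + 1) * (real k + 2)))" for j by (intro sum_nonneg) simp
  qed
  also have "\<dots> = exp 1 * (\<Sum>j<n. a j)"
    by (simp add: sum_distrib_left mult_ac)
  also have "\<dots> \<le> exp 1 * suminf a"
    using nonneg summable by (intro mult_left_mono sum_le_suminf) auto
  finally show ?thesis .
qed

lemma cos_taylor:
  fixes \<theta> \<phi> :: real
  shows "\<bar>cos (\<theta> + \<phi>) - (\<Sum>i<n. cos (\<theta> + real i * (pi / 2)) * (\<phi> ^ i / fact i))\<bar> \<le> \<bar>\<phi>\<bar> ^ n / fact n"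
proof (cases n)
  case (Suc m)
  have term_eq: "cos (\<theta> + real i * (pi / 2)) * (\<phi> ^ i / fact i) = Re (cis \<theta> * ((\<i> * \<phi>) ^ i / fact i))" for i
  proof -
    have "cis \<theta> * ((\<i> * \<phi>) ^ i / fact i) = (cis \<theta> * cis (pi / 2) ^ i) * of_real (\<phi> ^ i / fact i)"
      by (simp add: power_mult_distrib)
    also have "cis \<theta> * cis (pi / 2) ^ i = cis (\<theta> + real i * (pi / 2))"
      unfolding Complex.DeMoivre cis_mult ..
    finally show ?thesis by (simp del: of_real_divide of_real_power)
  qed
  have "cos (\<theta> + \<phi>) = Re (cis \<theta> * exp (\<i> * \<phi>))"
    by (simp add: cis_mult flip: cis_conv_exp)
  then have "cos (\<theta> + \<phi>) - (\<Sum>i<n. cos (\<theta> + real i * (pi / 2)) * (\<phi> ^ i / fact i))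
      = Re (cis \<theta> * (exp (\<i> * \<phi>) - (\<Sum>i\<le>m. (\<i> * \<phi>) ^ i / fact i)))"
    unfolding term_eq Suc lessThan_Suc_atMost by (simp only: Re_sum[symmetric] sum_distrib_left[symmetric] right_diff_distrib minus_complex.sel)
  also have "\<bar>\<dots>\<bar> \<le> cmod (exp (\<i> * \<phi>) - (\<Sum>i\<le>m. (\<i> * \<phi>) ^ i / fact i))"
    by (rule order_trans[OF abs_Re_le_cmod]) (simp add: norm_mult)
  also have "\<dots> \<le> \<bar>\<phi>\<bar> ^ n / fact n" unfolding Suc by (rule iexp_approx1)
  finally show ?thesis .
qed simp

text \<open>
  Carleman's criterion, in the form that a complex density against which all even powers of \<open>X\<close>
  integrate to \<open>0\<close> also annihilates \<open>cos (s X)\<close>.  The function of \<open>s\<close> in the conclusion has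
  derivatives bounded by the absolute moments \<open>N k\<close>, which are log-convex by Cauchy-Schwarz; its odd
  derivatives vanish at \<open>0\<close> because they are sines and its even ones by hypothesis.  Carleman's
  inequality passes from the divergence of the roots to that of the ratios.
\<close>

theorem carleman_stieltjes:
  fixes M :: "'a measure" and h :: "'a \<Rightarrow> complex" and X :: "'a \<Rightarrow> real"
  defines "N \<equiv> \<lambda>k. LINT w|M. cmod (h w) * X w ^ k"
  assumes X [measurable]: "X \<in> borel_measurable M" and X_pos: "\<And>w. X w > 0"
    and int: "\<And>k. integrable M (\<lambda>w. of_real (X w ^ k) * h w)"
    and moments: "\<And>k. (LINT w|M. of_real (X w ^ (2 * k)) * h w) = 0"
    and carleman: "\<not> summable (\<lambda>k. root (Suc k) (1 / N (Suc k)))"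
  shows "(LINT w|M. of_real (cos (s * X w)) * h w) = 0"
proof -
  have h_int: "integrable M h" using int[of 0] by simp
  then have h_meas [measurable]: "h \<in> borel_measurable M" by simp
  show ?thesis
  proof (cases "N 0 = 0")
    case True
    then have "AE w in M. h w = 0"
      using integral_nonneg_eq_0_iff_AE[of M "\<lambda>w. cmod (h w)"] h_int by (simp add: N_def)
    then have "(LINT w|M. of_real (cos (s * X w)) * h w) = (LINT w|M. 0)"
      by (intro integral_cong_AE) auto
    then show ?thesis by simp
  next
    case False
    have abs_int: "integrable M (\<lambda>w. cmod (h w) * X w ^ k)" for k
      using integrable_norm[OF int[of k]] X_pos
      by (simp add: norm_mult norm_power abs_of_pos mult.commute)
    have N_pos: "N k > 0" for k
    proof (rule ccontr)
      assume "\<not> N k > 0"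
      moreover have "N k \<ge> 0" unfolding N_def using X_pos
        by (intro integral_nonneg_AE AE_I2 mult_nonneg_nonneg zero_le_power) (auto intro: less_imp_le)
      ultimately have "N k = 0" by simp
      moreover have "AE w in M. 0 \<le> cmod (h w) * X w ^ k"
        using X_pos by (intro AE_I2 mult_nonneg_nonneg zero_le_power) (auto intro: less_imp_le)
      ultimately have "AE w in M. cmod (h w) * X w ^ k = 0"
        using integral_nonneg_eq_0_iff_AE[OF abs_int[of k]] by (simp add: N_def)
      then have "AE w in M. h w = 0" by eventually_elim (use X_pos in \<open>metis less_irrefl mult_eq_0_iff norm_eq_zero power_not_zero\<close>)
      then have "N 0 = (LINT w|M. 0)" unfolding N_def by (intro integral_cong_AE) auto
      then show False using False by simp
    qed
    have logconvex: "N (Suc k) * N (Suc k) \<le> N k * N (Suc (Suc k))" for k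
    proof -
      define c where "c = N (Suc k) / N k"
      have "0 \<le> (LINT w|M. cmod (h w) * X w ^ k * (X w - c)\<^sup>2)"
        using X_pos by (intro integral_nonneg_AE AE_I2 mult_nonneg_nonneg zero_le_power zero_le_power2) (auto intro: less_imp_le)
      also have "\<dots> = (LINT w|M. cmod (h w) * X w ^ Suc (Suc k) - 2 * c * (cmod (h w) * X w ^ Suc k)
          + c\<^sup>2 * (cmod (h w) * X w ^ k))"
        by (intro Bochner_Integration.integral_cong) (auto simp: power2_eq_square algebra_simps)
      also have "\<dots> = N (Suc (Suc k)) - 2 * c * N (Suc k) + c\<^sup>2 * N k"
        unfolding N_def using abs_int[of k] abs_int[of "Suc k"] abs_int[of "Suc (Suc k)"] by simp
      finally have "0 \<le> (N (Suc (Suc k)) - 2 * c * N (Suc k) + c\<^sup>2 * N k) * N k"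
        using N_pos[of k] by simp
      also have "\<dots> = N k * N (Suc (Suc k)) - N (Suc k) * N (Suc k)"
        using N_pos[of k] by (simp add: c_def field_simps power2_eq_square)
      finally show ?thesis by simp
    qed
    have diverge: "\<not> summable (\<lambda>k. N k / N (Suc k))"
    proof
      assume sum: "summable (\<lambda>k. N k / N (Suc k))"
      have prod: "(\<Prod>j\<le>k. N j / N (Suc j)) = N 0 / N (Suc k)" for k
        by (induction k) (use N_pos in \<open>auto simp: less_le\<close>)
      have "summable (\<lambda>k. root (Suc k) (N 0 / N (Suc k)))"
      proof (rule summableI_nonneg_bounded)
        show "(\<Sum>k<n. root (Suc k) (N 0 / N (Suc k))) \<le> exp 1 * (\<Sum>k. N k / N (Suc k))" for n
          using carleman_inequality[OF _ sum, of n] N_pos unfolding prod by (simp add: less_imp_le)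
        show "0 \<le> root (Suc k) (N 0 / N (Suc k))" for k
          using N_pos[of 0] N_pos[of "Suc k"] by (intro real_root_ge_zero) simp
      qed
      then have "summable (\<lambda>k. root (Suc k) (N 0 / N (Suc k)) / min 1 (N 0))"
        by (rule summable_divide)
      then have "summable (\<lambda>k. root (Suc k) (1 / N (Suc k)))"
      proof (rule summable_comparison_test')
        fix k :: nat assume "k \<ge> 0"
        have "min 1 (N 0) \<le> root (Suc k) (min 1 (N 0))"
          using N_pos[of 0] real_root_increasing[of 1 "Suc k" "min 1 (N 0)"] by simp
        also have "\<dots> \<le> root (Suc k) (N 0)" by simp
        finally have "min 1 (N 0) * root (Suc k) (1 / N (Suc k)) \<le> root (Suc k) (N 0) * root (Suc k) (1 / N (Suc k))"
          using N_pos[of "Suc k"] by (intro mult_right_mono real_root_ge_zero) auto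
        also have "\<dots> = root (Suc k) (N 0 / N (Suc k))" by (simp flip: real_root_mult)
        finally show "norm (root (Suc k) (1 / N (Suc k))) \<le> root (Suc k) (N 0 / N (Suc k)) / min 1 (N 0)"
          using N_pos[of 0] N_pos[of "Suc k"] by (simp add: pos_le_divide_eq mult.commute del: real_root_divide)
      qed
      with carleman show False by simp
    qed
    define G where "G k x = (LINT w|M. of_real (cos (x * X w + real k * (pi / 2)) * X w ^ k) * h w)" for k x
    have G_int: "integrable M (\<lambda>w. of_real (cos (x w + y) * X w ^ k) * h w)"
      if [measurable]: "x \<in> borel_measurable M" for x k y
    proof (rule Bochner_Integration.integrable_bound[OF abs_int[of k]], measurable, intro AE_I2)
        fix w
        have "\<bar>cos (x w + y)\<bar> * (X w ^ k * cmod (h w)) \<le> 1 * (X w ^ k * cmod (h w))"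
          using X_pos[of w] by (intro mult_right_mono) auto
        then show "norm (of_real (cos (x w + y) * X w ^ k) * h w) \<le> norm (cmod (h w) * X w ^ k)"
          using X_pos[of w] by (simp add: norm_mult norm_power abs_mult mult.commute mult.left_commute)
    qed
    have taylor: "cmod (G k (x + y) - (\<Sum>i<n. G (k + i) x * of_real (y ^ i / fact i)))
        \<le> N (k + n) * \<bar>y\<bar> ^ n / fact n" for k n x y
    proof -
      let ?D = "\<lambda>w. cos ((x + y) * X w + real k * (pi / 2)) - (\<Sum>i<n. cos ((x * X w + real k * (pi / 2)) + real i * (pi / 2))
          * ((y * X w) ^ i / fact i))"
      have D: "\<bar>?D w\<bar> \<le> \<bar>y * X w\<bar> ^ n / fact n" for w
      proof -
        have "x * X w + real k * (pi / 2) + y * X w = (x + y) * X w + real k * (pi / 2)"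
          by (simp only: distrib_right add_ac)
        then show ?thesis using cos_taylor[of "x * X w + real k * (pi / 2)" "y * X w" n] by (simp only:)
      qed
      have "G k (x + y) - (\<Sum>i<n. G (k + i) x * of_real (y ^ i / fact i))
          = (LINT w|M. of_real (cos ((x + y) * X w + real k * (pi / 2)) * X w ^ k) * h w
             - (\<Sum>i<n. (of_real (cos (x * X w + real (k + i) * (pi / 2)) * X w ^ (k + i)) * h w) * of_real (y ^ i / fact i)))"
      proof -
        have i1: "integrable M (\<lambda>w. of_real (cos (x * X w + real k * (pi / 2)) * X w ^ k) * h w)" for x k
          by (rule G_int) measurable
        then have i2: "integrable M (\<lambda>w. of_real (cos (x * X w + real k * (pi / 2)) * X w ^ k) * h w * of_real c)" for x k c
          by (rule integrable_mult_left)
        define a where "a w = of_real (cos ((x + y) * X w + real k * (pi / 2)) * X w ^ k) * h w" for w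
        define b where "b i w = of_real (cos (x * X w + real (k + i) * (pi / 2)) * X w ^ (k + i)) * h w * of_real (y ^ i / fact i)" for i w
        have a: "integrable M a" and b: "integrable M (b i)" for i
          unfolding a_def b_def by (rule i1 i2)+
        have "(LINT w|M. a w - (\<Sum>i<n. b i w)) = (LINT w|M. a w) - (LINT w|M. (\<Sum>i<n. b i w))"
          by (intro Bochner_Integration.integral_diff a Bochner_Integration.integrable_sum b)
        also have "(LINT w|M. (\<Sum>i<n. b i w)) = (\<Sum>i<n. (LINT w|M. b i w))"
          by (intro Bochner_Integration.integral_sum b)
        also have "\<dots> = (\<Sum>i<n. G (k + i) x * of_real (y ^ i / fact i))"
          unfolding b_def G_def by (intro sum.cong refl integral_mult_left_zero)
        finally show ?thesis unfolding a_def b_def G_def by (rule sym)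
      qed
      also have "\<dots> = (LINT w|M. of_real (?D w * X w ^ k) * h w)"
      proof (intro Bochner_Integration.integral_cong refl)
        fix w
        have factor: "of_real (C * a) * b - (\<Sum>i<n. of_real (g i * a) * b) = of_real ((C - (\<Sum>i<n. g i)) * a) * b"
          for C a :: real and b :: complex and g :: "nat \<Rightarrow> real"
          by (simp add: left_diff_distrib sum_distrib_right)
        have angle: "x * X w + real (k + i) * (pi / 2) = (x * X w + real k * (pi / 2)) + real i * (pi / 2)" for i
          by (simp only: of_nat_add distrib_right add.assoc)
        have split: "of_real (c * X w ^ (k + i)) * h w * of_real (y ^ i / fact i)
            = of_real (c * ((y * X w) ^ i / fact i) * X w ^ k) * h w" for c i
          by (simp add: power_add power_mult_distrib)
        have "(\<Sum>i<n. (of_real (cos (x * X w + real (k + i) * (pi / 2)) * X w ^ (k + i)) * h w) * of_real (y ^ i / fact i))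
            = (\<Sum>i<n. of_real (cos ((x * X w + real k * (pi / 2)) + real i * (pi / 2)) * ((y * X w) ^ i / fact i) * X w ^ k) * h w)"
        proof (rule sum.cong[OF refl])
          show "(of_real (cos (x * X w + real (k + i) * (pi / 2)) * X w ^ (k + i)) * h w) * of_real (y ^ i / fact i)
            = of_real (cos ((x * X w + real k * (pi / 2)) + real i * (pi / 2)) * ((y * X w) ^ i / fact i) * X w ^ k) * h w" for i
            by (subst angle) (rule split)
        qed
        then show "of_real (cos ((x + y) * X w + real k * (pi / 2)) * X w ^ k) * h w
             - (\<Sum>i<n. (of_real (cos (x * X w + real (k + i) * (pi / 2)) * X w ^ (k + i)) * h w) * of_real (y ^ i / fact i))
            = of_real (?D w * X w ^ k) * h w"
          by (rule trans[OF arg_cong[where f = "\<lambda>v. _ - v"] factor])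
      qed
      finally have eq: "G k (x + y) - (\<Sum>i<n. G (k + i) x * of_real (y ^ i / fact i)) = (LINT w|M. of_real (?D w * X w ^ k) * h w)" .
      have "cmod (LINT w|M. of_real (?D w * X w ^ k) * h w) \<le> (LINT w|M. cmod (h w) * X w ^ (k + n) * (\<bar>y\<bar> ^ n / fact n))"
      proof (rule norm_integral_le_integral)
        show "integrable M (\<lambda>w. cmod (h w) * X w ^ (k + n) * (\<bar>y\<bar> ^ n / fact n))"
          using abs_int by (intro integrable_mult_left) auto
        show "norm (of_real (?D w * X w ^ k) * h w) \<le> cmod (h w) * X w ^ (k + n) * (\<bar>y\<bar> ^ n / fact n)" for w
        proof -
          have "\<bar>?D w\<bar> * X w ^ k * cmod (h w) \<le> (\<bar>y * X w\<bar> ^ n / fact n) * X w ^ k * cmod (h w)"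
            using D[of w] X_pos[of w] by (intro mult_right_mono) auto
          moreover have "norm (of_real (D * X w ^ k) * h w) = \<bar>D\<bar> * X w ^ k * cmod (h w)" for D
            using X_pos[of w] by (simp add: norm_mult abs_mult norm_power)
          moreover have "(\<bar>y * X w\<bar> ^ n / fact n) * X w ^ k * cmod (h w) = cmod (h w) * X w ^ (k + n) * (\<bar>y\<bar> ^ n / fact n)"
            using X_pos[of w] by (simp add: abs_mult power_add power_mult_distrib)
          ultimately show ?thesis by (simp only:)
        qed
        show "(\<lambda>w. of_real (?D w * X w ^ k) * h w) \<in> borel_measurable M"
          by measurable
      qed
      also have "\<dots> = N (k + n) * (\<bar>y\<bar> ^ n / fact n)"
        unfolding N_def by (rule integral_mult_left_zero)
      finally show ?thesis unfolding eq by simp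
    qed
    have flat: "G k 0 = 0" for k
    proof (cases "even k")
      case True
      then obtain j where j: "k = 2 * j" by blast
      have "G k 0 = of_real (cos (real k * (pi / 2))) * (LINT w|M. of_real (X w ^ (2 * j)) * h w)"
        unfolding G_def j by (simp add: mult.assoc)
      then show ?thesis using moments by simp
    next
      case False
      then obtain j where "k = 2 * j + 1" using oddE by blast
      then have "cos (real k * (pi / 2)) = cos (pi / 2 + real j * pi)"
        by (simp add: algebra_simps add_divide_distrib)
      also have "\<dots> = 0" by (simp add: cos_add)
      finally show ?thesis unfolding G_def by simp
    qed
    have "G 0 s = 0" by (rule bang_quasianalytic[OF N_pos logconvex diverge taylor flat])
    then show ?thesis by (simp add: G_def)
  qed
qed

text \<open>
  On \<open>[16\<^sup>i, 16\<^bsup>i+1\<^esup>]\<close> the integral is at most \<open>\<Theta>(16\<^sup>i) ln 16\<close>.  The base \<open>16 = 2\<^sup>4\<close> matches the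
  exponent \<open>4\<close> in the choice of the cutoff \<open>s\<^sup>4\<close> with \<open>s = 2\<^sup>i\<close> below.
\<close>

lemma dyadic_sum_diverges:
  fixes \<Theta> :: "real \<Rightarrow> real"
  assumes nonneg: "\<And>t. t \<ge> 0 \<Longrightarrow> \<Theta> t \<ge> 0" and anti: "antimono_on {0..} \<Theta>"
    and diverge: "(\<integral>\<^sup>+ t\<in>{1..}. ennreal (\<Theta> t / t) \<partial>lborel) = \<infinity>"
  shows "\<not> summable (\<lambda>i. \<Theta> (16 ^ i))"
proof
  assume sum: "summable (\<lambda>i. \<Theta> (16 ^ i))"
  have le: "\<Theta> t \<le> \<Theta> s" if "0 \<le> s" "s \<le> t" for s t
    using anti that by (auto simp: monotone_on_def)
  have cover: "{1..} \<subseteq> (\<Union>i. {16 ^ i ..< 16 ^ Suc i :: real})"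
  proof
    fix t :: real assume "t \<in> {1..}"
    then have t: "t \<ge> 1" by simp
    obtain m where m: "t < 16 ^ m" using real_arch_pow[of 16 t] by (metis one_less_numeral_iff semiring_norm(76))
    define i where "i = (LEAST m. t < 16 ^ m)"
    have i: "t < 16 ^ i" unfolding i_def using m by (rule LeastI)
    have "i \<noteq> 0"
    proof
      assume "i = 0"
      with i t show False by simp
    qed
    then obtain j where j: "i = Suc j" using not0_implies_Suc by blast
    have "\<not> t < 16 ^ j" using not_less_Least[of j "\<lambda>m. t < 16 ^ m", folded i_def] j by simp
    then have "t \<in> {16 ^ j ..< 16 ^ Suc j}" using i unfolding j atLeastLessThan_iff not_less by (rule conjI)
    then show "t \<in> (\<Union>i. {16 ^ i ..< 16 ^ Suc i})" by (rule UN_I[OF UNIV_I])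
  qed
  have "(\<integral>\<^sup>+ t\<in>{1..}. ennreal (\<Theta> t / t) \<partial>lborel)
      \<le> (\<integral>\<^sup>+ t. (\<Sum>i. ennreal (\<Theta> (16 ^ i) / 16 ^ i) * indicator {16 ^ i ..< 16 ^ Suc i} (t :: real)) \<partial>lborel)"
  proof (intro nn_integral_mono)
    fix t :: real
    show "ennreal (\<Theta> t / t) * indicator {1..} t
      \<le> (\<Sum>i. ennreal (\<Theta> (16 ^ i) / 16 ^ i) * indicator {16 ^ i ..< 16 ^ Suc i} t)"
    proof (cases "t \<ge> 1")
      case True
      then have "t \<in> (\<Union>i. {16 ^ i ..< 16 ^ Suc i})" by (intro subsetD[OF cover]) simp
      then obtain i where i: "16 ^ i \<le> t" "t < 16 ^ Suc i" unfolding UN_iff atLeastLessThan_iff by blast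
      have "\<Theta> t \<le> \<Theta> (16 ^ i)" using i(1) by (intro le) simp_all
      then have "\<Theta> t / t \<le> \<Theta> (16 ^ i) / 16 ^ i"
        using i(1) nonneg[of "16 ^ i"] by (intro frac_le) simp_all
      moreover have "indicator {16 ^ i ..< 16 ^ Suc i} t = (1 :: ennreal)"
        unfolding indicator_def atLeastLessThan_iff using i by (simp only: simp_thms if_True of_bool_eq)
      ultimately have "ennreal (\<Theta> t / t) * indicator {1..} t \<le> ennreal (\<Theta> (16 ^ i) / 16 ^ i) * indicator {16 ^ i ..< 16 ^ Suc i} t"
        using True by (simp add: ennreal_leI)
      also have "\<dots> = (\<Sum>j\<in>{i}. ennreal (\<Theta> (16 ^ j) / 16 ^ j) * indicator {16 ^ j ..< 16 ^ Suc j} t)"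
        by (simp only: sum.insert sum.empty finite.emptyI empty_iff not_False_eq_True add_0_right)
      also have "\<dots> \<le> (\<Sum>i. ennreal (\<Theta> (16 ^ i) / 16 ^ i) * indicator {16 ^ i ..< 16 ^ Suc i} t)"
        by (rule sum_le_suminf) auto
      finally show ?thesis .
    qed simp
  qed
  also have "\<dots> = (\<Sum>i. ennreal (\<Theta> (16 ^ i) / 16 ^ i) * emeasure lborel {16 ^ i ..< 16 ^ Suc i :: real})"
    by (subst nn_integral_suminf) (simp_all only: nn_integral_cmult_indicator sets_lborel atLeastLessThan_borel
        borel_measurable_times_ennreal borel_measurable_const borel_measurable_indicator)
  also have "\<dots> = (\<Sum>i. ennreal (15 * \<Theta> (16 ^ i)))"
  proof (intro suminf_cong)
    fix i :: nat
    have "emeasure lborel {16 ^ i ..< 16 ^ Suc i :: real} = ennreal (15 * 16 ^ i)"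
      by (subst emeasure_lborel_Ico) auto
    then have "ennreal (\<Theta> (16 ^ i) / 16 ^ i) * emeasure lborel {16 ^ i ..< 16 ^ Suc i :: real}
        = ennreal (\<Theta> (16 ^ i) / 16 ^ i * (15 * 16 ^ i))"
      using nonneg[of "16 ^ i"] by (simp only:) (subst ennreal_mult, auto)
    then show "ennreal (\<Theta> (16 ^ i) / 16 ^ i) * emeasure lborel {16 ^ i ..< 16 ^ Suc i :: real} = ennreal (15 * \<Theta> (16 ^ i))"
      by (simp add: mult.commute)
  qed
  also have "\<dots> < \<infinity>"
  proof -
    have "(\<lambda>i. 15 * \<Theta> (16 ^ i)) sums (15 * (\<Sum>i. \<Theta> (16 ^ i)))"
      using sum by (intro sums_mult summable_sums)
    then have "(\<Sum>i. ennreal (15 * \<Theta> (16 ^ i))) = ennreal (15 * (\<Sum>i. \<Theta> (16 ^ i)))"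
      using nonneg by (intro suminf_ennreal_eq) auto
    then show ?thesis by simp
  qed
  finally show False using diverge by simp
qed

text \<open>
  The hypothesis bounds \<open>b\<close> below by \<open>c / 2\<^sup>i\<close> on about \<open>2\<^sup>i \<theta> i\<close> indices, which would contribute
  \<open>c \<theta> i\<close>.  For fixed \<open>k\<close> the values \<open>c / 2\<^sup>i\<close> over the admissible \<open>i\<close> form a geometric series
  dominated by its largest term, so summing over \<open>i\<close> counts each \<open>b k\<close> at most twice.
\<close>

lemma not_summable_from_counting:
  fixes \<theta> b :: "nat \<Rightarrow> real"
  assumes \<theta>: "\<And>i. \<theta> i \<ge> 0" "\<not> summable \<theta>" and c: "c > 0" and b_nonneg: "\<And>k. b k \<ge> 0"
    and b: "\<And>k i. real (Suc k) \<le> 2 ^ i * \<theta> i \<Longrightarrow> b k \<ge> c / 2 ^ i"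
  shows "\<not> summable b"
proof
  assume sum: "summable b"
  define n where "n i = nat \<lfloor>2 ^ i * \<theta> i\<rfloor>" for i
  have n_iff: "k < n i \<longleftrightarrow> real (Suc k) \<le> 2 ^ i * \<theta> i" for k i
  proof -
    have "k < n i \<longleftrightarrow> int (Suc k) \<le> \<lfloor>2 ^ i * \<theta> i\<rfloor>" unfolding n_def by linarith
    then show ?thesis by (simp add: le_floor_iff)
  qed
  have n_ge: "\<theta> i - (1 / 2) ^ i \<le> real (n i) / 2 ^ i" for i
  proof -
    have "2 ^ i * \<theta> i - 1 \<le> real (n i)" unfolding n_def using \<theta>(1)[of i] by linarith
    then have "(2 ^ i * \<theta> i - 1) / 2 ^ i \<le> real (n i) / 2 ^ i" by (rule divide_right_mono) simp
    then show ?thesis by (simp add: diff_divide_distrib power_one_over)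
  qed
  have geom: "(\<Sum>i\<in>{m..<I}. (1 / 2) ^ i) \<le> 2 * (1 / 2 :: real) ^ m" for m I
  proof (cases "m \<le> I")
    case True
    then have "(\<Sum>i\<in>{m..<I}. (1 / 2) ^ i) = 2 * (1 / 2 :: real) ^ m - 2 * (1 / 2) ^ I"
      by (induction I rule: dec_induct) auto
    then show ?thesis by simp
  qed simp
  have inner: "(\<Sum>i\<in>{i\<in>{..<I}. k < n i}. (1 / 2) ^ i) \<le> 2 / c * b k" for k I
  proof (cases "{i\<in>{..<I}. k < n i} = {}")
    case True
    then show ?thesis using c b_nonneg[of k] by (simp only: sum.empty) simp
  next
    case False
    define m where "m = Min {i\<in>{..<I}. k < n i}"
    have m: "k < n m" using Min_in[OF _ False] by (simp add: m_def)
    have "(\<Sum>i\<in>{i\<in>{..<I}. k < n i}. (1 / 2) ^ i) \<le> (\<Sum>i\<in>{m..<I}. (1 / 2 :: real) ^ i)"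
      by (intro sum_mono2) (auto simp: m_def)
    also have "\<dots> \<le> 2 * (1 / 2) ^ m" by (rule geom)
    also have "\<dots> \<le> 2 / c * b k"
      using b[of k m] m c by (simp add: n_iff field_simps)
    finally show ?thesis .
  qed
  have "(\<Sum>i<I. \<theta> i) \<le> 2 + 2 / c * suminf b" for I
  proof -
    define K where "K = Suc (\<Sum>i<I. n i)"
    have nK: "n i \<le> K" if "i < I" for i
      using that member_le_sum[of i "{..<I}" n] by (simp add: K_def)
    have "(\<Sum>i<I. \<theta> i) = (\<Sum>i<I. \<theta> i - (1 / 2) ^ i) + (\<Sum>i\<in>{0..<I}. (1 / 2) ^ i)"
      by (simp add: sum_subtractf atLeast0LessThan)
    also have "\<dots> \<le> (\<Sum>i<I. real (n i) / 2 ^ i) + 2"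
      using n_ge geom[of 0 I] by (intro add_mono sum_mono) auto
    also have "(\<Sum>i<I. real (n i) / 2 ^ i) = (\<Sum>i<I. \<Sum>k\<in>{k\<in>{..<K}. k < n i}. (1 / 2) ^ i)"
    proof (intro sum.cong refl)
      fix i assume "i \<in> {..<I}"
      then have "{k\<in>{..<K}. k < n i} = {..<n i}" using nK[of i] by auto
      then show "real (n i) / 2 ^ i = (\<Sum>k\<in>{k\<in>{..<K}. k < n i}. (1 / 2) ^ i)" by (simp add: field_simps)
    qed
    also have "\<dots> = (\<Sum>k<K. \<Sum>i\<in>{i\<in>{..<I}. k < n i}. (1 / 2) ^ i)"
      by (rule sum.swap_restrict) auto
    also have "\<dots> \<le> (\<Sum>k<K. 2 / c * b k)" by (intro sum_mono inner)
    also have "\<dots> \<le> 2 / c * suminf b"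
      unfolding sum_distrib_left[symmetric] using sum b_nonneg c by (intro mult_left_mono sum_le_suminf) auto
    finally show ?thesis by simp
  qed
  then have "summable \<theta>" by (intro summableI_nonneg_bounded \<theta>)
  with \<theta>(2) show False ..
qed

lemma exp_neg_taylor:
  fixes x :: real
  assumes "x \<ge> 0"
  shows "\<bar>exp (- x) - (\<Sum>l\<le>k. (- x) ^ l / fact l)\<bar> \<le> x ^ Suc k / fact (Suc k)"
proof (cases "x = 0")
  case True
  have "(\<Sum>l\<le>k. (0::real) ^ l / fact l) = (\<Sum>l\<in>{0}. 0 ^ l / fact l)"
    by (rule sum.mono_neutral_right) (auto simp: power_0_left)
  then show ?thesis using True by simp
next
  case False
  then have x: "x > 0" using assms by simp
  define d where "d m t = (- 1) ^ m * exp (- t)" for m :: nat and t :: real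
  have "\<exists>t>0. t \<le> x \<and> exp (- x) = (\<Sum>m<Suc k. d m 0 / fact m * x ^ m) + d (Suc k) t / fact (Suc k) * x ^ Suc k"
    by (rule Maclaurin2[OF x]) (auto simp: d_def intro!: derivative_eq_intros)
  then obtain t where t: "t > 0" and eq:
    "exp (- x) = (\<Sum>m<Suc k. d m 0 / fact m * x ^ m) + d (Suc k) t / fact (Suc k) * x ^ Suc k" by blast
  have "(\<Sum>m<Suc k. d m 0 / fact m * x ^ m) = (\<Sum>l\<le>k. (- x) ^ l / fact l)"
    unfolding lessThan_Suc_atMost d_def
    by (intro sum.cong refl) (subst power_minus, simp)
  then have "\<bar>exp (- x) - (\<Sum>l\<le>k. (- x) ^ l / fact l)\<bar> = exp (- t) * (x ^ Suc k / fact (Suc k))"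
    using eq x by (simp add: d_def abs_mult power_abs)
  also have "\<dots> \<le> 1 * (x ^ Suc k / fact (Suc k))"
    using t x by (intro mult_right_mono) auto
  finally show ?thesis by simp
qed

text \<open>
  Induction on \<open>k\<close>: once the lower moments vanish, Taylor's formula for \<open>exp (- \<tau> X\<^sup>2)\<close> shows that
  the transform divided by \<open>\<tau>\<^sup>k\<close> tends to a nonzero multiple of the next moment.
\<close>

lemma moments_vanish_if_flat:
  fixes h :: "'a \<Rightarrow> complex" and X :: "'a \<Rightarrow> real"
  assumes int: "\<And>k. integrable M (\<lambda>w. of_real (X w ^ k) * h w)"
    and X [measurable]: "X \<in> borel_measurable M"
    and flat: "\<And>k. ((\<lambda>\<tau>. (LINT w|M. of_real (exp (- \<tau> * (X w)\<^sup>2)) * h w) / of_real (\<tau> ^ k)) \<longlongrightarrow> 0) (at_right 0)"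
  shows "(LINT w|M. of_real (X w ^ (2 * k)) * h w) = 0"
proof (induction k rule: less_induct)
  case (less k)
  define m where "m l = (LINT w|M. of_real (X w ^ (2 * l)) * h w)" for l
  define A where "A \<tau> = (LINT w|M. of_real (exp (- \<tau> * (X w)\<^sup>2)) * h w)" for \<tau>
  define K where "K = (LINT w|M. cmod (of_real (X w ^ (2 * Suc k)) * h w))"
  have h_int: "integrable M h" using int[of 0] by simp
  then have [measurable]: "h \<in> borel_measurable M" by simp
  have low: "m l = 0" if "l < k" for l using less.IH[OF that] by (simp add: m_def)
  have approx: "cmod (A \<tau> - of_real ((- \<tau>) ^ k / fact k) * m k) \<le> \<tau> ^ Suc k * K" if \<tau>: "\<tau> > 0" for \<tau>
  proof -
    let ?D = "\<lambda>w. exp (- (\<tau> * (X w)\<^sup>2)) - (\<Sum>l\<le>k. (- (\<tau> * (X w)\<^sup>2)) ^ l / fact l)"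
    have A_int: "integrable M (\<lambda>w. of_real (exp (- (\<tau> * (X w)\<^sup>2))) * h w)"
      by (rule Bochner_Integration.integrable_bound[OF h_int])
        (use \<tau> in \<open>auto simp: norm_mult intro!: mult_left_le_one_le\<close>)
    have "A \<tau> - of_real ((- \<tau>) ^ k / fact k) * m k = A \<tau> - (\<Sum>l\<le>k. of_real ((- \<tau>) ^ l / fact l) * m l)"
      using low by (subst sum.remove[of _ k]) auto
    also have "\<dots> = (LINT w|M. of_real (exp (- (\<tau> * (X w)\<^sup>2))) * h w
        - (\<Sum>l\<le>k. of_real ((- \<tau>) ^ l / fact l) * (of_real (X w ^ (2 * l)) * h w)))"
      unfolding A_def m_def using int A_int
      by (simp only: Bochner_Integration.integral_diff Bochner_Integration.integrable_sum
          Bochner_Integration.integral_sum integrable_mult_right integral_mult_right_zero minus_mult_left)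
    also have "\<dots> = (LINT w|M. of_real (?D w) * h w)"
    proof (intro Bochner_Integration.integral_cong refl)
      fix w
      have "(- \<tau>) ^ l / fact l * X w ^ (2 * l) = (- (\<tau> * (X w)\<^sup>2)) ^ l / fact l" for l
        by (simp add: power_mult power_mult_distrib[symmetric])
      then have "of_real ((- \<tau>) ^ l / fact l) * (of_real (X w ^ (2 * l)) * h w) = of_real ((- (\<tau> * (X w)\<^sup>2)) ^ l / fact l) * h w" for l
        unfolding mult.assoc[symmetric] of_real_mult[symmetric] by simp
      then show "of_real (exp (- (\<tau> * (X w)\<^sup>2))) * h w
        - (\<Sum>l\<le>k. of_real ((- \<tau>) ^ l / fact l) * (of_real (X w ^ (2 * l)) * h w)) = of_real (?D w) * h w"
        by (simp only: of_real_diff of_real_sum left_diff_distrib sum_distrib_right)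
    qed
    finally have eq: "A \<tau> - of_real ((- \<tau>) ^ k / fact k) * m k = (LINT w|M. of_real (?D w) * h w)" .
    have "cmod (LINT w|M. of_real (?D w) * h w) \<le> (LINT w|M. \<tau> ^ Suc k * cmod (of_real (X w ^ (2 * Suc k)) * h w))"
    proof (rule norm_integral_le_integral)
      show "integrable M (\<lambda>w. \<tau> ^ Suc k * cmod (of_real (X w ^ (2 * Suc k)) * h w))"
        by (intro integrable_mult_right integrable_norm int)
      show "norm (of_real (?D w) * h w) \<le> \<tau> ^ Suc k * cmod (of_real (X w ^ (2 * Suc k)) * h w)" for w
      proof -
        have "\<bar>?D w\<bar> \<le> (\<tau> * (X w)\<^sup>2) ^ Suc k / fact (Suc k)"
          using \<tau> by (intro exp_neg_taylor) simp
        also have "\<dots> \<le> (\<tau> * (X w)\<^sup>2) ^ Suc k / 1"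
          using \<tau> by (intro divide_left_mono fact_ge_1) auto
        also have "\<dots> = \<tau> ^ Suc k * \<bar>X w ^ (2 * Suc k)\<bar>"
          by (simp add: power_mult power_mult_distrib del: power_Suc mult_Suc_right)
        finally have "\<bar>?D w\<bar> * cmod (h w) \<le> \<tau> ^ Suc k * \<bar>X w ^ (2 * Suc k)\<bar> * cmod (h w)"
          by (rule mult_right_mono) simp
        then show ?thesis by (simp only: norm_mult norm_of_real mult.assoc)
      qed
    qed measurable
    also have "\<dots> = \<tau> ^ Suc k * K" unfolding K_def by (rule integral_mult_right_zero)
    finally show ?thesis unfolding eq .
  qed
  have ev: "\<forall>\<^sub>F \<tau> in at_right 0. norm (A \<tau> / of_real (\<tau> ^ k) - of_real ((- 1) ^ k / fact k) * m k) \<le> \<tau> * K"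
      using eventually_at_right_less
    proof eventually_elim
      case (elim \<tau>)
      have "A \<tau> / of_real (\<tau> ^ k) - of_real ((- 1) ^ k / fact k) * m k
          = (A \<tau> - of_real ((- \<tau>) ^ k / fact k) * m k) / of_real (\<tau> ^ k)"
        using elim by (simp add: diff_divide_distrib power_minus[of \<tau>] power_minus[of "of_real \<tau>"])
      then have "norm (A \<tau> / of_real (\<tau> ^ k) - of_real ((- 1) ^ k / fact k) * m k)
          = cmod (A \<tau> - of_real ((- \<tau>) ^ k / fact k) * m k) / \<tau> ^ k"
        using elim by (simp add: norm_divide norm_power)
      also have "\<dots> \<le> \<tau> ^ Suc k * K / \<tau> ^ k"
        using approx[OF elim] elim by (intro divide_right_mono) auto
      finally show ?case using elim by simp
    qed
  have "((\<lambda>\<tau>. \<tau> * K) \<longlongrightarrow> 0 * K) (at_right 0)" by (intro tendsto_intros)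
  then have "((\<lambda>\<tau>. A \<tau> / of_real (\<tau> ^ k) - of_real ((- 1) ^ k / fact k) * m k) \<longlongrightarrow> 0) (at_right 0)"
    by (intro Lim_null_comparison[OF ev]) simp
  then have "((\<lambda>\<tau>. A \<tau> / of_real (\<tau> ^ k) - (A \<tau> / of_real (\<tau> ^ k) - of_real ((- 1) ^ k / fact k) * m k)) \<longlongrightarrow> 0 - 0) (at_right 0)"
    using flat[of k] unfolding A_def[symmetric] by (intro tendsto_diff)
  then have "((\<lambda>\<tau>::real. of_real ((- 1) ^ k / fact k) * m k) \<longlongrightarrow> 0) (at_right 0)" by simp
  then have "of_real ((- 1) ^ k / fact k) * m k = 0"
    by (intro tendsto_unique[OF trivial_limit_at_right_real tendsto_const])
  then show ?case by (simp add: m_def)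
qed

text \<open>
  The absolute moments are estimated through a scale \<open>s\<close> with \<open>k \<le> s \<Theta>(s\<^sup>4)\<close>.  Where \<open>X \<le> s\<close> the
  trivial bound \<open>s\<^sup>k\<close> suffices; where \<open>s < X \<le> s\<^sup>4\<close> monotonicity turns the first hypothesis into
  \<open>exp (- k X / s)\<close>, and \<open>X\<^sup>k exp (- k X / s) \<le> s\<^sup>k\<close>; where \<open>X > s\<^sup>4\<close> the Gevrey hypothesis with the
  same \<open>k\<close> wins, because \<open>((2 k)!)\<^sup>2\<close> is at most \<open>(const s)\<^bsup>4 k\<^esup> \<le> const\<^sup>k X\<^sup>k\<close>.  Hence the \<open>k\<close>-th
  root of the \<open>k\<close>-th moment is \<open>O(s)\<close>, and running through \<open>s = 2\<^sup>i\<close> gives Carleman's condition.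
  The transform of \<open>exp (- \<tau> X\<^sup>2)\<close> is finally recovered from cosines, as a Gaussian is an average of
  them.
\<close>

theorem flat_laplace_transform_vanishes:
  fixes \<Theta> :: "real \<Rightarrow> real" and h :: "'a \<Rightarrow> complex" and X \<sigma> :: "'a \<Rightarrow> real"
  assumes "sigma_finite_measure M"
    and nonneg: "\<And>t. t \<ge> 0 \<Longrightarrow> \<Theta> t \<ge> 0" and anti: "antimono_on {0..} \<Theta>"
    and diverge: "(\<integral>\<^sup>+ t\<in>{1..}. ennreal (\<Theta> t / t) \<partial>lborel) = \<infinity>"
    and [measurable]: "h \<in> borel_measurable M" "X \<in> borel_measurable M"
    and X_pos: "\<And>w. X w > 0"
    and \<sigma>_int: "integrable M \<sigma>" and \<sigma>_nonneg: "\<And>w. \<sigma> w \<ge> 0"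
    and ingham: "\<And>w. cmod (h w) \<le> exp (- \<Theta> (X w) * X w) * \<sigma> w"
    and gevrey: "\<And>w k. X w ^ (2 * k) * cmod (h w) \<le> A * D ^ k * (fact (2 * k))\<^sup>2 * \<sigma> w"
    and flat: "\<And>k. ((\<lambda>\<tau>. (LINT w|M. of_real (exp (- \<tau> * (X w)\<^sup>2)) * h w) / of_real (\<tau> ^ k)) \<longlongrightarrow> 0) (at_right 0)"
    and AD: "A \<ge> 0" "D \<ge> 0" and \<tau>: "\<tau> > 0"
  shows "(LINT w|M. of_real (exp (- \<tau> * (X w)\<^sup>2)) * h w) = 0"
proof -
  interpret sigma_finite_measure M by fact
  have \<Theta>_le: "\<Theta> t \<le> \<Theta> s" if "0 \<le> s" "s \<le> t" for s t
    using anti that by (auto simp: monotone_on_def)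
  have even_int: "integrable M (\<lambda>w. of_real (X w ^ (2 * k)) * h w)" for k
  proof (rule Bochner_Integration.integrable_bound)
    show "integrable M (\<lambda>w. A * D ^ k * (fact (2 * k))\<^sup>2 * \<sigma> w)" by (intro integrable_mult_right \<sigma>_int)
    show "AE w in M. norm (of_real (X w ^ (2 * k)) * h w) \<le> norm (A * D ^ k * (fact (2 * k))\<^sup>2 * \<sigma> w)"
    proof (intro AE_I2)
      fix w
      show "norm (of_real (X w ^ (2 * k)) * h w) \<le> norm (A * D ^ k * (fact (2 * k))\<^sup>2 * \<sigma> w)"
        using gevrey[of w k] X_pos[of w] by (simp add: norm_mult norm_power del: fact_Suc)
    qed
  qed measurable
  have h_int: "integrable M h" using even_int[of 0] by simp
  have int: "integrable M (\<lambda>w. of_real (X w ^ k) * h w)" for k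
  proof (rule Bochner_Integration.integrable_bound)
    show "integrable M (\<lambda>w. cmod (h w) + cmod (of_real (X w ^ (2 * k)) * h w))"
      by (intro Bochner_Integration.integrable_add integrable_norm h_int even_int)
    show "AE w in M. norm (of_real (X w ^ k) * h w) \<le> norm (cmod (h w) + cmod (of_real (X w ^ (2 * k)) * h w))"
    proof (intro AE_I2)
      fix w
      have "X w ^ k \<le> 1 + X w ^ (2 * k)"
      proof (cases "X w \<le> 1")
        case True
        then have "X w ^ k \<le> 1" using X_pos[of w] by (intro power_le_one) auto
        then show ?thesis using X_pos[of w] zero_le_power[of "X w" "2 * k"] by linarith
      next
        case False
        then have "X w ^ k \<le> X w ^ (2 * k)" by (intro power_increasing) auto
        then show ?thesis by simp
      qed
      then have "X w ^ k * cmod (h w) \<le> (1 + X w ^ (2 * k)) * cmod (h w)" by (rule mult_right_mono) simp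
      then show "norm (of_real (X w ^ k) * h w) \<le> norm (cmod (h w) + cmod (of_real (X w ^ (2 * k)) * h w))"
        using X_pos[of w] by (simp add: norm_mult norm_power distrib_right)
    qed
  qed measurable
  define N where "N k = (LINT w|M. cmod (h w) * X w ^ k)" for k
  define \<theta>0 where "\<theta>0 = \<Theta> 0 + 1"
  have \<theta>0: "\<theta>0 > 0" "\<Theta> t \<le> \<theta>0" if "t \<ge> 0" for t
    using nonneg[of 0] \<Theta>_le[of 0 t] that unfolding \<theta>0_def by linarith+
  define E where "E = 1 + D * (2 * \<theta>0) ^ 4"
  have E: "E \<ge> 1" "D * (2 * \<theta>0) ^ 4 \<le> E" using AD \<theta>0(1)[OF order_refl] by (auto simp: E_def)
  have pointwise: "X w ^ k * cmod (h w) \<le> (1 + A) * E ^ k * s ^ k * \<sigma> w"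
    if k: "real k \<le> s * \<Theta> (s ^ 4)" and s: "s \<ge> 1" for w k s
  proof -
    have case1: ?thesis if "X w ^ k * cmod (h w) \<le> s ^ k * \<sigma> w"
    proof -
      have "1 * (s ^ k * \<sigma> w) \<le> ((1 + A) * E ^ k) * (s ^ k * \<sigma> w)"
        using AD E s \<sigma>_nonneg[of w] one_le_power[of E k] mult_mono[of 1 "1 + A" 1 "E ^ k"]
        by (intro mult_right_mono) auto
      then show ?thesis using that by (simp add: mult.assoc)
    qed
    consider "X w \<le> s" | "s < X w" "X w \<le> s ^ 4" | "s ^ 4 < X w" by linarith
    then show ?thesis
    proof cases
      case 1
      have "cmod (h w) \<le> 1 * \<sigma> w"
        using ingham[of w] X_pos[of w] nonneg[of "X w"] \<sigma>_nonneg[of w]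
        by (elim order_trans, intro mult_right_mono) auto
      then show ?thesis using 1 X_pos[of w] s by (intro case1 mult_mono power_mono) auto
    next
      case 2
      have "\<Theta> (s ^ 4) * X w \<le> \<Theta> (X w) * X w"
        using 2 X_pos[of w] by (intro mult_right_mono \<Theta>_le) auto
      moreover have "real k * (X w / s) \<le> \<Theta> (s ^ 4) * X w"
        using mult_right_mono[OF k, of "X w / s"] X_pos[of w] s by simp
      ultimately have "cmod (h w) \<le> exp (- (real k * (X w / s))) * \<sigma> w"
        using ingham[of w] \<sigma>_nonneg[of w] by (elim order_trans, intro mult_right_mono) auto
      then have "X w ^ k * cmod (h w) \<le> X w ^ k * (exp (- (real k * (X w / s))) * \<sigma> w)"
        using X_pos[of w] by (intro mult_left_mono) auto
      also have "\<dots> = (X w * exp (- (X w / s))) ^ k * \<sigma> w"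
        by (simp add: power_mult_distrib exp_of_nat_mult[symmetric])
      also have "\<dots> \<le> s ^ k * \<sigma> w"
      proof (intro mult_right_mono power_mono \<sigma>_nonneg)
        have "X w / s \<le> exp (X w / s)" using exp_ge_add_one_self[of "X w / s"] by linarith
        then show "X w * exp (- (X w / s)) \<le> s" using s by (simp add: exp_minus field_simps)
      qed (use X_pos[of w] in auto)
      finally show ?thesis by (rule case1)
    next
      case 3
      have Xk: "X w ^ k > 0" using X_pos[of w] by simp
      have k_le: "real k \<le> \<theta>0 * s"
      proof -
        have "s * \<Theta> (s ^ 4) \<le> s * \<theta>0" using s by (intro mult_left_mono \<theta>0(2)) auto
        then show ?thesis using k by (simp add: mult.commute)
      qed
      have "(fact (2 * k))\<^sup>2 \<le> (real (2 * k) ^ (2 * k))\<^sup>2"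
        using fact_le_power[of "2 * k", where 'a = real] by (intro power_mono) auto
      also have "\<dots> = (2 * real k) ^ (4 * k)" 
      proof -
        have "2 * k * 2 = 4 * k" by simp
        then show ?thesis by (simp only: power_mult[symmetric] of_nat_mult of_nat_numeral)
      qed
      also have "\<dots> \<le> (2 * (\<theta>0 * s)) ^ (4 * k)" using k_le by (intro power_mono) auto
      also have "\<dots> = ((2 * \<theta>0) ^ 4) ^ k * (s ^ 4) ^ k"
        by (simp only: power_mult power_mult_distrib mult.assoc)
      also have "\<dots> \<le> ((2 * \<theta>0) ^ 4) ^ k * X w ^ k"
        using 3 s \<theta>0(1)[OF order_refl] by (intro mult_left_mono power_mono) auto
      finally have f: "(fact (2 * k))\<^sup>2 \<le> ((2 * \<theta>0) ^ 4) ^ k * X w ^ k" .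
      have "X w ^ k * (X w ^ k * cmod (h w)) = X w ^ (2 * k) * cmod (h w)"
        by (simp add: mult_2 power_add)
      also have "\<dots> \<le> A * D ^ k * (fact (2 * k))\<^sup>2 * \<sigma> w" by (rule gevrey)
      also have "\<dots> \<le> A * D ^ k * (((2 * \<theta>0) ^ 4) ^ k * X w ^ k) * \<sigma> w"
        using f AD \<sigma>_nonneg by (intro mult_right_mono mult_left_mono) auto
      also have "\<dots> = X w ^ k * (A * (D * (2 * \<theta>0) ^ 4) ^ k * \<sigma> w)"
        by (simp add: power_mult_distrib mult_ac)
      finally have "X w ^ k * cmod (h w) \<le> A * (D * (2 * \<theta>0) ^ 4) ^ k * \<sigma> w"
        using Xk by simp
      also have "\<dots> \<le> (1 + A) * E ^ k * \<sigma> w"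
        using AD E \<theta>0(1)[OF order_refl] \<sigma>_nonneg[of w] by (intro mult_right_mono mult_mono power_mono) auto
      also have "\<dots> * 1 \<le> (1 + A) * E ^ k * \<sigma> w * s ^ k"
        using AD E \<sigma>_nonneg[of w] one_le_power[OF s] by (intro mult_left_mono) auto
      finally show ?thesis by (simp add: mult_ac)
    qed
  qed
  define S where "S = (1 + A) * (1 + (LINT w|M. \<sigma> w))"
  have \<sigma>_ge: "(LINT w|M. \<sigma> w) \<ge> 0" using \<sigma>_nonneg by simp
  have S: "S \<ge> 1" using AD \<sigma>_ge mult_mono[of 1 "1 + A" 1 "1 + (LINT w|M. \<sigma> w)"] by (simp add: S_def)
  have abs_int: "integrable M (\<lambda>w. cmod (h w) * X w ^ k)" for k
    using integrable_norm[OF int[of k]] X_pos by (simp add: norm_mult norm_power abs_of_pos mult.commute)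
  have N_le: "N k \<le> S * E ^ k * s ^ k" if "real k \<le> s * \<Theta> (s ^ 4)" "s \<ge> 1" for k s
  proof -
    have "N k \<le> (LINT w|M. (1 + A) * E ^ k * s ^ k * \<sigma> w)"
      unfolding N_def using pointwise[OF that] \<sigma>_int
      by (intro integral_mono abs_int integrable_mult_right) (auto simp: mult.commute)
    also have "\<dots> = (1 + A) * (LINT w|M. \<sigma> w) * (E ^ k * s ^ k)" by simp
    also have "\<dots> \<le> S * (E ^ k * s ^ k)"
      unfolding S_def using AD E that by (intro mult_right_mono mult_left_mono) auto
    finally show ?thesis by (simp add: mult_ac)
  qed
  show ?thesis
  proof (cases "N 0 = 0")
    case True
    then have "AE w in M. h w = 0"
      using integral_nonneg_eq_0_iff_AE[of M "\<lambda>w. cmod (h w)"] h_int by (simp add: N_def)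
    then have "(LINT w|M. of_real (exp (- \<tau> * (X w)\<^sup>2)) * h w) = (LINT w|M. 0)"
      by (intro integral_cong_AE) auto
    then show ?thesis by simp
  next
    case False
    have N_pos: "N k > 0" for k
    proof (rule ccontr)
      assume "\<not> N k > 0"
      moreover have "N k \<ge> 0" unfolding N_def using X_pos
        by (intro integral_nonneg_AE AE_I2 mult_nonneg_nonneg zero_le_power) (auto intro: less_imp_le)
      ultimately have "N k = 0" by simp
      moreover have "AE w in M. 0 \<le> cmod (h w) * X w ^ k"
        using X_pos by (intro AE_I2 mult_nonneg_nonneg zero_le_power) (auto intro: less_imp_le)
      ultimately have "AE w in M. cmod (h w) * X w ^ k = 0"
        using integral_nonneg_eq_0_iff_AE[OF abs_int[of k]] by (simp add: N_def)
      then have "AE w in M. h w = 0" by eventually_elim (use X_pos in \<open>metis less_irrefl mult_eq_0_iff norm_eq_zero power_not_zero\<close>)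
      then have "N 0 = (LINT w|M. 0)" unfolding N_def by (intro integral_cong_AE) auto
      then show False using False by simp
    qed
    have carleman: "\<not> summable (\<lambda>k. root (Suc k) (1 / N (Suc k)))"
    proof (rule not_summable_from_counting[where \<theta> = "\<lambda>i. \<Theta> (16 ^ i)" and c = "1 / (S * E)"])
      show "\<not> summable (\<lambda>i. \<Theta> (16 ^ i))" by (rule dyadic_sum_diverges[OF nonneg anti diverge])
      show "0 \<le> root (Suc k) (1 / N (Suc k))" for k using N_pos by (intro real_root_ge_zero) (simp add: less_imp_le)
      show "root (Suc k) (1 / N (Suc k)) \<ge> 1 / (S * E) / 2 ^ i" if "real (Suc k) \<le> 2 ^ i * \<Theta> (16 ^ i)" for k i
      proof -
        have "(16::real) ^ i = (2 ^ i) ^ 4" by (simp add: power_mult[symmetric] mult.commute[of i] power_mult)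
        then have "N (Suc k) \<le> S * E ^ Suc k * (2 ^ i) ^ Suc k" using that by (intro N_le) auto
        also have "\<dots> \<le> S ^ Suc k * E ^ Suc k * (2 ^ i) ^ Suc k"
          using S E power_increasing[of 1 "Suc k" S] by (intro mult_right_mono) auto
        finally have "1 / (S * E * 2 ^ i) ^ Suc k \<le> 1 / N (Suc k)"
          using N_pos[of "Suc k"] S E unfolding power_mult_distrib by (intro divide_left_mono) auto
        then have "root (Suc k) ((1 / (S * E * 2 ^ i)) ^ Suc k) \<le> root (Suc k) (1 / N (Suc k))"
          by (simp add: power_one_over del: power_Suc)
        then show ?thesis using S E by (subst (asm) real_root_power_cancel) auto
      qed
    qed (use nonneg S E in auto)
    have cos_zero: "(LINT w|M. of_real (cos (s * X w)) * h w) = 0" for s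
      using carleman unfolding N_def
      by (intro carleman_stieltjes X_pos int moments_vanish_if_flat flat) auto
    define G where "G = density lborel std_normal_density"
    interpret G: prob_space std_normal_distribution by (rule prob_space_normal_density) simp
    interpret P: pair_sigma_finite std_normal_distribution M by standard
    have gauss: "(LINT s|std_normal_distribution. cos (s * c)) = exp (- c\<^sup>2 / 2)" for c
    proof -
      have "integrable std_normal_distribution (\<lambda>s. iexp (s * c))"
        by (rule G.integrable_const_bound[where B = 1]) auto
      then have "(LINT s|std_normal_distribution. cos (s * c)) = Re (char std_normal_distribution c)"
        unfolding char_def by (subst integral_Re[symmetric]) (auto simp: Re_exp mult.commute)
      then show ?thesis by (simp add: char_std_normal_distribution Re_exp)
    qed
    have "(LINT w|M. of_real (exp (- \<tau> * (X w)\<^sup>2)) * h w)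
        = (LINT w|M. (LINT s|std_normal_distribution. of_real (cos (s * (sqrt (2 * \<tau>) * X w))) * h w))"
    proof (intro Bochner_Integration.integral_cong refl)
      fix w
      have "(LINT s|std_normal_distribution. of_real (cos (s * (sqrt (2 * \<tau>) * X w))) * h w)
         = of_real (LINT s|std_normal_distribution. cos (s * (sqrt (2 * \<tau>) * X w))) * h w"
        by (simp only: integral_mult_left_zero integral_complex_of_real)
      then show "of_real (exp (- \<tau> * (X w)\<^sup>2)) * h w
          = (LINT s|std_normal_distribution. of_real (cos (s * (sqrt (2 * \<tau>) * X w))) * h w)"
        using \<tau> by (simp only: gauss) (simp add: power_mult_distrib)
    qed
    also have "\<dots> = (LINT s|std_normal_distribution. (LINT w|M. of_real (cos (s * (sqrt (2 * \<tau>) * X w))) * h w))"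
    proof (rule P.Fubini_integral)
      show "integrable (std_normal_distribution \<Otimes>\<^sub>M M) (\<lambda>(s, w). of_real (cos (s * (sqrt (2 * \<tau>) * X w))) * h w)"
      proof (rule P.Fubini_integrable)
        have b: "cmod (of_real (cos (s * (sqrt (2 * \<tau>) * X w))) * h w) \<le> cmod (h w)" for s w
          by (simp add: norm_mult mult_left_le_one_le)
        show "AE s in std_normal_distribution. integrable M (\<lambda>w. case (s, w) of (s, w) \<Rightarrow> of_real (cos (s * (sqrt (2 * \<tau>) * X w))) * h w)"
          by (intro AE_I2, simp only: prod.case, rule Bochner_Integration.integrable_bound[OF h_int])
            (use b in \<open>auto\<close>)
        show "integrable std_normal_distribution (\<lambda>s. LINT w|M. norm (case (s, w) of (s, w) \<Rightarrow> of_real (cos (s * (sqrt (2 * \<tau>) * X w))) * h w))"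
        proof (rule G.integrable_const_bound[where B = "LINT w|M. cmod (h w)"])
          show "AE s in std_normal_distribution. norm (LINT w|M. norm (case (s, w) of (s, w) \<Rightarrow> of_real (cos (s * (sqrt (2 * \<tau>) * X w))) * h w)) \<le> (LINT w|M. cmod (h w))"
            using b h_int by (intro AE_I2) (auto intro!: integral_mono Bochner_Integration.integrable_bound[OF h_int])
        qed measurable
      qed measurable
    qed
    also have "\<dots> = 0"
      using cos_zero[of "s * sqrt (2 * \<tau>)" for s] by (simp add: mult.assoc)
    finally show ?thesis .
  qed
qed

section \<open>Uniqueness of Fourier transforms and integrals over product spaces\<close>

text \<open>
  Splitting a real density into its positive and negative parts reduces the claim to Levy's
  uniqueness theorem for characteristic functions of probability measures: the two parts have equal
  mass, and after normalization the two image measures under \<open>X\<close> have equal characteristic functions.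
\<close>

lemma fourier_uniqueness_marginal_real:
  fixes h X :: "'a \<Rightarrow> real"
  assumes h_int: "integrable M h" and X [measurable]: "X \<in> borel_measurable M"
    and zero: "\<And>s. (LINT w|M. iexp (s * X w) * of_real (h w)) = 0" and B [measurable]: "B \<in> sets borel"
  shows "(LINT w|M. h w * indicator B (X w)) = 0"
proof -
  have [measurable]: "h \<in> borel_measurable M" using h_int by simp
  define p where "p w = max (h w) 0" for w
  define m where "m w = max (- h w) 0" for w
  have [measurable]: "p \<in> borel_measurable M" "m \<in> borel_measurable M" by (simp_all add: p_def[abs_def] m_def[abs_def])
  have h_eq: "h w = p w - m w" for w by (simp add: p_def m_def max_def)
  have pm_nonneg: "p w \<ge> 0" "m w \<ge> 0" for w by (auto simp: p_def m_def)
  have p_int: "integrable M p" and m_int: "integrable M m"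
    unfolding p_def m_def using h_int by auto
  have iexp_int: "integrable M (\<lambda>w. iexp (s * X w) * of_real (g w))"
    if "integrable M g" for g :: "'a \<Rightarrow> real" and s
    using that by (intro Bochner_Integration.integrable_bound[OF that]) (auto simp: norm_mult)
  have same: "(LINT w|M. iexp (s * X w) * of_real (p w)) = (LINT w|M. iexp (s * X w) * of_real (m w))" for s
    using zero[of s] Bochner_Integration.integral_diff[OF iexp_int[OF p_int] iexp_int[OF m_int], of s s]
    by (simp add: h_eq right_diff_distrib)
  define c where "c = (LINT w|M. p w)"
  have c_m: "(LINT w|M. m w) = c"
    using same[of 0] by (simp add: c_def)
  have restrict_int: "integrable M (\<lambda>w. g w * indicator B (X w))" if "integrable M g" for g :: "'a \<Rightarrow> real"
    using that by (intro Bochner_Integration.integrable_bound[OF that]) (auto simp: indicator_def)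
  have c_nonneg: "c \<ge> 0" unfolding c_def using pm_nonneg by simp
  show ?thesis
  proof (cases "c = 0")
    case True
    have "AE w in M. p w = 0" "AE w in M. m w = 0"
      using integral_nonneg_eq_0_iff_AE[OF p_int] integral_nonneg_eq_0_iff_AE[OF m_int] pm_nonneg True c_m
      by (auto simp: c_def)
    then have "AE w in M. h w * indicator B (X w) = 0" by eventually_elim (simp add: h_eq)
    then have "(LINT w|M. h w * indicator B (X w)) = (LINT w|M. 0)" by (intro integral_cong_AE) auto
    then show ?thesis by simp
  next
    case False
    then have c: "c > 0" using c_nonneg by simp
    define D where "D g = distr (density M (\<lambda>w. ennreal (g w / c))) borel X" for g :: "'a \<Rightarrow> real"
    have D_distr: "real_distribution (D g)"
      if g: "integrable M g" "\<And>w. g w \<ge> 0" "(LINT w|M. g w) = c" for g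
    proof -
      have [measurable]: "g \<in> borel_measurable M" using g by simp
      have "emeasure (density M (\<lambda>w. ennreal (g w / c))) (space M) = (\<integral>\<^sup>+ w. ennreal (g w / c) \<partial>M)"
        by (subst emeasure_density) (auto intro!: nn_integral_cong)
      also have "\<dots> = ennreal (LINT w|M. g w / c)"
        using g c by (intro nn_integral_eq_integral) auto
      also have "\<dots> = 1" using g c by simp
      finally have "prob_space (density M (\<lambda>w. ennreal (g w / c)))"
        by (intro prob_spaceI) simp
      then have "prob_space (D g)" unfolding D_def by (rule prob_space.prob_space_distr) simp
      then show ?thesis unfolding real_distribution_def real_distribution_axioms_def by (simp add: D_def)
    qed
    have D_char: "char (D g) s = (LINT w|M. iexp (s * X w) * of_real (g w)) / c"
      if g: "integrable M g" "\<And>w. g w \<ge> 0" for g s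
    proof -
      have [measurable]: "g \<in> borel_measurable M" using g by simp
      have "char (D g) s = (LINT w|density M (\<lambda>w. ennreal (g w / c)). iexp (s * X w))"
        unfolding char_def D_def by (subst integral_distr) auto
      also have "\<dots> = (LINT w|M. (g w / c) *\<^sub>R iexp (s * X w))"
        using g c by (subst integral_density) auto
      also have "\<dots> = (LINT w|M. iexp (s * X w) * of_real (g w) / c)"
        by (intro Bochner_Integration.integral_cong) (auto simp: scaleR_conv_of_real)
      finally show ?thesis by simp
    qed
    have "D p = D m"
      using p_int m_int pm_nonneg c_m same
      by (intro Levy_uniqueness D_distr ext) (auto simp: D_char c_def)
    then have "emeasure (D p) B = emeasure (D m) B" by simp
    moreover have "emeasure (D g) B = ennreal ((LINT w|M. g w * indicator B (X w)) / c)"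
      if g: "integrable M g" "\<And>w. g w \<ge> 0" for g
    proof -
      have [measurable]: "g \<in> borel_measurable M" using g by simp
      have "emeasure (D g) B = (\<integral>\<^sup>+ w. ennreal (g w / c) * indicator (X -` B \<inter> space M) w \<partial>M)"
        unfolding D_def by (subst emeasure_distr) (auto simp: emeasure_density)
      also have "\<dots> = (\<integral>\<^sup>+ w. ennreal (g w * indicator B (X w) / c) \<partial>M)"
        by (intro nn_integral_cong) (auto simp: indicator_def)
      also have "\<dots> = ennreal (LINT w|M. g w * indicator B (X w) / c)"
        using g c restrict_int[OF g(1)] by (intro nn_integral_eq_integral) auto
      finally show ?thesis by simp
    qed
    ultimately have "(LINT w|M. p w * indicator B (X w)) / c = (LINT w|M. m w * indicator B (X w)) / c"
      using p_int m_int pm_nonneg c by (simp add: integral_nonneg_AE divide_nonneg_pos)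
    then show ?thesis
      using c Bochner_Integration.integral_diff[OF restrict_int[OF p_int] restrict_int[OF m_int]]
      by (simp add: h_eq left_diff_distrib)
  qed
qed

lemma integral_cnj: "(LINT w|M. cnj (f w)) = cnj (LINT w|M. f w)"
  by (rule integral_bounded_linear'[OF bounded_linear_cnj bounded_linear_cnj]) simp

lemma integrable_unimodular_times:
  fixes h u :: "'a \<Rightarrow> complex"
  assumes "integrable M h" "u \<in> borel_measurable M" "\<And>w. cmod (u w) \<le> 1"
  shows "integrable M (\<lambda>w. u w * h w)"
  using assms by (intro Bochner_Integration.integrable_bound[OF assms(1)]) (auto simp: norm_mult mult_left_le_one_le)

text \<open>
  The transforms at \<open>s\<close> and \<open>- s\<close> together determine those of the real and the imaginary part of \<open>h\<close>.
\<close>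

theorem fourier_uniqueness_marginal:
  fixes h :: "'a \<Rightarrow> complex" and X :: "'a \<Rightarrow> real"
  assumes h_int: "integrable M h" and X [measurable]: "X \<in> borel_measurable M"
    and zero: "\<And>s. (LINT w|M. iexp (s * X w) * h w) = 0" and B [measurable]: "B \<in> sets borel"
  shows "(LINT w|M. indicator B (X w) * h w) = 0"
proof -
  have [measurable]: "h \<in> borel_measurable M" using h_int by simp
  have e_int: "integrable M (\<lambda>w. iexp (s * X w) * h w)" "integrable M (\<lambda>w. iexp (s * X w) * cnj (h w))" for s
    using h_int by (auto intro!: integrable_unimodular_times)
  have conj_zero: "(LINT w|M. iexp (s * X w) * cnj (h w)) = 0" for s
  proof -
    have "(LINT w|M. iexp (s * X w) * cnj (h w)) = cnj (LINT w|M. iexp ((- s) * X w) * h w)"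
      unfolding integral_cnj[symmetric] by (simp add: exp_cnj)
    then show ?thesis using zero[of "- s"] by simp
  qed
  have re: "(LINT w|M. iexp (s * X w) * of_real (Re (h w))) = 0" for s
  proof -
    have "(LINT w|M. iexp (s * X w) * of_real (Re (h w)))
        = (LINT w|M. (iexp (s * X w) * h w + iexp (s * X w) * cnj (h w)) / 2)"
      by (intro Bochner_Integration.integral_cong) (auto simp: complex_add_cnj simp flip: distrib_left)
    then show ?thesis using e_int[of s] zero[of s] conj_zero[of s] by simp
  qed
  have im: "(LINT w|M. iexp (s * X w) * of_real (Im (h w))) = 0" for s
  proof -
    have "(LINT w|M. iexp (s * X w) * of_real (Im (h w)))
        = (LINT w|M. (iexp (s * X w) * h w - iexp (s * X w) * cnj (h w)) / (2 * \<i>))"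
      unfolding right_diff_distrib[symmetric] complex_diff_cnj by (simp add: mult.commute)
    then show ?thesis using e_int[of s] zero[of s] conj_zero[of s] by simp
  qed
  have "(LINT w|M. Re (h w) * indicator B (X w)) = 0" "(LINT w|M. Im (h w) * indicator B (X w)) = 0"
    using h_int by (intro fourier_uniqueness_marginal_real X B re im; simp)+
  moreover have i: "integrable M (\<lambda>w. indicator B (X w) * h w)"
    by (intro integrable_unimodular_times h_int) (auto simp: indicator_def)
  moreover have "(LINT w|M. Re (h w) * indicator B (X w)) = Re (LINT w|M. indicator B (X w) * h w)"
    unfolding integral_Re[OF i, symmetric] by (intro Bochner_Integration.integral_cong) (auto simp: indicator_def)
  moreover have "(LINT w|M. Im (h w) * indicator B (X w)) = Im (LINT w|M. indicator B (X w) * h w)"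
    unfolding integral_Im[OF i, symmetric] by (intro Bochner_Integration.integral_cong) (auto simp: indicator_def)
  ultimately show ?thesis by (intro complex_eqI) simp_all
qed

lemma AE_zero_if_box_integrals_zero_real:
  fixes h :: "'a::euclidean_space \<Rightarrow> real"
  assumes h_int: "integrable lborel h" and zero: "\<And>a b. (LINT x|lborel. indicator (box a b) x * h x) = 0"
  shows "AE x in lborel. h x = 0"
proof -
  have [measurable]: "h \<in> borel_measurable borel" using borel_measurable_integrable[OF h_int] by simp
  define p where "p w = max (h w) 0" for w
  define m where "m w = max (- h w) 0" for w
  have [measurable]: "p \<in> borel_measurable borel" "m \<in> borel_measurable borel" by (simp_all add: p_def[abs_def] m_def[abs_def])
  have h_eq: "h w = p w - m w" for w by (simp add: p_def m_def max_def)
  have pm_nonneg: "p w \<ge> 0" "m w \<ge> 0" for w by (auto simp: p_def m_def)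
  have p_int: "integrable lborel p" and m_int: "integrable lborel m"
    unfolding p_def m_def using h_int by auto
  have r_int: "integrable lborel (\<lambda>x. indicator (box a b) x * g x)" if "integrable lborel g" for g :: "'a \<Rightarrow> real" and a b
    by (rule Bochner_Integration.integrable_bound[OF that])
      (use borel_measurable_integrable[OF that] in \<open>auto simp: indicator_def\<close>)
  have em: "emeasure (density lborel (\<lambda>x. ennreal (g x))) (box a b) = ennreal (LINT x|lborel. indicator (box a b) x * g x)"
    if g: "integrable lborel g" "\<And>x. g x \<ge> 0" for g :: "'a \<Rightarrow> real" and a b
  proof -
    have [measurable]: "g \<in> borel_measurable borel" using borel_measurable_integrable[OF g(1)] by simp
    have "emeasure (density lborel (\<lambda>x. ennreal (g x))) (box a b) = (\<integral>\<^sup>+ x. ennreal (indicator (box a b) x * g x) \<partial>lborel)"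
      by (subst emeasure_density) (auto intro!: nn_integral_cong simp: indicator_def)
    also have "\<dots> = ennreal (LINT x|lborel. indicator (box a b) x * g x)"
      using g r_int[OF g(1)] by (intro nn_integral_eq_integral) auto
    finally show ?thesis .
  qed
  have "density lborel (\<lambda>x. ennreal (p x)) = density lborel (\<lambda>x. ennreal (m x))"
  proof (rule measure_eqI_generator_eq)
    let ?E = "range (\<lambda>(a, b). box a b::'a set)"
    show "Int_stable ?E" by (auto simp: Int_stable_def box_Int_box)
    show "?E \<subseteq> Pow UNIV" "sets (density lborel (\<lambda>x. ennreal (p x))) = sigma_sets UNIV ?E"
      "sets (density lborel (\<lambda>x. ennreal (m x))) = sigma_sets UNIV ?E"
      by (simp_all add: borel_eq_box)
    let ?A = "\<lambda>n::nat. box (- (real n *\<^sub>R One)) (real n *\<^sub>R One) :: 'a set"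
    show "range ?A \<subseteq> ?E" "(\<Union>i. ?A i) = UNIV" unfolding UN_box_eq_UNIV by auto
    show "emeasure (density lborel (\<lambda>x. ennreal (p x))) (?A i) \<noteq> \<infinity>" for i
      by (simp add: em[OF p_int pm_nonneg(1)])
    show "emeasure (density lborel (\<lambda>x. ennreal (p x))) X = emeasure (density lborel (\<lambda>x. ennreal (m x))) X"
      if X_box: "X \<in> ?E" for X
    proof -
      obtain a b where X: "X = box a b" using X_box by auto
      have "(LINT x|lborel. indicator (box a b) x * p x) = (LINT x|lborel. indicator (box a b) x * m x)"
        using zero[of a b] Bochner_Integration.integral_diff[OF r_int[OF p_int] r_int[OF m_int], of a b a b]
        by (simp add: h_eq right_diff_distrib)
      then show ?thesis unfolding X by (simp only: em[OF p_int pm_nonneg(1)] em[OF m_int pm_nonneg(2)])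
    qed
  qed
  then have "AE x in lborel. ennreal (p x) = ennreal (m x)"
    using p_int pm_nonneg
    by (subst (asm) finite_density_unique) (auto simp: nn_integral_eq_integral)
  then show ?thesis by eventually_elim (use pm_nonneg in \<open>simp add: h_eq\<close>)
qed

lemma AE_zero_if_box_integrals_zero:
  fixes h :: "'a::euclidean_space \<Rightarrow> complex"
  assumes h_int: "integrable lborel h" and zero: "\<And>a b. (LINT x|lborel. indicator (box a b) x * h x) = 0"
  shows "AE x in lborel. h x = 0"
proof -
  have [measurable]: "h \<in> borel_measurable borel" using borel_measurable_integrable[OF h_int] by simp
  have i: "integrable lborel (\<lambda>x. indicator (box a b) x * h x)" for a b
    by (intro integrable_unimodular_times h_int) (auto simp: indicator_def)
  have "(LINT x|lborel. indicator (box a b) x * Re (h x)) = Re (LINT x|lborel. indicator (box a b) x * h x)" for a b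
    unfolding integral_Re[OF i, symmetric] by (intro Bochner_Integration.integral_cong) (auto simp: indicator_def)
  moreover have "(LINT x|lborel. indicator (box a b) x * Im (h x)) = Im (LINT x|lborel. indicator (box a b) x * h x)" for a b
    unfolding integral_Im[OF i, symmetric] by (intro Bochner_Integration.integral_cong) (auto simp: indicator_def)
  ultimately have "AE x in lborel. Re (h x) = 0" "AE x in lborel. Im (h x) = 0"
    using h_int by (intro AE_zero_if_box_integrals_zero_real; simp add: zero)+
  then show ?thesis by eventually_elim (simp add: complex_eq_iff)
qed

text \<open>
  The one-dimensional result is applied coordinate by coordinate: multiplying \<open>f\<close> by the indicator of
  an interval in one coordinate preserves the vanishing of the transform in the others, and after all
  coordinates the integrals of \<open>f\<close> over boxes are seen to be zero.
\<close>

theorem fourier_uniqueness: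
  fixes f :: "'a::euclidean_space \<Rightarrow> complex"
  assumes f_int: "integrable lborel f" and zero: "\<And>v. (LINT x|lborel. iexp (v \<bullet> x) * f x) = 0"
  shows "AE x in lborel. f x = 0"
proof (rule AE_zero_if_box_integrals_zero[OF f_int])
  fix l u :: 'a
  have [measurable]: "f \<in> borel_measurable borel" using borel_measurable_integrable[OF f_int] by simp
  define c where "c J x = (\<Prod>b\<in>J. indicator {l \<bullet> b <..< u \<bullet> b} (x \<bullet> b) :: complex)" for J and x :: 'a
  have c_meas [measurable]: "c J \<in> borel_measurable borel" for J unfolding c_def by measurable
  have c_le: "cmod (c J x) \<le> 1" for J x
    unfolding c_def prod_norm[symmetric] by (intro prod_le_1) (auto simp: indicator_def)
  have claim: "(LINT x|lborel. iexp (v \<bullet> x) * (c J x * f x)) = 0" if "finite J" for J v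
    using that
  proof (induction J arbitrary: v rule: finite_induct)
    case empty
    then show ?case using zero by (simp add: c_def)
  next
    case (insert b J)
    have "(LINT x|lborel. indicator {l \<bullet> b <..< u \<bullet> b} (x \<bullet> b) * (iexp (v \<bullet> x) * (c J x * f x))) = 0"
    proof (rule fourier_uniqueness_marginal)
      show "integrable lborel (\<lambda>x. iexp (v \<bullet> x) * (c J x * f x))"
        by (intro integrable_unimodular_times f_int c_le) auto
      show "(LINT x|lborel. iexp (s * (x \<bullet> b)) * (iexp (v \<bullet> x) * (c J x * f x))) = 0" for s
      proof -
        have "iexp (s * (x \<bullet> b)) * iexp (v \<bullet> x) = iexp ((v + s *\<^sub>R b) \<bullet> x)" for x
          by (simp add: exp_add[symmetric] inner_add_left inner_commute algebra_simps)
        then show ?thesis using insert.IH[of "v + s *\<^sub>R b"] by (simp add: mult.assoc[symmetric])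
      qed
    qed auto
    then show ?case using insert.hyps by (simp add: c_def mult_ac)
  qed
  have "c Basis x = indicator (box l u) x" for x
    by (auto simp: c_def indicator_def box_def prod_zero_iff)
  then show "(LINT x|lborel. indicator (box l u) x * f x) = 0"
    using claim[of Basis 0] by simp
qed

lemma prod_Basis_vec:
  fixes g :: "'a::euclidean_space ^ 'n::finite \<Rightarrow> 'b::comm_monoid_mult"
  shows "(\<Prod>b\<in>Basis. g b) = (\<Prod>i\<in>UNIV. \<Prod>u\<in>Basis. g (axis i u))"
proof -
  have "bij_betw (\<lambda>(i, u). axis i u :: 'a ^ 'n) (UNIV \<times> Basis) Basis"
    by (auto simp: bij_betw_def inj_on_def Basis_vec_def axis_eq_axis image_iff)
  then have "(\<Prod>p\<in>UNIV \<times> Basis. g (case p of (i, u) \<Rightarrow> axis i u)) = (\<Prod>b\<in>Basis. g b)"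
    by (rule prod.reindex_bij_betw)
  then have "(\<Prod>b\<in>Basis. g b) = (\<Prod>(i, u)\<in>UNIV \<times> Basis. g (axis i u))"
    by (simp add: case_prod_beta)
  then show ?thesis by (simp add: prod.cartesian_product)
qed

lemma measurable_vec_lambda:
  fixes f :: "'x \<Rightarrow> 'n::finite \<Rightarrow> 'a::euclidean_space"
  assumes "\<And>i. (\<lambda>x. f x i) \<in> borel_measurable M"
  shows "(\<lambda>x. \<chi> i. f x i) \<in> borel_measurable M"
proof (subst borel_measurable_euclidean_space, intro ballI)
  fix b :: "'a ^ 'n" assume "b \<in> Basis"
  then obtain i u where "b = axis i u" by (auto simp: Basis_vec_def)
  then show "(\<lambda>x. (\<chi> i. f x i) \<bullet> b) \<in> borel_measurable M" using assms[of i] by (simp add: inner_axis)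
qed

lemma measurable_vec_nth [measurable (raw)]:
  fixes f :: "'x \<Rightarrow> 'a::euclidean_space ^ 'n::finite"
  assumes "f \<in> borel_measurable M"
  shows "(\<lambda>x. f x $ i) \<in> borel_measurable M"
proof -
  have "(\<lambda>x::'a ^ 'n. x $ i) \<in> borel_measurable borel"
    by (intro borel_measurable_continuous_onI continuous_intros)
  then show ?thesis using assms by measurable
qed

text \<open>
  Lebesgue measure on a vector type as image of a product measure, through which integrals of
  products of functions of the single coordinates factor.
\<close>

lemma lborel_vec_eq_distr:
  "(lborel :: ('a::euclidean_space ^ 'n::finite) measure)
    = distr (Pi\<^sub>M UNIV (\<lambda>_. lborel)) borel (\<lambda>f. \<chi> i. f i)"
proof (rule lborel_eqI)
  interpret product_sigma_finite "\<lambda>_::'n. lborel :: 'a measure" by standard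
  fix l u :: "'a ^ 'n" assume le: "\<And>b. b \<in> Basis \<Longrightarrow> l \<bullet> b \<le> u \<bullet> b"
  have le': "l $ i \<bullet> b \<le> u $ i \<bullet> b" if "b \<in> Basis" for i b
    using le[of "axis i b"] that by (simp add: inner_axis)
  have meas: "(\<lambda>f. \<chi> i. f i) \<in> measurable (Pi\<^sub>M UNIV (\<lambda>_::'n. lborel :: 'a measure)) borel"
    by (rule measurable_vec_lambda) measurable
  have "(\<lambda>f. \<chi> i. f i) -` box l u \<inter> space (Pi\<^sub>M UNIV (\<lambda>_::'n. lborel :: 'a measure)) = Pi\<^sub>E UNIV (\<lambda>i. box (l $ i) (u $ i))"
    by (auto simp: space_PiM box_def Basis_vec_def inner_axis PiE_iff)
  then have "emeasure (distr (Pi\<^sub>M UNIV (\<lambda>_. lborel)) borel (\<lambda>f. \<chi> i. f i)) (box l u)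
      = emeasure (Pi\<^sub>M UNIV (\<lambda>_::'n. lborel :: 'a measure)) (Pi\<^sub>E UNIV (\<lambda>i. box (l $ i) (u $ i)))"
    using meas by (subst emeasure_distr) auto
  also have "\<dots> = (\<Prod>i\<in>UNIV. emeasure lborel (box (l $ i) (u $ i)))"
    by (rule emeasure_PiM) auto
  also have "\<dots> = (\<Prod>i\<in>UNIV. ennreal (\<Prod>b\<in>Basis. (u $ i - l $ i) \<bullet> b))"
    using le' by (intro prod.cong refl) (simp add: emeasure_lborel_box)
  also have "\<dots> = ennreal (\<Prod>i\<in>UNIV. \<Prod>b\<in>Basis. (u $ i - l $ i) \<bullet> b)"
    using le' by (intro prod_ennreal prod_nonneg) (simp add: inner_diff_left)
  also have "(\<Prod>i\<in>UNIV. \<Prod>b\<in>Basis. (u $ i - l $ i) \<bullet> b) = (\<Prod>b\<in>Basis. (u - l) \<bullet> b)"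
    by (simp add: prod_Basis_vec inner_axis)
  finally show "emeasure (distr (Pi\<^sub>M UNIV (\<lambda>_. lborel)) borel (\<lambda>f. \<chi> i. f i)) (box l u) = (\<Prod>b\<in>Basis. (u - l) \<bullet> b)"
    .
qed simp

lemma
  fixes f :: "'n::finite \<Rightarrow> 'a::euclidean_space \<Rightarrow> 'b::{real_normed_field,banach,second_countable_topology}"
  assumes f: "\<And>i. integrable lborel (f i)"
  shows integrable_vec_prod: "integrable lborel (\<lambda>x. \<Prod>i\<in>UNIV. f i (x $ i))"
    and integral_vec_prod: "(LINT x|lborel. (\<Prod>i\<in>UNIV. f i (x $ i))) = (\<Prod>i\<in>UNIV. (LINT y|lborel. f i y))"
proof -
  interpret product_sigma_finite "\<lambda>_::'n. lborel :: 'a measure" by standard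
  have meas [measurable]: "(\<lambda>f. \<chi> i. f i) \<in> measurable (Pi\<^sub>M UNIV (\<lambda>_::'n. lborel :: 'a measure)) borel"
    by (rule measurable_vec_lambda) measurable
  have f_meas [measurable]: "f i \<in> borel_measurable borel" for i
    using borel_measurable_integrable[OF f[of i]] by simp
  have prod_meas [measurable]: "(\<lambda>x. \<Prod>i\<in>UNIV. f i (x $ i)) \<in> borel_measurable borel"
    by measurable
  show "integrable lborel (\<lambda>x. \<Prod>i\<in>UNIV. f i (x $ i))"
    unfolding lborel_vec_eq_distr using product_integrable_prod[of UNIV f] f
    by (subst integrable_distr_eq) auto
  show "(LINT x|lborel. (\<Prod>i\<in>UNIV. f i (x $ i))) = (\<Prod>i\<in>UNIV. (LINT y|lborel. f i y))"
    unfolding lborel_vec_eq_distr[where 'a = 'a and 'n = 'n] using product_integral_prod[of UNIV f] f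
    by (subst integral_distr) auto
qed

lemma
  fixes f :: "'n::finite \<Rightarrow> nat \<Rightarrow> 'b::{real_normed_field,banach,second_countable_topology}"
  assumes f: "\<And>i. integrable (count_space UNIV) (f i)"
  shows integrable_multiindex_prod: "integrable (count_space UNIV) (\<lambda>\<alpha>::nat ^ 'n. \<Prod>i\<in>UNIV. f i (\<alpha> $ i))"
    and integral_multiindex_prod: "(LINT \<alpha>::nat ^ 'n|count_space UNIV. (\<Prod>i\<in>UNIV. f i (\<alpha> $ i)))
      = (\<Prod>i\<in>UNIV. (LINT k|count_space UNIV. f i k))"
proof -
  interpret product_sigma_finite "\<lambda>_::'n. count_space UNIV :: nat measure"
    by (intro product_sigma_finite.intro sigma_finite_measure_count_space)
  have PiM: "Pi\<^sub>M UNIV (\<lambda>_::'n. count_space UNIV :: nat measure) = count_space UNIV"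
    using count_space_PiM_finite[of UNIV "\<lambda>_::'n. UNIV :: nat set"] by (simp add: PiE_UNIV_domain)
  have bij: "bij_betw (vec_lambda :: ('n \<Rightarrow> nat) \<Rightarrow> nat ^ 'n) UNIV UNIV"
    by (rule bij_betw_byWitness[where f' = vec_nth]) auto
  show "integrable (count_space UNIV) (\<lambda>\<alpha>::nat ^ 'n. \<Prod>i\<in>UNIV. f i (\<alpha> $ i))"
    using product_integrable_prod[of UNIV f] f
    by (subst integrable_bij_count_space[OF bij, symmetric]) (simp add: PiM)
  show "(LINT \<alpha>::nat ^ 'n|count_space UNIV. (\<Prod>i\<in>UNIV. f i (\<alpha> $ i))) = (\<Prod>i\<in>UNIV. (LINT k|count_space UNIV. f i k))"
    using product_integral_prod[of UNIV f] f
    by (subst integral_bij_count_space[OF bij, symmetric]) (simp add: PiM)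
qed

lemma lborel_complex_eq_distr:
  "(lborel :: complex measure) = distr (lborel \<Otimes>\<^sub>M lborel) borel (\<lambda>(x, y). Complex x y)"
proof (rule lborel_eqI)
  fix l u :: complex assume le: "\<And>b. b \<in> Basis \<Longrightarrow> l \<bullet> b \<le> u \<bullet> b"
  have le': "Re l \<le> Re u" "Im l \<le> Im u" using le[of 1] le[of \<i>] by (auto simp: Basis_complex_def)
  have meas: "(\<lambda>(x, y). Complex x y) \<in> measurable (lborel \<Otimes>\<^sub>M lborel) borel"
    unfolding Complex_eq by measurable
  have "(\<lambda>(x, y). Complex x y) -` box l u \<inter> space (lborel \<Otimes>\<^sub>M lborel) = {Re l <..< Re u} \<times> {Im l <..< Im u}"
    by (auto simp: space_pair_measure in_box_complex_iff)
  then have "emeasure (distr (lborel \<Otimes>\<^sub>M lborel) borel (\<lambda>(x, y). Complex x y)) (box l u)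
      = emeasure (lborel \<Otimes>\<^sub>M lborel) ({Re l <..< Re u} \<times> {Im l <..< Im u})"
    using meas by (subst emeasure_distr) auto
  also have "\<dots> = emeasure lborel {Re l <..< Re u} * emeasure lborel {Im l <..< Im u}"
    by (rule lborel.emeasure_pair_measure_Times) auto
  also have "\<dots> = ennreal ((Re u - Re l) * (Im u - Im l))"
    using le' by (simp add: ennreal_mult)
  finally show "emeasure (distr (lborel \<Otimes>\<^sub>M lborel) borel (\<lambda>(x, y). Complex x y)) (box l u) = (\<Prod>b\<in>Basis. (u - l) \<bullet> b)"
    by (simp add: Basis_complex_def)
qed simp

lemma
  fixes g :: "complex \<Rightarrow> 'b::{banach,second_countable_topology}"
  assumes [measurable]: "g \<in> borel_measurable borel"
  shows integrable_complex_iff: "integrable lborel g \<longleftrightarrow> integrable (lborel \<Otimes>\<^sub>M lborel) (\<lambda>(x, y). g (Complex x y))"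
    and integral_complex_eq: "(LINT z|lborel. g z) = (LINT p|(lborel \<Otimes>\<^sub>M lborel). g (Complex (fst p) (snd p)))"
proof -
  have meas [measurable]: "(\<lambda>(x, y). Complex x y) \<in> measurable (lborel \<Otimes>\<^sub>M lborel) borel"
    unfolding Complex_eq by measurable
  show "integrable lborel g \<longleftrightarrow> integrable (lborel \<Otimes>\<^sub>M lborel) (\<lambda>(x, y). g (Complex x y))"
    by (subst lborel_complex_eq_distr, subst integrable_distr_eq) (auto simp: case_prod_beta')
  show "(LINT z|lborel. g z) = (LINT p|(lborel \<Otimes>\<^sub>M lborel). g (Complex (fst p) (snd p)))"
    by (subst lborel_complex_eq_distr, subst integral_distr) (auto simp: case_prod_beta')
qed

section \<open>Hermite functions and their Fourier-Wigner transforms\<close>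

lemma integral_derivative_eq_zero:
  fixes F :: "real \<Rightarrow> complex"
  assumes F: "\<And>x. (F has_vector_derivative F' x) (at x)" and cont: "continuous_on UNIV F'"
    and int: "integrable lborel F'" and top: "(F \<longlongrightarrow> 0) at_top" and bot: "(F \<longlongrightarrow> 0) at_bot"
  shows "(LINT x|lborel. F' x) = 0"
proof -
  have "(LBINT x=-\<infinity>..\<infinity>. F' x) = 0 - 0"
  proof (rule interval_integral_FTC_integrable[where F = F])
    show "isCont F' x" for x using cont by (simp add: continuous_on_eq_continuous_at)
    show "set_integrable lborel (einterval (-\<infinity>) \<infinity>) F'" using int by (simp add: set_integrable_def)
    show "((F \<circ> real_of_ereal) \<longlongrightarrow> 0) (at_right (-\<infinity>))"
      using bot unfolding at_right_MInf by (simp add: filterlim_filtermap o_def)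
    show "((F \<circ> real_of_ereal) \<longlongrightarrow> 0) (at_left \<infinity>)"
      using top unfolding at_left_PInf by (simp add: filterlim_filtermap o_def)
  qed (use F in auto)
  then show ?thesis
    by (simp add: interval_lebesgue_integral_def set_lebesgue_integral_def)
qed

definition gauss_poly :: "real poly \<Rightarrow> real \<Rightarrow> real" where
  "gauss_poly p x = poly p x * exp (- (x\<^sup>2) / 2)"

lemma poly_le_gaussian:
  fixes p :: "real poly"
  assumes "\<epsilon> > 0"
  shows "\<exists>C\<ge>0. \<forall>x. \<bar>poly p x\<bar> \<le> C * exp (\<epsilon> * x\<^sup>2)"
  using assms
proof (induction p arbitrary: \<epsilon>)
  case 0
  show ?case by (intro exI[of _ 0]) auto
next
  case (pCons a p)
  obtain C where C: "C \<ge> 0" "\<And>x. \<bar>poly p x\<bar> \<le> C * exp (\<epsilon> / 2 * x\<^sup>2)"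
    using pCons.IH[of "\<epsilon> / 2"] pCons.prems by auto
  define D where "D = 1 + 2 / \<epsilon>"
  have D: "\<bar>x\<bar> \<le> D * exp (\<epsilon> / 2 * x\<^sup>2)" for x
  proof -
    have nn: "0 \<le> \<epsilon> / 2 * x\<^sup>2" using pCons.prems by simp
    have e: "1 \<le> exp (\<epsilon> / 2 * x\<^sup>2)" "\<epsilon> / 2 * x\<^sup>2 \<le> exp (\<epsilon> / 2 * x\<^sup>2)"
      using nn exp_ge_add_one_self[of "\<epsilon> / 2 * x\<^sup>2"] by linarith+
    have "\<bar>x\<bar> \<le> 1 + x\<^sup>2"
      using zero_le_power2[of "\<bar>x\<bar> - 1"] zero_le_power2[of x] by (simp add: power2_diff)
    also have "x\<^sup>2 = 2 / \<epsilon> * (\<epsilon> / 2 * x\<^sup>2)" using pCons.prems by simp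
    also have "\<dots> \<le> 2 / \<epsilon> * exp (\<epsilon> / 2 * x\<^sup>2)" using e pCons.prems by (intro mult_left_mono) auto
    finally have "\<bar>x\<bar> \<le> exp (\<epsilon> / 2 * x\<^sup>2) + 2 / \<epsilon> * exp (\<epsilon> / 2 * x\<^sup>2)" using e(1) by linarith
    then show ?thesis by (simp add: D_def distrib_right)
  qed
  have "\<bar>poly (pCons a p) x\<bar> \<le> (\<bar>a\<bar> + D * C) * exp (\<epsilon> * x\<^sup>2)" for x
  proof -
    have "\<bar>x\<bar> * \<bar>poly p x\<bar> \<le> (D * exp (\<epsilon> / 2 * x\<^sup>2)) * (C * exp (\<epsilon> / 2 * x\<^sup>2))"
      using C D pCons.prems by (intro mult_mono) (auto simp: D_def)
    also have "\<dots> = D * C * exp (\<epsilon> * x\<^sup>2)" by (simp add: exp_add[symmetric] mult_ac)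
    finally have "\<bar>x * poly p x\<bar> \<le> D * C * exp (\<epsilon> * x\<^sup>2)" by (simp add: abs_mult)
    moreover have "\<bar>a\<bar> \<le> \<bar>a\<bar> * exp (\<epsilon> * x\<^sup>2)" 
      using mult_left_mono[of 1 "exp (\<epsilon> * x\<^sup>2)" "\<bar>a\<bar>"] pCons.prems by simp
    ultimately show ?thesis by (simp add: distrib_right)
  qed
  moreover have "\<bar>a\<bar> + D * C \<ge> 0" using C pCons.prems by (simp add: D_def)
  ultimately show ?case by blast
qed

lemma gauss_poly_decay: "\<exists>C\<ge>0. \<forall>x. \<bar>gauss_poly p x\<bar> \<le> C * exp (- (x\<^sup>2) / 4)"
proof -
  obtain C where C: "C \<ge> 0" "\<And>x. \<bar>poly p x\<bar> \<le> C * exp (1 / 4 * x\<^sup>2)"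
    using poly_le_gaussian[of "1/4" p] by auto
  have "\<bar>gauss_poly p x\<bar> \<le> C * exp (- (x\<^sup>2) / 4)" for x
  proof -
    have "\<bar>gauss_poly p x\<bar> \<le> C * exp (1 / 4 * x\<^sup>2) * exp (- (x\<^sup>2) / 2)"
      using mult_right_mono[OF C(2)[of x], of "exp (- (x\<^sup>2) / 2)"] by (simp add: gauss_poly_def abs_mult)
    also have "\<dots> = C * exp (- (x\<^sup>2) / 4)" by (simp add: exp_add[symmetric])
    finally show ?thesis .
  qed
  then show ?thesis using C(1) by blast
qed

lemma continuous_gauss_poly [continuous_intros]: "continuous_on S f \<Longrightarrow> continuous_on S (\<lambda>x. gauss_poly p (f x))"
  unfolding gauss_poly_def by (intro continuous_intros) auto

lemma measurable_gauss_poly [measurable]: "gauss_poly p \<in> borel_measurable borel"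
  by (intro borel_measurable_continuous_onI continuous_intros)

lemma integrable_exp_neg_square: "c > 0 \<Longrightarrow> integrable lborel (\<lambda>x::real. exp (- c * x\<^sup>2))"
proof -
  assume c: "c > 0"
  have "exp (- c * x\<^sup>2) = sqrt (pi / c) * normal_density 0 (1 / sqrt (2 * c)) x" for x
    using c by (simp add: normal_density_def power_divide real_sqrt_divide real_sqrt_mult field_simps)
  then have "(\<lambda>x. exp (- c * x\<^sup>2)) = (\<lambda>x. sqrt (pi / c) * normal_density 0 (1 / sqrt (2 * c)) x)" by (rule ext)
  then show ?thesis using c by (simp only:) (intro integrable_mult_right integrable_normal_density, simp)
qed

lemma integrable_gauss_poly: "integrable lborel (gauss_poly p)"
proof -
  obtain C where C: "C \<ge> 0" "\<And>x. \<bar>gauss_poly p x\<bar> \<le> C * exp (- (x\<^sup>2) / 4)" using gauss_poly_decay by blast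
  have "integrable lborel (\<lambda>x::real. C * exp (- (1/4) * x\<^sup>2))"
    by (intro integrable_mult_right integrable_exp_neg_square) auto
  then show ?thesis
    using C by (elim Bochner_Integration.integrable_bound) (auto intro: order_trans[OF C(2)])
qed

lemma gauss_poly_bounded: "\<exists>C\<ge>0. \<forall>x. \<bar>gauss_poly p x\<bar> \<le> C"
proof -
  obtain C where C: "C \<ge> 0" "\<And>x. \<bar>gauss_poly p x\<bar> \<le> C * exp (- (x\<^sup>2) / 4)" using gauss_poly_decay by blast
  have "C * exp (- (x\<^sup>2) / 4) \<le> C" for x using C(1) by (intro mult_left_le) auto
  then show ?thesis using C by (meson order_trans)
qed

lemma gauss_poly_tendsto:
  "(gauss_poly p \<longlongrightarrow> 0) at_top" "(gauss_poly p \<longlongrightarrow> 0) at_bot"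
proof -
  obtain C where C: "C \<ge> 0" "\<And>x. \<bar>gauss_poly p x\<bar> \<le> C * exp (- (x\<^sup>2) / 4)" using gauss_poly_decay by blast
  have "((\<lambda>x::real. C * exp (- (x\<^sup>2) / 4)) \<longlongrightarrow> 0) at_top" "((\<lambda>x::real. C * exp (- (x\<^sup>2) / 4)) \<longlongrightarrow> 0) at_bot"
    by real_asymp+
  moreover have ev: "\<forall>\<^sub>F x in F. norm (gauss_poly p x) \<le> C * exp (- (x\<^sup>2) / 4)" for F
    using C(2) by simp
  ultimately show "(gauss_poly p \<longlongrightarrow> 0) at_top" "(gauss_poly p \<longlongrightarrow> 0) at_bot"
    by (blast intro: Lim_null_comparison[OF ev])+
qed

lemma gauss_poly_has_derivative:
  "(gauss_poly p has_real_derivative gauss_poly (pderiv p - [:0, 1:] * p) x) (at x)"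
  unfolding gauss_poly_def
  by (auto intro!: derivative_eq_intros poly_DERIV simp: algebra_simps)

lemma gauss_poly_times_x: "x * gauss_poly p x = gauss_poly ([:0, 1:] * p) x"
  by (simp add: gauss_poly_def algebra_simps)

lemma integrable_gauss_poly_translates:
  "integrable lborel (\<lambda>\<eta>. iexp (x * \<eta>) * of_real (gauss_poly p (\<eta> + a) * gauss_poly q (\<eta> + b)))"
proof -
  obtain C where C: "C \<ge> 0" "\<And>x. \<bar>gauss_poly p x\<bar> \<le> C" using gauss_poly_bounded by blast
  have "integrable lborel (\<lambda>\<eta>. C * gauss_poly q (b + 1 * \<eta>))"
    by (intro integrable_mult_right lborel_integrable_real_affine integrable_gauss_poly) auto
  then show ?thesis
    by (rule Bochner_Integration.integrable_bound)
      (use C in \<open>auto simp: norm_mult abs_mult add.commute intro!: mult_right_mono\<close>)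
qed

lemma pderiv_hermite_poly_Suc: "pderiv (hermite_poly (Suc k)) = of_nat (2 * Suc k) * hermite_poly k"
proof -
  have "pderiv (hermite_poly (Suc k)) =
      2 * hermite_poly k + [:0, 2:] * pderiv (hermite_poly k) - pderiv (pderiv (hermite_poly k))"
    by (simp add: pderiv_diff pderiv_mult pderiv_pCons pderiv_smult numeral_poly)
  then show ?thesis by (simp add: hermite_poly_ode algebra_simps)
qed

definition hermite_factor :: "nat \<Rightarrow> real" where
  "hermite_factor k = 1 / sqrt (2 ^ k * fact k * sqrt pi)"

lemma hermite_function_eq: "hermite_function k = gauss_poly (smult (hermite_factor k) (hermite_poly k))"
  by (rule ext) (simp add: hermite_function_def gauss_poly_def hermite_factor_def)

lemma hermite_factor_Suc: "hermite_factor k = sqrt (2 * real (Suc k)) * hermite_factor (Suc k)"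
proof -
  have "(2::real) ^ Suc k * fact (Suc k) * sqrt pi = (2 * real (Suc k)) * (2 ^ k * fact k * sqrt pi)"
    by (simp add: algebra_simps)
  then show ?thesis unfolding hermite_factor_def by (simp only: real_sqrt_mult) simp
qed

definition hermite_deriv :: "nat \<Rightarrow> real \<Rightarrow> real" where
  "hermite_deriv k = gauss_poly (pderiv (smult (hermite_factor k) (hermite_poly k))
     - [:0, 1:] * smult (hermite_factor k) (hermite_poly k))"

lemma hermite_function_deriv: "(hermite_function k has_real_derivative hermite_deriv k x) (at x)"
  unfolding hermite_function_eq hermite_deriv_def by (rule gauss_poly_has_derivative)

lemma hermite_raise: "x * hermite_function k x - hermite_deriv k x = sqrt (2 * real (Suc k)) * hermite_function (Suc k) x"
proof -
  have "x * hermite_function k x - hermite_deriv k x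
      = (2 * x * poly (hermite_poly k) x - poly (pderiv (hermite_poly k)) x) * (hermite_factor k * exp (- (x\<^sup>2) / 2))"
    by (simp add: hermite_function_eq hermite_deriv_def gauss_poly_def pderiv_smult algebra_simps)
  also have "\<dots> = poly (hermite_poly (Suc k)) x * (hermite_factor k * exp (- (x\<^sup>2) / 2))"
    by (simp add: algebra_simps)
  also have "\<dots> = sqrt (2 * real (Suc k)) * hermite_function (Suc k) x"
    unfolding hermite_factor_Suc[of k] hermite_function_eq gauss_poly_def by (simp del: hermite_poly.simps of_nat_Suc)
  finally show ?thesis .
qed

lemma hermite_lower: "x * hermite_function k x + hermite_deriv k x = sqrt (2 * real k) * hermite_function (k - 1) x"
proof (cases k)
  case 0
  then show ?thesis by (simp add: hermite_function_eq hermite_deriv_def gauss_poly_def)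
next
  case (Suc m)
  have s: "sqrt (2 * real (Suc m)) * sqrt (2 * real (Suc m)) = 2 * real (Suc m)" by simp
  have "x * hermite_function (Suc m) x + hermite_deriv (Suc m) x
      = poly (pderiv (hermite_poly (Suc m))) x * (hermite_factor (Suc m) * exp (- (x\<^sup>2) / 2))"
    by (simp add: hermite_function_eq hermite_deriv_def gauss_poly_def pderiv_smult algebra_simps del: hermite_poly.simps)
  also have "\<dots> = (2 * real (Suc m)) * poly (hermite_poly m) x * (hermite_factor (Suc m) * exp (- (x\<^sup>2) / 2))"
    unfolding pderiv_hermite_poly_Suc by simp
  also have "\<dots> = sqrt (2 * real (Suc m)) * (poly (hermite_poly m) x * ((sqrt (2 * real (Suc m)) * hermite_factor (Suc m)) * exp (- (x\<^sup>2) / 2)))"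
    by (subst s[symmetric]) (simp only: mult_ac)
  also have "\<dots> = sqrt (2 * real (Suc m)) * hermite_function m x"
    unfolding hermite_factor_Suc[symmetric] hermite_function_eq gauss_poly_def by simp
  finally show ?thesis by (simp add: Suc)
qed

text \<open>
  The diagonal matrix coefficients of the one-dimensional representation are, up to scaling and a
  phase, of this form; the index pair is kept general because the recursion below leaves the
  diagonal.
\<close>

definition wigner :: "nat \<Rightarrow> nat \<Rightarrow> real \<Rightarrow> real \<Rightarrow> complex" where
  "wigner j k x y = (LINT \<eta>|lborel. iexp (x * \<eta>) * of_real (hermite_function j (\<eta> + y / 2) * hermite_function k (\<eta> - y / 2)))"

lemma wigner_by_parts:
  fixes p q :: "real poly"
  defines "p' \<equiv> pderiv p - [:0, 1:] * p" and "q' \<equiv> pderiv q - [:0, 1:] * q"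
  shows "(LINT \<eta>|lborel. iexp (x * \<eta>) * of_real (gauss_poly p (\<eta> + a) * gauss_poly q' (\<eta> + b)))
    = - (\<i> * x) * (LINT \<eta>|lborel. iexp (x * \<eta>) * of_real (gauss_poly p (\<eta> + a) * gauss_poly q (\<eta> + b)))
      - (LINT \<eta>|lborel. iexp (x * \<eta>) * of_real (gauss_poly p' (\<eta> + a) * gauss_poly q (\<eta> + b)))"
proof -
  define F where "F \<eta> = iexp (x * \<eta>) * of_real (gauss_poly p (\<eta> + a) * gauss_poly q (\<eta> + b))" for \<eta>
  define F1 where "F1 \<eta> = iexp (x * \<eta>) * of_real (gauss_poly p' (\<eta> + a) * gauss_poly q (\<eta> + b))" for \<eta>
  define F2 where "F2 \<eta> = iexp (x * \<eta>) * of_real (gauss_poly p (\<eta> + a) * gauss_poly q' (\<eta> + b))" for \<eta>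
  have int: "integrable lborel F" "integrable lborel F1" "integrable lborel F2"
    unfolding F_def F1_def F2_def by (rule integrable_gauss_poly_translates)+
  have "(LINT \<eta>|lborel. \<i> * x * F \<eta> + F1 \<eta> + F2 \<eta>) = 0"
  proof (rule integral_derivative_eq_zero)
    show "(F has_vector_derivative (\<i> * x * F \<eta> + F1 \<eta> + F2 \<eta>)) (at \<eta>)" for \<eta>
    proof -
      have "((\<lambda>z. exp (\<i> * x * z)) has_field_derivative (\<i> * x * exp (\<i> * x * of_real \<eta>))) (at (of_real \<eta>))"
        by (auto intro!: derivative_eq_intros)
      from has_vector_derivative_real_field[OF this]
      have e: "((\<lambda>\<eta>. iexp (x * \<eta>)) has_vector_derivative (\<i> * x * iexp (x * \<eta>))) (at \<eta>)"
        by (simp add: mult.assoc)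
      have "((\<lambda>\<eta>. gauss_poly r (\<eta> + c)) has_real_derivative gauss_poly (pderiv r - [:0, 1:] * r) (\<eta> + c)) (at \<eta>)" for r c
        by (subst DERIV_shift[symmetric]) (rule gauss_poly_has_derivative)
      from DERIV_mult[OF this[of p a] this[of q b]]
      have "((\<lambda>\<eta>. gauss_poly p (\<eta> + a) * gauss_poly q (\<eta> + b)) has_real_derivative
          (gauss_poly p' (\<eta> + a) * gauss_poly q (\<eta> + b) + gauss_poly p (\<eta> + a) * gauss_poly q' (\<eta> + b))) (at \<eta>)"
        unfolding p'_def q'_def by (simp only: mult.commute add.commute)
      then have "((\<lambda>\<eta>. complex_of_real (gauss_poly p (\<eta> + a) * gauss_poly q (\<eta> + b))) has_vector_derivative
          of_real (gauss_poly p' (\<eta> + a) * gauss_poly q (\<eta> + b) + gauss_poly p (\<eta> + a) * gauss_poly q' (\<eta> + b))) (at \<eta>)"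
        by (intro has_vector_derivative_of_real) (simp add: has_real_derivative_iff_has_vector_derivative)
      from has_vector_derivative_mult[OF e this]
      have "(F has_vector_derivative (iexp (x * \<eta>) * of_real (gauss_poly p' (\<eta> + a) * gauss_poly q (\<eta> + b) + gauss_poly p (\<eta> + a) * gauss_poly q' (\<eta> + b))
          + \<i> * x * iexp (x * \<eta>) * of_real (gauss_poly p (\<eta> + a) * gauss_poly q (\<eta> + b)))) (at \<eta>)"
        unfolding F_def .
      then show ?thesis
        unfolding F_def F1_def F2_def of_real_add by (simp only: distrib_left mult.assoc add.commute add.left_commute)
    qed
    show "continuous_on UNIV (\<lambda>\<eta>. \<i> * x * F \<eta> + F1 \<eta> + F2 \<eta>)"
      unfolding F_def F1_def F2_def by (intro continuous_intros)
    show "integrable lborel (\<lambda>\<eta>. \<i> * x * F \<eta> + F1 \<eta> + F2 \<eta>)"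
      using int by (intro Bochner_Integration.integrable_add integrable_mult_right)
    obtain C where C: "C \<ge> 0" "\<And>x. \<bar>gauss_poly p x\<bar> \<le> C" using gauss_poly_bounded by blast
    have F_le: "norm (F \<eta>) \<le> C * \<bar>gauss_poly q (\<eta> + b)\<bar>" for \<eta>
      using C(2)[of "\<eta> + a"] unfolding F_def by (simp add: norm_mult abs_mult mult_right_mono)
    have ev: "\<forall>\<^sub>F \<eta> in A. norm (F \<eta>) \<le> C * \<bar>gauss_poly q (\<eta> + b)\<bar>" for A
      using F_le by simp
    have "((\<lambda>\<eta>. C * \<bar>gauss_poly q (\<eta> + b)\<bar>) \<longlongrightarrow> C * \<bar>0\<bar>) at_top"
    proof (intro tendsto_intros filterlim_compose[OF gauss_poly_tendsto(1)])
      show "filterlim (\<lambda>\<eta>. \<eta> + b) at_top at_top" by real_asymp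
    qed
    then have "((\<lambda>\<eta>. C * \<bar>gauss_poly q (\<eta> + b)\<bar>) \<longlongrightarrow> 0) at_top" by simp
    then show "(F \<longlongrightarrow> 0) at_top" by (rule Lim_null_comparison[OF ev])
    have "((\<lambda>\<eta>. C * \<bar>gauss_poly q (\<eta> + b)\<bar>) \<longlongrightarrow> C * \<bar>0\<bar>) at_bot"
    proof (intro tendsto_intros filterlim_compose[OF gauss_poly_tendsto(2)])
      show "filterlim (\<lambda>\<eta>. \<eta> + b) at_bot at_bot" by real_asymp
    qed
    then have "((\<lambda>\<eta>. C * \<bar>gauss_poly q (\<eta> + b)\<bar>) \<longlongrightarrow> 0) at_bot" by simp
    then show "(F \<longlongrightarrow> 0) at_bot" by (rule Lim_null_comparison[OF ev])
  qed
  moreover have "(LINT \<eta>|lborel. \<i> * x * F \<eta> + F1 \<eta> + F2 \<eta>)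
      = \<i> * x * (LINT \<eta>|lborel. F \<eta>) + (LINT \<eta>|lborel. F1 \<eta>) + (LINT \<eta>|lborel. F2 \<eta>)"
    using int by simp
  ultimately have "\<i> * x * (LINT \<eta>|lborel. F \<eta>) + (LINT \<eta>|lborel. F1 \<eta>) + (LINT \<eta>|lborel. F2 \<eta>) = 0" by (simp only:)
  then have "(LINT \<eta>|lborel. F2 \<eta>) = - (\<i> * x) * (LINT \<eta>|lborel. F \<eta>) - (LINT \<eta>|lborel. F1 \<eta>)"
    by (simp add: add_eq_0_iff)
  then show ?thesis unfolding F_def F1_def F2_def .
qed

text \<open>
  The creation operator acting on the second factor is moved to the first by parts, where it becomes
  the annihilation operator; the shift by \<open>y\<close> and the frequency \<open>x\<close> contribute the scalar term.
\<close>

lemma wigner_Suc_right: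
  "sqrt (2 * real (Suc k)) * wigner j (Suc k) x y
    = sqrt (2 * real j) * wigner (j - 1) k x y + (\<i> * x - y) * wigner j k x y"
proof -
  define e where "e \<eta> = iexp (x * \<eta>)" for \<eta>
  define P where "P \<eta> = hermite_function j (\<eta> + y / 2)" for \<eta>
  define P1 where "P1 \<eta> = hermite_function (j - 1) (\<eta> + y / 2)" for \<eta>
  define P' where "P' \<eta> = hermite_deriv j (\<eta> + y / 2)" for \<eta>
  define Q where "Q \<eta> = hermite_function k (\<eta> - y / 2)" for \<eta>
  define Q' where "Q' \<eta> = hermite_deriv k (\<eta> - y / 2)" for \<eta>
  have int: "integrable lborel (\<lambda>\<eta>. e \<eta> * of_real (P \<eta> * Q \<eta>))"
    "integrable lborel (\<lambda>\<eta>. e \<eta> * of_real (P' \<eta> * Q \<eta>))"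
    "integrable lborel (\<lambda>\<eta>. e \<eta> * of_real (P \<eta> * Q' \<eta>))"
    "integrable lborel (\<lambda>\<eta>. e \<eta> * of_real (P1 \<eta> * Q \<eta>))"
    "integrable lborel (\<lambda>\<eta>. e \<eta> * of_real (P \<eta> * ((\<eta> - y / 2) * Q \<eta>)))"
    unfolding e_def P_def P1_def P'_def Q_def Q'_def hermite_function_eq hermite_deriv_def gauss_poly_times_x
    using integrable_gauss_poly_translates[where a = "y / 2" and b = "- (y / 2)"] by simp_all
  have parts: "(LINT \<eta>|lborel. e \<eta> * of_real (P \<eta> * Q' \<eta>))
      = - (\<i> * x) * wigner j k x y - (LINT \<eta>|lborel. e \<eta> * of_real (P' \<eta> * Q \<eta>))"
    unfolding e_def P_def P'_def Q_def Q'_def hermite_function_eq hermite_deriv_def wigner_def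
    using wigner_by_parts[where a = "y / 2" and b = "- (y / 2)"] by simp
  have raise: "(\<eta> - y / 2) * Q \<eta> - Q' \<eta> = sqrt (2 * real (Suc k)) * hermite_function (Suc k) (\<eta> - y / 2)" for \<eta>
    unfolding Q_def Q'_def by (rule hermite_raise)
  have lower: "(\<eta> + y / 2) * P \<eta> + P' \<eta> = sqrt (2 * real j) * P1 \<eta>" for \<eta>
    unfolding P_def P'_def P1_def by (rule hermite_lower)
  define IA where "IA = (LINT \<eta>|lborel. e \<eta> * of_real (P \<eta> * ((\<eta> - y / 2) * Q \<eta>)))"
  define IB where "IB = (LINT \<eta>|lborel. e \<eta> * of_real (P \<eta> * Q' \<eta>))"
  define IC where "IC = (LINT \<eta>|lborel. e \<eta> * of_real (P' \<eta> * Q \<eta>))"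
  define ID where "ID = (LINT \<eta>|lborel. e \<eta> * of_real (P1 \<eta> * Q \<eta>))"
  define I0 where "I0 = (LINT \<eta>|lborel. e \<eta> * of_real (P \<eta> * Q \<eta>))"
  have "IA - IB = (LINT \<eta>|lborel. e \<eta> * of_real (P \<eta> * ((\<eta> - y / 2) * Q \<eta>)) - e \<eta> * of_real (P \<eta> * Q' \<eta>))"
    unfolding IA_def IB_def by (intro Bochner_Integration.integral_diff[symmetric] int)
  also have "\<dots> = (LINT \<eta>|lborel. of_real (sqrt (2 * real (Suc k))) * (e \<eta> * of_real (P \<eta> * hermite_function (Suc k) (\<eta> - y / 2))))"
  proof (intro Bochner_Integration.integral_cong refl)
    fix \<eta>
    have "of_real (sqrt (2 * real (Suc k))) * (e \<eta> * of_real (P \<eta> * hermite_function (Suc k) (\<eta> - y / 2)))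
        = e \<eta> * of_real (P \<eta> * (sqrt (2 * real (Suc k)) * hermite_function (Suc k) (\<eta> - y / 2)))"
      by (simp add: mult_ac)
    then show "e \<eta> * of_real (P \<eta> * ((\<eta> - y / 2) * Q \<eta>)) - e \<eta> * of_real (P \<eta> * Q' \<eta>)
      = of_real (sqrt (2 * real (Suc k))) * (e \<eta> * of_real (P \<eta> * hermite_function (Suc k) (\<eta> - y / 2)))"
      unfolding raise[symmetric] by (simp add: algebra_simps)
  qed
  also have "\<dots> = sqrt (2 * real (Suc k)) * wigner j (Suc k) x y"
    unfolding wigner_def e_def P_def by (rule integral_mult_right_zero)
  finally have f1: "IA - IB = sqrt (2 * real (Suc k)) * wigner j (Suc k) x y" .
  have "IA + IC = (LINT \<eta>|lborel. e \<eta> * of_real (P \<eta> * ((\<eta> - y / 2) * Q \<eta>)) + e \<eta> * of_real (P' \<eta> * Q \<eta>))"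
    unfolding IA_def IC_def by (intro Bochner_Integration.integral_add[symmetric] int)
  also have "\<dots> = (LINT \<eta>|lborel. of_real (sqrt (2 * real j)) * (e \<eta> * of_real (P1 \<eta> * Q \<eta>)) - of_real y * (e \<eta> * of_real (P \<eta> * Q \<eta>)))"
  proof (intro Bochner_Integration.integral_cong refl)
    fix \<eta>
    have "P \<eta> * ((\<eta> - y / 2) * Q \<eta>) + P' \<eta> * Q \<eta> = ((\<eta> + y / 2) * P \<eta> + P' \<eta>) * Q \<eta> - y * (P \<eta> * Q \<eta>)"
      by (simp add: field_simps)
    then have eq: "P \<eta> * ((\<eta> - y / 2) * Q \<eta>) + P' \<eta> * Q \<eta> = sqrt (2 * real j) * (P1 \<eta> * Q \<eta>) - y * (P \<eta> * Q \<eta>)"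
      unfolding lower by simp
    have "e \<eta> * of_real (P \<eta> * ((\<eta> - y / 2) * Q \<eta>)) + e \<eta> * of_real (P' \<eta> * Q \<eta>)
      = e \<eta> * of_real (P \<eta> * ((\<eta> - y / 2) * Q \<eta>) + P' \<eta> * Q \<eta>)"
      unfolding of_real_add by (rule distrib_left[symmetric])
    also have "\<dots> = of_real (sqrt (2 * real j)) * (e \<eta> * of_real (P1 \<eta> * Q \<eta>)) - of_real y * (e \<eta> * of_real (P \<eta> * Q \<eta>))"
      unfolding eq by (simp add: right_diff_distrib mult_ac)
    finally show "e \<eta> * of_real (P \<eta> * ((\<eta> - y / 2) * Q \<eta>)) + e \<eta> * of_real (P' \<eta> * Q \<eta>)
      = of_real (sqrt (2 * real j)) * (e \<eta> * of_real (P1 \<eta> * Q \<eta>)) - of_real y * (e \<eta> * of_real (P \<eta> * Q \<eta>))" .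
  qed
  also have "\<dots> = of_real (sqrt (2 * real j)) * ID - of_real y * I0"
    unfolding ID_def I0_def using int by simp
  finally have f2: "IA + IC = of_real (sqrt (2 * real j)) * ID - of_real y * I0" .
  have f3: "IB = - (\<i> * x) * wigner j k x y - IC" unfolding IB_def IC_def by (rule parts)
  have w: "ID = wigner (j - 1) k x y" "I0 = wigner j k x y"
    unfolding ID_def I0_def wigner_def e_def P1_def P_def Q_def by (rule refl)+
  have "sqrt (2 * real (Suc k)) * wigner j (Suc k) x y = (IA + IC) + \<i> * x * wigner j k x y"
    unfolding f1[symmetric] f3 by simp
  then show ?thesis unfolding f2 w by (simp add: algebra_simps)
qed

lemma wigner_swap: "wigner j k x y = cnj (wigner k j (- x) (- y))"
  unfolding wigner_def integral_cnj[symmetric]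
  by (intro Bochner_Integration.integral_cong) (auto simp: exp_cnj mult_ac)

lemma wigner_Suc_left_0: "sqrt (2 * real (Suc j)) * wigner (Suc j) 0 x y = (\<i> * x + y) * wigner j 0 x y"
proof -
  have "sqrt (2 * real (Suc j)) * wigner (Suc j) 0 x y = cnj (sqrt (2 * real (Suc j)) * wigner 0 (Suc j) (- x) (- y))"
    by (subst wigner_swap) simp
  also have "\<dots> = (\<i> * x + y) * wigner j 0 x y"
    unfolding wigner_Suc_right wigner_swap[of j 0] by simp
  finally show ?thesis .
qed

lemma wigner_0_0: "wigner 0 0 x y = exp (- (x\<^sup>2 + y\<^sup>2) / 4)"
proof -
  have h0: "hermite_function 0 u = exp (- (u\<^sup>2) / 2) / sqrt (sqrt pi)" for u
    by (simp add: hermite_function_def)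
  have "hermite_function 0 (\<eta> + y / 2) * hermite_function 0 (\<eta> - y / 2) = exp (- (y\<^sup>2) / 4) / sqrt pi * exp (- (\<eta>\<^sup>2))" for \<eta>
    unfolding h0 by (simp add: exp_add[symmetric] power2_eq_square field_simps)
  then have "wigner 0 0 x y = (LINT \<eta>|lborel. of_real (exp (- (y\<^sup>2) / 4) / sqrt pi) * (iexp (x * \<eta>) * of_real (exp (- (\<eta>\<^sup>2)))))"
    unfolding wigner_def by (intro Bochner_Integration.integral_cong) (auto simp: mult_ac)
  also have "\<dots> = of_real (exp (- (y\<^sup>2) / 4) / sqrt pi) * (LINT \<eta>|lborel. iexp (x * \<eta>) * of_real (exp (- (\<eta>\<^sup>2))))"
    by (rule integral_mult_right_zero)
  finally have w: "wigner 0 0 x y = of_real (exp (- (y\<^sup>2) / 4) / sqrt pi) * (LINT \<eta>|lborel. iexp (x * \<eta>) * of_real (exp (- (\<eta>\<^sup>2))))" .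
  have "(LINT \<eta>|lborel. iexp (x * \<eta>) * of_real (exp (- (\<eta>\<^sup>2))))
      = (1 / sqrt 2) *\<^sub>R (LINT s|lborel. iexp (x * (0 + 1 / sqrt 2 * s)) * of_real (exp (- ((0 + 1 / sqrt 2 * s)\<^sup>2))))"
    by (subst lborel_integral_real_affine[where c = "1 / sqrt 2" and t = 0]) auto
  moreover have "(LINT s|lborel. iexp (x * (0 + 1 / sqrt 2 * s)) * of_real (exp (- ((0 + 1 / sqrt 2 * s)\<^sup>2))))
      = (LINT s|lborel. of_real (sqrt (2 * pi)) * (std_normal_density s *\<^sub>R iexp (x / sqrt 2 * s)))"
    by (intro Bochner_Integration.integral_cong)
      (auto simp: normal_density_def power_divide power_mult_distrib scaleR_conv_of_real)
  moreover have "\<dots> = of_real (sqrt (2 * pi)) * (LINT s|lborel. std_normal_density s *\<^sub>R iexp (x / sqrt 2 * s))"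
    by (rule integral_mult_right_zero)
  moreover have "(LINT s|lborel. std_normal_density s *\<^sub>R iexp (x / sqrt 2 * s)) = char std_normal_distribution (x / sqrt 2)"
    unfolding char_def by (subst integral_density) auto
  moreover have "char std_normal_distribution (x / sqrt 2) = of_real (exp (- (x\<^sup>2) / 4))"
    by (simp add: char_std_normal_distribution power_divide)
  ultimately have "wigner 0 0 x y
      = of_real (exp (- (y\<^sup>2) / 4) / sqrt pi) * ((1 / sqrt 2) *\<^sub>R (of_real (sqrt (2 * pi)) * complex_of_real (exp (- (x\<^sup>2) / 4))))"
    unfolding w by (simp only:)
  also have "\<dots> = of_real ((exp (- (y\<^sup>2) / 4) * exp (- (x\<^sup>2) / 4)) * (sqrt (2 * pi) / (sqrt pi * sqrt 2)))"
    by (simp add: scaleR_conv_of_real)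
  finally have "wigner 0 0 x y = of_real ((exp (- (y\<^sup>2) / 4) * exp (- (x\<^sup>2) / 4)) * (sqrt (2 * pi) / (sqrt pi * sqrt 2)))" .
  moreover have "sqrt (2 * pi) / (sqrt pi * sqrt 2) = 1" by (simp add: real_sqrt_mult)
  moreover have "exp (- (y\<^sup>2) / 4) * exp (- (x\<^sup>2) / 4) = exp (- (x\<^sup>2 + y\<^sup>2) / 4)"
    by (simp add: exp_add[symmetric] add_divide_distrib)
  ultimately show ?thesis by (simp only: mult_1_right)
qed

lemma sum_choose_Suc:
  fixes g :: "nat \<Rightarrow> complex"
  shows "(\<Sum>i\<le>Suc k. of_nat (Suc k choose i) * g i) = (\<Sum>i\<le>k. of_nat (k choose i) * g i) + (\<Sum>i\<le>k. of_nat (k choose i) * g (Suc i))"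
proof -
  have "(\<Sum>i\<le>Suc k. of_nat (Suc k choose i) * g i) = g 0 + (\<Sum>i\<le>k. of_nat (Suc k choose Suc i) * g (Suc i))"
    by (subst sum.atMost_Suc_shift) simp
  also have "\<dots> = g 0 + (\<Sum>i\<le>k. of_nat (k choose Suc i) * g (Suc i)) + (\<Sum>i\<le>k. of_nat (k choose i) * g (Suc i))"
    by (simp add: distrib_right sum.distrib add.commute)
  also have "g 0 + (\<Sum>i\<le>k. of_nat (k choose Suc i) * g (Suc i)) = (\<Sum>i\<le>Suc k. of_nat (k choose i) * g i)"
    by (subst sum.atMost_Suc_shift) simp
  finally show ?thesis by simp
qed

lemma sqrt_fact_Suc: "sqrt (fact (Suc k)) = sqrt (real (Suc k)) * sqrt (fact k)"
  by (simp only: real_sqrt_mult[symmetric] fact_Suc)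

theorem wigner_closed_form:
  fixes x y :: real
  defines "a \<equiv> (\<i> * x + y) / sqrt 2" and "b \<equiv> (\<i> * x - y) / sqrt 2"
  shows "wigner j k x y * of_real (sqrt (fact j) * sqrt (fact k)) = of_real (exp (- (x\<^sup>2 + y\<^sup>2) / 4)) *
    (\<Sum>i\<le>k. of_nat (k choose i) * (of_nat (fact i * (j choose i)) * b ^ (k - i) * a ^ (j - i)))"
proof (induction k arbitrary: j)
  case 0
  show ?case
  proof (induction j)
    case 0
    then show ?case by (simp add: wigner_0_0)
  next
    case (Suc j)
    have s2: "complex_of_real (sqrt 2) \<noteq> 0" by simp
    have "of_real (sqrt 2) * (wigner (Suc j) 0 x y * of_real (sqrt (fact (Suc j)) * sqrt (fact 0)))
       = (of_real (sqrt (2 * real (Suc j))) * wigner (Suc j) 0 x y) * of_real (sqrt (fact j) * sqrt (fact 0))"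
      unfolding sqrt_fact_Suc real_sqrt_mult[of 2] of_real_mult by (simp only: mult_ac)
    also have "\<dots> = of_real (sqrt 2) * (a * (wigner j 0 x y * of_real (sqrt (fact j) * sqrt (fact 0))))"
      unfolding wigner_Suc_left_0 a_def by simp
    finally have "wigner (Suc j) 0 x y * of_real (sqrt (fact (Suc j)) * sqrt (fact 0)) = a * (wigner j 0 x y * of_real (sqrt (fact j) * sqrt (fact 0)))"
      using s2 by simp
    then show ?case unfolding Suc by simp
  qed
next
  case (Suc k)
  define E where "E = complex_of_real (exp (- (x\<^sup>2 + y\<^sup>2) / 4))"
  define W where "W j k = wigner j k x y * of_real (sqrt (fact j) * sqrt (fact k))" for j k
  define g where "g m j i = of_nat (fact i * (j choose i)) * b ^ (m - i) * a ^ (j - i)" for m j i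
  have s2: "complex_of_real (sqrt 2) \<noteq> 0" by simp
  have step: "W j (Suc k) = of_nat j * W (j - 1) k + b * W j k"
  proof -
    have j: "sqrt (real j) * sqrt (fact j) = real j * sqrt (fact (j - 1))"
      by (cases j) (simp_all add: real_sqrt_mult flip: mult.assoc)
    have "of_real (sqrt 2) * W j (Suc k)
        = (of_real (sqrt (2 * real (Suc k))) * wigner j (Suc k) x y) * of_real (sqrt (fact j) * sqrt (fact k))"
      unfolding W_def sqrt_fact_Suc real_sqrt_mult[of 2] of_real_mult by (simp only: mult_ac)
    also have "\<dots> = of_real (sqrt 2) * (of_real (sqrt (real j) * sqrt (fact j)) * (wigner (j - 1) k x y * of_real (sqrt (fact k))) + b * W j k)"
    proof -
      have sb: "\<i> * x - y = of_real (sqrt 2) * b" by (simp add: b_def)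
      show ?thesis
        unfolding wigner_Suc_right unfolding W_def sb real_sqrt_mult[of 2] of_real_mult
        by (simp only: distrib_left distrib_right mult_ac)
    qed
    also have "of_real (sqrt (real j) * sqrt (fact j)) * (wigner (j - 1) k x y * of_real (sqrt (fact k))) = of_nat j * W (j - 1) k"
      unfolding j W_def by (simp add: mult_ac)
    finally show ?thesis using s2 by simp
  qed
  have IH: "W j k = E * (\<Sum>i\<le>k. of_nat (k choose i) * g k j i)" for j
    unfolding W_def E_def g_def by (rule Suc.IH)
  have "of_nat j * (\<Sum>i\<le>k. of_nat (k choose i) * g k (j - 1) i) = (\<Sum>i\<le>k. of_nat (k choose i) * g (Suc k) j (Suc i))"
    unfolding sum_distrib_left
  proof (intro sum.cong refl)
    fix i
    show "of_nat j * (of_nat (k choose i) * g k (j - 1) i) = of_nat (k choose i) * g (Suc k) j (Suc i)"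
    proof (cases j)
      case (Suc l)
      have "fact (Suc i) * (Suc l choose Suc i) = Suc l * (fact i * (l choose i))"
      proof -
        have "fact (Suc i) * (Suc l choose Suc i) = fact i * (Suc i * (Suc l choose Suc i))"
          by (simp only: fact_Suc of_nat_id mult_ac)
        then show ?thesis unfolding Suc_times_binomial by (simp only: mult_ac)
      qed
      then have "(of_nat (fact (Suc i) * (Suc l choose Suc i)) :: complex) = of_nat (Suc l * (fact i * (l choose i)))" by (rule arg_cong)
      then show ?thesis unfolding g_def Suc by (simp only: of_nat_mult diff_Suc_Suc diff_Suc_1 mult_ac)
    qed (simp add: g_def)
  qed
  moreover have "b * (\<Sum>i\<le>k. of_nat (k choose i) * g k j i) = (\<Sum>i\<le>k. of_nat (k choose i) * g (Suc k) j i)"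
    unfolding sum_distrib_left by (intro sum.cong refl) (simp add: g_def Suc_diff_le mult_ac)
  ultimately have "W j (Suc k) = E * (\<Sum>i\<le>Suc k. of_nat (Suc k choose i) * g (Suc k) j i)"
    unfolding step IH sum_choose_Suc by (simp add: algebra_simps)
  then show ?case unfolding W_def E_def g_def .
qed

corollary wigner_origin: "wigner j k 0 0 = (if j = k then 1 else 0)"
proof -
  have "wigner j k 0 0 * of_real (sqrt (fact j) * sqrt (fact k)) =
      (\<Sum>i\<le>k. if i = k \<and> j \<le> k then of_nat (k choose i) * (of_nat (fact i * (j choose i))) else 0)"
    unfolding wigner_closed_form by (simp, intro sum.cong refl) (auto simp: power_0_left)
  also have "\<dots> = (if j = k then fact k else 0)"
    by (cases "j \<le> k") (auto simp: binomial_eq_0)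
  also have "\<dots> = (if j = k then 1 else 0) * of_real (sqrt (fact j) * sqrt (fact k))"
    by (simp flip: of_real_mult)
  finally show ?thesis by simp
qed

corollary wigner_diagonal:
  "wigner k k x y = of_real (exp (- (x\<^sup>2 + y\<^sup>2) / 4) * (\<Sum>m\<le>k. real (k choose m) * ((- (x\<^sup>2 + y\<^sup>2) / 2) ^ m / fact m)))"
proof -
  define s where "s = - (x\<^sup>2 + y\<^sup>2) / 2"
  have ab: "(\<i> * x - y) / sqrt 2 * ((\<i> * x + y) / sqrt 2) = of_real s"
  proof -
    have "(\<i> * x - y) / sqrt 2 * ((\<i> * x + y) / sqrt 2) = ((\<i> * x - y) * (\<i> * x + y)) / of_real (sqrt 2 * sqrt 2)"
      unfolding of_real_mult by (rule times_divide_times_eq)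
    also have "(\<i> * x - y) * (\<i> * x + y) = of_real (- (x\<^sup>2 + y\<^sup>2))"
      by (simp add: algebra_simps power2_eq_square)
    finally show ?thesis by (simp add: s_def)
  qed
  have "(\<Sum>i\<le>k. of_nat (k choose i) * (of_nat (fact i * (k choose i)) * ((\<i> * x - y) / sqrt 2) ^ (k - i) * ((\<i> * x + y) / sqrt 2) ^ (k - i)))
      = (\<Sum>i\<le>k. of_nat (k choose i) * (of_nat (fact i * (k choose i)) * of_real s ^ (k - i)))"
    by (simp only: mult.assoc power_mult_distrib[symmetric] ab)
  also have "\<dots> = of_real (fact k * (\<Sum>i\<le>k. real (k choose i) * (s ^ (k - i) / fact (k - i))))"
  proof -
    have "of_nat (fact i * (k choose i)) * of_real s ^ (k - i) = complex_of_real (fact k * (s ^ (k - i) / fact (k - i)))" if "i \<le> k" for i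
    proof -
      have "real (fact i * (k choose i)) = fact k / fact (k - i)"
      proof -
        have "real (fact i * fact (k - i) * (k choose i)) = real (fact k)"
          unfolding binomial_fact_lemma[OF that] ..
        then have "real (fact i * (k choose i)) * fact (k - i) = fact k" by (simp add: mult_ac)
        then show ?thesis by (simp add: eq_divide_eq)
      qed
      then have "real (fact i * (k choose i)) * s ^ (k - i) = fact k * (s ^ (k - i) / fact (k - i))" by simp
      then have "complex_of_real (real (fact i * (k choose i)) * s ^ (k - i)) = complex_of_real (fact k * (s ^ (k - i) / fact (k - i)))"
        by (rule arg_cong)
      then show ?thesis by (simp only: of_real_mult of_real_power of_real_of_nat_eq)
    qed
    then have "(\<Sum>i\<le>k. of_nat (k choose i) * (of_nat (fact i * (k choose i)) * complex_of_real s ^ (k - i)))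
        = (\<Sum>i\<le>k. of_nat (k choose i) * complex_of_real (fact k * (s ^ (k - i) / fact (k - i))))"
      by (intro sum.cong refl arg_cong2[where f = "(*)"]) auto
    also have "\<dots> = complex_of_real (\<Sum>i\<le>k. fact k * (real (k choose i) * (s ^ (k - i) / fact (k - i))))"
      by (simp add: mult_ac)
    finally show ?thesis by (simp only: sum_distrib_left)
  qed
  also have "(\<Sum>i\<le>k. real (k choose i) * (s ^ (k - i) / fact (k - i))) = (\<Sum>m\<le>k. real (k choose m) * (s ^ m / fact m))"
    by (rule sum.reindex_bij_witness[of _ "\<lambda>m. k - m" "\<lambda>m. k - m"]) (auto simp: binomial_symmetric[symmetric])
  finally have "wigner k k x y * of_real (fact k) = of_real (exp (- (x\<^sup>2 + y\<^sup>2) / 4)) * of_real (fact k * (\<Sum>m\<le>k. real (k choose m) * (s ^ m / fact m)))"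
    using wigner_closed_form[of k k x y] by simp
  then show ?thesis unfolding s_def by (simp add: mult_ac)
qed

lemma choose_generating_function:
  fixes r :: real
  assumes "\<bar>r\<bar> < 1"
  shows "(\<lambda>k. real (k choose m) * r ^ k) sums (r ^ m / (1 - r) ^ Suc m)"
proof -
  have "(\<lambda>n. (- (real m + 1) gchoose n) * (- r) ^ n) sums (1 + - r) powr (- (real m + 1))"
    using assms by (intro gen_binomial_real) simp
  moreover have "(- (real m + 1) gchoose n) * (- r) ^ n = real ((n + m) choose m) * r ^ n" for n
  proof -
    have "(- (real m + 1) gchoose n) = (- 1) ^ n * (real (n + m) gchoose n)"
      unfolding gbinomial_minus by (simp add: add.commute)
    also have "real (n + m) gchoose n = real ((n + m) choose n)" by (rule binomial_gbinomial[symmetric])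
    also have "(n + m) choose n = (n + m) choose m" using binomial_symmetric[of n "n + m"] by simp
    finally have "(- (real m + 1) gchoose n) * (- r) ^ n = real ((n + m) choose m) * ((- 1) ^ n * (- r) ^ n)" by simp
    also have "(- 1) ^ n * (- r) ^ n = r ^ n" by (simp flip: power_mult_distrib)
    finally show ?thesis .
  qed
  moreover have "(1 + - r) powr (- (real m + 1)) = 1 / (1 - r) ^ Suc m"
  proof -
    have "(1 - r) powr real (Suc m) = (1 - r) ^ Suc m" using assms by (intro powr_realpow) auto
    moreover have "(1 + - r) powr (- (real m + 1)) = 1 / (1 - r) powr real (Suc m)"
      unfolding powr_minus_divide by (simp add: add.commute)
    ultimately show ?thesis by (simp only:)
  qed
  ultimately have "(\<lambda>n. real ((n + m) choose m) * r ^ n) sums (1 / (1 - r) ^ Suc m)" by (simp only:)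
  then have "(\<lambda>n. r ^ m * (real ((n + m) choose m) * r ^ n)) sums (r ^ m * (1 / (1 - r) ^ Suc m))" by (rule sums_mult)
  then have "(\<lambda>n. real ((n + m) choose m) * r ^ (n + m)) sums (r ^ m / (1 - r) ^ Suc m)"
    by (simp add: power_add mult_ac)
  then have "(\<lambda>k. real (k choose m) * r ^ k) sums (r ^ m / (1 - r) ^ Suc m + (\<Sum>i<m. real (i choose m) * r ^ i))"
    by (subst (asm) sums_iff_shift)
  moreover have "(\<Sum>i<m. real (i choose m) * r ^ i) = 0" by (intro sum.neutral) (auto simp: binomial_eq_0)
  ultimately show ?thesis by simp
qed

text \<open>
  The diagonal values of the closed form are Laguerre polynomials; their generating function comes
  from exchanging the two sums.
\<close>

lemma
  fixes r s :: real
  assumes r: "0 \<le> r" "r < 1"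
  defines "L \<equiv> \<lambda>k. \<Sum>m\<le>k. real (k choose m) * (s ^ m / fact m)"
  shows integrable_laguerre: "integrable (count_space UNIV) (\<lambda>k. r ^ k * L k)"
    and integral_laguerre: "(LINT k|count_space UNIV. r ^ k * L k) = exp (s * (r / (1 - r))) / (1 - r)"
proof -
  interpret N: sigma_finite_measure "count_space UNIV :: nat measure" by (rule sigma_finite_measure_count_space)
  interpret P: pair_sigma_finite "count_space UNIV :: nat measure" "count_space UNIV :: nat measure" ..
  define g where "g m k = s ^ m / fact m * (real (k choose m) * r ^ k)" for m k
  have gk: "(\<lambda>k. real (k choose m) * r ^ k) sums (r ^ m / (1 - r) ^ Suc m)" for m
    using r by (intro choose_generating_function) auto
  have gk_int: "integrable (count_space UNIV) (\<lambda>k. real (k choose m) * r ^ k)" for m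
    unfolding integrable_count_space_nat_iff using sums_summable[OF gk[of m]] r by simp
  have gk_eq: "(LINT k|count_space UNIV. real (k choose m) * r ^ k) = r ^ m / (1 - r) ^ Suc m" for m
    unfolding integral_count_space_nat[OF gk_int] by (rule sums_unique[OF gk, symmetric])
  have e: "(\<lambda>m. c ^ m / fact m * (r ^ m / (1 - r) ^ Suc m)) sums (exp (c * (r / (1 - r))) / (1 - r))" for c
  proof -
    have "(\<lambda>m. (c * (r / (1 - r))) ^ m /\<^sub>R fact m / (1 - r)) sums (exp (c * (r / (1 - r))) / (1 - r))"
      by (intro sums_divide exp_converges)
    then show ?thesis
      by (simp add: divide_inverse power_mult_distrib power_inverse mult_ac)
  qed
  have int: "integrable (count_space UNIV \<Otimes>\<^sub>M count_space UNIV) (\<lambda>(m, k). g m k)"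
  proof (rule P.Fubini_integrable)
    show "(\<lambda>(m, k). g m k) \<in> borel_measurable (count_space UNIV \<Otimes>\<^sub>M count_space UNIV)"
      by (simp add: pair_measure_countable)
    have "(LINT k|count_space UNIV. norm (g m k)) = \<bar>s\<bar> ^ m / fact m * (r ^ m / (1 - r) ^ Suc m)" for m
      using r unfolding g_def gk_eq[symmetric] by (simp add: abs_mult power_abs)
    then show "integrable (count_space UNIV) (\<lambda>m. LINT k|count_space UNIV. norm (case (m, k) of (m, k) \<Rightarrow> g m k))"
      using sums_summable[OF e[of "\<bar>s\<bar>"]] r by (simp add: integrable_count_space_nat_iff)
    show "AE m in count_space UNIV. integrable (count_space UNIV) (\<lambda>k. case (m, k) of (m, k) \<Rightarrow> g m k)"
      unfolding prod.case g_def by (intro AE_I2 integrable_mult_right gk_int)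
  qed
  have inner: "(LINT m|count_space UNIV. g m k) = r ^ k * L k" for k
  proof -
    have z: "g m k = 0" if "m \<notin> {..k}" for m using that by (simp add: g_def binomial_eq_0)
    have "summable (\<lambda>m. norm (g m k))" using z by (intro summable_finite[of "{..k}"]) auto
    then have "(LINT m|count_space UNIV. g m k) = (\<Sum>m. g m k)"
      by (intro integral_count_space_nat) (simp add: integrable_count_space_nat_iff)
    also have "\<dots> = (\<Sum>m\<le>k. g m k)" using z by (intro suminf_finite) auto
    finally show ?thesis by (simp add: g_def L_def sum_distrib_left mult_ac)
  qed
  show "integrable (count_space UNIV) (\<lambda>k. r ^ k * L k)"
    using P.integrable_snd[OF int] by (simp only: inner)
  have "(LINT k|count_space UNIV. (LINT m|count_space UNIV. g m k)) = (LINT m|count_space UNIV. (LINT k|count_space UNIV. g m k))"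
    by (rule P.Fubini_integral[OF int])
  also have "\<dots> = (LINT m|count_space UNIV. s ^ m / fact m * (r ^ m / (1 - r) ^ Suc m))"
    unfolding g_def gk_eq[symmetric] by (intro Bochner_Integration.integral_cong refl integral_mult_right_zero)
  also have "\<dots> = exp (s * (r / (1 - r))) / (1 - r)"
  proof -
    have "integrable (count_space UNIV) (\<lambda>m. s ^ m / fact m * (r ^ m / (1 - r) ^ Suc m))"
      unfolding integrable_count_space_nat_iff
      using sums_summable[OF e[of "\<bar>s\<bar>"]] r by (simp add: abs_mult power_abs)
    from integral_count_space_nat[OF this] show ?thesis using sums_unique[OF e[of s]] by simp
  qed
  finally show "(LINT k|count_space UNIV. r ^ k * L k) = exp (s * (r / (1 - r))) / (1 - r)" unfolding inner .
qed

text \<open>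
  Mehler's formula on the diagonal, the source of the Gaussian kernel.
\<close>

theorem
  fixes r x y :: real
  assumes r: "0 \<le> r" "r < 1"
  shows integrable_wigner_diagonal: "integrable (count_space UNIV) (\<lambda>k. of_real (r ^ k) * wigner k k x y)"
    and integral_wigner_diagonal: "(LINT k|count_space UNIV. of_real (r ^ k) * wigner k k x y)
      = of_real (exp (- ((1 + r) / (4 * (1 - r)) * (x\<^sup>2 + y\<^sup>2))) / (1 - r))"
proof -
  define s where "s = - (x\<^sup>2 + y\<^sup>2) / 2"
  define L where "L k = (\<Sum>m\<le>k. real (k choose m) * (s ^ m / fact m))" for k
  have w: "of_real (r ^ k) * wigner k k x y = of_real (exp (s / 2) * (r ^ k * L k))" for k
    unfolding wigner_diagonal L_def s_def by (simp add: mult_ac)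
  show "integrable (count_space UNIV) (\<lambda>k. of_real (r ^ k) * wigner k k x y)"
    unfolding w L_def by (intro integrable_of_real integrable_mult_right integrable_laguerre r)
  have "(LINT k|count_space UNIV. of_real (r ^ k) * wigner k k x y) = of_real (exp (s / 2) * (exp (s * (r / (1 - r))) / (1 - r)))"
    unfolding w integral_complex_of_real unfolding L_def using integral_laguerre[OF r, of s] by simp
  also have "exp (s / 2) * (exp (s * (r / (1 - r))) / (1 - r)) = exp (s / 2 + s * (r / (1 - r))) / (1 - r)"
    by (simp add: exp_add)
  also have "s / 2 + s * (r / (1 - r)) = - ((1 + r) / (4 * (1 - r)) * (x\<^sup>2 + y\<^sup>2))"
    using r by (simp add: s_def divide_simps) (simp add: algebra_simps)
  finally show "(LINT k|count_space UNIV. of_real (r ^ k) * wigner k k x y)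
      = of_real (exp (- ((1 + r) / (4 * (1 - r)) * (x\<^sup>2 + y\<^sup>2))) / (1 - r))" .
qed

section \<open>Operators on square-integrable functions\<close>

lemma l2_norm_nonneg: "l2_norm \<phi> \<ge> 0" by (simp add: l2_norm_def)

lemma l2_norm_power2: "(l2_norm \<phi>)\<^sup>2 = (LINT x|lborel. (cmod (\<phi> x))\<^sup>2)"
  by (simp add: l2_norm_def)

lemma L2_nn_integral:
  assumes "\<phi> \<in> L2"
  shows "(\<integral>\<^sup>+ x. ennreal ((cmod (\<phi> x))\<^sup>2) \<partial>lborel) = ennreal ((l2_norm \<phi>)\<^sup>2)"
  using assms unfolding l2_norm_power2 by (intro nn_integral_eq_integral) (auto simp: L2_def)

lemma measurable_cnj [measurable (raw)]:
  "f \<in> borel_measurable M \<Longrightarrow> (\<lambda>x. cnj (f x)) \<in> borel_measurable M"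
  by (rule measurable_compose[OF _ borel_measurable_continuous_onI[OF continuous_on_cnj[OF continuous_on_id]]])

lemma nn_integral_translate:
  fixes f :: "'a::euclidean_space \<Rightarrow> ennreal"
  assumes [measurable]: "f \<in> borel_measurable borel"
  shows "(\<integral>\<^sup>+ x. f (x + a) \<partial>lborel) = (\<integral>\<^sup>+ x. f x \<partial>lborel)"
proof -
  have "(\<integral>\<^sup>+ x. f x \<partial>lborel) = (\<integral>\<^sup>+ x. f x \<partial>distr lborel borel ((+) a))" by (simp only: lborel_distr_plus)
  also have "\<dots> = (\<integral>\<^sup>+ x. f (a + x) \<partial>lborel)" by (rule nn_integral_distr) auto
  finally show ?thesis by (simp add: add.commute)
qed

text \<open>
  Minkowski's integral inequality for averages of translates, proved through Cauchy-Schwarz with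
  respect to the weight \<open>w\<close>.  All the operators below are of this form: the Fourier transform of the
  group, the Weyl transform, and the window \<open>local_mass\<close>.
\<close>

lemma
  fixes k :: "'b \<Rightarrow> 'a::euclidean_space \<Rightarrow> complex" and w :: "'b \<Rightarrow> real" and y :: "'b \<Rightarrow> 'a"
  assumes "sigma_finite_measure M"
    and k [measurable]: "(\<lambda>(\<xi>, g). k g \<xi>) \<in> borel_measurable (borel \<Otimes>\<^sub>M M)"
    and w: "integrable M w" "\<And>g. w g \<ge> 0" and y [measurable]: "y \<in> borel_measurable M"
    and \<psi>: "\<psi> \<in> L2" and le: "\<And>g \<xi>. cmod (k g \<xi>) \<le> w g * cmod (\<psi> (\<xi> + y g))"
  shows L2_averaged_translates: "(\<lambda>\<xi>. LINT g|M. k g \<xi>) \<in> L2"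
    and l2_norm_averaged_translates: "l2_norm (\<lambda>\<xi>. LINT g|M. k g \<xi>) \<le> (LINT g|M. w g) * l2_norm \<psi>"
proof -
  interpret sigma_finite_measure M by fact
  interpret P: pair_sigma_finite "lborel :: 'a measure" M ..
  have [measurable]: "w \<in> borel_measurable M" using w by simp
  have [measurable]: "\<psi> \<in> borel_measurable borel" using \<psi> by (simp add: L2_def)
  have k': "(\<lambda>(\<xi>, g). k g \<xi>) \<in> borel_measurable (lborel \<Otimes>\<^sub>M M)" using k by simp
  have k_sect [measurable]: "(\<lambda>g. k g \<xi>) \<in> borel_measurable M" for \<xi>
    using measurable_Pair2[OF k, of \<xi>] by simp
  define K where "K \<xi> = (LINT g|M. k g \<xi>)" for \<xi>
  have K_meas [measurable]: "K \<in> borel_measurable borel"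
    unfolding K_def[abs_def] using borel_measurable_lebesgue_integral[OF k] by simp
  define W where "W = (LINT g|M. w g)"
  have W: "W \<ge> 0" "(\<integral>\<^sup>+ g. ennreal (w g) \<partial>M) = ennreal W"
    unfolding W_def using w by (simp_all add: nn_integral_eq_integral)
  have K_le: "ennreal (cmod (K \<xi>)) \<le> (\<integral>\<^sup>+ g. ennreal (w g * cmod (\<psi> (\<xi> + y g))) \<partial>M)" for \<xi>
  proof (cases "integrable M (\<lambda>g. k g \<xi>)")
    case True
    have "ennreal (cmod (K \<xi>)) \<le> (\<integral>\<^sup>+ g. ennreal (cmod (k g \<xi>)) \<partial>M)"
      unfolding K_def by (rule integral_norm_bound_ennreal[OF True])
    also have "\<dots> \<le> (\<integral>\<^sup>+ g. ennreal (w g * cmod (\<psi> (\<xi> + y g))) \<partial>M)"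
      using le by (intro nn_integral_mono ennreal_leI)
    finally show ?thesis .
  qed (simp add: K_def not_integrable_integral_eq)
  have K_sq: "ennreal ((cmod (K \<xi>))\<^sup>2) \<le> ennreal W * (\<integral>\<^sup>+ g. ennreal (w g * (cmod (\<psi> (\<xi> + y g)))\<^sup>2) \<partial>M)" for \<xi>
  proof -
    define I1 where "I1 = (\<integral>\<^sup>+ g. ennreal (w g * cmod (\<psi> (\<xi> + y g))) \<partial>M)"
    define I2 where "I2 = (\<integral>\<^sup>+ g. ennreal (w g * (cmod (\<psi> (\<xi> + y g)))\<^sup>2) \<partial>M)"
    define A where "A = (\<integral>\<^sup>+ g. (ennreal (sqrt (w g)))\<^sup>2 \<partial>M)"
    define B where "B = (\<integral>\<^sup>+ g. (ennreal (sqrt (w g) * cmod (\<psi> (\<xi> + y g))))\<^sup>2 \<partial>M)"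
    define J1 where "J1 = (\<integral>\<^sup>+ g. ennreal (sqrt (w g)) * ennreal (sqrt (w g) * cmod (\<psi> (\<xi> + y g))) \<partial>M)"
    have K1: "(ennreal (cmod (K \<xi>)))\<^sup>2 \<le> I1\<^sup>2"
      using K_le unfolding I1_def by (intro power_mono) auto
    have I1_eq: "I1 = J1"
      unfolding I1_def J1_def
    proof (intro nn_integral_cong)
      fix g
      have "w g * cmod (\<psi> (\<xi> + y g)) = sqrt (w g) * (sqrt (w g) * cmod (\<psi> (\<xi> + y g)))"
        using w(2)[of g] by (simp add: mult.assoc[symmetric])
      then show "ennreal (w g * cmod (\<psi> (\<xi> + y g))) = ennreal (sqrt (w g)) * ennreal (sqrt (w g) * cmod (\<psi> (\<xi> + y g)))"
        using w(2)[of g] by (simp only:) (rule ennreal_mult, auto)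
    qed
    have CS: "J1\<^sup>2 \<le> A * B"
      unfolding J1_def A_def B_def by (rule Cauchy_Schwarz_nn_integral) measurable
    have A: "A = ennreal W"
      unfolding W(2)[symmetric] A_def using w(2) by (intro nn_integral_cong) (simp add: ennreal_power)
    have B: "B = I2"
      unfolding I2_def B_def using w(2) by (intro nn_integral_cong) (simp add: ennreal_power power_mult_distrib)
    have "ennreal ((cmod (K \<xi>))\<^sup>2) = (ennreal (cmod (K \<xi>)))\<^sup>2" by (simp add: ennreal_power)
    also have "\<dots> \<le> ennreal W * I2"
      using K1 CS unfolding I1_eq A B by (rule order_trans)
    finally show ?thesis unfolding I2_def .
  qed
  have inner: "(\<integral>\<^sup>+ \<xi>. ennreal (w g * (cmod (\<psi> (\<xi> + y g)))\<^sup>2) \<partial>lborel) = ennreal (w g) * ennreal ((l2_norm \<psi>)\<^sup>2)" for g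
  proof -
    have "(\<integral>\<^sup>+ \<xi>. ennreal (w g * (cmod (\<psi> (\<xi> + y g)))\<^sup>2) \<partial>lborel)
        = (\<integral>\<^sup>+ \<xi>. ennreal (w g) * ennreal ((cmod (\<psi> (\<xi> + y g)))\<^sup>2) \<partial>lborel)"
      using w(2) by (intro nn_integral_cong ennreal_mult) auto
    also have "\<dots> = ennreal (w g) * (\<integral>\<^sup>+ \<xi>. ennreal ((cmod (\<psi> (\<xi> + y g)))\<^sup>2) \<partial>lborel)"
      by (rule nn_integral_cmult) measurable
    moreover have "(\<integral>\<^sup>+ \<xi>. ennreal ((cmod (\<psi> (\<xi> + y g)))\<^sup>2) \<partial>lborel) = ennreal ((l2_norm \<psi>)\<^sup>2)"
      unfolding L2_nn_integral[OF \<psi>, symmetric] by (rule nn_integral_translate) measurable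
    ultimately show ?thesis by (simp only:)
  qed
  define J where "J = (\<integral>\<^sup>+ \<xi>. \<integral>\<^sup>+ g. ennreal (w g * (cmod (\<psi> (\<xi> + y g)))\<^sup>2) \<partial>M \<partial>lborel)"
  have "J = (\<integral>\<^sup>+ g. \<integral>\<^sup>+ \<xi>. ennreal (w g * (cmod (\<psi> (\<xi> + y g)))\<^sup>2) \<partial>lborel \<partial>M)"
    unfolding J_def by (rule P.Fubini'[symmetric]) measurable
  also have "\<dots> = (\<integral>\<^sup>+ g. ennreal (w g) * ennreal ((l2_norm \<psi>)\<^sup>2) \<partial>M)"
    by (simp only: inner)
  also have "\<dots> = ennreal W * ennreal ((l2_norm \<psi>)\<^sup>2)"
    unfolding W(2)[symmetric] by (rule nn_integral_multc) measurable
  finally have J: "J = ennreal W * ennreal ((l2_norm \<psi>)\<^sup>2)" .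
  have "(\<integral>\<^sup>+ \<xi>. ennreal ((cmod (K \<xi>))\<^sup>2) \<partial>lborel)
      \<le> (\<integral>\<^sup>+ \<xi>. ennreal W * (\<integral>\<^sup>+ g. ennreal (w g * (cmod (\<psi> (\<xi> + y g)))\<^sup>2) \<partial>M) \<partial>lborel)"
    by (intro nn_integral_mono K_sq)
  also have "\<dots> = ennreal W * J"
    unfolding J_def by (rule nn_integral_cmult) measurable
  also have "\<dots> = ennreal ((W * l2_norm \<psi>)\<^sup>2)"
  proof -
    have "(W * l2_norm \<psi>)\<^sup>2 = W * (W * (l2_norm \<psi>)\<^sup>2)" by (simp add: power2_eq_square)
    then show ?thesis unfolding J by (simp only: ennreal_mult'[OF W(1)])
  qed
  finally have bound: "(\<integral>\<^sup>+ \<xi>. ennreal ((cmod (K \<xi>))\<^sup>2) \<partial>lborel) \<le> ennreal ((W * l2_norm \<psi>)\<^sup>2)" .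
  have "integrable lborel (\<lambda>\<xi>. (cmod (K \<xi>))\<^sup>2)"
    using le_less_trans[OF bound ennreal_less_top] by (intro integrableI_bounded) simp_all
  then have K_L2: "K \<in> L2" by (simp add: L2_def)
  then have "(l2_norm K)\<^sup>2 \<le> (W * l2_norm \<psi>)\<^sup>2"
    using bound unfolding L2_nn_integral[OF K_L2] by simp
  then have "l2_norm K \<le> W * l2_norm \<psi>"
    by (rule power2_le_imp_le) (use W(1) l2_norm_nonneg[of \<psi>] in simp)
  then show "(\<lambda>\<xi>. LINT g|M. k g \<xi>) \<in> L2" "l2_norm (\<lambda>\<xi>. LINT g|M. k g \<xi>) \<le> (LINT g|M. w g) * l2_norm \<psi>"
    using K_L2 unfolding K_def[abs_def] W_def by simp_all
qed

lemma
  assumes \<phi>: "\<phi> \<in> L2" and \<psi>: "\<psi> \<in> L2"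
  shows integrable_L2_product: "integrable lborel (\<lambda>x. \<phi> x * cnj (\<psi> x))"
    and l2_Cauchy_Schwarz: "(LINT x|lborel. cmod (\<phi> x) * cmod (\<psi> x)) \<le> l2_norm \<phi> * l2_norm \<psi>"
proof -
  have [measurable]: "\<phi> \<in> borel_measurable borel" "\<psi> \<in> borel_measurable borel" using \<phi> \<psi> by (simp_all add: L2_def)
  have "(\<integral>\<^sup>+ x. ennreal (cmod (\<phi> x)) * ennreal (cmod (\<psi> x)) \<partial>lborel)\<^sup>2
      \<le> (\<integral>\<^sup>+ x. (ennreal (cmod (\<phi> x)))\<^sup>2 \<partial>lborel) * (\<integral>\<^sup>+ x. (ennreal (cmod (\<psi> x)))\<^sup>2 \<partial>lborel)"
    by (rule Cauchy_Schwarz_nn_integral) measurable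
  moreover have "(\<integral>\<^sup>+ x. (ennreal (cmod (\<phi> x)))\<^sup>2 \<partial>lborel) * (\<integral>\<^sup>+ x. (ennreal (cmod (\<psi> x)))\<^sup>2 \<partial>lborel)
      = (ennreal (l2_norm \<phi> * l2_norm \<psi>))\<^sup>2"
  proof -
    have "ennreal ((l2_norm \<phi>)\<^sup>2) * ennreal ((l2_norm \<psi>)\<^sup>2) = ennreal ((l2_norm \<phi> * l2_norm \<psi>)\<^sup>2)"
      unfolding power_mult_distrib by (rule ennreal_mult[symmetric]) simp_all
    moreover have "(ennreal (l2_norm \<phi> * l2_norm \<psi>))\<^sup>2 = ennreal ((l2_norm \<phi> * l2_norm \<psi>)\<^sup>2)"
      by (rule ennreal_power) (use l2_norm_nonneg[of \<phi>] l2_norm_nonneg[of \<psi>] in simp)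
    moreover have "(ennreal (cmod z))\<^sup>2 = ennreal ((cmod z)\<^sup>2)" for z by (rule ennreal_power) simp
    ultimately show ?thesis by (simp only: L2_nn_integral[OF \<phi>] L2_nn_integral[OF \<psi>])
  qed
  ultimately have sq: "(\<integral>\<^sup>+ x. ennreal (cmod (\<phi> x)) * ennreal (cmod (\<psi> x)) \<partial>lborel)\<^sup>2 \<le> (ennreal (l2_norm \<phi> * l2_norm \<psi>))\<^sup>2"
    by (simp only:)
  have "(\<integral>\<^sup>+ x. ennreal (cmod (\<phi> x)) * ennreal (cmod (\<psi> x)) \<partial>lborel) \<le> ennreal (l2_norm \<phi> * l2_norm \<psi>)"
  proof (cases "(\<integral>\<^sup>+ x. ennreal (cmod (\<phi> x)) * ennreal (cmod (\<psi> x)) \<partial>lborel)" rule: ennreal_cases)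
    case (real i)
    have nn: "0 \<le> l2_norm \<phi> * l2_norm \<psi>" using l2_norm_nonneg[of \<phi>] l2_norm_nonneg[of \<psi>] by simp
    have "ennreal (i\<^sup>2) \<le> ennreal ((l2_norm \<phi> * l2_norm \<psi>)\<^sup>2)"
      using sq unfolding real(2) ennreal_power[OF real(1)] ennreal_power[OF nn] .
    then have "i\<^sup>2 \<le> (l2_norm \<phi> * l2_norm \<psi>)\<^sup>2" by (simp only: ennreal_le_iff zero_le_power2)
    then have "i \<le> l2_norm \<phi> * l2_norm \<psi>" using nn by (rule power2_le_imp_le)
    then show ?thesis unfolding real(2) by (rule ennreal_leI)
  next
    case top
    moreover have "(ennreal (l2_norm \<phi> * l2_norm \<psi>))\<^sup>2 = ennreal ((l2_norm \<phi> * l2_norm \<psi>)\<^sup>2)"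
      by (rule ennreal_power) (use l2_norm_nonneg[of \<phi>] l2_norm_nonneg[of \<psi>] in simp)
    ultimately show ?thesis using sq by (simp add: top_unique power2_eq_square[of top])
  qed
  then have b: "(\<integral>\<^sup>+ x. ennreal (cmod (\<phi> x) * cmod (\<psi> x)) \<partial>lborel) \<le> ennreal (l2_norm \<phi> * l2_norm \<psi>)"
    by (simp add: ennreal_mult)
  have i: "integrable lborel (\<lambda>x. cmod (\<phi> x) * cmod (\<psi> x))"
    using le_less_trans[OF b ennreal_less_top] by (intro integrableI_bounded) simp_all
  then show "integrable lborel (\<lambda>x. \<phi> x * cnj (\<psi> x))"
    by (rule Bochner_Integration.integrable_bound) (auto simp: norm_mult)
  show "(LINT x|lborel. cmod (\<phi> x) * cmod (\<psi> x)) \<le> l2_norm \<phi> * l2_norm \<psi>"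
    using b i l2_norm_nonneg[of \<phi>] l2_norm_nonneg[of \<psi>] by (simp add: nn_integral_eq_integral)
qed

corollary cmod_l2_inner_le:
  assumes "\<phi> \<in> L2" "\<psi> \<in> L2"
  shows "cmod (l2_inner \<phi> \<psi>) \<le> l2_norm \<phi> * l2_norm \<psi>"
proof -
  have "cmod (l2_inner \<phi> \<psi>) \<le> (LINT x|lborel. cmod (\<phi> x * cnj (\<psi> x)))"
    unfolding l2_inner_def by (rule integral_norm_bound)
  also have "\<dots> \<le> l2_norm \<phi> * l2_norm \<psi>" using l2_Cauchy_Schwarz[OF assms] by (simp add: norm_mult)
  finally show ?thesis .
qed

section \<open>Compactly supported functions of Gevrey class\<close>

text \<open>
  The exponent \<open>2\<close> of the factorial is the Gevrey order; any order above \<open>1\<close> admits compact support,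
  and order \<open>2\<close> is small enough for \<open>flat_laplace_transform_vanishes\<close>.
\<close>

definition gevrey_bound :: "real \<Rightarrow> nat \<Rightarrow> real" where
  "gevrey_bound C k = C ^ k * (fact k)\<^sup>2"

text \<open>
  The sequence \<open>u\<close> lists a function and its derivatives.  The shift \<open>j\<close> counts how many operations
  (differentiation or multiplication by the variable) have been applied to an original function, so
  that each of them preserves the same constants.
\<close>

definition gevrey :: "real \<Rightarrow> real \<Rightarrow> nat \<Rightarrow> (nat \<Rightarrow> real \<Rightarrow> complex) \<Rightarrow> bool" where
  "gevrey C R j u \<longleftrightarrow> (\<forall>i x. (u i has_vector_derivative u (Suc i) x) (at x))
    \<and> (\<forall>i x. cmod (u i x) \<le> gevrey_bound C (i + j)) \<and> (\<forall>i x. \<bar>x\<bar> > R \<longrightarrow> u i x = 0)"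

lemma gevrey_derivative:
  fixes u :: "nat \<Rightarrow> real \<Rightarrow> complex"
  assumes "gevrey C R j u"
  shows "gevrey C R (Suc j) (\<lambda>i. u (Suc i))"
  using assms unfolding gevrey_def add_Suc_right add_Suc[symmetric] by blast

text \<open>
  By Leibniz' rule a product with the variable costs \<open>R\<close> plus the order of differentiation, and both
  are absorbed into the growth of \<open>gevrey_bound\<close> from one index to the next.
\<close>

lemma gevrey_times_x:
  fixes u :: "nat \<Rightarrow> real \<Rightarrow> complex"
  assumes u: "gevrey C R j u" and C: "C \<ge> R + 1" and R: "R \<ge> 0"
  shows "gevrey C R (Suc j) (\<lambda>i x. x * u i x + of_nat i * u (i - 1) x)"
  unfolding gevrey_def
proof (intro conjI allI impI)
  fix i x
  have D: "(u i has_vector_derivative u (Suc i) x) (at x)" for i using u by (simp add: gevrey_def)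
  have "((\<lambda>x. of_nat i * u (i - 1) x) has_vector_derivative of_nat i * u i x) (at x)"
    by (cases i) (auto intro!: derivative_eq_intros D)
  moreover have "((\<lambda>x. of_real x * u i x) has_vector_derivative of_real x * u (Suc i) x + of_real 1 * u i x) (at x)"
    by (intro has_vector_derivative_mult D has_vector_derivative_of_real has_vector_derivative_id DERIV_ident)
  ultimately have "((\<lambda>x. x * u i x + of_nat i * u (i - 1) x) has_vector_derivative
      ((of_real x * u (Suc i) x + of_real 1 * u i x) + of_nat i * u i x)) (at x)"
    by (intro has_vector_derivative_add)
  moreover have "(of_real x * u (Suc i) x + of_real 1 * u i x) + of_nat i * u i x = x * u (Suc i) x + of_nat (Suc i) * u (Suc i - 1) x"
    by (simp add: distrib_right)
  ultimately show "((\<lambda>x. x * u i x + of_nat i * u (i - 1) x) has_vector_derivative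
      (x * u (Suc i) x + of_nat (Suc i) * u (Suc i - 1) x)) (at x)"
    by (simp only:)
  have b: "cmod (u i x) \<le> gevrey_bound C (i + j)" for i using u by (simp add: gevrey_def)
  have pos: "gevrey_bound C k \<ge> 0" for k using C R by (simp add: gevrey_bound_def)
  have grow: "C * gevrey_bound C k * (real (Suc k))\<^sup>2 = gevrey_bound C (Suc k)" for k
    by (simp add: gevrey_bound_def power_mult_distrib mult_ac)
  have 1: "cmod (x * u i x) \<le> R * gevrey_bound C (i + j)"
  proof (cases "\<bar>x\<bar> > R")
    case True
    then have "u i x = 0" using u by (simp add: gevrey_def)
    then show ?thesis using pos R by simp
  next
    case False
    then show ?thesis using b[of i] R by (simp add: norm_mult mult_mono)
  qed
  have 2: "cmod (of_nat i * u (i - 1) x) \<le> 1 * gevrey_bound C (i + j)"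
  proof (cases i)
    case (Suc l)
    have "real i * cmod (u l x) \<le> real i * gevrey_bound C (l + j)" using b[of l] by (intro mult_left_mono) auto
    also have "\<dots> \<le> (C * (real (Suc (l + j)))\<^sup>2) * gevrey_bound C (l + j)"
    proof (intro mult_right_mono pos)
      have "real i \<le> real (Suc (l + j))" using Suc by simp
      also have "\<dots> \<le> (real (Suc (l + j)))\<^sup>2" by (simp add: power2_eq_square)
      also have "\<dots> \<le> C * (real (Suc (l + j)))\<^sup>2" using C R by (intro mult_right_mono[of 1 C, simplified mult_1]) auto
      finally show "real i \<le> C * (real (Suc (l + j)))\<^sup>2" .
    qed
    also have "\<dots> = gevrey_bound C (i + j)" using grow[of "l + j"] Suc by (simp add: mult_ac)
    finally show ?thesis unfolding Suc norm_mult norm_of_nat by simp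
  qed (use pos in simp)
  have "cmod (x * u i x + of_nat i * u (i - 1) x) \<le> R * gevrey_bound C (i + j) + 1 * gevrey_bound C (i + j)"
    using 1 2 by (intro order_trans[OF norm_triangle_ineq] add_mono)
  also have "\<dots> \<le> C * gevrey_bound C (i + j) * 1"
    using mult_right_mono[OF C pos[of "i + j"]] by (simp add: distrib_right)
  also have "\<dots> \<le> C * gevrey_bound C (i + j) * (real (Suc (i + j)))\<^sup>2"
    using C R pos by (intro mult_left_mono one_le_power) auto
  finally show "cmod (x * u i x + of_nat i * u (i - 1) x) \<le> gevrey_bound C (i + Suc j)"
    unfolding grow by simp
next
  fix i x assume "\<bar>x\<bar> > R"
  then show "x * u i x + of_nat i * u (i - 1) x = 0" using u by (simp add: gevrey_def)
qed

definition bump_exponential :: "complex \<Rightarrow> complex" where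
  "bump_exponential z = exp (- (1 / (1 - z)) - 1 / (1 + z))"

text \<open>
  The standard cutoff \<open>exp (-1/(1-x) - 1/(1+x))\<close> on \<open>(-1, 1)\<close> with its derivatives.  Taking complex
  derivatives of a holomorphic function makes Cauchy's estimate available.
\<close>

definition bump :: "nat \<Rightarrow> real \<Rightarrow> complex" where
  "bump i x = (if \<bar>x\<bar> < 1 then (deriv ^^ i) bump_exponential (of_real x) else 0)"

lemma holomorphic_bump_exponential: "bump_exponential holomorphic_on - {1, -1}"
proof -
  have "(\<lambda>z. 1 / (1 - z)) holomorphic_on - {1, -1 :: complex}"
    by (rule holomorphic_on_divide[OF holomorphic_on_const holomorphic_on_diff[OF holomorphic_on_const holomorphic_on_ident]]) simp
  moreover have "(\<lambda>z. 1 / (1 + z)) holomorphic_on - {1, -1 :: complex}"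
    by (rule holomorphic_on_divide[OF holomorphic_on_const holomorphic_on_add[OF holomorphic_on_const holomorphic_on_ident]])
      (simp add: add_eq_0_iff)
  ultimately have "(\<lambda>z. - (1 / (1 - z)) - 1 / (1 + z)) holomorphic_on - {1, -1 :: complex}"
    by (rule holomorphic_on_diff[OF holomorphic_on_minus])
  then show ?thesis unfolding bump_exponential_def by (rule holomorphic_on_exp')
qed

lemma Re_inverse_ge:
  fixes w :: complex
  assumes "cmod (w - of_real d) = d / 2" "d > 0"
  shows "Re (1 / w) \<ge> 2 / (9 * d)"
proof -
  have "\<bar>Re w - d\<bar> \<le> d / 2" using abs_Re_le_cmod[of "w - of_real d"] assms by simp
  then have re: "Re w \<ge> d / 2" by linarith
  have "cmod w \<le> cmod (w - of_real d) + cmod (of_real d :: complex)"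
    using norm_triangle_ineq[of "w - of_real d" "of_real d"] by simp
  then have "cmod w \<le> 3 * d / 2" using assms by simp
  then have "(cmod w)\<^sup>2 \<le> (3 * d / 2)\<^sup>2" by (intro power_mono) auto
  moreover have "cmod w > 0" using re assms abs_Re_le_cmod[of w] by linarith
  ultimately have "(d / 2) / (3 * d / 2)\<^sup>2 \<le> Re w / (cmod w)\<^sup>2"
    using re assms by (intro frac_le) auto
  also have "\<dots> = Re (1 / w)" by (simp add: Re_divide cmod_power2)
  finally show ?thesis using assms by (simp add: field_simps power2_eq_square)
qed

text \<open>
  Cauchy's estimate on the circle of radius \<open>(1 - |x|)/2\<close>; there the real part of
  \<open>1/(1 - z)\<close> or \<open>1/(1 + z)\<close>, whichever has its pole nearer to \<open>x\<close>, is still comparable to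
  \<open>1/(1 - |x|)\<close>.
\<close>

lemma cmod_deriv_bump_exponential:
  assumes x: "\<bar>x\<bar> < 1"
  shows "cmod ((deriv ^^ i) bump_exponential (of_real x)) \<le> fact i * exp (- (2 / (9 * (1 - \<bar>x\<bar>)))) / ((1 - \<bar>x\<bar>) / 2) ^ i"
proof (rule Cauchy_inequality)
  define d where "d = 1 - \<bar>x\<bar>"
  have d: "d > 0" using x by (simp add: d_def)
  have sub: "cball (of_real x) ((1 - \<bar>x\<bar>) / 2) \<subseteq> - {1, -1 :: complex}"
  proof
    fix z :: complex assume "z \<in> cball (of_real x) ((1 - \<bar>x\<bar>) / 2)"
    then have "cmod (z - of_real x) \<le> d / 2" by (simp add: dist_norm norm_minus_commute d_def)
    moreover have "cmod (1 - of_real x) \<ge> d" "cmod (- 1 - of_real x) \<ge> d"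
      using x norm_of_real[of "1 - x", where 'a = complex] norm_of_real[of "- 1 - x", where 'a = complex]
      by (auto simp: d_def)
    ultimately show "z \<in> - {1, -1}" using d by auto
  qed
  show "bump_exponential holomorphic_on ball (of_real x) ((1 - \<bar>x\<bar>) / 2)"
    by (rule holomorphic_on_subset[OF holomorphic_bump_exponential order_trans[OF ball_subset_cball sub]])
  show "continuous_on (cball (of_real x) ((1 - \<bar>x\<bar>) / 2)) bump_exponential"
    by (rule holomorphic_on_imp_continuous_on[OF holomorphic_on_subset[OF holomorphic_bump_exponential sub]])
  show "0 < (1 - \<bar>x\<bar>) / 2" using x by simp
  fix z :: complex assume "cmod (of_real x - z) = (1 - \<bar>x\<bar>) / 2"
  then have z: "cmod (z - of_real x) = d / 2" by (simp add: norm_minus_commute d_def)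
  have re_z: "\<bar>Re z - x\<bar> \<le> d / 2" using abs_Re_le_cmod[of "z - of_real x"] z by simp
  have nonneg: "Re (1 / w) \<ge> 0" if "Re w \<ge> 0" for w :: complex using that by (simp add: Re_divide)
  have "Re (1 / (1 - z)) + Re (1 / (1 + z)) \<ge> 2 / (9 * d)"
  proof (cases "x \<ge> 0")
    case True
    then have "1 - z - of_real d = - (z - of_real x)" by (simp add: d_def)
    then have "Re (1 / (1 - z)) \<ge> 2 / (9 * d)" using z d by (intro Re_inverse_ge) (simp_all only: norm_minus_cancel)
    moreover have "Re (1 / (1 + z)) \<ge> 0" using re_z True d x by (intro nonneg) (simp add: d_def abs_if split: if_splits)
    ultimately show ?thesis by linarith
  next
    case False
    then have "1 + z - of_real d = z - of_real x" by (simp add: d_def)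
    then have "Re (1 / (1 + z)) \<ge> 2 / (9 * d)" using z d by (intro Re_inverse_ge) (simp_all only:)
    moreover have "Re (1 / (1 - z)) \<ge> 0" using re_z False d x by (intro nonneg) (simp add: d_def abs_if split: if_splits)
    ultimately show ?thesis by linarith
  qed
  then show "cmod (bump_exponential z) \<le> exp (- (2 / (9 * (1 - \<bar>x\<bar>))))"
    by (simp add: bump_exponential_def d_def)
qed

lemma exp_neg_le_fact: "exp (- y) \<le> fact n / y ^ n" if "y > 0" for y :: real
proof -
  have "(\<Sum>k\<in>{n}. y ^ k /\<^sub>R fact k) \<le> (\<Sum>k. y ^ k /\<^sub>R fact k)"
    by (rule sum_le_suminf[OF summable_exp_generic]) (use that in auto)
  then have "y ^ n / fact n \<le> exp y" unfolding exp_def by (simp add: divide_inverse mult.commute)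
  then have "1 / exp y \<le> 1 / (y ^ n / fact n)" using that by (intro divide_left_mono) auto
  then show ?thesis by (simp add: exp_minus inverse_eq_divide)
qed

text \<open>
  The exponential beats the power of \<open>1/(1 - |x|)\<close> lost in Cauchy's estimate, at the price of a
  second factorial.
\<close>

lemma cmod_bump_le: "cmod (bump i x) \<le> 9 ^ i * (fact i)\<^sup>2"
  and cmod_bump_le_flat: "\<exists>K\<ge>0. \<forall>x. \<bar>x\<bar> < 1 \<longrightarrow> cmod (bump i x) \<le> K * (1 - \<bar>x\<bar>)\<^sup>2"
proof -
  have general: "cmod (bump i x) \<le> fact i * (fact n / (2 / (9 * (1 - \<bar>x\<bar>))) ^ n) / ((1 - \<bar>x\<bar>) / 2) ^ i" if "\<bar>x\<bar> < 1" for x n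
  proof -
    have "cmod (bump i x) \<le> fact i * exp (- (2 / (9 * (1 - \<bar>x\<bar>)))) / ((1 - \<bar>x\<bar>) / 2) ^ i"
      using cmod_deriv_bump_exponential[OF that] that by (simp add: bump_def)
    also have "\<dots> \<le> fact i * (fact n / (2 / (9 * (1 - \<bar>x\<bar>))) ^ n) / ((1 - \<bar>x\<bar>) / 2) ^ i"
      using that by (intro divide_right_mono mult_left_mono exp_neg_le_fact) auto
    finally show ?thesis .
  qed
  show "cmod (bump i x) \<le> 9 ^ i * (fact i)\<^sup>2"
  proof (cases "\<bar>x\<bar> < 1")
    case True
    define d where "d = 1 - \<bar>x\<bar>"
    have d: "d > 0" using True by (simp add: d_def)
    have "2 / (9 * d) * (d / 2) = 1 / 9" using d by simp
    then have "(2 / (9 * d)) ^ i * (d / 2) ^ i = (1 / 9) ^ i" by (simp only: power_mult_distrib[symmetric])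
    then have "fact i * (fact i / (2 / (9 * d)) ^ i) / (d / 2) ^ i = (fact i)\<^sup>2 / (1 / 9) ^ i"
      by (simp add: power2_eq_square)
    then show ?thesis using general[OF True, of i] unfolding d_def[symmetric] by (simp add: power_one_over mult.commute)
  qed (simp add: bump_def)
  define K where "K = (fact i * fact (i + 2) * 9 ^ i * (81 / 4) :: real)"
  have "cmod (bump i x) \<le> K * (1 - \<bar>x\<bar>)\<^sup>2" if "\<bar>x\<bar> < 1" for x
  proof -
    define d where "d = 1 - \<bar>x\<bar>"
    have d: "d > 0" using that by (simp add: d_def)
    have "(2 / (9 * d)) ^ (i + 2) * (d / 2) ^ i = (1 / 9) ^ i * (2 / (9 * d))\<^sup>2"
    proof -
      have ab: "2 / (9 * d) * (d / 2) = 1 / 9" using d by simp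
      have "a ^ (i + 2) * b ^ i = (a * b) ^ i * a\<^sup>2" for a b :: real
        by (simp only: power_add power_mult_distrib mult_ac)
      from this[of "2 / (9 * d)" "d / 2"] show ?thesis unfolding ab .
    qed
    then have "fact i * (fact (i + 2) / (2 / (9 * d)) ^ (i + 2)) / (d / 2) ^ i = fact i * fact (i + 2) / ((1 / 9) ^ i * (2 / (9 * d))\<^sup>2)"
      by (metis divide_divide_eq_left times_divide_eq_right)
    also have "\<dots> = K * d\<^sup>2"
    proof -
      have "(1 / 9) ^ i * (2 / (9 * d))\<^sup>2 = 1 / (9 ^ i * (81 / 4) * d\<^sup>2)"
        using d by (simp add: power_one_over power_divide power_mult_distrib)
      then show ?thesis by (simp only: K_def) (simp del: fact_Suc add_2_eq_Suc')
    qed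
    finally show ?thesis using general[OF that, of "i + 2"] unfolding d_def[symmetric] by simp
  qed
  moreover have "K \<ge> 0" by (simp add: K_def)
  ultimately show "\<exists>K\<ge>0. \<forall>x. \<bar>x\<bar> < 1 \<longrightarrow> cmod (bump i x) \<le> K * (1 - \<bar>x\<bar>)\<^sup>2" by blast
qed

lemma bump_has_derivative: "(bump i has_vector_derivative bump (Suc i) x) (at x)"
proof -
  consider "\<bar>x\<bar> < 1" | "\<bar>x\<bar> = 1" | "\<bar>x\<bar> > 1" by linarith
  then show ?thesis
  proof cases
    case 1
    have "of_real x \<noteq> (1 :: complex)" "of_real x \<noteq> (- 1 :: complex)"
      using 1 by (auto simp: complex_eq_iff)
    then have mem: "complex_of_real x \<in> - {1, -1}" by simp
    have op: "open (- {1, -1 :: complex})" by (intro open_Compl finite_imp_closed) simp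
    have "((deriv ^^ i) bump_exponential has_field_derivative deriv ((deriv ^^ i) bump_exponential) (of_real x)) (at (of_real x))"
    
      by (rule holomorphic_derivI[OF holomorphic_higher_deriv[OF holomorphic_bump_exponential op] op mem])
    from has_vector_derivative_real_field[OF this]
    have "((\<lambda>x. (deriv ^^ i) bump_exponential (of_real x)) has_vector_derivative bump (Suc i) x) (at x)"
      using 1 by (simp add: bump_def)
    then show ?thesis
      by (rule has_vector_derivative_transform_within_open[where S = "{-1<..<1}"]) (use 1 in \<open>auto simp: bump_def\<close>)
  next
    case 3
    have "((\<lambda>x. 0) has_vector_derivative (0 :: complex)) (at x)" by simp
    then have "(bump i has_vector_derivative 0) (at x)"
      by (rule has_vector_derivative_transform_within_open[where S = "- {-1..1}"]) (use 3 in \<open>auto simp: bump_def\<close>)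
    then show ?thesis using 3 by (simp add: bump_def)
  next
    case 2
    obtain K where K: "K \<ge> 0" "\<And>x. \<bar>x\<bar> < 1 \<Longrightarrow> cmod (bump i x) \<le> K * (1 - \<bar>x\<bar>)\<^sup>2" using cmod_bump_le_flat by blast
    have K': "cmod (bump i y) \<le> K * (y - x)\<^sup>2" for y
    proof (cases "\<bar>y\<bar> < 1")
      case True
      have "cmod (bump i y) \<le> K * (1 - \<bar>y\<bar>)\<^sup>2" by (rule K(2)[OF True])
      also have "\<dots> \<le> K * (y - x)\<^sup>2"
        using K(1) True 2 by (intro mult_left_mono) (auto simp: abs_le_square_iff[symmetric])
      finally show ?thesis .
    qed (use K(1) in \<open>simp add: bump_def\<close>)
    have x0: "bump i x = 0" "bump (Suc i) x = 0" using 2 by (simp_all add: bump_def)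
    have "((\<lambda>y. norm (bump i y - bump i x - (y - x) *\<^sub>R bump (Suc i) x) / norm (y - x)) \<longlongrightarrow> 0) (at x)"
    proof (rule Lim_null_comparison)
      show "\<forall>\<^sub>F y in at x. norm (norm (bump i y - bump i x - (y - x) *\<^sub>R bump (Suc i) x) / norm (y - x)) \<le> K * \<bar>y - x\<bar>"
        unfolding eventually_at_filter
      proof (intro always_eventually allI impI)
        fix y assume "y \<noteq> x"
        then have pos: "\<bar>y - x\<bar> > 0" by simp
        have "cmod (bump i y) / \<bar>y - x\<bar> \<le> (K * \<bar>y - x\<bar> * \<bar>y - x\<bar>) / \<bar>y - x\<bar>"
          using K'[of y] by (intro divide_right_mono) (simp_all add: power2_eq_square mult.assoc)
        then show "norm (norm (bump i y - bump i x - (y - x) *\<^sub>R bump (Suc i) x) / norm (y - x)) \<le> K * \<bar>y - x\<bar>"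
          using pos by (simp add: x0)
      qed
      have "((\<lambda>y. K * \<bar>y - x\<bar>) \<longlongrightarrow> K * \<bar>x - x\<bar>) (at x)" by (intro tendsto_intros)
      then show "((\<lambda>y. K * \<bar>y - x\<bar>) \<longlongrightarrow> 0) (at x)" by simp
    qed
    then show ?thesis
      unfolding has_vector_derivative_def has_derivative_iff_norm
      using bounded_linear_scaleR_left[of "bump (Suc i) x"] by (rule conjI[rotated])
  qed
qed

lemma gevrey_bump_exists:
  fixes c \<delta> :: real
  assumes \<delta>: "\<delta> > 0"
  obtains C :: real and u :: "nat \<Rightarrow> real \<Rightarrow> complex" and v :: "real \<Rightarrow> real" where "C \<ge> (\<bar>c\<bar> + \<delta>) + 1" "gevrey C (\<bar>c\<bar> + \<delta>) 0 u"
    "\<And>x. u 0 x = of_real (v x)" "\<And>x. v x \<ge> 0" "v c > 0" "\<And>x. \<bar>x - c\<bar> \<ge> \<delta> \<Longrightarrow> v x = 0"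
proof
  define C where "C = 9 / \<delta> + (\<bar>c\<bar> + \<delta>) + 1"
  define u where "u i x = of_real ((1 / \<delta>) ^ i) * bump i ((x - c) / \<delta>)" for i x
  define v where "v x = (if \<bar>(x - c) / \<delta>\<bar> < 1 then exp (- (1 / (1 - (x - c) / \<delta>)) - 1 / (1 + (x - c) / \<delta>)) else 0)" for x
  show "C \<ge> (\<bar>c\<bar> + \<delta>) + 1" using \<delta> by (simp add: C_def)
  show "u 0 x = of_real (v x)" for x
    by (simp add: u_def v_def bump_def bump_exponential_def exp_of_real[symmetric])
  show "v x \<ge> 0" for x by (simp add: v_def)
  show "v c > 0" using \<delta> by (simp add: v_def)
  have out: "\<not> \<bar>(x - c) / \<delta>\<bar> < 1" if "\<bar>x - c\<bar> \<ge> \<delta>" for x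
    using that \<delta> by (simp add: abs_divide)
  show "v x = 0" if "\<bar>x - c\<bar> \<ge> \<delta>" for x using out[OF that] by (simp add: v_def)
  show "gevrey C (\<bar>c\<bar> + \<delta>) 0 u"
    unfolding gevrey_def
  proof (intro conjI allI impI)
    fix i x
    have lin: "((\<lambda>x. (x - c) / \<delta>) has_real_derivative 1 / \<delta>) (at x)"
      using \<delta> by (auto intro!: derivative_eq_intros)
    have "((bump i \<circ> (\<lambda>x. (x - c) / \<delta>)) has_vector_derivative (1 / \<delta>) *\<^sub>R bump (Suc i) ((x - c) / \<delta>)) (at x)"
      by (rule vector_diff_chain_at[OF lin[unfolded has_real_derivative_iff_has_vector_derivative] bump_has_derivative])
    from has_vector_derivative_mult_right[OF this, of "of_real ((1 / \<delta>) ^ i)"]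
    show "(u i has_vector_derivative u (Suc i) x) (at x)"
      unfolding u_def o_def by (simp add: scaleR_conv_of_real mult_ac)
    have "cmod (u i x) \<le> (1 / \<delta>) ^ i * (9 ^ i * (fact i)\<^sup>2)"
      unfolding u_def norm_mult using \<delta> cmod_bump_le[of i "(x - c) / \<delta>"]
      by (intro mult_mono) (auto simp: norm_power norm_divide)
    also have "\<dots> = (9 / \<delta>) ^ i * (fact i)\<^sup>2" by (simp add: power_divide)
    also have "\<dots> \<le> gevrey_bound C (i + 0)"
    proof -
      have "9 / \<delta> \<le> C" unfolding C_def using \<delta> abs_ge_zero[of c] by linarith
      then have "(9 / \<delta>) ^ i \<le> C ^ i" using \<delta> by (intro power_mono) auto
      then show ?thesis unfolding gevrey_bound_def by (simp add: mult_right_mono)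
    qed
    finally show "cmod (u i x) \<le> gevrey_bound C (i + 0)" .
  next
    fix i x assume "\<bar>x\<bar> > \<bar>c\<bar> + \<delta>"
    then have "\<bar>x - c\<bar> \<ge> \<delta>" by linarith
    then show "u i x = 0" using out by (simp add: u_def bump_def)
  qed
qed

section \<open>Matrix coefficients of the Schroedinger representation\<close>

definition hermite1 :: "real \<Rightarrow> nat \<Rightarrow> real \<Rightarrow> real" where
  "hermite1 lam k u = \<bar>lam\<bar> powr (1 / 4) * hermite_function k (sqrt \<bar>lam\<bar> * u)"

lemma scaled_hermite_eq_prod:
  fixes \<alpha> :: "nat ^ 'n::finite"
  shows "scaled_hermite lam \<alpha> x = of_real (\<Prod>j\<in>UNIV. hermite1 lam (\<alpha> $ j) (x $ j))"
proof -
  have "(\<bar>lam\<bar> powr (1 / 4)) ^ CARD('n) = \<bar>lam\<bar> powr (real CARD('n) / 4)"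
    by (cases "lam = 0") (simp_all add: powr_power)
  then show ?thesis by (simp add: scaled_hermite_def hermite1_def prod.distrib)
qed

lemma hermite_function_continuous [continuous_intros]:
  "continuous_on S f \<Longrightarrow> continuous_on S (\<lambda>x. hermite_function k (f x))"
  unfolding hermite_function_eq by (intro continuous_intros)

lemma hermite1_continuous [continuous_intros]:
  "continuous_on S f \<Longrightarrow> continuous_on S (\<lambda>x. hermite1 lam k (f x))"
  unfolding hermite1_def by (intro continuous_intros)

lemma hermite1_measurable [measurable]: "hermite1 lam k \<in> borel_measurable borel"
  by (intro borel_measurable_continuous_onI continuous_intros)

lemma hermite1_bounded: "\<exists>C\<ge>0. \<forall>u. \<bar>hermite1 lam k u\<bar> \<le> C"
proof -
  obtain C where C: "C \<ge> 0" "\<And>x. \<bar>hermite_function k x\<bar> \<le> C"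
    using gauss_poly_bounded unfolding hermite_function_eq by blast
  have "\<bar>hermite1 lam k u\<bar> \<le> \<bar>lam\<bar> powr (1 / 4) * C" for u
    unfolding hermite1_def abs_mult using C by (intro mult_mono) auto
  moreover have "\<bar>lam\<bar> powr (1 / 4) * C \<ge> 0" using C by simp
  ultimately show ?thesis by blast
qed

lemma hermite1_times: "hermite1 lam j u * hermite1 lam k v
    = sqrt \<bar>lam\<bar> * (hermite_function j (sqrt \<bar>lam\<bar> * u) * hermite_function k (sqrt \<bar>lam\<bar> * v))"
proof -
  have sq: "\<bar>lam\<bar> powr (1 / 4) * \<bar>lam\<bar> powr (1 / 4) = sqrt \<bar>lam\<bar>"
    by (simp add: powr_add[symmetric] powr_half_sqrt)
  have "(a * x) * (a * y) = (a * a) * (x * y)" for a x y :: real by (simp only: mult_ac)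
  then show ?thesis unfolding hermite1_def sq[symmetric] .
qed

lemma integrable_hermite1: "lam \<noteq> 0 \<Longrightarrow> integrable lborel (\<lambda>u. hermite1 lam k (u + a))"
proof -
  assume lam: "lam \<noteq> 0"
  have "integrable lborel (\<lambda>u. hermite_function k (sqrt \<bar>lam\<bar> * a + sqrt \<bar>lam\<bar> * u))"
    unfolding hermite_function_eq using lam by (intro lborel_integrable_real_affine integrable_gauss_poly) auto
  then show ?thesis unfolding hermite1_def by (intro integrable_mult_right) (simp add: distrib_left add.commute)
qed

lemma integrable_hermite1_product:
  assumes "lam \<noteq> 0"
  shows "integrable lborel (\<lambda>u. hermite1 lam j (u + a) * hermite1 lam k (u + b))"
proof -
  obtain C where C: "C \<ge> 0" "\<And>u. \<bar>hermite1 lam j u\<bar> \<le> C" using hermite1_bounded by blast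
  have "integrable lborel (\<lambda>u. C * hermite1 lam k (u + b))" by (intro integrable_mult_right integrable_hermite1 assms)
  then show ?thesis
    by (rule Bochner_Integration.integrable_bound) (use C in \<open>auto simp: abs_mult intro!: mult_right_mono\<close>)
qed

lemma hermite1_orthonormal:
  assumes "lam \<noteq> 0"
  shows "(LINT u|lborel. hermite1 lam j u * hermite1 lam k u) = (if j = k then 1 else 0)"
proof -
  define c where "c = sqrt \<bar>lam\<bar>"
  have c: "c > 0" using assms by (simp add: c_def)
  have "(LINT u|lborel. hermite1 lam j u * hermite1 lam k u) = \<bar>1 / c\<bar> *\<^sub>R (LINT u|lborel. hermite1 lam j (0 + 1 / c * u) * hermite1 lam k (0 + 1 / c * u))"
    using c by (intro lborel_integral_real_affine) auto
  also have "\<dots> = \<bar>1 / c\<bar> *\<^sub>R (LINT u|lborel. c * (hermite_function j u * hermite_function k u))"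
    unfolding hermite1_times c_def[symmetric] using c by simp
  also have "\<dots> = (LINT u|lborel. hermite_function j u * hermite_function k u)" using c by simp
  finally have "complex_of_real (LINT u|lborel. hermite1 lam j u * hermite1 lam k u) = wigner j k 0 0"
    unfolding wigner_def by (simp flip: integral_complex_of_real)
  then show ?thesis unfolding wigner_origin by (metis of_real_1 of_real_0 of_real_eq_iff)
qed

lemma scaled_hermite_L2:
  assumes "lam \<noteq> 0"
  shows "scaled_hermite lam \<alpha> \<in> L2"
proof -
  have m: "scaled_hermite lam \<alpha> \<in> borel_measurable borel"
    unfolding scaled_hermite_eq_prod[abs_def] by measurable
  have "integrable lborel (\<lambda>x. \<Prod>j\<in>UNIV. (\<lambda>u. hermite1 lam (\<alpha> $ j) (u + 0) * hermite1 lam (\<alpha> $ j) (u + 0)) (x $ j))"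
    by (intro integrable_vec_prod integrable_hermite1_product assms)
  moreover have "(cmod (scaled_hermite lam \<alpha> x))\<^sup>2 = (\<Prod>j\<in>UNIV. (\<lambda>u. hermite1 lam (\<alpha> $ j) (u + 0) * hermite1 lam (\<alpha> $ j) (u + 0)) (x $ j))" for x
    by (simp only: scaled_hermite_eq_prod norm_of_real power2_abs power2_eq_square prod.distrib add_0_right abs_mult_self_eq)
  ultimately show ?thesis using m by (simp add: L2_def)
qed

lemma scaled_hermite_orthonormal:
  fixes \<alpha> \<beta> :: "nat ^ 'n::finite"
  assumes "lam \<noteq> 0"
  shows "l2_inner (scaled_hermite lam \<alpha>) (scaled_hermite lam \<beta>) = (if \<alpha> = \<beta> then 1 else 0)"
proof -
  have "l2_inner (scaled_hermite lam \<alpha>) (scaled_hermite lam \<beta>)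
      = of_real (LINT x|lborel. (\<Prod>j\<in>UNIV. (\<lambda>u. hermite1 lam (\<alpha> $ j) (u + 0) * hermite1 lam (\<beta> $ j) (u + 0)) ((x :: real ^ 'n) $ j)))"
    unfolding l2_inner_def scaled_hermite_eq_prod by (simp add: prod.distrib flip: integral_complex_of_real)
  also have "\<dots> = of_real (\<Prod>j\<in>UNIV. (LINT u|lborel. hermite1 lam (\<alpha> $ j) (u + 0) * hermite1 lam (\<beta> $ j) (u + 0)))"
    by (subst integral_vec_prod) (rule integrable_hermite1_product[OF assms], rule refl)
  also have "\<dots> = (if \<alpha> = \<beta> then 1 else 0)"
    by (auto simp: hermite1_orthonormal[OF assms] vec_eq_iff)
  finally show ?thesis .
qed

definition schroedinger1 :: "real \<Rightarrow> nat \<Rightarrow> complex \<Rightarrow> real \<Rightarrow> complex" where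
  "schroedinger1 lam k z \<xi> = iexp (lam * (Re z * \<xi> + Re z * Im z / 2)) * of_real (hermite1 lam k (\<xi> + Im z))"

lemma cmod_schroedinger1: "cmod (schroedinger1 lam k z \<xi>) = \<bar>hermite1 lam k (\<xi> + Im z)\<bar>"
  by (simp add: schroedinger1_def norm_mult)

lemma schroedinger_scaled_hermite:
  fixes z :: "complex ^ 'n::finite"
  shows "schroedinger lam (z, 0) (scaled_hermite lam \<alpha>) \<xi> = (\<Prod>j\<in>UNIV. schroedinger1 lam (\<alpha> $ j) (z $ j) (\<xi> $ j))"
proof -
  have "lam * (re_vec z \<bullet> \<xi> + re_vec z \<bullet> im_vec z / 2) = (\<Sum>j\<in>UNIV. lam * (Re (z $ j) * \<xi> $ j + Re (z $ j) * Im (z $ j) / 2))"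
    by (simp add: inner_vec_def re_vec_def im_vec_def sum_distrib_left sum.distrib sum_divide_distrib distrib_left)
  then have "iexp (lam * (re_vec z \<bullet> \<xi> + re_vec z \<bullet> im_vec z / 2)) = (\<Prod>j\<in>UNIV. iexp (lam * (Re (z $ j) * \<xi> $ j + Re (z $ j) * Im (z $ j) / 2)))"
    by (simp only: of_real_sum sum_distrib_left exp_sum[OF finite_class.finite_UNIV])
  then show ?thesis
    by (simp add: schroedinger_def schroedinger1_def scaled_hermite_eq_prod prod.distrib im_vec_def del: of_real_mult of_real_add)
qed

definition matrix_coeff1 :: "real \<Rightarrow> nat \<Rightarrow> complex \<Rightarrow> complex \<Rightarrow> complex" where
  "matrix_coeff1 lam k z w = (LINT \<xi>|lborel. schroedinger1 lam k z \<xi> * cnj (schroedinger1 lam k w \<xi>))"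

lemma integrable_schroedinger1_product:
  assumes "lam \<noteq> 0"
  shows "integrable lborel (\<lambda>\<xi>. schroedinger1 lam k z \<xi> * cnj (schroedinger1 lam k w \<xi>))"
proof (rule Bochner_Integration.integrable_bound[OF integrable_hermite1_product[OF assms, of k "Im z" k "Im w"]])
  show "(\<lambda>\<xi>. schroedinger1 lam k z \<xi> * cnj (schroedinger1 lam k w \<xi>)) \<in> borel_measurable lborel"
    unfolding schroedinger1_def by (auto intro!: borel_measurable_continuous_onI continuous_intros)
qed (simp add: norm_mult cmod_schroedinger1 abs_mult)

lemma iexp_times_cnj: "(iexp a * of_real p) * cnj (iexp b * of_real q) = iexp (a - b) * of_real (p * q)"
proof -
  have "iexp (a - b) = iexp a * cnj (iexp b)" by (simp add: exp_cnj exp_add[symmetric] right_diff_distrib)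
  then show ?thesis by (simp only: complex_cnj_mult complex_cnj_complex_of_real of_real_mult mult_ac)
qed

text \<open>
  Centering the variable at the midpoint of \<open>- Im z\<close> and \<open>- Im w\<close> separates the symplectic phase from
  a function of \<open>z - w\<close>.
\<close>

lemma matrix_coeff1_eq_wigner:
  assumes "lam \<noteq> 0"
  shows "matrix_coeff1 lam k z w = iexp (lam / 2 * (Re w * Im z - Re z * Im w))
    * wigner k k (sgn lam * sqrt \<bar>lam\<bar> * (Re z - Re w)) (sqrt \<bar>lam\<bar> * (Im z - Im w))"
proof -
  define c where "c = sqrt \<bar>lam\<bar>"
  have c: "c > 0" and cc: "c * c = \<bar>lam\<bar>" using assms by (simp_all add: c_def)
  have "lam = sgn lam * c * c" using cc sgn_mult_abs[of lam] by (simp add: mult.assoc)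
  then have lc: "lam / c = sgn lam * c" using c by (metis nonzero_mult_div_cancel_right less_irrefl)
  define t where "t = - (Im z + Im w) / 2"
  define P where "P = iexp (lam / 2 * (Re w * Im z - Re z * Im w))"
  have eq: "schroedinger1 lam k z (t + 1 / c * \<eta>) * cnj (schroedinger1 lam k w (t + 1 / c * \<eta>))
      = of_real c * (P * (iexp (sgn lam * c * (Re z - Re w) * \<eta>)
        * of_real (hermite_function k (\<eta> + c * (Im z - Im w) / 2) * hermite_function k (\<eta> - c * (Im z - Im w) / 2))))" for \<eta>
  proof -
    define \<xi> where "\<xi> = t + 1 / c * \<eta>"
    have "lam * \<xi> = lam / c * \<eta> + lam * t" by (simp add: \<xi>_def distrib_left)
    then have xi: "lam * \<xi> = sgn lam * c * \<eta> + lam * t" unfolding lc .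
    have "lam * (Re z * \<xi> + Re z * Im z / 2) - lam * (Re w * \<xi> + Re w * Im w / 2)
        = (Re z - Re w) * (lam * \<xi>) + lam / 2 * (Re z * Im z - Re w * Im w)" by (simp add: algebra_simps)
    then have phase: "lam * (Re z * \<xi> + Re z * Im z / 2) - lam * (Re w * \<xi> + Re w * Im w / 2)
        = lam / 2 * (Re w * Im z - Re z * Im w) + sgn lam * c * (Re z - Re w) * \<eta>"
      unfolding xi t_def by (simp add: algebra_simps diff_divide_distrib add_divide_distrib)
    have split: "iexp (x + y) = iexp x * iexp y" for x y by (simp add: exp_add distrib_left)
    have arg: "c * (\<xi> + Im z) = \<eta> + c * (Im z - Im w) / 2" "c * (\<xi> + Im w) = \<eta> - c * (Im z - Im w) / 2"
      using c by (simp_all add: \<xi>_def t_def field_simps)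
    have "schroedinger1 lam k z \<xi> * cnj (schroedinger1 lam k w \<xi>)
        = iexp (lam * (Re z * \<xi> + Re z * Im z / 2) - lam * (Re w * \<xi> + Re w * Im w / 2))
          * of_real (hermite1 lam k (\<xi> + Im z) * hermite1 lam k (\<xi> + Im w))"
      unfolding schroedinger1_def by (rule iexp_times_cnj)
    also have "\<dots> = (P * iexp (sgn lam * c * (Re z - Re w) * \<eta>))
          * of_real (c * (hermite_function k (\<eta> + c * (Im z - Im w) / 2) * hermite_function k (\<eta> - c * (Im z - Im w) / 2)))"
      unfolding phase split hermite1_times c_def[symmetric] arg P_def ..
    finally show ?thesis unfolding \<xi>_def by (simp only: of_real_mult mult_ac)
  qed
  have affine: "matrix_coeff1 lam k z w = \<bar>1 / c\<bar> *\<^sub>R (LINT \<eta>|lborel. schroedinger1 lam k z (t + 1 / c * \<eta>) * cnj (schroedinger1 lam k w (t + 1 / c * \<eta>)))"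
    unfolding matrix_coeff1_def using c by (intro lborel_integral_real_affine) simp
  have "matrix_coeff1 lam k z w = \<bar>1 / c\<bar> *\<^sub>R (LINT \<eta>|lborel. of_real c * (P * (iexp (sgn lam * c * (Re z - Re w) * \<eta>)
        * of_real (hermite_function k (\<eta> + c * (Im z - Im w) / 2) * hermite_function k (\<eta> - c * (Im z - Im w) / 2)))))"
    unfolding affine eq ..
  also have "\<dots> = \<bar>1 / c\<bar> *\<^sub>R (of_real c * (P * wigner k k (sgn lam * c * (Re z - Re w)) (c * (Im z - Im w))))"
    unfolding wigner_def integral_mult_right_zero ..
  also have "\<dots> = P * wigner k k (sgn lam * c * (Re z - Re w)) (c * (Im z - Im w))"
    using c by (simp add: scaleR_conv_of_real)
  finally show ?thesis unfolding P_def c_def .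
qed

definition heat_kernel1 :: "real \<Rightarrow> real \<Rightarrow> complex \<Rightarrow> complex \<Rightarrow> complex" where
  "heat_kernel1 lam r z w = iexp (lam / 2 * (Re w * Im z - Re z * Im w))
    * of_real (exp (- (\<bar>lam\<bar> * (1 + r) / (4 * (1 - r)) * (cmod (z - w))\<^sup>2)) / (1 - r))"

lemma
  assumes lam: "lam \<noteq> 0" and r: "0 \<le> r" "r < 1"
  shows integrable_matrix_coeff1: "integrable (count_space UNIV) (\<lambda>k. of_real (r ^ k) * matrix_coeff1 lam k z w)"
    and integral_matrix_coeff1: "(LINT k|count_space UNIV. of_real (r ^ k) * matrix_coeff1 lam k z w) = heat_kernel1 lam r z w"
proof -
  define c where "c = sqrt \<bar>lam\<bar>"
  define P where "P = iexp (lam / 2 * (Re w * Im z - Re z * Im w))"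
  define x where "x = sgn lam * c * (Re z - Re w)"
  define y where "y = c * (Im z - Im w)"
  have eq: "of_real (r ^ k) * matrix_coeff1 lam k z w = P * (of_real (r ^ k) * wigner k k x y)" for k
    unfolding matrix_coeff1_eq_wigner[OF lam] P_def x_def y_def c_def by (simp only: mult_ac)
  show "integrable (count_space UNIV) (\<lambda>k. of_real (r ^ k) * matrix_coeff1 lam k z w)"
    unfolding eq by (intro integrable_mult_right integrable_wigner_diagonal r)
  have "x\<^sup>2 + y\<^sup>2 = \<bar>lam\<bar> * (cmod (z - w))\<^sup>2"
    using lam by (simp add: x_def y_def c_def power_mult_distrib cmod_power2 distrib_left sgn_if)
  then have "(1 + r) / (4 * (1 - r)) * (x\<^sup>2 + y\<^sup>2) = \<bar>lam\<bar> * (1 + r) / (4 * (1 - r)) * (cmod (z - w))\<^sup>2"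
    by (simp add: mult_ac)
  then show "(LINT k|count_space UNIV. of_real (r ^ k) * matrix_coeff1 lam k z w) = heat_kernel1 lam r z w"
    unfolding eq integral_mult_right_zero integral_wigner_diagonal[OF r] heat_kernel1_def P_def by (simp only:)
qed

text \<open>
  A product over the coordinates; it equals the inner product of \<open>\<pi>(z, 0) \<Phi>\<^sub>\<alpha>\<close> and \<open>\<pi>(w, 0) \<Phi>\<^sub>\<alpha>\<close>
  by \<open>integral_schroedinger_product\<close> when \<open>\<lambda> \<noteq> 0\<close>.
\<close>

definition matrix_coeff :: "real \<Rightarrow> nat ^ 'n::finite \<Rightarrow> complex ^ 'n \<Rightarrow> complex ^ 'n \<Rightarrow> complex" where
  "matrix_coeff lam \<alpha> z w = (\<Prod>j\<in>UNIV. matrix_coeff1 lam (\<alpha> $ j) (z $ j) (w $ j))"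

definition heat_kernel :: "real \<Rightarrow> real \<Rightarrow> complex ^ 'n::finite \<Rightarrow> complex ^ 'n \<Rightarrow> complex" where
  "heat_kernel lam r z w = (\<Prod>j\<in>UNIV. heat_kernel1 lam r (z $ j) (w $ j))"

lemma integral_schroedinger_product:
  fixes z w :: "complex ^ 'n::finite"
  assumes "lam \<noteq> 0"
  shows "(LINT \<xi>|lborel. schroedinger lam (z, 0) (scaled_hermite lam \<alpha>) \<xi> * cnj (schroedinger lam (w, 0) (scaled_hermite lam \<alpha>) \<xi>))
    = matrix_coeff lam \<alpha> z w"
proof -
  have "(LINT \<xi>|lborel. schroedinger lam (z, 0) (scaled_hermite lam \<alpha>) \<xi> * cnj (schroedinger lam (w, 0) (scaled_hermite lam \<alpha>) \<xi>))
    = (LINT \<xi>|lborel. (\<Prod>j\<in>UNIV. (\<lambda>u. schroedinger1 lam (\<alpha> $ j) (z $ j) u * cnj (schroedinger1 lam (\<alpha> $ j) (w $ j) u)) ((\<xi> :: real ^ 'n) $ j)))"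
    by (simp only: schroedinger_scaled_hermite cnj_prod prod.distrib)
  also have "\<dots> = matrix_coeff lam \<alpha> z w"
    unfolding matrix_coeff_def matrix_coeff1_def
    by (rule integral_vec_prod) (rule integrable_schroedinger1_product[OF assms])
  finally show ?thesis .
qed

lemma integral_matrix_coeff:
  fixes z w :: "complex ^ 'n::finite"
  assumes lam: "lam \<noteq> 0" and r: "0 \<le> r" "r < 1"
  shows "(LINT \<alpha>|count_space UNIV. of_real (r ^ (\<Sum>j\<in>UNIV. \<alpha> $ j)) * matrix_coeff lam \<alpha> z w) = heat_kernel lam r z w"
proof -
  have eq: "of_real (r ^ (\<Sum>j\<in>UNIV. \<alpha> $ j)) * matrix_coeff lam \<alpha> z w
      = (\<Prod>j\<in>UNIV. (\<lambda>k. of_real (r ^ k) * matrix_coeff1 lam k (z $ j) (w $ j)) (\<alpha> $ j))" for \<alpha>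
    by (simp add: matrix_coeff_def prod.distrib power_sum)
  show "(LINT \<alpha>|count_space UNIV. of_real (r ^ (\<Sum>j\<in>UNIV. \<alpha> $ j)) * matrix_coeff lam \<alpha> z w) = heat_kernel lam r z w"
  proof -
    have "(LINT \<alpha>|count_space UNIV. (\<Prod>j\<in>UNIV. (\<lambda>k. of_real (r ^ k) * matrix_coeff1 lam k (z $ j) (w $ j)) ((\<alpha> :: nat ^ 'n) $ j)))
        = (\<Prod>j\<in>UNIV. (LINT k|count_space UNIV. of_real (r ^ k) * matrix_coeff1 lam k (z $ j) (w $ j)))"
      by (rule integral_multiindex_prod) (rule integrable_matrix_coeff1[OF lam r])
    then show ?thesis unfolding eq integral_matrix_coeff1[OF lam r] heat_kernel_def .
  qed
qed

text \<open>
  Only the Gaussian factor survives in absolute value; its exponent blows up as \<open>r\<close> tends to \<open>1\<close>.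
\<close>

lemma cmod_heat_kernel:
  fixes z w :: "complex ^ 'n::finite"
  assumes "r < 1"
  shows "cmod (heat_kernel lam r z w) = exp (- (\<bar>lam\<bar> * (1 + r) / (4 * (1 - r)) * (norm (z - w))\<^sup>2)) / (1 - r) ^ CARD('n)"
proof -
  have n: "(norm (z - w))\<^sup>2 = (\<Sum>j\<in>UNIV. (cmod (z $ j - w $ j))\<^sup>2)"
    by (simp add: norm_vec_def L2_set_def sum_nonneg)
  have one: "cmod (heat_kernel1 lam r a b) = exp (- (\<bar>lam\<bar> * (1 + r) / (4 * (1 - r)) * (cmod (a - b))\<^sup>2)) / (1 - r)" for a b
    unfolding heat_kernel1_def norm_mult norm_exp_i_times norm_of_real using assms by simp
  have "cmod (heat_kernel lam r z w) = (\<Prod>j\<in>UNIV. exp (- (\<bar>lam\<bar> * (1 + r) / (4 * (1 - r)) * (cmod (z $ j - w $ j))\<^sup>2)) / (1 - r))"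
    unfolding heat_kernel_def prod_norm[symmetric] one ..
  then show ?thesis unfolding n by (simp add: prod_dividef exp_sum sum_distrib_left sum_negf[symmetric])
qed

section \<open>The Weyl transform and its decay on Hermite functions\<close>

lemma re_vec_continuous [continuous_intros]: "continuous_on S f \<Longrightarrow> continuous_on S (\<lambda>x. re_vec (f x))"
  unfolding re_vec_def by (intro continuous_intros)

lemma im_vec_continuous [continuous_intros]: "continuous_on S f \<Longrightarrow> continuous_on S (\<lambda>x. im_vec (f x))"
  unfolding im_vec_def by (intro continuous_intros)

lemma re_vec_measurable [measurable]: "re_vec \<in> borel_measurable borel"
  and im_vec_measurable [measurable]: "im_vec \<in> borel_measurable borel"
  by (intro borel_measurable_continuous_onI continuous_intros)+

lemma scaled_hermite_continuous [continuous_intros]: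
  "continuous_on S f \<Longrightarrow> continuous_on S (\<lambda>x. scaled_hermite lam \<alpha> (f x))"
  unfolding scaled_hermite_eq_prod by (intro continuous_intros)

lemma schroedinger_measurable [measurable (raw)]:
  fixes g :: "'x \<Rightarrow> 'n::finite heis" and \<xi> :: "'x \<Rightarrow> real ^ 'n"
  assumes [measurable]: "\<phi> \<in> borel_measurable borel" "g \<in> borel_measurable M" "\<xi> \<in> borel_measurable M"
  shows "(\<lambda>x. schroedinger lam (g x) \<phi> (\<xi> x)) \<in> borel_measurable M"
proof -
  have [measurable]: "(\<lambda>x. fst (g x)) \<in> borel_measurable M" "(\<lambda>x. snd (g x)) \<in> borel_measurable M"
    using assms(2) by (simp_all add: borel_prod[symmetric])
  show ?thesis unfolding schroedinger_def case_prod_beta by measurable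
qed

lemma cmod_schroedinger: "cmod (schroedinger lam (z, t) \<phi> \<xi>) = cmod (\<phi> (\<xi> + im_vec z))"
  by (simp add: schroedinger_def norm_mult)

lemma schroedinger_split: "schroedinger lam (z, t) \<phi> \<xi> = iexp (lam * t) * schroedinger lam (z, 0) \<phi> \<xi>"
  by (simp add: schroedinger_def mult.assoc)

text \<open>
  The representation integrated over the quotient by the center, with respect to a function on
  \<open>\<complex>\<^sup>n\<close>.
\<close>

definition weyl :: "real \<Rightarrow> (complex ^ 'n::finite \<Rightarrow> complex) \<Rightarrow> (real ^ 'n) l2_op" where
  "weyl lam F \<phi> \<xi> = (LINT z|lborel. F z * schroedinger lam (z, 0) \<phi> \<xi>)"

lemma group_fourier_L2:
  fixes f :: "'n::finite heis \<Rightarrow> complex"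
  assumes f: "integrable lborel f" and \<phi>: "\<phi> \<in> L2"
  shows "group_fourier f lam \<phi> \<in> L2"
proof -
  have [measurable]: "f \<in> borel_measurable borel" "\<phi> \<in> borel_measurable borel"
    using borel_measurable_integrable[OF f] \<phi> by (simp_all add: L2_def)
  have 1: "(\<lambda>(\<xi>, g). f g * schroedinger lam g \<phi> \<xi>) \<in> borel_measurable (borel \<Otimes>\<^sub>M lborel)"
    by measurable
  have 2: "(\<lambda>g::'n heis. im_vec (fst g)) \<in> borel_measurable lborel"
  proof -
    have "continuous_on UNIV (\<lambda>g::'n heis. im_vec (fst g))" by (intro continuous_intros)
    then show ?thesis by (simp add: borel_measurable_continuous_onI)
  qed
  have 3: "cmod (f g * schroedinger lam g \<phi> \<xi>) \<le> cmod (f g) * cmod (\<phi> (\<xi> + im_vec (fst g)))" for g \<xi>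
    by (cases g) (simp add: norm_mult cmod_schroedinger)
  note * = sigma_finite_lborel 1 integrable_norm[OF f] norm_ge_zero 2 \<phi> 3
  show "group_fourier f lam \<phi> \<in> L2" unfolding group_fourier_def[abs_def] by (rule L2_averaged_translates[OF *])
qed

lemma weyl_L2:
  fixes F :: "complex ^ 'n::finite \<Rightarrow> complex"
  assumes F: "integrable lborel F" and \<phi>: "\<phi> \<in> L2"
  shows "weyl lam F \<phi> \<in> L2"
proof -
  have [measurable]: "F \<in> borel_measurable borel" "\<phi> \<in> borel_measurable borel"
    using borel_measurable_integrable[OF F] \<phi> by (simp_all add: L2_def)
  have 1: "(\<lambda>(\<xi>, z). F z * schroedinger lam (z, 0) \<phi> \<xi>) \<in> borel_measurable (borel \<Otimes>\<^sub>M lborel)"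
    by measurable
  have 2: "im_vec \<in> borel_measurable lborel" by simp
  have 3: "cmod (F z * schroedinger lam (z, 0) \<phi> \<xi>) \<le> cmod (F z) * cmod (\<phi> (\<xi> + im_vec z))" for z \<xi>
    by (simp add: norm_mult cmod_schroedinger)
  note * = sigma_finite_lborel 1 integrable_norm[OF F] norm_ge_zero 2 \<phi> 3
  show "weyl lam F \<phi> \<in> L2" unfolding weyl_def[abs_def] by (rule L2_averaged_translates[OF *])
qed

text \<open>
  Integrating out the central variable first.  Boundedness of \<open>\<phi>\<close> makes the identity hold at every
  point, since Fubini's theorem then applies for each \<open>\<xi>\<close>.
\<close>

lemma
  fixes f :: "'n::finite heis \<Rightarrow> complex"
  assumes f: "integrable lborel f"
  shows integrable_central_fourier: "integrable lborel (central_fourier f lam)"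
    and group_fourier_eq_weyl: "\<phi> \<in> borel_measurable borel \<Longrightarrow> (\<And>\<xi>. cmod (\<phi> \<xi>) \<le> C) \<Longrightarrow>
      group_fourier f lam \<phi> = weyl lam (central_fourier f lam) \<phi>"
proof -
  have [measurable]: "f \<in> borel_measurable borel" using borel_measurable_integrable[OF f] by simp
  have e: "integrable lborel (\<lambda>g. iexp (lam * snd g) * f g)"
    using f by (intro integrable_unimodular_times) (auto intro!: borel_measurable_continuous_onI continuous_intros)
  then have e': "integrable (lborel \<Otimes>\<^sub>M lborel) (\<lambda>(z, t). iexp (lam * t) * f (z, t))"
    unfolding lborel_prod by (simp add: case_prod_unfold)
  show "integrable lborel (central_fourier f lam)"
    unfolding central_fourier_def[abs_def] using lborel_pair.integrable_fst[OF e'] by simp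
  assume \<phi> [measurable]: "\<phi> \<in> borel_measurable borel" and C: "\<And>\<xi>. cmod (\<phi> \<xi>) \<le> C"
  show "group_fourier f lam \<phi> = weyl lam (central_fourier f lam) \<phi>"
  proof
    fix \<xi>
    have "integrable lborel (\<lambda>g. C * cmod (f g))" using f by simp
    then have i: "integrable lborel (\<lambda>g. f g * schroedinger lam g \<phi> \<xi>)"
    proof (rule Bochner_Integration.integrable_bound)
      show "AE g in lborel. norm (f g * schroedinger lam g \<phi> \<xi>) \<le> norm (C * cmod (f g))"
      proof (intro AE_I2)
        fix g :: "'n heis"
        obtain z t where g: "g = (z, t)" by (cases g)
        have "cmod (f g) * cmod (\<phi> (\<xi> + im_vec z)) \<le> cmod (f g) * C" by (intro mult_left_mono C) simp
        moreover have "0 \<le> C" using C norm_ge_zero order_trans by blast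
        ultimately show "norm (f g * schroedinger lam g \<phi> \<xi>) \<le> norm (C * cmod (f g))"
          by (simp add: g norm_mult cmod_schroedinger abs_mult mult.commute)
      qed
    qed measurable
    then have i': "integrable (lborel \<Otimes>\<^sub>M lborel) (\<lambda>(z, t). f (z, t) * schroedinger lam (z, t) \<phi> \<xi>)"
      unfolding lborel_prod by (simp add: case_prod_unfold)
    have "group_fourier f lam \<phi> \<xi> = (LINT g|(lborel \<Otimes>\<^sub>M lborel). f g * schroedinger lam g \<phi> \<xi>)"
      unfolding group_fourier_def lborel_prod ..
    also have "\<dots> = (LINT z|lborel. (LINT t|lborel. f (z, t) * schroedinger lam (z, t) \<phi> \<xi>))"
      using lborel_pair.integral_fst[OF i'] by (simp add: case_prod_unfold)
    also have "\<dots> = (LINT z|lborel. (LINT t|lborel. iexp (lam * t) * f (z, t) * schroedinger lam (z, 0) \<phi> \<xi>))"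
      by (intro Bochner_Integration.integral_cong refl) (subst schroedinger_split, simp only: mult_ac)
    also have "\<dots> = weyl lam (central_fourier f lam) \<phi> \<xi>"
      unfolding weyl_def central_fourier_def integral_mult_left_zero ..
    finally show "group_fourier f lam \<phi> \<xi> = weyl lam (central_fourier f lam) \<phi> \<xi>" .
  qed
qed

lemma L2_translate:
  fixes \<phi> :: "'a::euclidean_space \<Rightarrow> complex"
  assumes \<phi>: "\<phi> \<in> L2"
  shows "(\<lambda>x. \<phi> (x + a)) \<in> L2" and "l2_norm (\<lambda>x. \<phi> (x + a)) = l2_norm \<phi>"
proof -
  have [measurable]: "\<phi> \<in> borel_measurable borel" using \<phi> by (simp add: L2_def)
  have eq: "(\<integral>\<^sup>+ x. ennreal ((cmod (\<phi> (x + a)))\<^sup>2) \<partial>lborel) = ennreal ((l2_norm \<phi>)\<^sup>2)"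
    unfolding L2_nn_integral[OF \<phi>, symmetric] by (rule nn_integral_translate) measurable
  have "integrable lborel (\<lambda>x. (cmod (\<phi> (x + a)))\<^sup>2)"
    using eq by (intro integrableI_bounded) simp_all
  then show L2: "(\<lambda>x. \<phi> (x + a)) \<in> L2" by (simp add: L2_def)
  have "(l2_norm (\<lambda>x. \<phi> (x + a)))\<^sup>2 = (l2_norm \<phi>)\<^sup>2"
    using eq unfolding L2_nn_integral[OF L2] by simp
  then show "l2_norm (\<lambda>x. \<phi> (x + a)) = l2_norm \<phi>" by (simp add: power2_eq_iff_nonneg l2_norm_nonneg)
qed

lemma schroedinger_L2:
  assumes "\<phi> \<in> L2"
  shows "schroedinger lam g \<phi> \<in> L2" "l2_norm (schroedinger lam g \<phi>) = l2_norm \<phi>"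
proof -
  obtain z t where g: "g = (z, t)" by (cases g)
  have [measurable]: "\<phi> \<in> borel_measurable borel" using assms by (simp add: L2_def)
  have m: "schroedinger lam g \<phi> \<in> borel_measurable borel" by measurable
  show "schroedinger lam g \<phi> \<in> L2"
    using L2_translate(1)[OF assms, of "im_vec z"] m by (simp add: L2_def g cmod_schroedinger)
  show "l2_norm (schroedinger lam g \<phi>) = l2_norm \<phi>"
    using L2_translate(2)[OF assms, of "im_vec z"] by (simp add: l2_norm_def g cmod_schroedinger)
qed

lemma integral_translate:
  fixes f :: "'a::euclidean_space \<Rightarrow> complex"
  assumes [measurable]: "f \<in> borel_measurable borel"
  shows "(LINT x|lborel. f (x + a)) = (LINT x|lborel. f x)"
proof -
  have "(LINT x|lborel. f x) = (LINT x|distr lborel borel ((+) a). f x)" by (simp only: lborel_distr_plus)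
  also have "\<dots> = (LINT x|lborel. f (a + x))" by (rule integral_distr) auto
  finally show ?thesis by (simp add: add.commute)
qed

lemma l2_inner_schroedinger:
  fixes z :: "complex ^ 'n::finite"
  assumes [measurable]: "\<phi> \<in> borel_measurable borel" "\<psi> \<in> borel_measurable borel"
  shows "l2_inner (schroedinger lam (z, t) \<phi>) \<psi> = l2_inner \<phi> (schroedinger lam (- z, - t) \<psi>)"
proof -
  have neg: "re_vec (- z) = - re_vec z" "im_vec (- z) = - im_vec z" by (simp_all add: re_vec_def im_vec_def vec_eq_iff)
  have "l2_inner \<phi> (schroedinger lam (- z, - t) \<psi>)
      = (LINT \<xi>|lborel. \<phi> (\<xi> + im_vec z) * cnj (schroedinger lam (- z, - t) \<psi> (\<xi> + im_vec z)))"
    unfolding l2_inner_def by (rule integral_translate[symmetric]) measurable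
  also have "\<dots> = l2_inner (schroedinger lam (z, t) \<phi>) \<psi>"
    unfolding l2_inner_def
  proof (intro Bochner_Integration.integral_cong refl)
    fix \<xi>
    have "cnj (schroedinger lam (- z, - t) \<psi> (\<xi> + im_vec z))
        = iexp (lam * t) * iexp (lam * (re_vec z \<bullet> (\<xi> + im_vec z) - re_vec z \<bullet> im_vec z / 2)) * cnj (\<psi> \<xi>)"
      by (simp add: schroedinger_def neg exp_cnj algebra_simps)
    also have "lam * (re_vec z \<bullet> (\<xi> + im_vec z) - re_vec z \<bullet> im_vec z / 2) = lam * (re_vec z \<bullet> \<xi> + re_vec z \<bullet> im_vec z / 2)"
      by (simp add: inner_add_right)
    finally show "\<phi> (\<xi> + im_vec z) * cnj (schroedinger lam (- z, - t) \<psi> (\<xi> + im_vec z)) = schroedinger lam (z, t) \<phi> \<xi> * cnj (\<psi> \<xi>)"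
      by (simp only: schroedinger_def prod.case mult_ac)
  qed
  finally show ?thesis by simp
qed

lemma l2_inner_group_fourier:
  fixes f :: "'n::finite heis \<Rightarrow> complex"
  assumes f: "integrable lborel f" and \<phi>: "\<phi> \<in> L2" and \<psi>: "\<psi> \<in> L2"
  shows "l2_inner (group_fourier f lam \<phi>) \<psi> = (LINT g|lborel. f g * l2_inner (schroedinger lam g \<phi>) \<psi>)"
proof -
  have [measurable]: "f \<in> borel_measurable borel" "\<phi> \<in> borel_measurable borel" "\<psi> \<in> borel_measurable borel"
    using borel_measurable_integrable[OF f] \<phi> \<psi> by (simp_all add: L2_def)
  define k where "k g \<xi> = f g * schroedinger lam g \<phi> \<xi> * cnj (\<psi> \<xi>)" for g \<xi>
  have k_meas [measurable]: "(\<lambda>(g, \<xi>). k g \<xi>) \<in> borel_measurable (lborel \<Otimes>\<^sub>M lborel)"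
    unfolding k_def by measurable
  have norm_k: "cmod (k g \<xi>) = cmod (f g) * (cmod (schroedinger lam g \<phi> \<xi>) * cmod (\<psi> \<xi>))" for g \<xi>
    by (simp add: k_def norm_mult)
  have k_int: "integrable lborel (\<lambda>\<xi>. k g \<xi>)" for g
    unfolding k_def mult.assoc by (intro integrable_mult_right integrable_L2_product schroedinger_L2 \<phi> \<psi>)
  have int: "integrable (lborel \<Otimes>\<^sub>M lborel) (\<lambda>(g, \<xi>). k g \<xi>)"
  proof (rule lborel_pair.Fubini_integrable[OF k_meas])
    show "integrable lborel (\<lambda>g. LINT \<xi>|lborel. norm (case (g, \<xi>) of (g, \<xi>) \<Rightarrow> k g \<xi>))"
    proof (rule Bochner_Integration.integrable_bound)
      show "integrable lborel (\<lambda>g. cmod (f g) * (l2_norm \<phi> * l2_norm \<psi>))" using f by simp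
      show "AE g in lborel. norm (LINT \<xi>|lborel. norm (case (g, \<xi>) of (g, \<xi>) \<Rightarrow> k g \<xi>)) \<le> norm (cmod (f g) * (l2_norm \<phi> * l2_norm \<psi>))"
      proof (intro AE_I2)
        fix g
        have "(LINT \<xi>|lborel. cmod (k g \<xi>)) = cmod (f g) * (LINT \<xi>|lborel. cmod (schroedinger lam g \<phi> \<xi>) * cmod (\<psi> \<xi>))"
          unfolding norm_k by (rule integral_mult_right_zero)
        also have "\<dots> \<le> cmod (f g) * (l2_norm \<phi> * l2_norm \<psi>)"
          using l2_Cauchy_Schwarz[OF schroedinger_L2(1)[OF \<phi>] \<psi>, of lam g] schroedinger_L2(2)[OF \<phi>, of lam g]
          by (intro mult_left_mono) simp_all
        finally show "norm (LINT \<xi>|lborel. norm (case (g, \<xi>) of (g, \<xi>) \<Rightarrow> k g \<xi>)) \<le> norm (cmod (f g) * (l2_norm \<phi> * l2_norm \<psi>))"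
          by (simp add: l2_norm_nonneg)
      qed
    qed measurable
    show "AE g in lborel. integrable lborel (\<lambda>\<xi>. case (g, \<xi>) of (g, \<xi>) \<Rightarrow> k g \<xi>)" using k_int by simp
  qed
  have "l2_inner (group_fourier f lam \<phi>) \<psi> = (LINT \<xi>|lborel. (LINT g|lborel. k g \<xi>))"
    unfolding l2_inner_def group_fourier_def k_def integral_mult_left_zero ..
  also have "\<dots> = (LINT g|lborel. (LINT \<xi>|lborel. k g \<xi>))"
    by (rule lborel_pair.Fubini_integral[OF int])
  also have "\<dots> = (LINT g|lborel. f g * l2_inner (schroedinger lam g \<phi>) \<psi>)"
    unfolding l2_inner_def k_def mult.assoc integral_mult_right_zero ..
  finally show ?thesis .
qed

lemma l2_inner_commute: "l2_inner \<phi> \<psi> = cnj (l2_inner \<psi> \<phi>)"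
  unfolding l2_inner_def integral_cnj[symmetric] by (simp add: mult.commute)

text \<open>
  The representation is unitary and the inverse of \<open>g\<close> in the Heisenberg group is \<open>- g\<close>; so the
  adjoint of the Fourier transform of \<open>f\<close> is that of \<open>g \<mapsto> cnj (f (- g))\<close>.
\<close>

lemma group_fourier_adjoint_exists:
  fixes f :: "'n::finite heis \<Rightarrow> complex"
  assumes f: "integrable lborel f"
  defines "f' \<equiv> \<lambda>g. cnj (f (- g))"
  shows "integrable lborel f'"
    and "\<phi> \<in> L2 \<Longrightarrow> \<psi> \<in> L2 \<Longrightarrow> l2_inner (group_fourier f lam \<phi>) \<psi> = l2_inner \<phi> (group_fourier f' lam \<psi>)"
proof -
  have [measurable]: "f \<in> borel_measurable borel" using borel_measurable_integrable[OF f] by simp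
  have nz: "- 1 \<noteq> (0 :: real)" by simp
  have refl: "distr lborel borel uminus = (lborel :: 'n heis measure)"
    using lborel_affine[OF nz, of "0 :: 'n heis"]
    unfolding add_0 scaleR_minus1_left abs_minus_cancel abs_one power_one ennreal_1 density_1 by (rule sym)
  have "integrable (distr lborel borel uminus) f" unfolding refl by (rule f)
  then have "integrable lborel (\<lambda>g. f (- g))" by (subst (asm) integrable_distr_eq) auto
  then show f': "integrable lborel f'" unfolding f'_def by simp
  assume \<phi>: "\<phi> \<in> L2" and \<psi>: "\<psi> \<in> L2"
  have [measurable]: "\<phi> \<in> borel_measurable borel" "\<psi> \<in> borel_measurable borel" using \<phi> \<psi> by (simp_all add: L2_def)
  have m: "(\<lambda>g. f g * l2_inner (schroedinger lam g \<phi>) \<psi>) \<in> borel_measurable borel"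
  proof -
    have "(\<lambda>(g, \<xi>). schroedinger lam g \<phi> \<xi> * cnj (\<psi> \<xi>)) \<in> borel_measurable (borel \<Otimes>\<^sub>M lborel)" by measurable
    then have "(\<lambda>g. l2_inner (schroedinger lam g \<phi>) \<psi>) \<in> borel_measurable borel"
      unfolding l2_inner_def by (rule lborel.borel_measurable_lebesgue_integral)
    then show ?thesis by measurable
  qed
  have inv: "l2_inner (schroedinger lam (- g) \<phi>) \<psi> = cnj (l2_inner (schroedinger lam g \<psi>) \<phi>)" for g
  proof -
    obtain z t where g: "g = (z, t)" by (cases g)
    have "l2_inner (schroedinger lam (- z, - t) \<phi>) \<psi> = l2_inner \<phi> (schroedinger lam (- (- z), - (- t)) \<psi>)"
      by (rule l2_inner_schroedinger) auto
    then show ?thesis unfolding g by (subst l2_inner_commute) (simp add: l2_inner_commute[of \<phi>])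
  qed
  have "l2_inner (group_fourier f lam \<phi>) \<psi> = (LINT g|distr lborel borel uminus. f g * l2_inner (schroedinger lam g \<phi>) \<psi>)"
    unfolding refl by (rule l2_inner_group_fourier[OF f \<phi> \<psi>])
  also have "\<dots> = (LINT g|lborel. f (- g) * l2_inner (schroedinger lam (- g) \<phi>) \<psi>)"
    using m by (intro integral_distr) auto
  also have "\<dots> = (LINT g|lborel. cnj (f' g * l2_inner (schroedinger lam g \<psi>) \<phi>))"
    unfolding inv f'_def by simp
  also have "\<dots> = cnj (l2_inner (group_fourier f' lam \<psi>) \<phi>)"
    unfolding integral_cnj l2_inner_group_fourier[OF f' \<psi> \<phi>] ..
  finally show "l2_inner (group_fourier f lam \<phi>) \<psi> = l2_inner \<phi> (group_fourier f' lam \<psi>)"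
    by (simp only: l2_inner_commute[of \<phi>])
qed

text \<open>
  An adjoint having been exhibited, the choice in the definition of the adjoint satisfies its
  specification.
\<close>

lemma l2_adjoint_group_fourier:
  fixes f :: "'n::finite heis \<Rightarrow> complex"
  assumes f: "integrable lborel f" and \<phi>: "\<phi> \<in> L2" and \<psi>: "\<psi> \<in> L2"
  shows "l2_inner (group_fourier f lam \<phi>) \<psi> = l2_inner \<phi> (l2_adjoint (group_fourier f lam) \<psi>)"
proof -
  let ?P = "\<lambda>S. (\<forall>\<psi>\<in>L2. S \<psi> \<in> L2) \<and> (\<forall>\<phi>\<in>L2. \<forall>\<psi>\<in>L2. l2_inner (group_fourier f lam \<phi>) \<psi> = l2_inner \<phi> (S \<psi>))"
  have "?P (group_fourier (\<lambda>g. cnj (f (- g))) lam)"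
    using group_fourier_adjoint_exists[OF f] group_fourier_L2 by blast
  then have "?P (l2_adjoint (group_fourier f lam))" unfolding l2_adjoint_def by (rule someI[of ?P])
  then show ?thesis using \<phi> \<psi> by blast
qed

lemma l2_norm_eq_0_imp_AE:
  assumes "integrable lborel (\<lambda>x. (cmod (\<phi> x))\<^sup>2)" "l2_norm \<phi> = 0"
  shows "AE x in lborel. \<phi> x = 0"
proof -
  have "(LINT x|lborel. (cmod (\<phi> x))\<^sup>2) = 0" using assms(2) l2_norm_power2[of \<phi>] by simp
  then show ?thesis using integral_nonneg_eq_0_iff_AE[OF assms(1)] by simp
qed

text \<open>
  For a basis vector the defining series has a single nonzero term, so that its limit is forced up to
  a null set.
\<close>

lemma hermite_calculus_scaled_hermite:
  fixes \<alpha> :: "nat ^ 'n::finite"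
  assumes lam: "lam \<noteq> 0"
  shows "hermite_calculus m lam (scaled_hermite lam \<alpha>) \<in> L2"
    and "AE x in lborel. hermite_calculus m lam (scaled_hermite lam \<alpha>) x = m (hermite_eigenvalue lam \<alpha>) * scaled_hermite lam \<alpha> x"
proof -
  define \<Phi> where "\<Phi> = (scaled_hermite lam :: nat ^ 'n \<Rightarrow> _)"
  define summand where "summand = (\<lambda>\<beta> x. m (hermite_eigenvalue lam \<beta>) * l2_inner (\<Phi> \<alpha>) (\<Phi> \<beta>) * \<Phi> \<beta> x)"
  define limit where "limit = (\<lambda>x. m (hermite_eigenvalue lam \<alpha>) * \<Phi> \<alpha> x)"
  have \<Phi>_L2: "\<Phi> \<alpha> \<in> L2" unfolding \<Phi>_def by (rule scaled_hermite_L2[OF lam])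
  have limit_L2: "limit \<in> L2"
    using \<Phi>_L2 unfolding limit_def L2_def by (simp add: norm_mult power_mult_distrib borel_measurable_times)
  have sum_eq: "(\<Sum>\<beta>\<in>F. summand \<beta> x) = limit x" if "finite F" "\<alpha> \<in> F" for F x
  proof -
    have "(\<Sum>\<beta>\<in>F. summand \<beta> x) = (\<Sum>\<beta>\<in>F. if \<beta> = \<alpha> then limit x else 0)"
      unfolding summand_def \<Phi>_def scaled_hermite_orthonormal[OF lam] limit_def by (intro sum.cong refl) auto
    then show ?thesis using that by simp
  qed
  have ev: "\<forall>\<^sub>F F in finite_subsets_at_top UNIV. finite F \<and> \<alpha> \<in> F"
    by (auto simp: eventually_finite_subsets_at_top intro!: exI[of _ "{\<alpha>}"])
  have "((\<lambda>F. l2_norm (\<lambda>x. limit x - (\<Sum>\<beta>\<in>F. summand \<beta> x))) \<longlongrightarrow> 0) (finite_subsets_at_top UNIV)"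
    by (rule tendsto_eventually, rule eventually_mono[OF ev]) (simp add: sum_eq l2_norm_def)
  then have "l2_has_sum summand limit" using limit_L2 by (simp add: l2_has_sum_def)
  then have "l2_has_sum summand (Eps (l2_has_sum summand))" by (rule someI[of "l2_has_sum summand"])
  then have h: "l2_has_sum summand (hermite_calculus m lam (\<Phi> \<alpha>))"
    unfolding hermite_calculus_def summand_def \<Phi>_def .
  define \<psi> where "\<psi> = hermite_calculus m lam (\<Phi> \<alpha>)"
  have \<psi>_L2: "\<psi> \<in> L2" and lim: "((\<lambda>F. l2_norm (\<lambda>x. \<psi> x - (\<Sum>\<beta>\<in>F. summand \<beta> x))) \<longlongrightarrow> 0) (finite_subsets_at_top UNIV)"
    using h unfolding \<psi>_def by (simp_all add: l2_has_sum_def)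
  have "((\<lambda>F. l2_norm (\<lambda>x. \<psi> x - (\<Sum>\<beta>\<in>F. summand \<beta> x))) \<longlongrightarrow> l2_norm (\<lambda>x. \<psi> x - limit x)) (finite_subsets_at_top UNIV)"
    by (rule tendsto_eventually, rule eventually_mono[OF ev]) (simp add: sum_eq)
  then have zero: "l2_norm (\<lambda>x. \<psi> x - limit x) = 0"
    using lim by (intro tendsto_unique) auto
  have [measurable]: "\<psi> \<in> borel_measurable borel" "limit \<in> borel_measurable borel" using \<psi>_L2 limit_L2 by (simp_all add: L2_def)
  have "integrable lborel (\<lambda>x. (cmod (\<psi> x - limit x))\<^sup>2)"
  proof (rule Bochner_Integration.integrable_bound)
    show "integrable lborel (\<lambda>x. 2 * (cmod (\<psi> x))\<^sup>2 + 2 * (cmod (limit x))\<^sup>2)"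
      using \<psi>_L2 limit_L2 by (simp add: L2_def)
    have "(cmod (a - b))\<^sup>2 \<le> 2 * (cmod a)\<^sup>2 + 2 * (cmod b)\<^sup>2" for a b :: complex
    proof -
      have "(cmod (a - b))\<^sup>2 \<le> (cmod a + cmod b)\<^sup>2" by (intro power_mono norm_triangle_ineq4) simp
      also have "\<dots> \<le> 2 * (cmod a)\<^sup>2 + 2 * (cmod b)\<^sup>2"
        using zero_le_power2[of "cmod a - cmod b"] by (simp add: power2_eq_square algebra_simps)
      finally show ?thesis .
    qed
    then show "AE x in lborel. norm ((cmod (\<psi> x - limit x))\<^sup>2) \<le> norm (2 * (cmod (\<psi> x))\<^sup>2 + 2 * (cmod (limit x))\<^sup>2)"
      by simp
  qed measurable
  from l2_norm_eq_0_imp_AE[OF this zero]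
  show "AE x in lborel. hermite_calculus m lam (scaled_hermite lam \<alpha>) x = m (hermite_eigenvalue lam \<alpha>) * scaled_hermite lam \<alpha> x"
    by eventually_elim (simp add: \<psi>_def limit_def \<Phi>_def)
  show "hermite_calculus m lam (scaled_hermite lam \<alpha>) \<in> L2" using \<psi>_L2 unfolding \<psi>_def \<Phi>_def .
qed

text \<open>
  The operator inequality, tested on an eigenvector of the Hermite operator.
\<close>

theorem group_fourier_scaled_hermite_decay:
  fixes f :: "'n::finite heis \<Rightarrow> complex" and m :: "real \<Rightarrow> real"
  assumes f: "integrable lborel f" and lam: "lam \<noteq> 0"
    and le: "l2_op_le (\<lambda>\<phi>. l2_adjoint (group_fourier f lam) (group_fourier f lam \<phi>))
        (\<lambda>\<phi> \<xi>. of_real C * hermite_calculus (\<lambda>s. of_real (m s)) lam \<phi> \<xi>)"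
  shows "(l2_norm (group_fourier f lam (scaled_hermite lam \<alpha>)))\<^sup>2 \<le> C * m (hermite_eigenvalue lam \<alpha>)"
proof -
  define \<Phi> where "\<Phi> = scaled_hermite lam \<alpha>"
  define T where "T = group_fourier f lam"
  have \<Phi>: "\<Phi> \<in> L2" and T\<Phi>: "T \<Phi> \<in> L2"
    unfolding \<Phi>_def T_def using scaled_hermite_L2[OF lam] group_fourier_L2[OF f] by blast+
  have [measurable]: "\<Phi> \<in> borel_measurable borel" using \<Phi> by (simp add: L2_def)
  have self: "l2_inner \<phi> \<phi> = of_real ((l2_norm \<phi>)\<^sup>2)" for \<phi> :: "real ^ 'n \<Rightarrow> complex"
    unfolding l2_inner_def l2_norm_power2 by (simp add: complex_norm_square[symmetric] flip: integral_complex_of_real)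
  have "l2_inner (l2_adjoint T (T \<Phi>)) \<Phi> = cnj (l2_inner (T \<Phi>) (T \<Phi>))"
    unfolding T_def l2_adjoint_group_fourier[OF f \<Phi> T\<Phi>[unfolded T_def]] by (rule l2_inner_commute)
  then have left: "Re (l2_inner (l2_adjoint T (T \<Phi>)) \<Phi>) = (l2_norm (T \<Phi>))\<^sup>2" by (simp add: self)
  have "l2_inner (\<lambda>\<xi>. of_real C * hermite_calculus (\<lambda>s. of_real (m s)) lam \<Phi> \<xi>) \<Phi>
      = (LINT x|lborel. of_real (C * m (hermite_eigenvalue lam \<alpha>)) * (\<Phi> x * cnj (\<Phi> x)))"
    unfolding l2_inner_def
  proof (rule integral_cong_AE)
    have [measurable]: "hermite_calculus (\<lambda>s. of_real (m s)) lam \<Phi> \<in> borel_measurable borel"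
      using hermite_calculus_scaled_hermite(1)[OF lam, of "\<lambda>s. of_real (m s)" \<alpha>] by (simp add: L2_def \<Phi>_def)
    show "(\<lambda>\<xi>. of_real C * hermite_calculus (\<lambda>s. of_real (m s)) lam \<Phi> \<xi> * cnj (\<Phi> \<xi>)) \<in> borel_measurable lborel"
      "(\<lambda>x. of_real (C * m (hermite_eigenvalue lam \<alpha>)) * (\<Phi> x * cnj (\<Phi> x))) \<in> borel_measurable lborel" by measurable
    show "AE x in lborel. of_real C * hermite_calculus (\<lambda>s. of_real (m s)) lam \<Phi> x * cnj (\<Phi> x)
      = of_real (C * m (hermite_eigenvalue lam \<alpha>)) * (\<Phi> x * cnj (\<Phi> x))"
      using hermite_calculus_scaled_hermite(2)[OF lam, of "\<lambda>s. of_real (m s)" \<alpha>] unfolding \<Phi>_def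
      by eventually_elim simp
  qed
  also have "\<dots> = of_real (C * m (hermite_eigenvalue lam \<alpha>)) * l2_inner \<Phi> \<Phi>"
    unfolding l2_inner_def by (rule integral_mult_right_zero)
  also have "l2_inner \<Phi> \<Phi> = 1" unfolding \<Phi>_def scaled_hermite_orthonormal[OF lam] by simp
  finally have right: "Re (l2_inner (\<lambda>\<xi>. of_real C * hermite_calculus (\<lambda>s. of_real (m s)) lam \<Phi> \<xi>) \<Phi>) = C * m (hermite_eigenvalue lam \<alpha>)"
    by simp
  show ?thesis
    using le \<Phi> left right unfolding l2_op_le_def T_def \<Phi>_def by fastforce
qed

section \<open>Weyl transforms of functions of Gevrey class\<close>

lemma gevreyD:
  assumes "gevrey C R j u"
  shows "(u i has_vector_derivative u (Suc i) x) (at x)" "cmod (u i x) \<le> gevrey_bound C (i + j)"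
    "\<bar>x\<bar> > R \<Longrightarrow> u i x = 0"
  using assms unfolding gevrey_def by blast+

lemma gevrey_continuous:
  assumes "gevrey C R j u"
  shows "continuous_on S (u i)"
  by (intro continuous_at_imp_continuous_on ballI has_vector_derivative_continuous[OF gevreyD(1)[OF assms]])

lemma gevrey_measurable: "gevrey C R j u \<Longrightarrow> u i \<in> borel_measurable borel"
  by (intro borel_measurable_continuous_onI gevrey_continuous)

lemma gevrey_integrable_times:
  assumes u: "gevrey C R j u" and g: "continuous_on UNIV g"
  shows "integrable lborel (\<lambda>x. u i x * g x :: complex)"
proof -
  have "set_integrable lborel {-R..R} (\<lambda>x. u i x * g x)"
    by (intro borel_integrable_atLeastAtMost' continuous_intros gevrey_continuous[OF u] continuous_on_subset[OF g]) simp
  moreover have "indicator {-R..R} x *\<^sub>R (u i x * g x) = u i x * g x" for x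
    using gevreyD(3)[OF u, of x i] by (auto simp: indicator_def abs_le_iff)
  ultimately show ?thesis by (simp add: set_integrable_def)
qed

lemma gevrey_integrable: "gevrey C R j u \<Longrightarrow> integrable lborel (u i)"
  using gevrey_integrable_times[of C R j u "\<lambda>_. 1" i] by simp

lemma gevrey_by_parts:
  fixes v v' :: "real \<Rightarrow> complex"
  assumes u: "gevrey C R j u" and v: "\<And>x. (v has_vector_derivative v' x) (at x)" and v': "continuous_on UNIV v'"
  shows "(LINT x|lborel. u i x * v' x) = - (LINT x|lborel. u (Suc i) x * v x)"
proof -
  have cv: "continuous_on UNIV v"
    by (intro continuous_at_imp_continuous_on ballI has_vector_derivative_continuous[OF v])
  have int: "integrable lborel (\<lambda>x. u i x * v' x)" "integrable lborel (\<lambda>x. u (Suc i) x * v x)"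
    by (intro gevrey_integrable_times[OF u] v' cv)+
  have "(LINT x|lborel. u i x * v' x + u (Suc i) x * v x) = 0"
  proof (rule integral_derivative_eq_zero)
    show "((\<lambda>x. u i x * v x) has_vector_derivative (u i x * v' x + u (Suc i) x * v x)) (at x)" for x
      by (rule has_vector_derivative_mult[OF gevreyD(1)[OF u] v])
    show "continuous_on UNIV (\<lambda>x. u i x * v' x + u (Suc i) x * v x)"
      by (intro continuous_intros gevrey_continuous[OF u] v' cv)
    show "integrable lborel (\<lambda>x. u i x * v' x + u (Suc i) x * v x)"
      by (intro Bochner_Integration.integrable_add int)
    have "\<forall>\<^sub>F x in at_top. u i x * v x = 0"
      using eventually_gt_at_top[of "\<bar>R\<bar>"] by eventually_elim (simp add: gevreyD(3)[OF u])
    then show "((\<lambda>x. u i x * v x) \<longlongrightarrow> 0) at_top" by (rule tendsto_eventually)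
    have "\<forall>\<^sub>F x in at_bot. u i x * v x = 0"
      using eventually_le_at_bot[of "- \<bar>R\<bar> - 1"] by eventually_elim (simp add: gevreyD(3)[OF u])
    then show "((\<lambda>x. u i x * v x) \<longlongrightarrow> 0) at_bot" by (rule tendsto_eventually)
  qed
  then show ?thesis using int by (simp add: add_eq_0_iff)
qed

definition hermite1_deriv :: "real \<Rightarrow> nat \<Rightarrow> real \<Rightarrow> real" where
  "hermite1_deriv lam k u = \<bar>lam\<bar> powr (1 / 4) * (sqrt \<bar>lam\<bar> * hermite_deriv k (sqrt \<bar>lam\<bar> * u))"

lemma hermite_deriv_continuous [continuous_intros]:
  "continuous_on S f \<Longrightarrow> continuous_on S (\<lambda>x. hermite_deriv k (f x))"
  unfolding hermite_deriv_def by (intro continuous_intros)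

lemma hermite1_has_derivative: "(hermite1 lam k has_real_derivative hermite1_deriv lam k u) (at u)"
proof -
  have "((\<lambda>u. hermite_function k (sqrt \<bar>lam\<bar> * u)) has_real_derivative hermite_deriv k (sqrt \<bar>lam\<bar> * u) * sqrt \<bar>lam\<bar>) (at u)"
    by (rule DERIV_chain2[OF hermite_function_deriv]) (auto intro!: derivative_eq_intros)
  from DERIV_cmult[OF this, of "\<bar>lam\<bar> powr (1 / 4)"] show ?thesis
    unfolding hermite1_def[abs_def] hermite1_deriv_def by (simp only: mult.commute mult.left_commute)
qed

lemma hermite1_has_second_derivative:
  "(hermite1_deriv lam k has_real_derivative (lam\<^sup>2 * u\<^sup>2 - (2 * real k + 1) * \<bar>lam\<bar>) * hermite1 lam k u) (at u)"
proof -
  define c where "c = sqrt \<bar>lam\<bar>"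
  have c2: "c * c = \<bar>lam\<bar>" by (simp add: c_def)
  obtain d where d: "\<And>u. (hermite_function k has_real_derivative d u) (at u)"
    "\<And>u. (d has_real_derivative (u\<^sup>2 - 1 - 2 * real k) * hermite_function k u) (at u)"
    by (rule that) (rule hermite_function_has_derivatives)+
  have "d = hermite_deriv k" using DERIV_unique[OF d(1) hermite_function_deriv] by blast
  then have dd: "(hermite_deriv k has_real_derivative (u\<^sup>2 - 1 - 2 * real k) * hermite_function k u) (at u)" for u using d(2) by simp
  have "((\<lambda>u. hermite_deriv k (c * u)) has_real_derivative (((c * u)\<^sup>2 - 1 - 2 * real k) * hermite_function k (c * u)) * c) (at u)"
    by (rule DERIV_chain2[OF dd]) (auto intro!: derivative_eq_intros)
  from DERIV_cmult[OF DERIV_cmult[OF this, of c], of "\<bar>lam\<bar> powr (1 / 4)"]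
  have "(hermite1_deriv lam k has_real_derivative \<bar>lam\<bar> powr (1 / 4) * (c * ((((c * u)\<^sup>2 - 1 - 2 * real k) * hermite_function k (c * u)) * c))) (at u)"
    unfolding hermite1_deriv_def[abs_def] c_def[symmetric] .
  moreover have "\<bar>lam\<bar> powr (1 / 4) * (c * ((((c * u)\<^sup>2 - 1 - 2 * real k) * hermite_function k (c * u)) * c))
      = ((c * c) * (c * c) * u\<^sup>2 - (2 * real k + 1) * (c * c)) * (\<bar>lam\<bar> powr (1 / 4) * hermite_function k (c * u))"
    by (simp add: power2_eq_square algebra_simps)
  moreover have "(c * c) * (c * c) * u\<^sup>2 = lam\<^sup>2 * u\<^sup>2" unfolding c2 by (simp add: power2_eq_square)
  ultimately show ?thesis unfolding hermite1_def c_def[symmetric] c2 by (simp only:)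
qed

text \<open>
  The Weyl transform of a product \<open>p(x) q(y)\<close> times a suitable phase maps the Hermite function to a
  product of two functions of \<open>\<xi>\<close>: a Fourier transform of \<open>p\<close> and a correlation with \<open>q\<close>.
\<close>

definition modulate :: "real \<Rightarrow> (real \<Rightarrow> complex) \<Rightarrow> real \<Rightarrow> complex" where
  "modulate lam p \<xi> = (LINT x|lborel. p x * iexp (lam * (x * \<xi>)))"

definition slide :: "real \<Rightarrow> nat \<Rightarrow> (real \<Rightarrow> complex) \<Rightarrow> real \<Rightarrow> complex" where
  "slide lam k q \<xi> = (LINT y|lborel. q y * of_real (hermite1 lam k (\<xi> + y)))"

lemma modulate_derivative:
  assumes u: "gevrey C R j u"
  shows "\<i> * lam * \<xi> * modulate lam (u i) \<xi> = - modulate lam (u (Suc i)) \<xi>"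
proof -
  have "(LINT x|lborel. u i x * (\<i> * lam * \<xi> * iexp (lam * (x * \<xi>)))) = - (LINT x|lborel. u (Suc i) x * iexp (lam * (x * \<xi>)))"
  proof (rule gevrey_by_parts[OF u])
    fix x
    have "((\<lambda>z. exp (\<i> * lam * \<xi> * z)) has_field_derivative (\<i> * lam * \<xi> * exp (\<i> * lam * \<xi> * of_real x))) (at (of_real x))"
      by (auto intro!: derivative_eq_intros)
    from has_vector_derivative_real_field[OF this]
    show "((\<lambda>x. iexp (lam * (x * \<xi>))) has_vector_derivative (\<i> * lam * \<xi> * iexp (lam * (x * \<xi>)))) (at x)"
      by (simp add: mult_ac)
  qed (intro continuous_intros)
  moreover have "(LINT x|lborel. u i x * (\<i> * lam * \<xi> * iexp (lam * (x * \<xi>)))) = \<i> * lam * \<xi> * modulate lam (u i) \<xi>"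
    unfolding modulate_def integral_mult_right_zero[symmetric] by (simp only: mult_ac)
  ultimately show ?thesis by (simp add: modulate_def)
qed

text \<open>
  The eigenvalue equation at \<open>\<xi> + y\<close> is integrated by parts in \<open>y\<close>, and \<open>(\<xi> + y)\<^sup>2\<close> is expanded.
\<close>

lemma slide_eigen:
  fixes lam \<xi> :: real and k :: nat and u :: "nat \<Rightarrow> real \<Rightarrow> complex"
  assumes u: "gevrey C R j u"
  defines "\<mu> \<equiv> (2 * real k + 1) * \<bar>lam\<bar>"
  shows "\<mu> * slide lam k (u i) \<xi> = lam\<^sup>2 * \<xi>\<^sup>2 * slide lam k (u i) \<xi> + 2 * lam\<^sup>2 * \<xi> * slide lam k (\<lambda>y. y * u i y) \<xi>
    + lam\<^sup>2 * slide lam k (\<lambda>y. y * (y * u i y)) \<xi> - slide lam k (u (Suc (Suc i))) \<xi>"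
proof -
  define h where "h y = complex_of_real (hermite1 lam k (\<xi> + y))" for y
  define h1 where "h1 y = complex_of_real (hermite1_deriv lam k (\<xi> + y))" for y
  define h2 where "h2 y = complex_of_real ((lam\<^sup>2 * (\<xi> + y)\<^sup>2 - (2 * real k + 1) * \<bar>lam\<bar>) * hermite1 lam k (\<xi> + y))" for y
  have shift: "(f has_real_derivative D (\<xi> + y)) (at (\<xi> + y)) \<Longrightarrow>
      ((\<lambda>y. complex_of_real (f (\<xi> + y))) has_vector_derivative of_real (D (\<xi> + y))) (at y)" for f D and y :: real
    by (intro has_vector_derivative_of_real) (simp add: DERIV_shift add.commute[of \<xi>])
  have d1: "(h has_vector_derivative h1 y) (at y)" for y
    unfolding h_def h1_def by (rule shift[of "hermite1 lam k" "hermite1_deriv lam k", OF hermite1_has_derivative])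
  have d2: "(h1 has_vector_derivative h2 y) (at y)" for y
    unfolding h1_def h2_def by (rule shift[where f = "hermite1_deriv lam k" and D = "\<lambda>u. (lam\<^sup>2 * u\<^sup>2 - (2 * real k + 1) * \<bar>lam\<bar>) * hermite1 lam k u", OF hermite1_has_second_derivative])
  have cont: "continuous_on UNIV h" "continuous_on UNIV h1" "continuous_on UNIV h2"
    unfolding h_def h1_def h2_def hermite1_deriv_def by (intro continuous_intros)+
  have int: "integrable lborel (\<lambda>y. u i y * (of_real y ^ n * h y))" for n
    by (intro gevrey_integrable_times[OF u] continuous_intros cont)
  have "(LINT y|lborel. u i y * h2 y) = (LINT y|lborel. u (Suc (Suc i)) y * h y)"
    using gevrey_by_parts[OF u d2 cont(3), of i] gevrey_by_parts[OF u d1 cont(2), of "Suc i"] by simp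
  moreover have "(LINT y|lborel. u i y * h2 y) = (LINT y|lborel. (lam\<^sup>2 * \<xi>\<^sup>2 - \<mu>) * (u i y * (of_real y ^ 0 * h y))
      + 2 * lam\<^sup>2 * \<xi> * (u i y * (of_real y ^ 1 * h y)) + lam\<^sup>2 * (u i y * (of_real y ^ 2 * h y)))"
    unfolding h2_def h_def \<mu>_def
    by (intro Bochner_Integration.integral_cong refl) (simp add: power2_eq_square algebra_simps)
  moreover have "\<dots> = (lam\<^sup>2 * \<xi>\<^sup>2 - \<mu>) * (LINT y|lborel. u i y * (of_real y ^ 0 * h y))
      + 2 * lam\<^sup>2 * \<xi> * (LINT y|lborel. u i y * (of_real y ^ 1 * h y)) + lam\<^sup>2 * (LINT y|lborel. u i y * (of_real y ^ 2 * h y))"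
    using int[of 0] int[of 1] int[of 2] by simp
  ultimately have e: "(LINT y|lborel. u (Suc (Suc i)) y * h y) = (lam\<^sup>2 * \<xi>\<^sup>2 - \<mu>) * (LINT y|lborel. u i y * (of_real y ^ 0 * h y))
      + 2 * lam\<^sup>2 * \<xi> * (LINT y|lborel. u i y * (of_real y ^ 1 * h y)) + lam\<^sup>2 * (LINT y|lborel. u i y * (of_real y ^ 2 * h y))"
    by (simp only:)
  have s: "slide lam k (u i) \<xi> = (LINT y|lborel. u i y * (of_real y ^ 0 * h y))"
    "slide lam k (\<lambda>y. y * u i y) \<xi> = (LINT y|lborel. u i y * (of_real y ^ 1 * h y))"
    "slide lam k (\<lambda>y. y * (y * u i y)) \<xi> = (LINT y|lborel. u i y * (of_real y ^ 2 * h y))"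
    "slide lam k (u (Suc (Suc i))) \<xi> = (LINT y|lborel. u (Suc (Suc i)) y * h y)"
    unfolding slide_def h_def by (simp_all add: power2_eq_square mult_ac)
  show ?thesis unfolding s e by (simp add: algebra_simps)
qed

text \<open>
  The eigenvalue is exchanged for operations on the test functions: powers of \<open>\<xi>\<close> left over from
  \<open>slide_eigen\<close> become derivatives of the first factor.
\<close>

lemma modulate_slide_eigen:
  fixes lam \<xi> :: real and k :: nat and u v :: "nat \<Rightarrow> real \<Rightarrow> complex" and A :: "(real \<Rightarrow> complex) \<Rightarrow> (real \<Rightarrow> complex) \<Rightarrow> complex"
  assumes u: "gevrey C R i u" and v: "gevrey C R j v"
  defines "\<mu> \<equiv> (2 * real k + 1) * \<bar>lam\<bar>" and "A \<equiv> \<lambda>p q. modulate lam p \<xi> * slide lam k q \<xi>"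
  shows "\<mu> * A (u 0) (v 0) = - A (u 2) (v 0) + 2 * \<i> * lam * A (u 1) (\<lambda>y. y * v 0 y)
    + lam\<^sup>2 * A (u 0) (\<lambda>y. y * (y * v 0 y)) - A (u 0) (v 2)"
proof -
  have P1: "\<i> * lam * \<xi> * modulate lam (u 0) \<xi> = - modulate lam (u 1) \<xi>"
    and P2: "\<i> * lam * \<xi> * modulate lam (u 1) \<xi> = - modulate lam (u 2) \<xi>"
    using modulate_derivative[OF u, of lam \<xi> 0] modulate_derivative[OF u, of lam \<xi> 1] by (simp_all add: numeral_2_eq_2)
  define S0 where "S0 = slide lam k (v 0) \<xi>"
  define S1 where "S1 = slide lam k (\<lambda>y. y * v 0 y) \<xi>"
  define S2 where "S2 = slide lam k (\<lambda>y. y * (y * v 0 y)) \<xi>"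
  define S3 where "S3 = slide lam k (v 2) \<xi>"
  define P where "P = modulate lam (u 0) \<xi>"
  have S: "\<mu> * S0 = lam\<^sup>2 * \<xi>\<^sup>2 * S0 + 2 * lam\<^sup>2 * \<xi> * S1 + lam\<^sup>2 * S2 - S3"
    using slide_eigen[OF v, of k lam 0 \<xi>] unfolding \<mu>_def S0_def S1_def S2_def S3_def by (simp add: numeral_2_eq_2)
  have m1: "modulate lam (u 1) \<xi> = - (\<i> * lam * \<xi> * P)" using P1 by (simp add: P_def)
  have m2: "modulate lam (u 2) \<xi> = - (lam\<^sup>2 * \<xi>\<^sup>2 * P)"
  proof -
    have "modulate lam (u 2) \<xi> = - (\<i> * lam * \<xi> * modulate lam (u 1) \<xi>)" unfolding P2 by simp
    also have "\<dots> = (\<i> * \<i>) * (lam\<^sup>2 * \<xi>\<^sup>2 * P)" unfolding m1 by (simp only: power2_eq_square of_real_mult mult_minus_right minus_minus mult_ac)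
    finally show ?thesis by simp
  qed
  have "\<mu> * (P * S0) = P * (\<mu> * S0)" by simp
  also have "\<dots> = - (modulate lam (u 2) \<xi> * S0) + 2 * \<i> * lam * (modulate lam (u 1) \<xi> * S1) + lam\<^sup>2 * (P * S2) - P * S3"
    unfolding S m1 m2 by (simp add: power2_eq_square algebra_simps)
  finally show ?thesis unfolding A_def P_def S0_def S1_def S2_def S3_def .
qed

text \<open>
  Dominates \<open>slide\<close> up to the maximum of the test function.  Keeping this dependence on \<open>\<xi>\<close>, instead of
  a constant bound, is what makes the estimate square-integrable, uniformly in \<open>k\<close>.
\<close>

definition local_mass :: "real \<Rightarrow> nat \<Rightarrow> real \<Rightarrow> real \<Rightarrow> real" where
  "local_mass lam k R \<xi> = (LINT y|lborel. indicator {-R..R} y * \<bar>hermite1 lam k (\<xi> + y)\<bar>)"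

lemma gevrey_bound_mult_le: "C \<ge> 0 \<Longrightarrow> gevrey_bound C i * gevrey_bound C j \<le> gevrey_bound C (i + j)"
proof -
  assume C: "C \<ge> 0"
  have "fact i * fact j \<le> (fact (i + j) :: nat)" by (rule dvd_imp_le[OF fact_fact_dvd_fact]) simp
  then have "real (fact i * fact j) \<le> real (fact (i + j))" by (simp only: of_nat_le_iff)
  then have "fact i * fact j \<le> (fact (i + j) :: real)" by (simp only: of_nat_mult of_nat_fact)
  then have "(fact i * fact j)\<^sup>2 \<le> (fact (i + j) :: real)\<^sup>2" by (intro power_mono) auto
  then have "C ^ (i + j) * (fact i * fact j)\<^sup>2 \<le> C ^ (i + j) * (fact (i + j))\<^sup>2" using C by (intro mult_left_mono) auto
  then show ?thesis unfolding gevrey_bound_def power_add power_mult_distrib by (simp only: mult_ac)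
qed

text \<open>
  Iteration of \<open>modulate_slide_eigen\<close>: each eigenvalue costs at most two of the operations counted by
  the shift in \<open>gevrey\<close>, whence \<open>2 n\<close> in the bound.
\<close>

lemma modulate_slide_bound:
  assumes u: "gevrey C R i u" and v: "gevrey C R j v" and C: "C \<ge> R + 1" and R: "R \<ge> 0"
  shows "((2 * real k + 1) * \<bar>lam\<bar>) ^ n * cmod (modulate lam (u 0) \<xi> * slide lam k (v 0) \<xi>)
    \<le> (2 + 2 * \<bar>lam\<bar> + lam\<^sup>2) ^ n * (2 * R * gevrey_bound C (i + j + 2 * n) * local_mass lam k R \<xi>)"
  using u v
proof (induction n arbitrary: i j u v)
  case (0 i j u v)
  have ind: "integrable lborel (\<lambda>y. indicator {-R..R} y * g y :: real)" if "continuous_on UNIV g" for g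
    using borel_integrable_atLeastAtMost'[of "-R" R g] continuous_on_subset[OF that] by (simp add: set_integrable_def)
  have "cmod (modulate lam (u 0) \<xi>) \<le> (LINT x|lborel. indicator {-R..R} x * gevrey_bound C i)"
    unfolding modulate_def
  proof (rule norm_integral_le_integral)
    show "integrable lborel (\<lambda>x. indicator {-R..R} x * gevrey_bound C i)" by (intro ind continuous_intros)
    show "(\<lambda>x. u 0 x * iexp (lam * (x * \<xi>))) \<in> borel_measurable lborel"
      by (intro borel_measurable_integrable gevrey_integrable_times[OF 0(1)] continuous_intros)
    show "norm (u 0 x * iexp (lam * (x * \<xi>))) \<le> indicator {-R..R} x * gevrey_bound C i" for x
      using gevreyD(2)[OF 0(1), of 0 x] gevreyD(3)[OF 0(1), of x 0] by (auto simp: norm_mult indicator_def abs_le_iff)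
  qed
  also have "\<dots> = 2 * R * gevrey_bound C i"
    unfolding integral_mult_left_zero using R by (simp add: measure_def)
  finally have m: "cmod (modulate lam (u 0) \<xi>) \<le> 2 * R * gevrey_bound C i" .
  have "cmod (slide lam k (v 0) \<xi>) \<le> (LINT y|lborel. gevrey_bound C j * (indicator {-R..R} y * \<bar>hermite1 lam k (\<xi> + y)\<bar>))"
    unfolding slide_def
  proof (rule norm_integral_le_integral)
    show "integrable lborel (\<lambda>y. gevrey_bound C j * (indicator {-R..R} y * \<bar>hermite1 lam k (\<xi> + y)\<bar>))"
      by (intro integrable_mult_right ind continuous_intros)
    show "(\<lambda>y. v 0 y * of_real (hermite1 lam k (\<xi> + y))) \<in> borel_measurable lborel"
      by (intro borel_measurable_integrable gevrey_integrable_times[OF 0(2)] continuous_intros)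
    show "norm (v 0 y * of_real (hermite1 lam k (\<xi> + y))) \<le> gevrey_bound C j * (indicator {-R..R} y * \<bar>hermite1 lam k (\<xi> + y)\<bar>)" for y
      using gevreyD(2)[OF 0(2), of 0 y] gevreyD(3)[OF 0(2), of y 0] by (auto simp: norm_mult indicator_def abs_le_iff mult_right_mono)
  qed
  also have "\<dots> = gevrey_bound C j * local_mass lam k R \<xi>" unfolding local_mass_def by (rule integral_mult_right_zero)
  finally have s: "cmod (slide lam k (v 0) \<xi>) \<le> gevrey_bound C j * local_mass lam k R \<xi>" .
  have lm: "local_mass lam k R \<xi> \<ge> 0" unfolding local_mass_def by (intro integral_nonneg_AE) auto
  have gb: "gevrey_bound C l \<ge> 0" for l using C R by (simp add: gevrey_bound_def)
  have "cmod (modulate lam (u 0) \<xi> * slide lam k (v 0) \<xi>) \<le> (2 * R * gevrey_bound C i) * (gevrey_bound C j * local_mass lam k R \<xi>)"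
    unfolding norm_mult using R gb by (intro mult_mono m s) auto
  also have "\<dots> = 2 * R * (gevrey_bound C i * gevrey_bound C j) * local_mass lam k R \<xi>" by (simp only: mult_ac)
  also have "\<dots> \<le> 2 * R * gevrey_bound C (i + j) * local_mass lam k R \<xi>"
    using R lm C by (intro mult_right_mono mult_left_mono gevrey_bound_mult_le) auto
  finally show ?case by simp
next
  case (Suc n i j u v)
  define \<mu> where "\<mu> = (2 * real k + 1) * \<bar>lam\<bar>"
  define A where "A = (\<lambda>p q. modulate lam p \<xi> * slide lam k q \<xi>)"
  define X where "X = (2 + 2 * \<bar>lam\<bar> + lam\<^sup>2) ^ n * (2 * R * gevrey_bound C (i + j + 2 * Suc n) * local_mass lam k R \<xi>)"
  note u = Suc.prems(1) and v = Suc.prems(2)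
  have mu: "\<mu> \<ge> 0" by (simp add: \<mu>_def)
  note xv = gevrey_times_x[OF v C R] note xxv = gevrey_times_x[OF xv C R]
  have b1: "\<mu> ^ n * cmod (A (u 2) (v 0)) \<le> X"
    using Suc.IH[OF gevrey_derivative[OF gevrey_derivative[OF u]] v] unfolding A_def X_def \<mu>_def by (simp add: numeral_2_eq_2)
  have b2: "\<mu> ^ n * cmod (A (u 1) (\<lambda>y. y * v 0 y)) \<le> X"
    using Suc.IH[OF gevrey_derivative[OF u] xv] unfolding A_def X_def \<mu>_def by simp
  have b3: "\<mu> ^ n * cmod (A (u 0) (\<lambda>y. y * (y * v 0 y))) \<le> X"
    using Suc.IH[OF u xxv] unfolding A_def X_def \<mu>_def by simp
  have b4: "\<mu> ^ n * cmod (A (u 0) (v 2)) \<le> X"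
    using Suc.IH[OF u gevrey_derivative[OF gevrey_derivative[OF v]]] unfolding A_def X_def \<mu>_def by (simp add: numeral_2_eq_2)
  have eq: "\<mu> * A (u 0) (v 0) = - A (u 2) (v 0) + 2 * \<i> * lam * A (u 1) (\<lambda>y. y * v 0 y)
    + lam\<^sup>2 * A (u 0) (\<lambda>y. y * (y * v 0 y)) - A (u 0) (v 2)"
    unfolding \<mu>_def A_def by (rule modulate_slide_eigen[OF u v])
  have tri: "cmod (- a + 2 * \<i> * lam * b + lam\<^sup>2 * c - d) \<le> cmod a + 2 * \<bar>lam\<bar> * cmod b + lam\<^sup>2 * cmod c + cmod d" for a b c d :: complex
  proof -
    have "cmod (- a + 2 * \<i> * lam * b + lam\<^sup>2 * c - d) \<le> cmod (- a) + cmod (2 * \<i> * lam * b) + cmod (lam\<^sup>2 * c) + cmod d"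
      by (intro order_trans[OF norm_triangle_ineq4] add_mono order_trans[OF norm_triangle_ineq] order_refl)
    then show ?thesis by (simp add: norm_mult norm_power)
  qed
  have "\<mu> ^ Suc n * cmod (A (u 0) (v 0)) = \<mu> ^ n * cmod (\<mu> * A (u 0) (v 0))"
    using mu by (simp add: norm_mult)
  also have "\<dots> \<le> \<mu> ^ n * (cmod (A (u 2) (v 0)) + 2 * \<bar>lam\<bar> * cmod (A (u 1) (\<lambda>y. y * v 0 y))
      + lam\<^sup>2 * cmod (A (u 0) (\<lambda>y. y * (y * v 0 y))) + cmod (A (u 0) (v 2)))"
    unfolding eq using mu by (intro mult_left_mono tri) auto
  also have "\<dots> = \<mu> ^ n * cmod (A (u 2) (v 0)) + 2 * \<bar>lam\<bar> * (\<mu> ^ n * cmod (A (u 1) (\<lambda>y. y * v 0 y)))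
      + lam\<^sup>2 * (\<mu> ^ n * cmod (A (u 0) (\<lambda>y. y * (y * v 0 y)))) + \<mu> ^ n * cmod (A (u 0) (v 2))"
    by (simp only: distrib_left mult_ac)
  also have "\<dots> \<le> X + 2 * \<bar>lam\<bar> * X + lam\<^sup>2 * X + X"
    by (intro add_mono mult_left_mono b1 b2 b3 b4) auto
  also have "\<dots> = (2 + 2 * \<bar>lam\<bar> + lam\<^sup>2) * X" by (simp add: algebra_simps)
  finally show ?case unfolding X_def \<mu>_def A_def by (simp only: power_Suc mult.assoc)
qed

lemma hermite1_L2: "lam \<noteq> 0 \<Longrightarrow> (\<lambda>u. complex_of_real (hermite1 lam k u)) \<in> L2 \<and> l2_norm (\<lambda>u. complex_of_real (hermite1 lam k u)) = 1"
  using integrable_hermite1_product[of lam k 0 k 0] hermite1_orthonormal[of lam k k]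
  by (simp add: L2_def l2_norm_def power2_eq_square)

lemma local_mass_L2:
  assumes lam: "lam \<noteq> 0" and R: "R \<ge> 0"
  shows "(\<lambda>\<xi>. complex_of_real (local_mass lam k R \<xi>)) \<in> L2"
    and "l2_norm (\<lambda>\<xi>. complex_of_real (local_mass lam k R \<xi>)) \<le> 2 * R"
proof -
  define \<psi> where "\<psi> u = complex_of_real (hermite1 lam k u)" for u
  have \<psi>: "\<psi> \<in> L2" "l2_norm \<psi> = 1" using hermite1_L2[OF lam, of k] unfolding \<psi>_def[abs_def] by blast+
  have eq: "(\<lambda>\<xi>. complex_of_real (local_mass lam k R \<xi>)) = (\<lambda>\<xi>. LINT y|lborel. of_real (indicator {-R..R} y * \<bar>hermite1 lam k (\<xi> + y)\<bar>))"
    unfolding local_mass_def integral_complex_of_real ..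
  have 1: "(\<lambda>(\<xi>, y). complex_of_real (indicator {-R..R} y * \<bar>hermite1 lam k (\<xi> + y)\<bar>)) \<in> borel_measurable (borel \<Otimes>\<^sub>M lborel)" by measurable
  have 2: "integrable lborel (indicator {-R..R} :: real \<Rightarrow> real)" by (intro integrable_real_indicator) (simp_all add: emeasure_lborel_Icc_eq)
  have 3: "(0 :: real) \<le> indicator {-R..R} y" for y :: real by simp
  have 4: "(\<lambda>y :: real. y) \<in> borel_measurable lborel" by simp
  have 5: "cmod (complex_of_real (indicator {-R..R} y * \<bar>hermite1 lam k (\<xi> + y)\<bar>)) \<le> indicator {-R..R} y * cmod (\<psi> (\<xi> + y))" for y \<xi>
    by (simp add: \<psi>_def norm_mult abs_mult)
  note * = sigma_finite_lborel 1 2 3 4 \<psi>(1) 5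
  show "(\<lambda>\<xi>. complex_of_real (local_mass lam k R \<xi>)) \<in> L2" unfolding eq by (rule L2_averaged_translates[OF *])
  have "l2_norm (\<lambda>\<xi>. complex_of_real (local_mass lam k R \<xi>)) \<le> (LINT y|lborel. indicator {-R..R} y) * l2_norm \<psi>"
    unfolding eq by (rule l2_norm_averaged_translates[OF *])
  then show "l2_norm (\<lambda>\<xi>. complex_of_real (local_mass lam k R \<xi>)) \<le> 2 * R" using R \<psi>(2) by (simp add: measure_def)
qed

lemma l2_norm_mono:
  assumes \<psi>: "\<psi> \<in> L2" and m: "\<phi> \<in> borel_measurable borel" and le: "\<And>x. c * cmod (\<phi> x) \<le> d * cmod (\<psi> x)" and cd: "c > 0" "d \<ge> 0"
  shows "\<phi> \<in> L2" and "c * l2_norm \<phi> \<le> d * l2_norm \<psi>"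
proof -
  have sq: "(c * cmod (\<phi> x))\<^sup>2 \<le> (d * cmod (\<psi> x))\<^sup>2" for x using le cd by (intro power_mono) auto
  have i\<psi>: "integrable lborel (\<lambda>x. (cmod (\<psi> x))\<^sup>2)" using \<psi> by (simp add: L2_def)
  have "integrable lborel (\<lambda>x. d\<^sup>2 / c\<^sup>2 * (cmod (\<psi> x))\<^sup>2)" using i\<psi> by simp
  then have i\<phi>: "integrable lborel (\<lambda>x. (cmod (\<phi> x))\<^sup>2)"
  proof (rule Bochner_Integration.integrable_bound)
    show "(\<lambda>x. (cmod (\<phi> x))\<^sup>2) \<in> borel_measurable lborel" using m by simp
    show "AE x in lborel. norm ((cmod (\<phi> x))\<^sup>2) \<le> norm (d\<^sup>2 / c\<^sup>2 * (cmod (\<psi> x))\<^sup>2)"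
      using sq cd by (intro AE_I2) (simp add: power_mult_distrib field_simps)
  qed
  then show "\<phi> \<in> L2" using m by (simp add: L2_def)
  have "(c * l2_norm \<phi>)\<^sup>2 = (LINT x|lborel. (c * cmod (\<phi> x))\<^sup>2)" by (simp add: power_mult_distrib l2_norm_power2)
  also have "\<dots> \<le> (LINT x|lborel. (d * cmod (\<psi> x))\<^sup>2)"
    using sq i\<phi> i\<psi> by (intro integral_mono) (simp_all add: power_mult_distrib)
  also have "\<dots> = (d * l2_norm \<psi>)\<^sup>2" by (simp add: power_mult_distrib l2_norm_power2)
  finally show "c * l2_norm \<phi> \<le> d * l2_norm \<psi>"
    by (rule power2_le_imp_le) (use cd l2_norm_nonneg[of \<psi>] in simp)
qed

lemma modulate_slide_decay:
  fixes A :: "nat \<Rightarrow> real \<Rightarrow> complex"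
  assumes u: "gevrey C R 0 u" and v: "gevrey C R 0 v" and C: "C \<ge> R + 1" and R: "R \<ge> 0" and lam: "lam \<noteq> 0"
  defines "A \<equiv> \<lambda>k \<xi>. modulate lam (u 0) \<xi> * slide lam k (v 0) \<xi>"
  shows "A k \<in> L2"
    and "(2 * real k + 1) ^ n * l2_norm (A k) \<le> (2 * R * (2 * R)) * ((2 + 2 * \<bar>lam\<bar> + lam\<^sup>2) * C\<^sup>2 / \<bar>lam\<bar>) ^ n * (fact (2 * n))\<^sup>2"
proof -
  define L where "L \<xi> = complex_of_real (local_mass lam k R \<xi>)" for \<xi>
  have L: "L \<in> L2" "l2_norm L \<le> 2 * R" unfolding L_def[abs_def] by (rule local_mass_L2[OF lam R])+
  have [measurable]: "u 0 \<in> borel_measurable borel" "v 0 \<in> borel_measurable borel"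
    by (rule gevrey_measurable[OF u] gevrey_measurable[OF v])+
  have mm: "modulate lam (u 0) \<in> borel_measurable borel"
  proof -
    have "(\<lambda>(\<xi>, x). u 0 x * iexp (lam * (x * \<xi>))) \<in> borel_measurable (borel \<Otimes>\<^sub>M lborel)" by measurable
    then show ?thesis unfolding modulate_def[abs_def] by (rule lborel.borel_measurable_lebesgue_integral)
  qed
  have ms: "slide lam k (v 0) \<in> borel_measurable borel"
  proof -
    have "(\<lambda>(\<xi>, y). v 0 y * complex_of_real (hermite1 lam k (\<xi> + y))) \<in> borel_measurable (borel \<Otimes>\<^sub>M lborel)" by measurable
    then show ?thesis unfolding slide_def[abs_def] by (rule lborel.borel_measurable_lebesgue_integral)
  qed
  have m: "A k \<in> borel_measurable borel" unfolding A_def using mm ms by measurable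
  have lm: "local_mass lam k R \<xi> \<ge> 0" for \<xi> unfolding local_mass_def by (intro integral_nonneg_AE) auto
  define K where "K = 2 + 2 * \<bar>lam\<bar> + lam\<^sup>2"
  have K: "K \<ge> 0" by (simp add: K_def)
  have pw: "((2 * real k + 1) * \<bar>lam\<bar>) ^ n * cmod (A k \<xi>) \<le> (K ^ n * (2 * R * gevrey_bound C (2 * n))) * cmod (L \<xi>)" for n \<xi>
    using modulate_slide_bound[OF u v C R, of k lam n \<xi>] lm[of \<xi>] by (simp add: A_def L_def K_def mult.assoc)
  have gb: "gevrey_bound C l \<ge> 0" for l using C R by (simp add: gevrey_bound_def)
  have pos: "((2 * real k + 1) * \<bar>lam\<bar>) ^ n > 0" "K ^ n * (2 * R * gevrey_bound C (2 * n)) \<ge> 0" for n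
    using lam K R gb by simp_all
  show "A k \<in> L2" by (rule l2_norm_mono(1)[OF L(1) m pw[of 0] pos[of 0]])
  have "((2 * real k + 1) * \<bar>lam\<bar>) ^ n * l2_norm (A k) \<le> (K ^ n * (2 * R * gevrey_bound C (2 * n))) * l2_norm L"
    by (rule l2_norm_mono(2)[OF L(1) m pw pos])
  also have "\<dots> \<le> (K ^ n * (2 * R * gevrey_bound C (2 * n))) * (2 * R)"
    using L(2) pos by (intro mult_left_mono) auto
  also have "\<dots> = ((2 * R * (2 * R)) * (K * C\<^sup>2) ^ n * (fact (2 * n))\<^sup>2)"
    unfolding gevrey_bound_def power_mult power_mult_distrib by (simp only: mult_ac)
  finally have "(2 * real k + 1) ^ n * l2_norm (A k) * \<bar>lam\<bar> ^ n \<le> (2 * R * (2 * R)) * (K * C\<^sup>2) ^ n * (fact (2 * n))\<^sup>2"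
    by (simp add: power_mult_distrib mult_ac)
  then have "(2 * real k + 1) ^ n * l2_norm (A k) \<le> (2 * R * (2 * R)) * (K * C\<^sup>2) ^ n * (fact (2 * n))\<^sup>2 / \<bar>lam\<bar> ^ n"
    using lam by (subst pos_le_divide_eq) auto
  then show "(2 * real k + 1) ^ n * l2_norm (A k) \<le> (2 * R * (2 * R)) * ((2 + 2 * \<bar>lam\<bar> + lam\<^sup>2) * C\<^sup>2 / \<bar>lam\<bar>) ^ n * (fact (2 * n))\<^sup>2"
    unfolding K_def by (simp add: power_divide)
qed

section \<open>Test functions\<close>

lemma
  fixes f :: "'a::euclidean_space \<Rightarrow> complex" and g :: "'b::euclidean_space \<Rightarrow> complex"
  assumes f: "integrable lborel f" and g: "integrable lborel g"
  shows integrable_pair_product: "integrable (lborel \<Otimes>\<^sub>M lborel) (\<lambda>p. f (fst p) * g (snd p))"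
    and integral_pair_product: "(LINT p|(lborel \<Otimes>\<^sub>M lborel). f (fst p) * g (snd p)) = (LINT x|lborel. f x) * (LINT y|lborel. g y)"
proof -
  have [measurable]: "f \<in> borel_measurable borel" "g \<in> borel_measurable borel"
    using borel_measurable_integrable[OF f] borel_measurable_integrable[OF g] by simp_all
  have "integrable (lborel \<Otimes>\<^sub>M lborel) (\<lambda>(x, y). f x * g y)"
  proof (rule lborel_pair.Fubini_integrable)
    have "(LINT y|lborel. norm (case (x, y) of (x, y) \<Rightarrow> f x * g y)) = cmod (f x) * (LINT y|lborel. cmod (g y))" for x
      by (simp add: norm_mult)
    then show "integrable lborel (\<lambda>x. LINT y|lborel. norm (case (x, y) of (x, y) \<Rightarrow> f x * g y))" using f by simp
    show "AE x in lborel. integrable lborel (\<lambda>y. case (x, y) of (x, y) \<Rightarrow> f x * g y)" using g by simp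
  qed measurable
  then show i: "integrable (lborel \<Otimes>\<^sub>M lborel) (\<lambda>p. f (fst p) * g (snd p))" by (simp add: case_prod_unfold)
  have "(LINT p|(lborel \<Otimes>\<^sub>M lborel). f (fst p) * g (snd p)) = (LINT x|lborel. (LINT y|lborel. f x * g y))"
    using lborel_pair.integral_fst'[OF i] by simp
  then show "(LINT p|(lborel \<Otimes>\<^sub>M lborel). f (fst p) * g (snd p)) = (LINT x|lborel. f x) * (LINT y|lborel. g y)" by simp
qed

text \<open>
  The phase cancels the quadratic phase of the Schroedinger representation, so that the real and
  imaginary parts of \<open>w\<close> separate in its Weyl transform.
\<close>

definition test_factor :: "real \<Rightarrow> (real \<Rightarrow> complex) \<Rightarrow> (real \<Rightarrow> complex) \<Rightarrow> complex \<Rightarrow> complex" where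
  "test_factor lam p q w = p (Re w) * q (Im w) * iexp (- (lam * (Re w * Im w / 2)))"

lemma
  assumes u: "gevrey C R 0 u" and v: "gevrey C R 0 v"
  shows integrable_test_factor: "integrable lborel (test_factor lam (u 0) (v 0))"
    and integrable_test_factor_schroedinger1: "integrable lborel (\<lambda>w. test_factor lam (u 0) (v 0) w * schroedinger1 lam k w \<xi>)"
    and integral_test_factor_schroedinger1: "(LINT w|lborel. test_factor lam (u 0) (v 0) w * schroedinger1 lam k w \<xi>)
      = modulate lam (u 0) \<xi> * slide lam k (v 0) \<xi>"
proof -
  have cu: "continuous_on S (u 0)" and cv: "continuous_on S (v 0)" for S
    by (rule gevrey_continuous[OF u] gevrey_continuous[OF v])+
  have ct: "continuous_on UNIV (test_factor lam (u 0) (v 0))"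
    unfolding test_factor_def by (intro continuous_intros continuous_on_compose2[OF cu[of UNIV]] continuous_on_compose2[OF cv[of UNIV]]) auto
  have cs: "continuous_on UNIV (\<lambda>w. schroedinger1 lam k w \<xi>)"
    unfolding schroedinger1_def by (intro continuous_intros) auto
  have meas [measurable]: "test_factor lam (u 0) (v 0) \<in> borel_measurable borel" "(\<lambda>w. schroedinger1 lam k w \<xi>) \<in> borel_measurable borel"
    by (intro borel_measurable_continuous_onI ct cs)+
  have "integrable (lborel \<Otimes>\<^sub>M lborel) (\<lambda>p. u 0 (fst p) * v 0 (snd p))"
    by (intro integrable_pair_product gevrey_integrable[OF u] gevrey_integrable[OF v])
  then have "integrable (lborel \<Otimes>\<^sub>M lborel) (\<lambda>(x, y). test_factor lam (u 0) (v 0) (Complex x y))"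
  proof (rule Bochner_Integration.integrable_bound)
    have "(\<lambda>p. Complex (fst p) (snd p)) \<in> borel_measurable (borel \<Otimes>\<^sub>M borel)" unfolding Complex_eq by measurable
    then show "(\<lambda>(x, y). test_factor lam (u 0) (v 0) (Complex x y)) \<in> borel_measurable (lborel \<Otimes>\<^sub>M lborel)"
      unfolding case_prod_beta by measurable
  qed (simp add: test_factor_def norm_mult case_prod_beta)
  then show "integrable lborel (test_factor lam (u 0) (v 0))" by (subst integrable_complex_iff) simp_all
  define f where "f x = u 0 x * iexp (lam * (x * \<xi>))" for x
  define g where "g y = v 0 y * of_real (hermite1 lam k (\<xi> + y))" for y
  have f: "integrable lborel f" and g: "integrable lborel g"
    unfolding f_def g_def by (intro gevrey_integrable_times[OF u] gevrey_integrable_times[OF v] continuous_intros)+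
  have phase: "iexp (- (lam * (x * y / 2))) * iexp (lam * (x * \<xi> + x * y / 2)) = iexp (lam * (x * \<xi>))" for x y
  proof -
    have "- (lam * (x * y / 2)) + lam * (x * \<xi> + x * y / 2) = lam * (x * \<xi>)" by (simp add: distrib_left)
    then show ?thesis by (simp only: exp_add[symmetric] distrib_left[symmetric] of_real_add[symmetric])
  qed
  have eq: "test_factor lam (u 0) (v 0) (Complex x y) * schroedinger1 lam k (Complex x y) \<xi> = f x * g y" for x y
  proof -
    define E1 where "E1 = iexp (- (lam * (x * y / 2)))"
    define E2 where "E2 = iexp (lam * (x * \<xi> + x * y / 2))"
    define hh where "hh = complex_of_real (hermite1 lam k (\<xi> + y))"
    have "test_factor lam (u 0) (v 0) (Complex x y) * schroedinger1 lam k (Complex x y) \<xi> = (u 0 x * v 0 y * E1) * (E2 * hh)"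
      unfolding test_factor_def schroedinger1_def complex.sel E1_def E2_def hh_def ..
    also have "\<dots> = (u 0 x * (E1 * E2)) * (v 0 y * hh)" by (simp only: mult_ac)
    finally show ?thesis unfolding E1_def E2_def phase f_def g_def hh_def .
  qed
  show "integrable lborel (\<lambda>w. test_factor lam (u 0) (v 0) w * schroedinger1 lam k w \<xi>)"
    using integrable_pair_product[OF f g] by (subst integrable_complex_iff) (simp_all add: eq case_prod_unfold)
  have "(LINT w|lborel. test_factor lam (u 0) (v 0) w * schroedinger1 lam k w \<xi>) = (LINT p|(lborel \<Otimes>\<^sub>M lborel). f (fst p) * g (snd p))"
    by (subst integral_complex_eq) (simp_all add: eq)
  then show "(LINT w|lborel. test_factor lam (u 0) (v 0) w * schroedinger1 lam k w \<xi>) = modulate lam (u 0) \<xi> * slide lam k (v 0) \<xi>"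
    unfolding integral_pair_product[OF f g] unfolding f_def g_def modulate_def slide_def .
qed

lemma gevrey_mono:
  fixes u :: "nat \<Rightarrow> real \<Rightarrow> complex"
  assumes u: "gevrey C R j u" and "0 \<le> C" "C \<le> C'" "R \<le> R'"
  shows "gevrey C' R' j u"
proof -
  have "gevrey_bound C i \<le> gevrey_bound C' i" for i
    unfolding gevrey_bound_def using assms by (intro mult_right_mono power_mono) auto
  then show ?thesis using assms unfolding gevrey_def by (meson order_le_less_trans order_trans)
qed

text \<open>
  The largest \<open>x i\<close> carries the whole power of the sum.  Two of the powers that it can absorb, and two
  powers for each other coordinate, are spent on the summable factors \<open>1/(x j)\<^sup>2\<close>.
\<close>

lemma sum_power_times_prod_le:
  fixes x N :: "'n::finite \<Rightarrow> real"
  assumes x: "\<And>j. x j \<ge> 1" and N: "\<And>j. N j \<ge> 0"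
    and bound: "\<And>j m. x j ^ m * N j \<le> A * D ^ m * (fact (2 * m))\<^sup>2" and A: "A \<ge> 0" and D: "D \<ge> 0"
  shows "(\<Sum>j\<in>UNIV. x j) ^ k * (\<Prod>j\<in>UNIV. N j)
    \<le> ((A * D\<^sup>2 * 16 * (fact 4)\<^sup>2) * (\<Prod>j\<in>(UNIV :: 'n set). 1 + A * D\<^sup>2 * (fact 4)\<^sup>2) * 16) * (real CARD('n) * D * 16) ^ k * (fact (2 * k))\<^sup>2
      * (\<Prod>j\<in>UNIV. 1 / (x j)\<^sup>2)"
proof -
  define n where "n = real CARD('n)"
  obtain i where i: "\<And>j. x j \<le> x i"
  proof -
    have "Max (range x) \<in> range x" by (intro Max_in) auto
    then obtain i where "x i = Max (range x)" by (metis imageE)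
    then show thesis using that[of i] Max_ge[of "range x"] by auto
  qed
  have x0: "x j > 0" for j using x[of j] by simp
  have "(\<Sum>j\<in>UNIV. x j) \<le> (\<Sum>j\<in>(UNIV :: 'n set). x i)" using i by (intro sum_mono)
  also have "\<dots> = n * x i" by (simp add: n_def)
  finally have "(\<Sum>j\<in>UNIV. x j) ^ k \<le> (n * x i) ^ k" by (intro power_mono sum_nonneg less_imp_le[OF x0])
  then have 1: "(\<Sum>j\<in>UNIV. x j) ^ k * (\<Prod>j\<in>UNIV. N j) \<le> (n * x i) ^ k * (\<Prod>j\<in>UNIV. N j)"
    using N by (intro mult_right_mono prod_nonneg) auto
  have fact_le: "(fact (2 * (k + 2)) :: real)\<^sup>2 \<le> (2 ^ (2 * k + 4) * (fact (2 * k) * fact 4))\<^sup>2"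
  proof (rule power_mono)
    have "(2 * k + 4) choose (2 * k) \<le> 2 ^ (2 * k + 4)" by (rule binomial_le_pow2)
    then have "real ((2 * k + 4) choose (2 * k)) \<le> 2 ^ (2 * k + 4)" by (metis of_nat_le_iff of_nat_numeral of_nat_power)
    then have le: "(fact (2 * k) * fact 4) * real ((2 * k + 4) choose (2 * k)) \<le> (fact (2 * k) * fact 4) * (2 ^ (2 * k + 4) :: real)"
      by (rule mult_left_mono) simp
    have "fact (2 * k) * fact (2 * k + 4 - 2 * k) * ((2 * k + 4) choose (2 * k)) = (fact (2 * k + 4) :: nat)"
      by (rule binomial_fact_lemma) simp
    then have "real (fact (2 * k) * fact 4 * ((2 * k + 4) choose (2 * k))) = real (fact (2 * k + 4))"
      by (simp only: diff_add_inverse)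
    then have eq: "(fact (2 * k) * fact 4) * real ((2 * k + 4) choose (2 * k)) = (fact (2 * k + 4) :: real)"
      by (simp only: of_nat_mult of_nat_fact)
    have "2 * (k + 2) = 2 * k + 4" by simp
    then show "(fact (2 * (k + 2)) :: real) \<le> 2 ^ (2 * k + 4) * (fact (2 * k) * fact 4)"
      using le unfolding eq by (simp only: mult.commute)
  qed simp
  have p16: "((2::real) ^ (2 * k + 4))\<^sup>2 = 16 ^ k * 256"
  proof -
    have "(2::real) ^ (2 * k + 4) = 4 ^ k * 16" by (simp add: power_add power_mult)
    then have "((2::real) ^ (2 * k + 4))\<^sup>2 = (4 ^ k * 4 ^ k) * 256" by (simp add: power2_eq_square)
    also have "(4 ^ k * 4 ^ k :: real) = 16 ^ k" unfolding power_mult_distrib[symmetric] by simp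
    finally show ?thesis .
  qed
  have Ni: "x i ^ k * N i \<le> (A * D\<^sup>2 * 256 * (fact 4)\<^sup>2) * (D * 16) ^ k * (fact (2 * k))\<^sup>2 * (1 / (x i)\<^sup>2)"
  proof -
    have "x i ^ (k + 2) * N i \<le> A * D ^ (k + 2) * (fact (2 * (k + 2)))\<^sup>2" by (rule bound)
    also have "\<dots> \<le> A * D ^ (k + 2) * (2 ^ (2 * k + 4) * (fact (2 * k) * fact 4))\<^sup>2"
      using A D by (intro mult_left_mono fact_le) auto
    also have "\<dots> = (A * D\<^sup>2 * 256 * (fact 4)\<^sup>2) * (D * 16) ^ k * (fact (2 * k))\<^sup>2"
    proof -
      have "(2 ^ (2 * k + 4) * (fact (2 * k) * fact 4))\<^sup>2 = (16 ^ k * 256) * ((fact (2 * k))\<^sup>2 * (fact 4)\<^sup>2 :: real)"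
        by (simp only: power_mult_distrib p16)
      then show ?thesis by (simp only: power_add power_mult_distrib mult_ac)
    qed
    finally have "x i ^ k * N i * (x i)\<^sup>2 \<le> (A * D\<^sup>2 * 256 * (fact 4)\<^sup>2) * (D * 16) ^ k * (fact (2 * k))\<^sup>2"
      by (simp only: power_add mult_ac)
    then have "x i ^ k * N i \<le> (A * D\<^sup>2 * 256 * (fact 4)\<^sup>2) * (D * 16) ^ k * (fact (2 * k))\<^sup>2 / (x i)\<^sup>2"
      using x0[of i] by (subst pos_le_divide_eq) auto
    then show ?thesis by (simp only: times_divide_eq_right mult_1_right)
  qed
  have Nj: "N j \<le> (1 + A * D\<^sup>2 * (fact 4)\<^sup>2) * (1 / (x j)\<^sup>2)" for j
  proof -
    have "2 * 2 = (4 :: nat)" by simp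
    then have "(x j)\<^sup>2 * N j \<le> A * D\<^sup>2 * (fact 4)\<^sup>2" using bound[of j 2] by (simp only:)
    then have "N j \<le> A * D\<^sup>2 * (fact 4)\<^sup>2 / (x j)\<^sup>2" using x0[of j] by (subst pos_le_divide_eq) (auto simp: mult.commute)
    also have "\<dots> \<le> (1 + A * D\<^sup>2 * (fact 4)\<^sup>2) / (x j)\<^sup>2" by (intro divide_right_mono) auto
    finally show ?thesis by simp
  qed
  have "(n * x i) ^ k * (\<Prod>j\<in>UNIV. N j) = n ^ k * (x i ^ k * N i) * (\<Prod>j\<in>UNIV - {i}. N j)"
    by (subst prod.remove[of UNIV i]) (auto simp: power_mult_distrib)
  also have "\<dots> \<le> n ^ k * ((A * D\<^sup>2 * 256 * (fact 4)\<^sup>2) * (D * 16) ^ k * (fact (2 * k))\<^sup>2 * (1 / (x i)\<^sup>2))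
      * (\<Prod>j\<in>UNIV - {i}. (1 + A * D\<^sup>2 * (fact 4)\<^sup>2) * (1 / (x j)\<^sup>2))"
  proof (rule mult_mono)
    show "n ^ k * (x i ^ k * N i) \<le> n ^ k * ((A * D\<^sup>2 * 256 * (fact 4)\<^sup>2) * (D * 16) ^ k * (fact (2 * k))\<^sup>2 * (1 / (x i)\<^sup>2))"
      by (rule mult_left_mono[OF Ni]) (simp add: n_def)
    show "(\<Prod>j\<in>UNIV - {i}. N j) \<le> (\<Prod>j\<in>UNIV - {i}. (1 + A * D\<^sup>2 * (fact 4)\<^sup>2) * (1 / (x j)\<^sup>2))"
      by (rule prod_mono) (use N Nj in blast)
    show "0 \<le> n ^ k * ((A * D\<^sup>2 * 256 * (fact 4)\<^sup>2) * (D * 16) ^ k * (fact (2 * k))\<^sup>2 * (1 / (x i)\<^sup>2))"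
      using A D by (simp add: n_def)
    show "0 \<le> (\<Prod>j\<in>UNIV - {i}. N j)" using N by (intro prod_nonneg) auto
  qed
  also have "\<dots> = ((A * D\<^sup>2 * 256 * (fact 4)\<^sup>2) * (\<Prod>j\<in>UNIV - {i}. 1 + A * D\<^sup>2 * (fact 4)\<^sup>2)) * (n * D * 16) ^ k * (fact (2 * k))\<^sup>2
      * ((1 / (x i)\<^sup>2) * (\<Prod>j\<in>UNIV - {i}. 1 / (x j)\<^sup>2))"
    unfolding prod.distrib power_mult_distrib by (simp only: mult_ac)
  finally have 2: "(n * x i) ^ k * (\<Prod>j\<in>UNIV. N j) \<le> ((A * D\<^sup>2 * 256 * (fact 4)\<^sup>2) * (\<Prod>j\<in>UNIV - {i}. 1 + A * D\<^sup>2 * (fact 4)\<^sup>2))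
      * (n * D * 16) ^ k * (fact (2 * k))\<^sup>2 * ((1 / (x i)\<^sup>2) * (\<Prod>j\<in>UNIV - {i}. 1 / (x j)\<^sup>2))" .
  have "(\<Prod>j\<in>UNIV. 1 / (x j)\<^sup>2) = (1 / (x i)\<^sup>2) * (\<Prod>j\<in>UNIV - {i}. 1 / (x j)\<^sup>2)"
    by (rule prod.remove) simp_all
  then have 2: "(n * x i) ^ k * (\<Prod>j\<in>UNIV. N j) \<le> ((A * D\<^sup>2 * 256 * (fact 4)\<^sup>2) * (\<Prod>j\<in>UNIV - {i}. 1 + A * D\<^sup>2 * (fact 4)\<^sup>2))
      * ((n * D * 16) ^ k * (fact (2 * k))\<^sup>2 * (\<Prod>j\<in>UNIV. 1 / (x j)\<^sup>2))"
    using 2 by (simp only: mult.assoc)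
  have 3: "(\<Prod>j\<in>UNIV - {i}. 1 + A * D\<^sup>2 * (fact 4)\<^sup>2) \<le> (\<Prod>j\<in>(UNIV :: 'n set). 1 + A * D\<^sup>2 * (fact 4)\<^sup>2)"
    using A by (intro prod_mono2) auto
  have 4: "((A * D\<^sup>2 * 256 * (fact 4)\<^sup>2) * (\<Prod>j\<in>UNIV - {i}. 1 + A * D\<^sup>2 * (fact 4)\<^sup>2)) * ((n * D * 16) ^ k * (fact (2 * k))\<^sup>2 * (\<Prod>j\<in>UNIV. 1 / (x j)\<^sup>2))
      \<le> ((A * D\<^sup>2 * 256 * (fact 4)\<^sup>2) * (\<Prod>j\<in>(UNIV :: 'n set). 1 + A * D\<^sup>2 * (fact 4)\<^sup>2)) * ((n * D * 16) ^ k * (fact (2 * k))\<^sup>2 * (\<Prod>j\<in>UNIV. 1 / (x j)\<^sup>2))"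
    using A D by (intro mult_right_mono mult_left_mono 3 mult_nonneg_nonneg prod_nonneg) (auto simp: n_def)
  have ring: "((a * 16 * b) * p * 16) * r * s * t = ((a * 256 * b) * p) * (r * s * t)" for a b p r s t :: real by simp
  show ?thesis unfolding n_def[symmetric] ring by (rule order_trans[OF 1 order_trans[OF 2 4]])
qed

definition twist :: "real \<Rightarrow> complex ^ 'n::finite \<Rightarrow> complex" where
  "twist lam w = (\<Prod>j\<in>UNIV. iexp (lam * (Re (w $ j) * Im (w $ j) / 2)))"

text \<open>
  A tensor product of bump functions.  It is nonnegative only up to the unimodular factor \<open>twist\<close>,
  which does not matter when \<open>\<rho>\<close> shrinks to a point.
\<close>

lemma test_function_exists:
  fixes w0 :: "complex ^ 'n::finite"
  assumes lam: "lam \<noteq> 0" and \<delta>: "\<delta> > 0"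
  obtains \<rho> :: "complex ^ 'n \<Rightarrow> complex" and B :: "complex ^ 'n \<Rightarrow> real" and A D :: real where
    "integrable lborel \<rho>" "\<And>w. cnj (\<rho> w) = of_real (B w) * twist lam w" "\<And>w. B w \<ge> 0" "B w0 > 0"
    "continuous_on UNIV B" "\<And>w j. cmod (w $ j - w0 $ j) \<ge> 2 * \<delta> \<Longrightarrow> B w = 0" "A \<ge> 0" "D \<ge> 0"
    "\<And>\<alpha> k. hermite_eigenvalue lam \<alpha> ^ k * l2_norm (weyl lam \<rho> (scaled_hermite lam \<alpha>))
      \<le> A * D ^ k * (fact (2 * k))\<^sup>2 * (\<Prod>j\<in>UNIV. 1 / (2 * real (\<alpha> $ j) + 1)\<^sup>2)"
proof -
  have "\<exists>C u v. C \<ge> (\<bar>c\<bar> + \<delta>) + 1 \<and> gevrey C (\<bar>c\<bar> + \<delta>) 0 u \<and> (\<forall>x. u 0 x = of_real (v x)) \<and> (\<forall>x. v x \<ge> 0)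
      \<and> v c > 0 \<and> (\<forall>x. \<bar>x - c\<bar> \<ge> \<delta> \<longrightarrow> v x = 0)" for c
    using gevrey_bump_exists[OF \<delta>, of c] by metis
  then obtain C u v where
    C: "\<And>c. C c \<ge> (\<bar>c\<bar> + \<delta>) + 1" and u: "\<And>c. gevrey (C c) (\<bar>c\<bar> + \<delta>) 0 (u c)"
    and uv: "\<And>c x. u c 0 x = complex_of_real (v c x)" and v: "\<And>c x. v c x \<ge> 0" "\<And>c. v c c > 0"
    "\<And>c x. \<bar>x - c\<bar> \<ge> \<delta> \<Longrightarrow> v c x = 0"
    by metis
  define a where "a j = Re (w0 $ j)" for j
  define b where "b j = Im (w0 $ j)" for j
  define R where "R = (\<Sum>j\<in>UNIV. (\<bar>a j\<bar> + \<delta>) + (\<bar>b j\<bar> + \<delta>))"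
  define CC where "CC = (\<Sum>j\<in>UNIV. C (a j) + C (b j))"
  have C_pos: "C c \<ge> 0" for c using C[of c] \<delta> by linarith
  have R_ge: "\<bar>a j\<bar> + \<delta> \<le> R" "\<bar>b j\<bar> + \<delta> \<le> R" for j
    using member_le_sum[of j UNIV "\<lambda>j. (\<bar>a j\<bar> + \<delta>) + (\<bar>b j\<bar> + \<delta>)"] \<delta> by (auto simp: R_def)
  have CC_ge: "C (a j) \<le> CC" "C (b j) \<le> CC" for j
  proof -
    have "C (a j) + C (b j) \<le> CC"
      unfolding CC_def using C_pos by (intro member_le_sum[of j UNIV "\<lambda>j. C (a j) + C (b j)"]) (auto intro: add_nonneg_nonneg)
    then show "C (a j) \<le> CC" "C (b j) \<le> CC" using C_pos[of "a j"] C_pos[of "b j"] by linarith+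
  qed
  have R0: "R \<ge> 0" unfolding R_def using \<delta> by (intro sum_nonneg) auto
  have CC_R: "CC \<ge> R + 1"
  proof -
    have "R + 1 \<le> (\<Sum>j\<in>(UNIV :: 'n set). ((\<bar>a j\<bar> + \<delta>) + (\<bar>b j\<bar> + \<delta>)) + 1)"
      unfolding R_def sum.distrib[of _ "\<lambda>_. 1"] by (simp add: Suc_leI)
    also have "\<dots> \<le> CC" unfolding CC_def
    proof (intro sum_mono)
      fix j show "((\<bar>a j\<bar> + \<delta>) + (\<bar>b j\<bar> + \<delta>)) + 1 \<le> C (a j) + C (b j)" using C[of "a j"] C[of "b j"] by linarith
    qed
    finally show ?thesis .
  qed
  have ga: "gevrey CC R 0 (u (a j))" and gb: "gevrey CC R 0 (u (b j))" for j
    by (rule gevrey_mono[OF u C_pos CC_ge(1) R_ge(1)], rule gevrey_mono[OF u C_pos CC_ge(2) R_ge(2)])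
  define \<rho> where "\<rho> w = (\<Prod>j\<in>UNIV. test_factor lam (u (a j) 0) (u (b j) 0) (w $ j))" for w :: "complex ^ 'n"
  define B where "B w = (\<Prod>j\<in>UNIV. v (a j) (Re (w $ j)) * v (b j) (Im (w $ j)))" for w :: "complex ^ 'n"
  have 1: "integrable lborel \<rho>"
    unfolding \<rho>_def[abs_def] by (intro integrable_vec_prod integrable_test_factor[OF ga gb])
  have 2: "cnj (\<rho> w) = of_real (B w) * twist lam w" for w
    unfolding \<rho>_def B_def twist_def test_factor_def uv
    by (simp add: prod.distrib exp_cnj)
  have 3: "B w \<ge> 0" for w unfolding B_def using v(1) by (intro prod_nonneg) auto
  have 4: "B w0 > 0" unfolding B_def a_def b_def using v(2) by (intro prod_pos) auto
  have cv: "continuous_on S (v c)" for S c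
  proof -
    have "v c = (\<lambda>x. Re (u c 0 x))" by (simp add: uv)
    then show ?thesis using gevrey_continuous[OF u, of S c 0] by (simp add: continuous_on_Re)
  qed
  have 5: "continuous_on UNIV B"
    unfolding B_def by (intro continuous_intros continuous_on_compose2[OF cv[of UNIV]]) auto
  have 6: "B w = 0" if w: "cmod (w $ j - w0 $ j) \<ge> 2 * \<delta>" for w j
  proof -
    have "cmod (w $ j - w0 $ j) \<le> \<bar>Re (w $ j - w0 $ j)\<bar> + \<bar>Im (w $ j - w0 $ j)\<bar>" by (rule cmod_le)
    then have "\<bar>Re (w $ j) - a j\<bar> \<ge> \<delta> \<or> \<bar>Im (w $ j) - b j\<bar> \<ge> \<delta>" using w by (simp add: a_def b_def) linarith
    then have "v (a j) (Re (w $ j)) * v (b j) (Im (w $ j)) = 0" using v(3) by auto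
    then show ?thesis unfolding B_def by (intro prod_zero) auto
  qed
  define T where "T j k \<xi> = modulate lam (u (a j) 0) \<xi> * slide lam k (u (b j) 0) \<xi>" for j k \<xi>
  define D1 where "D1 = (2 + 2 * \<bar>lam\<bar> + lam\<^sup>2) * CC\<^sup>2 / \<bar>lam\<bar>"
  define A1 where "A1 = 2 * R * (2 * R)"
  have D1: "D1 \<ge> 0" and A1: "A1 \<ge> 0" using R0 by (auto simp: D1_def A1_def)
  have T: "T j k \<in> L2" "(2 * real k + 1) ^ m * l2_norm (T j k) \<le> A1 * D1 ^ m * (fact (2 * m))\<^sup>2" for j k m
    unfolding T_def[abs_def] A1_def D1_def by (rule modulate_slide_decay[OF ga gb CC_R R0 lam])+
  have weyl_eq: "weyl lam \<rho> (scaled_hermite lam \<alpha>) \<xi> = (\<Prod>j\<in>UNIV. T j (\<alpha> $ j) (\<xi> $ j))" for \<alpha> \<xi>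
  proof -
    have "weyl lam \<rho> (scaled_hermite lam \<alpha>) \<xi>
        = (LINT w|lborel. (\<Prod>j\<in>UNIV. (\<lambda>z. test_factor lam (u (a j) 0) (u (b j) 0) z * schroedinger1 lam (\<alpha> $ j) z (\<xi> $ j)) (w $ j)))"
      unfolding weyl_def \<rho>_def schroedinger_scaled_hermite by (simp only: prod.distrib)
    also have "\<dots> = (\<Prod>j\<in>UNIV. (LINT z|lborel. test_factor lam (u (a j) 0) (u (b j) 0) z * schroedinger1 lam (\<alpha> $ j) z (\<xi> $ j)))"
      by (rule integral_vec_prod) (rule integrable_test_factor_schroedinger1[OF ga gb])
    finally show ?thesis unfolding T_def integral_test_factor_schroedinger1[OF ga gb] .
  qed
  have norm_eq: "l2_norm (weyl lam \<rho> (scaled_hermite lam \<alpha>)) = (\<Prod>j\<in>UNIV. l2_norm (T j (\<alpha> $ j)))" for \<alpha>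
  proof -
    have "(l2_norm (weyl lam \<rho> (scaled_hermite lam \<alpha>)))\<^sup>2
        = (LINT \<xi>|lborel. (\<Prod>j\<in>UNIV. (\<lambda>x. (cmod (T j (\<alpha> $ j) x))\<^sup>2) ((\<xi> :: real ^ 'n) $ j)))"
      unfolding l2_norm_power2 weyl_eq by (simp only: prod_norm[symmetric] prod_power_distrib)
    also have "\<dots> = (\<Prod>j\<in>UNIV. (LINT x|lborel. (cmod (T j (\<alpha> $ j) x))\<^sup>2))"
      using T(1) by (intro integral_vec_prod) (simp add: L2_def)
    also have "\<dots> = (\<Prod>j\<in>UNIV. l2_norm (T j (\<alpha> $ j)))\<^sup>2"
      unfolding l2_norm_power2[symmetric] prod_power_distrib ..
    finally show ?thesis
      by (subst (asm) power2_eq_iff_nonneg) (auto intro!: l2_norm_nonneg prod_nonneg)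
  qed
  define A2 where "A2 = (A1 * D1\<^sup>2 * 16 * (fact 4)\<^sup>2) * (\<Prod>j\<in>(UNIV :: 'n set). 1 + A1 * D1\<^sup>2 * (fact 4)\<^sup>2) * 16"
  define D2 where "D2 = \<bar>lam\<bar> * (real CARD('n) * D1 * 16)"
  have 7: "A2 \<ge> 0" "D2 \<ge> 0" unfolding A2_def D2_def using A1 D1 by (auto intro!: mult_nonneg_nonneg prod_nonneg)
  have 8: "hermite_eigenvalue lam \<alpha> ^ k * l2_norm (weyl lam \<rho> (scaled_hermite lam \<alpha>))
      \<le> A2 * D2 ^ k * (fact (2 * k))\<^sup>2 * (\<Prod>j\<in>UNIV. 1 / (2 * real (\<alpha> $ j) + 1)\<^sup>2)" for \<alpha> k
  proof -
    have "hermite_eigenvalue lam \<alpha> = \<bar>lam\<bar> * (\<Sum>j\<in>UNIV. 2 * real (\<alpha> $ j) + 1)"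
      by (simp add: hermite_eigenvalue_def sum.distrib sum_distrib_left mult.commute)
    then have "hermite_eigenvalue lam \<alpha> ^ k * l2_norm (weyl lam \<rho> (scaled_hermite lam \<alpha>))
        = \<bar>lam\<bar> ^ k * ((\<Sum>j\<in>UNIV. 2 * real (\<alpha> $ j) + 1) ^ k * (\<Prod>j\<in>UNIV. l2_norm (T j (\<alpha> $ j))))"
      by (simp add: norm_eq power_mult_distrib)
    also have "\<dots> \<le> \<bar>lam\<bar> ^ k * (A2 * (real CARD('n) * D1 * 16) ^ k * (fact (2 * k))\<^sup>2 * (\<Prod>j\<in>UNIV. 1 / (2 * real (\<alpha> $ j) + 1)\<^sup>2))"
      unfolding A2_def using T(2) A1 D1 by (intro mult_left_mono sum_power_times_prod_le) (auto simp: l2_norm_nonneg)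
    finally show ?thesis unfolding D2_def power_mult_distrib by (simp only: mult_ac)
  qed
  show thesis by (rule that[OF 1 2 3 4 5 6 7 8])
qed

section \<open>Abel sums of the pairing and the twisted heat kernel\<close>

lemma l2_norm_scaled_hermite: "lam \<noteq> 0 \<Longrightarrow> l2_norm (scaled_hermite lam \<alpha>) = 1"
  using scaled_hermite_orthonormal[of lam \<alpha> \<alpha>]
  by (simp add: l2_norm_def l2_inner_def complex_norm_square[symmetric] integral_complex_of_real del: of_real_power)

lemma matrix_coeff_eq_l2_inner:
  assumes "lam \<noteq> 0"
  shows "matrix_coeff lam \<alpha> z w = l2_inner (schroedinger lam (z, 0) (scaled_hermite lam \<alpha>)) (schroedinger lam (w, 0) (scaled_hermite lam \<alpha>))"
  unfolding l2_inner_def by (rule integral_schroedinger_product[OF assms, symmetric])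

lemma cmod_matrix_coeff_le: "lam \<noteq> 0 \<Longrightarrow> cmod (matrix_coeff lam \<alpha> z w) \<le> 1"
  unfolding matrix_coeff_eq_l2_inner
  using cmod_l2_inner_le[OF schroedinger_L2(1)[OF scaled_hermite_L2] schroedinger_L2(1)[OF scaled_hermite_L2], of lam lam lam "(z, 0)" \<alpha> lam "(w, 0)" \<alpha>]
  by (simp add: schroedinger_L2(2) scaled_hermite_L2 l2_norm_scaled_hermite)

lemma schroedinger_scaled_hermite_measurable [measurable (raw)]:
  fixes z :: "'x \<Rightarrow> complex ^ 'n::finite" and \<xi> :: "'x \<Rightarrow> real ^ 'n"
  assumes [measurable]: "z \<in> borel_measurable M" "\<xi> \<in> borel_measurable M"
  shows "(\<lambda>x. schroedinger lam (z x, 0) (scaled_hermite lam \<alpha>) (\<xi> x)) \<in> borel_measurable M"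
proof -
  have [measurable]: "scaled_hermite lam \<alpha> \<in> borel_measurable borel"
    by (intro borel_measurable_continuous_onI continuous_intros)
  have "(\<lambda>x. (z x, 0 :: real)) \<in> borel_measurable M"
    unfolding borel_prod[symmetric] by measurable
  then show ?thesis by (intro schroedinger_measurable) measurable
qed

lemma matrix_coeff_measurable:
  fixes \<alpha> :: "nat ^ 'n::finite"
  assumes "lam \<noteq> 0"
  shows "(\<lambda>p. matrix_coeff lam \<alpha> (fst p) (snd p)) \<in> borel_measurable (lborel \<Otimes>\<^sub>M lborel)"
proof -
  have "(\<lambda>(p, \<xi>). schroedinger lam (fst p, 0) (scaled_hermite lam \<alpha>) \<xi> * cnj (schroedinger lam (snd p, 0) (scaled_hermite lam \<alpha>) \<xi>))
      \<in> borel_measurable ((lborel \<Otimes>\<^sub>M lborel) \<Otimes>\<^sub>M lborel)"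
    by measurable
  then show ?thesis
    unfolding matrix_coeff_eq_l2_inner[OF assms] l2_inner_def by (rule lborel.borel_measurable_lebesgue_integral)
qed

lemma scaled_hermite_bounded:
  fixes \<alpha> :: "nat ^ 'n::finite"
  obtains C where "\<And>\<xi>. cmod (scaled_hermite lam \<alpha> \<xi>) \<le> C"
proof -
  obtain c where c: "\<And>k u. \<bar>hermite1 lam k u\<bar> \<le> c k" using hermite1_bounded by metis
  have "cmod (scaled_hermite lam \<alpha> \<xi>) \<le> (\<Prod>j\<in>UNIV. c (\<alpha> $ j))" for \<xi>
    unfolding scaled_hermite_eq_prod norm_of_real abs_prod by (intro prod_mono conjI c) auto
  then show thesis by (rule that)
qed

lemma l2_inner_weyl:
  fixes F \<rho> :: "complex ^ 'n::finite \<Rightarrow> complex" and \<alpha> :: "nat ^ 'n"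
  assumes lam: "lam \<noteq> 0" and F: "integrable lborel F" and \<rho>: "integrable lborel \<rho>"
  shows "l2_inner (weyl lam F (scaled_hermite lam \<alpha>)) (weyl lam \<rho> (scaled_hermite lam \<alpha>))
    = (LINT p|(lborel \<Otimes>\<^sub>M lborel). F (fst p) * cnj (\<rho> (snd p)) * matrix_coeff lam \<alpha> (fst p) (snd p))"
proof -
  define \<pi> where "\<pi> z \<xi> = schroedinger lam (z, 0) (scaled_hermite lam \<alpha>) \<xi>" for z \<xi>
  have [measurable]: "F \<in> borel_measurable borel" "\<rho> \<in> borel_measurable borel"
    using borel_measurable_integrable[OF F] borel_measurable_integrable[OF \<rho>] by simp_all
  interpret P: pair_sigma_finite "lborel \<Otimes>\<^sub>M lborel :: ((complex ^ 'n) \<times> (complex ^ 'n)) measure" "lborel :: (real ^ 'n) measure"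
    unfolding lborel_prod ..
  define k where "k p \<xi> = F (fst p) * cnj (\<rho> (snd p)) * (\<pi> (fst p) \<xi> * cnj (\<pi> (snd p) \<xi>))" for p \<xi>
  have k_meas: "(\<lambda>(p, \<xi>). k p \<xi>) \<in> borel_measurable ((lborel \<Otimes>\<^sub>M lborel) \<Otimes>\<^sub>M lborel)"
    unfolding k_def \<pi>_def by measurable
  have \<pi>_L2: "\<pi> z \<in> L2" "l2_norm (\<pi> z) = 1" for z
    unfolding \<pi>_def[abs_def] using schroedinger_L2[OF scaled_hermite_L2[OF lam, of \<alpha>], of lam "(z, 0)"] l2_norm_scaled_hermite[OF lam] by simp_all
  have \<rho>': "integrable lborel (\<lambda>w. cnj (\<rho> w))" using \<rho> by simp
  have int: "integrable ((lborel \<Otimes>\<^sub>M lborel) \<Otimes>\<^sub>M lborel) (\<lambda>(p, \<xi>). k p \<xi>)"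
  proof (rule P.Fubini_integrable[OF k_meas])
    show "integrable (lborel \<Otimes>\<^sub>M lborel) (\<lambda>p. LINT \<xi>|lborel. norm (case (p, \<xi>) of (p, \<xi>) \<Rightarrow> k p \<xi>))"
    proof (rule Bochner_Integration.integrable_bound[OF integrable_pair_product[OF F \<rho>']])
      show "(\<lambda>p. LINT \<xi>|lborel. norm (case (p, \<xi>) of (p, \<xi>) \<Rightarrow> k p \<xi>)) \<in> borel_measurable (lborel \<Otimes>\<^sub>M lborel)"
        by (rule lborel.borel_measurable_lebesgue_integral) (use k_meas in \<open>simp add: case_prod_beta\<close>)
      show "AE p in lborel \<Otimes>\<^sub>M lborel. norm (LINT \<xi>|lborel. norm (case (p, \<xi>) of (p, \<xi>) \<Rightarrow> k p \<xi>)) \<le> norm (F (fst p) * cnj (\<rho> (snd p)))"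
      proof (intro AE_I2)
        fix p :: "(complex ^ 'n) \<times> (complex ^ 'n)"
        have "(LINT \<xi>|lborel. cmod (k p \<xi>)) = cmod (F (fst p) * cnj (\<rho> (snd p))) * (LINT \<xi>|lborel. cmod (\<pi> (fst p) \<xi>) * cmod (\<pi> (snd p) \<xi>))"
          unfolding k_def norm_mult complex_mod_cnj by (rule integral_mult_right_zero)
        also have "\<dots> \<le> cmod (F (fst p) * cnj (\<rho> (snd p))) * 1"
          using l2_Cauchy_Schwarz[OF \<pi>_L2(1) \<pi>_L2(1), of "fst p" "snd p"] by (intro mult_left_mono) (simp_all add: \<pi>_L2)
        finally show "norm (LINT \<xi>|lborel. norm (case (p, \<xi>) of (p, \<xi>) \<Rightarrow> k p \<xi>)) \<le> norm (F (fst p) * cnj (\<rho> (snd p)))" by simp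
      qed
    qed
    show "AE p in lborel \<Otimes>\<^sub>M lborel. integrable lborel (\<lambda>\<xi>. case (p, \<xi>) of (p, \<xi>) \<Rightarrow> k p \<xi>)"
      unfolding prod.case k_def by (intro AE_I2 integrable_mult_right integrable_L2_product \<pi>_L2)
  qed
  have \<pi>_int: "integrable lborel (\<lambda>z. H z * \<pi> z \<xi>)" if H: "integrable lborel H" for H \<xi>
  proof -
    obtain C where C: "\<And>\<xi>. cmod (scaled_hermite lam \<alpha> \<xi>) \<le> C" using scaled_hermite_bounded by blast
    have [measurable]: "H \<in> borel_measurable borel" using borel_measurable_integrable[OF H] by simp
    have "integrable lborel (\<lambda>z. C * cmod (H z))" using H by simp
    then show ?thesis
    proof (rule Bochner_Integration.integrable_bound)
      show "(\<lambda>z. H z * \<pi> z \<xi>) \<in> borel_measurable lborel" unfolding \<pi>_def by measurable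
      have "C \<ge> 0" using C norm_ge_zero order_trans by blast
      show "AE z in lborel. norm (H z * \<pi> z \<xi>) \<le> norm (C * cmod (H z))"
      proof (intro AE_I2)
        fix z
        have "cmod (H z) * cmod (scaled_hermite lam \<alpha> (\<xi> + im_vec z)) \<le> cmod (H z) * C" by (intro mult_left_mono C) simp
        then show "norm (H z * \<pi> z \<xi>) \<le> norm (C * cmod (H z))"
          using \<open>C \<ge> 0\<close> by (simp add: norm_mult \<pi>_def cmod_schroedinger abs_mult mult.commute)
      qed
    qed
  qed
  have "weyl lam F (scaled_hermite lam \<alpha>) \<xi> * cnj (weyl lam \<rho> (scaled_hermite lam \<alpha>) \<xi>) = (LINT p|(lborel \<Otimes>\<^sub>M lborel). k p \<xi>)" for \<xi>
  proof -
    have c: "integrable lborel (\<lambda>w. cnj (\<rho> w * \<pi> w \<xi>))" by (rule integrable_bounded_linear[OF bounded_linear_cnj \<pi>_int[OF \<rho>]])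
    have "weyl lam F (scaled_hermite lam \<alpha>) \<xi> * cnj (weyl lam \<rho> (scaled_hermite lam \<alpha>) \<xi>)
        = (LINT z|lborel. F z * \<pi> z \<xi>) * (LINT w|lborel. cnj (\<rho> w * \<pi> w \<xi>))"
      unfolding weyl_def \<pi>_def integral_cnj ..
    also have "\<dots> = (LINT p|(lborel \<Otimes>\<^sub>M lborel). (F (fst p) * \<pi> (fst p) \<xi>) * cnj (\<rho> (snd p) * \<pi> (snd p) \<xi>))"
      by (rule integral_pair_product[OF \<pi>_int[OF F] c, symmetric])
    finally show ?thesis by (simp add: k_def mult_ac)
  qed
  then have "l2_inner (weyl lam F (scaled_hermite lam \<alpha>)) (weyl lam \<rho> (scaled_hermite lam \<alpha>)) = (LINT \<xi>|lborel. (LINT p|(lborel \<Otimes>\<^sub>M lborel). k p \<xi>))"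
    unfolding l2_inner_def by (simp only:)
  also have "\<dots> = (LINT p|(lborel \<Otimes>\<^sub>M lborel). (LINT \<xi>|lborel. k p \<xi>))" by (rule P.Fubini_integral[OF int])
  also have "\<dots> = (LINT p|(lborel \<Otimes>\<^sub>M lborel). F (fst p) * cnj (\<rho> (snd p)) * matrix_coeff lam \<alpha> (fst p) (snd p))"
    unfolding k_def integral_mult_right_zero \<pi>_def integral_schroedinger_product[OF lam] ..
  finally show ?thesis .
qed

text \<open>
  The matrix coefficients are bounded by \<open>1\<close>, so the geometric weight makes sum and integral
  interchangeable and the inner sum is the heat kernel.
\<close>

lemma abel_sum_l2_inner_weyl:
  fixes F \<rho> :: "complex ^ 'n::finite \<Rightarrow> complex"
  assumes lam: "lam \<noteq> 0" and F: "integrable lborel F" and \<rho>: "integrable lborel \<rho>" and r: "0 \<le> r" "r < 1"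
  shows "(LINT \<alpha>|count_space UNIV. of_real (r ^ (\<Sum>j\<in>UNIV. \<alpha> $ j))
      * l2_inner (weyl lam F (scaled_hermite lam \<alpha>)) (weyl lam \<rho> (scaled_hermite lam \<alpha>)))
    = (LINT p|(lborel \<Otimes>\<^sub>M lborel). F (fst p) * cnj (\<rho> (snd p)) * heat_kernel lam r (fst p) (snd p))"
proof -
  let ?N = "count_space UNIV :: (nat ^ 'n) measure"
  let ?L = "lborel \<Otimes>\<^sub>M lborel :: ((complex ^ 'n) \<times> (complex ^ 'n)) measure"
  interpret N: sigma_finite_measure ?N by (rule sigma_finite_measure_count_space)
  interpret L: sigma_finite_measure ?L unfolding lborel_prod ..
  interpret P: pair_sigma_finite ?N ?L ..
  define H where "H p = F (fst p) * cnj (\<rho> (snd p))" for p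
  define g where "g \<alpha> p = of_real (r ^ (\<Sum>j\<in>UNIV. \<alpha> $ j)) * (H p * matrix_coeff lam \<alpha> (fst p) (snd p))" for \<alpha> :: "nat ^ 'n" and p
  have H: "integrable ?L H" unfolding H_def using F \<rho> by (intro integrable_pair_product) simp_all
  then have H_meas: "H \<in> borel_measurable ?L" by simp
  have g_meas: "(\<lambda>p. g \<alpha> p) \<in> borel_measurable ?L" for \<alpha>
    unfolding g_def using H_meas matrix_coeff_measurable[OF lam, of \<alpha>] by measurable
  have g_le: "cmod (g \<alpha> p) \<le> r ^ (\<Sum>j\<in>UNIV. \<alpha> $ j) * cmod (H p)" for \<alpha> p
  proof -
    have "cmod (H p) * cmod (matrix_coeff lam \<alpha> (fst p) (snd p)) \<le> cmod (H p) * 1"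
      by (intro mult_left_mono cmod_matrix_coeff_le lam) auto
    then show ?thesis using r unfolding g_def by (simp add: norm_mult norm_power mult_left_mono)
  qed
  have g_int: "integrable ?L (g \<alpha>)" for \<alpha>
  proof (rule Bochner_Integration.integrable_bound[OF _ g_meas])
    show "integrable ?L (\<lambda>p. r ^ (\<Sum>j\<in>UNIV. \<alpha> $ j) * cmod (H p))" using H by simp
    show "AE p in ?L. norm (g \<alpha> p) \<le> norm (r ^ (\<Sum>j\<in>UNIV. \<alpha> $ j) * cmod (H p))"
      using g_le r by (intro AE_I2) (simp add: abs_mult)
  qed
  have geom: "integrable ?N (\<lambda>\<alpha>. r ^ (\<Sum>j\<in>UNIV. \<alpha> $ j))"
  proof -
    have "integrable (count_space UNIV) (\<lambda>k. r ^ k)"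
      using r by (simp add: integrable_count_space_nat_iff norm_power)
    then have "integrable ?N (\<lambda>\<alpha>. \<Prod>j\<in>UNIV. (\<lambda>k. r ^ k) (\<alpha> $ j))" by (rule integrable_multiindex_prod)
    then show ?thesis by (simp add: power_sum)
  qed
  have int: "integrable (?N \<Otimes>\<^sub>M ?L) (\<lambda>(\<alpha>, p). g \<alpha> p)"
  proof (rule P.Fubini_integrable)
    show "(\<lambda>(\<alpha>, p). g \<alpha> p) \<in> borel_measurable (?N \<Otimes>\<^sub>M ?L)"
      by (rule measurable_pair_measure_countable1) (use g_meas in auto)
    show "integrable ?N (\<lambda>\<alpha>. LINT p|?L. norm (case (\<alpha>, p) of (\<alpha>, p) \<Rightarrow> g \<alpha> p))"
    proof (rule Bochner_Integration.integrable_bound)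
      show "integrable ?N (\<lambda>\<alpha>. r ^ (\<Sum>j\<in>UNIV. \<alpha> $ j) * (LINT p|?L. cmod (H p)))" using geom by simp
      show "AE \<alpha> in ?N. norm (LINT p|?L. norm (case (\<alpha>, p) of (\<alpha>, p) \<Rightarrow> g \<alpha> p)) \<le> norm (r ^ (\<Sum>j\<in>UNIV. \<alpha> $ j) * (LINT p|?L. cmod (H p)))"
      proof (intro AE_I2)
        fix \<alpha> :: "nat ^ 'n"
        have "(LINT p|?L. cmod (g \<alpha> p)) \<le> (LINT p|?L. r ^ (\<Sum>j\<in>UNIV. \<alpha> $ j) * cmod (H p))"
          using g_int H g_le by (intro integral_mono integrable_norm integrable_mult_right) auto
        then show "norm (LINT p|?L. norm (case (\<alpha>, p) of (\<alpha>, p) \<Rightarrow> g \<alpha> p)) \<le> norm (r ^ (\<Sum>j\<in>UNIV. \<alpha> $ j) * (LINT p|?L. cmod (H p)))"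
          using r by (simp add: abs_mult)
      qed
    qed simp
    show "AE \<alpha> in ?N. integrable ?L (\<lambda>p. case (\<alpha>, p) of (\<alpha>, p) \<Rightarrow> g \<alpha> p)" using g_int by simp
  qed
  have "(LINT \<alpha>|?N. of_real (r ^ (\<Sum>j\<in>UNIV. \<alpha> $ j)) * l2_inner (weyl lam F (scaled_hermite lam \<alpha>)) (weyl lam \<rho> (scaled_hermite lam \<alpha>)))
      = (LINT \<alpha>|?N. (LINT p|?L. g \<alpha> p))"
    unfolding l2_inner_weyl[OF lam F \<rho>] g_def H_def integral_mult_right_zero ..
  also have "\<dots> = (LINT p|?L. (LINT \<alpha>|?N. g \<alpha> p))" by (rule P.Fubini_integral[OF int, symmetric])
  also have "\<dots> = (LINT p|?L. H p * heat_kernel lam r (fst p) (snd p))"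
  proof (intro Bochner_Integration.integral_cong refl)
    fix p
    have "(LINT \<alpha>|?N. g \<alpha> p) = (LINT \<alpha>|?N. H p * (of_real (r ^ (\<Sum>j\<in>UNIV. \<alpha> $ j)) * matrix_coeff lam \<alpha> (fst p) (snd p)))"
      unfolding g_def by (simp only: mult_ac)
    then show "(LINT \<alpha>|?N. g \<alpha> p) = H p * heat_kernel lam r (fst p) (snd p)"
      unfolding integral_mult_right_zero integral_matrix_coeff[OF lam r] .
  qed
  finally show ?thesis unfolding H_def .
qed

text \<open>
  Expanding the square in the Gaussian exhibits the dependence on \<open>w\<close> as an exponential of a form
  that is linear in \<open>z\<close> and in \<open>w\<close>.
\<close>

lemma heat_kernel_eq:
  fixes z w :: "complex ^ 'n::finite" and lam r :: real
  defines "\<kappa> \<equiv> \<bar>lam\<bar> * (1 + r) / (4 * (1 - r))"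
  shows "heat_kernel lam r z w = of_real (exp (- \<kappa> * (norm z)\<^sup>2) * (exp (- \<kappa> * (norm w)\<^sup>2) / (1 - r) ^ CARD('n)))
    * exp (of_real (2 * \<kappa> * (z \<bullet> w)) + \<i> * of_real (lam / 2 * (z \<bullet> (\<i> *s w))))"
proof -
  have n: "(norm x)\<^sup>2 = (\<Sum>j\<in>UNIV. (cmod (x $ j))\<^sup>2)" for x :: "complex ^ 'n"
    by (simp add: norm_vec_def L2_set_def sum_nonneg)
  have phase: "iexp (lam / 2 * (z \<bullet> (\<i> *s w))) = (\<Prod>j\<in>UNIV. iexp (lam / 2 * (Re (w $ j) * Im (z $ j) - Re (z $ j) * Im (w $ j))))"
  proof -
    have "lam / 2 * (z \<bullet> (\<i> *s w)) = (\<Sum>j\<in>UNIV. lam / 2 * (Re (w $ j) * Im (z $ j) - Re (z $ j) * Im (w $ j)))"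
      by (simp add: inner_vec_def inner_complex_def sum_distrib_left mult.commute)
    then show ?thesis by (simp only: of_real_sum sum_distrib_left exp_sum[OF finite_class.finite_UNIV])
  qed
  have "(\<Prod>j\<in>UNIV. exp (- (\<kappa> * (cmod (z $ j - w $ j))\<^sup>2)) / (1 - r)) = exp (- (\<kappa> * (norm (z - w))\<^sup>2)) / (1 - r) ^ CARD('n)"
    unfolding n by (simp add: prod_dividef exp_sum sum_distrib_left sum_negf[symmetric])
  then have polar: "heat_kernel lam r z w = iexp (lam / 2 * (z \<bullet> (\<i> *s w))) * of_real (exp (- (\<kappa> * (norm (z - w))\<^sup>2)) / (1 - r) ^ CARD('n))"
    unfolding heat_kernel_def heat_kernel1_def \<kappa>_def[symmetric] prod.distrib phase of_real_prod[symmetric] by (simp only:)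
  have gauss: "exp (- (\<kappa> * (norm (z - w))\<^sup>2)) = exp (- \<kappa> * (norm z)\<^sup>2) * (exp (- \<kappa> * (norm w)\<^sup>2) * exp (2 * \<kappa> * (z \<bullet> w)))"
    unfolding exp_add[symmetric]
    by (rule arg_cong[where f = exp]) (simp add: power2_norm_eq_inner inner_diff_left inner_diff_right inner_commute algebra_simps)
  have split: "exp (of_real (2 * \<kappa> * (z \<bullet> w)) + \<i> * of_real (lam / 2 * (z \<bullet> (\<i> *s w))))
      = of_real (exp (2 * \<kappa> * (z \<bullet> w))) * iexp (lam / 2 * (z \<bullet> (\<i> *s w)))"
    by (simp only: exp_add exp_of_real)
  show ?thesis
    unfolding polar gauss split by (simp only: of_real_mult of_real_divide times_divide_eq_left times_divide_eq_right mult_ac)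
qed

text \<open>
  The integral is an entire function of \<open>s\<close>, as is seen from its power series.
\<close>

lemma exponential_family_vanishes:
  fixes h c :: "'a \<Rightarrow> complex"
  assumes h: "integrable M h" and c [measurable]: "c \<in> borel_measurable M"
    and exp_int: "\<And>R. integrable M (\<lambda>z. exp (R * cmod (c z)) * cmod (h z))"
    and \<epsilon>: "\<epsilon> > 0" and zero: "\<And>t. \<bar>t\<bar> < \<epsilon> \<Longrightarrow> (LINT z|M. exp (of_real t * c z) * h z) = 0"
  shows "(LINT z|M. exp (s * c z) * h z) = 0"
proof -
  have [measurable]: "h \<in> borel_measurable M" using h by simp
  define a where "a k = (LINT z|M. c z ^ k / fact k * h z)" for k
  define g where "g s = (LINT z|M. exp (s * c z) * h z)" for s
  have sums: "(\<lambda>k. a k * s ^ k) sums g s" for s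
  proof -
    define f where "f k z = (s * c z) ^ k / fact k * h z" for k z
    have f_meas: "f k \<in> borel_measurable M" for k unfolding f_def by measurable
    have le: "(\<Sum>k<n. cmod (f k z)) \<le> exp (cmod s * cmod (c z)) * cmod (h z)" for n z
    proof -
      have "(\<Sum>k<n. (cmod s * cmod (c z)) ^ k /\<^sub>R fact k) \<le> exp (cmod s * cmod (c z))"
        unfolding exp_def by (rule sum_le_suminf[OF summable_exp_generic]) auto
      then have "(\<Sum>k<n. (cmod s * cmod (c z)) ^ k /\<^sub>R fact k) * cmod (h z) \<le> exp (cmod s * cmod (c z)) * cmod (h z)"
        by (rule mult_right_mono) simp
      then show ?thesis
        by (simp add: f_def norm_mult norm_divide norm_inverse norm_power sum_distrib_left sum_distrib_right divide_inverse mult_ac)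
    qed
    have f_le: "cmod (f k z) \<le> exp (cmod s * cmod (c z)) * cmod (h z)" for k z
    proof -
      have "cmod (f k z) \<le> (\<Sum>k<Suc k. cmod (f k z))" by (simp add: sum_nonneg)
      then show ?thesis using le[of z "Suc k"] by linarith
    qed
    have f_int: "integrable M (f k)" for k
    proof (rule Bochner_Integration.integrable_bound[OF exp_int[of "cmod s"] f_meas], intro AE_I2)
      fix z
      show "norm (f k z) \<le> norm (exp (cmod s * cmod (c z)) * cmod (h z))"
        using f_le[of k z] unfolding real_norm_def by (rule order_trans[OF _ abs_ge_self])
    qed
    have "summable (\<lambda>k. LINT z|M. cmod (f k z))"
    proof (rule summableI_nonneg_bounded)
      fix n
      have "(\<Sum>k<n. LINT z|M. cmod (f k z)) = (LINT z|M. (\<Sum>k<n. cmod (f k z)))"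
        by (rule Bochner_Integration.integral_sum[symmetric]) (use f_int in simp)
      also have "\<dots> \<le> (LINT z|M. exp (cmod s * cmod (c z)) * cmod (h z))"
        using f_int le exp_int[of "cmod s"] by (intro integral_mono) auto
      finally show "(\<Sum>k<n. LINT z|M. cmod (f k z)) \<le> (LINT z|M. exp (cmod s * cmod (c z)) * cmod (h z))" .
    qed simp
    moreover have "AE z in M. summable (\<lambda>k. norm (f k z))"
      by (intro AE_I2 summableI_nonneg_bounded[OF _ le]) simp
    ultimately have "(\<lambda>k. LINT z|M. f k z) sums (LINT z|M. (\<Sum>k. f k z))"
      using f_int by (intro sums_integral) auto
    moreover have "(\<Sum>k. f k z) = exp (s * c z) * h z" for z
    proof -
      have "(\<lambda>k. (s * c z) ^ k /\<^sub>R fact k * h z) sums (exp (s * c z) * h z)" by (intro sums_mult2 exp_converges)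
      moreover have "(s * c z) ^ k /\<^sub>R fact k * h z = f k z" for k by (simp add: f_def scaleR_conv_of_real divide_inverse)
      ultimately show ?thesis by (simp add: sums_iff)
    qed
    moreover have "(LINT z|M. f k z) = a k * s ^ k" for k
    proof -
      have "(LINT z|M. f k z) = (LINT z|M. (c z ^ k / fact k * h z) * s ^ k)"
        unfolding f_def by (intro Bochner_Integration.integral_cong refl) (simp add: power_mult_distrib)
      then show ?thesis unfolding a_def integral_mult_left_zero .
    qed
    ultimately show ?thesis by (simp add: g_def)
  qed
  have hol: "g holomorphic_on ball 0 R" for R
    by (rule power_series_holomorphic[where a = a]) (use sums in simp)
  define r where "r = cmod s + \<epsilon>"
  have "g s = 0"
  proof (rule analytic_continuation[OF hol, of r "of_real ` {t. \<bar>t\<bar> < \<epsilon>}" 0])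
    show "(0 :: complex) islimpt of_real ` {t. \<bar>t\<bar> < \<epsilon>}"
      unfolding islimpt_approachable
    proof (intro allI impI)
      fix e :: real assume e: "e > 0"
      have "of_real (min e \<epsilon> / 2) \<in> complex_of_real ` {t. \<bar>t\<bar> < \<epsilon>}" using e \<epsilon> by (intro imageI) simp
      then show "\<exists>x'\<in>complex_of_real ` {t. \<bar>t\<bar> < \<epsilon>}. x' \<noteq> 0 \<and> dist x' 0 < e"
        using e \<epsilon> by (intro bexI[of _ "of_real (min e \<epsilon> / 2)"]) (auto simp: min_def)
    qed
    show "g z = 0" if "z \<in> of_real ` {t. \<bar>t\<bar> < \<epsilon>}" for z using that zero by (auto simp: g_def)
    show "complex_of_real ` {t. \<bar>t\<bar> < \<epsilon>} \<subseteq> ball 0 r" using \<epsilon> by (auto simp: r_def intro!: add_strict_increasing2)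
  qed (use \<epsilon> in \<open>auto simp: r_def add_nonneg_pos\<close>)
  then show ?thesis by (simp add: g_def)
qed

text \<open>
  After removal of a factor depending on \<open>w\<close> only, the transform is
  \<open>\<integral> exp (L z w) H z dz\<close> with \<open>H\<close> of Gaussian decay and \<open>L\<close> real-bilinear with complex values.
  It extends holomorphically to \<open>w = A + \<i> B\<close>, and the linear system \<open>L z A + \<i> L z B = \<i> (v \<bullet> z)\<close>
  is solvable because its determinant is proportional to \<open>(4 \<kappa>)\<^sup>2 - \<lambda>\<^sup>2\<close>, which is positive.
  The extension is carried out along two real lines, first towards \<open>A\<close> and then in the direction of
  \<open>\<i> B\<close>.
\<close>

lemma AE_zero_if_heat_transform_vanishes:
  fixes F :: "complex ^ 'n::finite \<Rightarrow> complex"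
  assumes lam: "lam \<noteq> 0" and F: "integrable lborel F" and r: "0 < r" "r < 1"
    and U: "open U" "w0 \<in> U" and zero: "\<And>w. w \<in> U \<Longrightarrow> (LINT z|lborel. F z * heat_kernel lam r z w) = 0"
  shows "AE z in lborel. F z = 0"
proof -
  have [measurable]: "F \<in> borel_measurable borel" using borel_measurable_integrable[OF F] by simp
  define \<kappa> where "\<kappa> = \<bar>lam\<bar> * (1 + r) / (4 * (1 - r))"
  have \<kappa>: "\<kappa> > 0" using lam r by (simp add: \<kappa>_def)
  have "4 * \<kappa> > \<bar>lam\<bar>"
  proof -
    have "4 * \<kappa> = \<bar>lam\<bar> * ((1 + r) / (1 - r))" using r by (simp add: \<kappa>_def field_simps)
    moreover have "(1 + r) / (1 - r) > 1" using r by (simp add: less_divide_eq)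
    then have "\<bar>lam\<bar> * 1 < \<bar>lam\<bar> * ((1 + r) / (1 - r))" using lam by (intro mult_strict_left_mono) auto
    ultimately show ?thesis by (simp only: mult_1_right)
  qed
  then have "(4 * \<kappa>)\<^sup>2 > \<bar>lam\<bar>\<^sup>2" by (intro power_strict_mono) auto
  \<comment> \<open>the determinant of the linear system for the complex point, up to a factor\<close>
  define D where "D = 2 * \<kappa> - lam\<^sup>2 / (8 * \<kappa>)"
  have D: "D \<noteq> 0"
    using \<open>(4 * \<kappa>)\<^sup>2 > \<bar>lam\<bar>\<^sup>2\<close> \<kappa> by (simp add: D_def field_simps power2_eq_square)
  define J where "J w = \<i> *s w" for w :: "complex ^ 'n"
  have J_add: "J (v + w) = J v + J w" and J_scale: "J (t *\<^sub>R w) = t *\<^sub>R J w" and J_J: "J (J w) = - w" for v w t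
    by (simp_all add: J_def vec_eq_iff distrib_left)
  have J_norm: "norm (J w) = norm w" for w by (simp add: J_def norm_vec_def norm_mult)
  define L where "L z w = of_real (2 * \<kappa> * (z \<bullet> w)) + \<i> * of_real (lam / 2 * (z \<bullet> J w))" for z w
  have L_add: "L z (v + w) = L z v + L z w" and L_scale: "L z (t *\<^sub>R w) = of_real t * L z w" for z v w t
    by (simp_all add: L_def J_add J_scale inner_add_right algebra_simps)
  have L_meas [measurable]: "(\<lambda>z. L z w) \<in> borel_measurable borel" for w
    unfolding L_def by (intro borel_measurable_continuous_onI continuous_intros)
  have L_le: "cmod (L z w) \<le> (2 * \<kappa> + \<bar>lam\<bar>) * norm w * norm z" for z w
  proof -
    have "cmod (L z w) \<le> \<bar>2 * \<kappa> * (z \<bullet> w)\<bar> + \<bar>lam / 2 * (z \<bullet> J w)\<bar>"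
      unfolding L_def by (rule order_trans[OF norm_triangle_ineq]) (simp add: norm_mult)
    also have "\<dots> \<le> 2 * \<kappa> * (norm z * norm w) + \<bar>lam\<bar> * (norm z * norm w)"
    proof (rule add_mono)
      show "\<bar>2 * \<kappa> * (z \<bullet> w)\<bar> \<le> 2 * \<kappa> * (norm z * norm w)"
        using \<kappa> Cauchy_Schwarz_ineq2[of z w] by (simp add: abs_mult)
      have "\<bar>lam\<bar> / 2 * \<bar>z \<bullet> J w\<bar> \<le> \<bar>lam\<bar> * (norm z * norm (J w))"
        using Cauchy_Schwarz_ineq2[of z "J w"] by (intro mult_mono) auto
      then show "\<bar>lam / 2 * (z \<bullet> J w)\<bar> \<le> \<bar>lam\<bar> * (norm z * norm w)" by (simp add: abs_mult J_norm)
    qed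
    finally show ?thesis by (simp add: algebra_simps)
  qed
  define H where "H z = F z * of_real (exp (- \<kappa> * (norm z)\<^sup>2))" for z
  have [measurable]: "H \<in> borel_measurable borel" unfolding H_def by measurable
  have H_exp: "integrable lborel (\<lambda>z. exp (K * norm z) * cmod (H z))" for K
  proof (rule Bochner_Integration.integrable_bound)
    show "integrable lborel (\<lambda>z. exp (K\<^sup>2 / (4 * \<kappa>)) * cmod (F z))" using F by simp
    have "exp (K * x) * exp (- \<kappa> * x\<^sup>2) \<le> exp (K\<^sup>2 / (4 * \<kappa>))" for x :: real
    proof -
      have "0 \<le> \<kappa> * (x - K / (2 * \<kappa>))\<^sup>2" using \<kappa> by simp
      also have "\<dots> = \<kappa> * x\<^sup>2 - K * x + K\<^sup>2 / (4 * \<kappa>)"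
        using \<kappa> by (simp add: power2_eq_square field_simps)
      finally show ?thesis unfolding exp_add[symmetric] by simp
    qed
    then have "exp (K * norm z) * exp (- \<kappa> * (norm z)\<^sup>2) * cmod (F z) \<le> exp (K\<^sup>2 / (4 * \<kappa>)) * cmod (F z)" for z
      by (rule mult_right_mono) simp
    then show "AE z in lborel. norm (exp (K * norm z) * cmod (H z)) \<le> norm (exp (K\<^sup>2 / (4 * \<kappa>)) * cmod (F z))"
      by (intro AE_I2) (simp add: H_def norm_mult abs_mult mult_ac)
  qed measurable
  have H_exp2: "integrable lborel (\<lambda>z. exp (K * cmod (L z v)) * cmod (exp (L z w) * H z))" for K v w
  proof (rule Bochner_Integration.integrable_bound)
    let ?K = "\<bar>K\<bar> * ((2 * \<kappa> + \<bar>lam\<bar>) * norm v) + (2 * \<kappa> + \<bar>lam\<bar>) * norm w"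
    show "integrable lborel (\<lambda>z. exp (?K * norm z) * cmod (H z))" by (rule H_exp)
    have "exp (K * cmod (L z v)) * cmod (exp (L z w)) \<le> exp (?K * norm z)" for z
    proof -
      have "K * cmod (L z v) \<le> \<bar>K\<bar> * ((2 * \<kappa> + \<bar>lam\<bar>) * norm v * norm z)"
        using L_le[of z v] by (intro mult_mono) auto
      moreover have "Re (L z w) \<le> (2 * \<kappa> + \<bar>lam\<bar>) * norm w * norm z"
        using L_le[of z w] complex_Re_le_cmod[of "L z w"] by linarith
      ultimately have "K * cmod (L z v) + Re (L z w) \<le> ?K * norm z" by (simp add: algebra_simps)
      then show ?thesis by (simp add: exp_add[symmetric])
    qed
    then have "exp (K * cmod (L z v)) * cmod (exp (L z w)) * cmod (H z) \<le> exp (?K * norm z) * cmod (H z)" for z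
      by (rule mult_right_mono) simp
    then show "AE z in lborel. norm (exp (K * cmod (L z v)) * cmod (exp (L z w) * H z)) \<le> norm (exp (?K * norm z) * cmod (H z))"
      by (intro AE_I2) (simp add: norm_mult abs_mult mult_ac)
  qed measurable
  have base_int: "integrable lborel (\<lambda>z. exp (L z w) * H z)" for w
  proof -
    have "integrable lborel (\<lambda>z. cmod (exp (L z w) * H z))" using H_exp2[of 0 0 w] by simp
    then show ?thesis by (subst (asm) integrable_norm_iff) auto
  qed
  have base_zero: "(LINT z|lborel. exp (L z w) * H z) = 0" if "w \<in> U" for w
  proof -
    define q where "q = exp (- \<kappa> * (norm w)\<^sup>2) / (1 - r) ^ CARD('n)"
    have q: "q \<noteq> 0" using r by (simp add: q_def)
    have "F z * heat_kernel lam r z w = of_real q * (exp (L z w) * H z)" for z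
      unfolding heat_kernel_eq \<kappa>_def[symmetric] q_def[symmetric] L_def J_def H_def by (simp add: mult_ac)
    then have "of_real q * (LINT z|lborel. exp (L z w) * H z) = 0"
      using zero[OF that] unfolding integral_mult_right_zero[symmetric] by (simp only:)
    then show ?thesis using q by simp
  qed
  have "(LINT z|lborel. iexp (v \<bullet> z) * H z) = 0" for v
  proof -
    define B where "B = (1 / D) *\<^sub>R v"
    \<comment> \<open>this choice cancels the part of \<open>L z A + \<i> * L z B\<close> that is real\<close>
    define A where "A = (lam / (4 * \<kappa>)) *\<^sub>R J B"
    have AB: "L z A + \<i> * L z B = \<i> * of_real (z \<bullet> v)" for z
    proof -
      have JA: "J A = (- lam / (4 * \<kappa>)) *\<^sub>R B" by (simp add: A_def J_scale J_J)
      have "2 * \<kappa> * (z \<bullet> A) - lam / 2 * (z \<bullet> J B) = 0" using \<kappa> by (simp add: A_def)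
      moreover have "lam / 2 * (z \<bullet> J A) + 2 * \<kappa> * (z \<bullet> B) = z \<bullet> v"
      proof -
        have "lam / 2 * (z \<bullet> J A) + 2 * \<kappa> * (z \<bullet> B) = D * (z \<bullet> B)"
          unfolding JA D_def using \<kappa> by (simp add: field_simps power2_eq_square)
        also have "\<dots> = z \<bullet> v" using D by (simp add: B_def)
        finally show ?thesis .
      qed
      ultimately show ?thesis by (simp add: L_def complex_eq_iff)
    qed
    obtain e where e: "e > 0" "ball w0 e \<subseteq> U" using U open_contains_ball by blast
    define \<epsilon> where "\<epsilon> = e / (norm (A - w0) + norm B + 1)"
    have den: "norm (A - w0) + norm B + 1 > 0" by (simp add: add_nonneg_pos)
    have \<epsilon>: "\<epsilon> > 0" using e(1) den by (simp add: \<epsilon>_def)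
    have inU: "w0 + s *\<^sub>R (A - w0) + t *\<^sub>R B \<in> U" if "\<bar>s\<bar> < \<epsilon>" "\<bar>t\<bar> < \<epsilon>" for s t
    proof -
      have "norm (s *\<^sub>R (A - w0) + t *\<^sub>R B) \<le> \<bar>s\<bar> * norm (A - w0) + \<bar>t\<bar> * norm B"
        by (rule order_trans[OF norm_triangle_ineq]) simp
      also have "\<dots> \<le> \<epsilon> * norm (A - w0) + \<epsilon> * norm B" using that by (intro add_mono mult_right_mono) auto
      also have "\<dots> < \<epsilon> * (norm (A - w0) + norm B + 1)" using \<epsilon> by (simp add: algebra_simps)
      also have "\<dots> = e" using den by (simp add: \<epsilon>_def)
      finally have lt: "norm (s *\<^sub>R (A - w0) + t *\<^sub>R B) < e" .
      have "dist w0 (w0 + x) = norm x" for x by (simp add: dist_norm)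
      then have "dist w0 (w0 + (s *\<^sub>R (A - w0) + t *\<^sub>R B)) < e" using lt by (simp only:)
      then show ?thesis using e(2) by (auto simp: add.assoc)
    qed
    have step1: "(LINT z|lborel. exp (L z (A + t *\<^sub>R B)) * H z) = 0" if t: "\<bar>t\<bar> < \<epsilon>" for t
    proof -
      have "(LINT z|lborel. exp (1 * L z (A - w0)) * (exp (L z (w0 + t *\<^sub>R B)) * H z)) = 0"
      proof (rule exponential_family_vanishes[OF base_int _ H_exp2 \<epsilon>])
        fix s :: real assume s: "\<bar>s\<bar> < \<epsilon>"
        have "exp (of_real s * L z (A - w0)) * (exp (L z (w0 + t *\<^sub>R B)) * H z) = exp (L z (w0 + s *\<^sub>R (A - w0) + t *\<^sub>R B)) * H z" for z
          by (simp add: L_add L_scale exp_add mult_ac)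
        then show "(LINT z|lborel. exp (of_real s * L z (A - w0)) * (exp (L z (w0 + t *\<^sub>R B)) * H z)) = 0"
          using base_zero[OF inU[OF s t]] by (simp only:)
      qed measurable
      moreover have "exp (1 * L z (A - w0)) * (exp (L z (w0 + t *\<^sub>R B)) * H z) = exp (L z (A + t *\<^sub>R B)) * H z" for z
        unfolding mult.assoc[symmetric] mult_1 exp_add[symmetric] L_add[symmetric] by simp
      ultimately show ?thesis by (simp only:)
    qed
    have "(LINT z|lborel. exp (\<i> * L z B) * (exp (L z A) * H z)) = 0"
    proof (rule exponential_family_vanishes[OF base_int _ H_exp2 \<epsilon>])
      fix t :: real assume t: "\<bar>t\<bar> < \<epsilon>"
      have "exp (of_real t * L z B) * (exp (L z A) * H z) = exp (L z (A + t *\<^sub>R B)) * H z" for z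
        by (simp add: L_add L_scale exp_add mult_ac)
      then show "(LINT z|lborel. exp (of_real t * L z B) * (exp (L z A) * H z)) = 0" using step1[OF t] by (simp only:)
    qed measurable
    moreover have "exp (\<i> * L z B) * (exp (L z A) * H z) = iexp (v \<bullet> z) * H z" for z
      unfolding mult.assoc[symmetric] exp_add[symmetric] using AB[of z] by (simp add: add.commute inner_commute)
    ultimately show ?thesis by simp
  qed
  moreover have "integrable lborel H"
  proof -
    have "integrable lborel (\<lambda>z. cmod (H z))" using H_exp[of 0] by simp
    then show ?thesis by (subst (asm) integrable_norm_iff) auto
  qed
  ultimately have "AE z in lborel. H z = 0" by (intro fourier_uniqueness)
  then show ?thesis by eventually_elim (simp add: H_def)
qed

section \<open>Vanishing of the heat transform\<close>

lemma summable_reciprocal_odd_squares: "summable (\<lambda>k. 1 / (2 * real k + 1)\<^sup>2)"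
proof (rule summable_comparison_test'[of "\<lambda>k. inverse (real (Suc k) ^ 2)" 0])
  show "summable (\<lambda>k. inverse (real (Suc k) ^ 2))"
    using inverse_power_summable[of 2, where 'a = real] by (subst summable_Suc_iff) simp
  fix k :: nat
  have "inverse ((2 * real k + 1)\<^sup>2) \<le> inverse (real (Suc k) ^ 2)"
    by (rule le_imp_inverse_le) (auto intro!: power_mono)
  then show "norm (1 / (2 * real k + 1)\<^sup>2) \<le> inverse (real (Suc k) ^ 2)" by (simp add: divide_inverse)
qed

lemma heat_kernel_continuous:
  assumes "r < 1"
  shows "continuous_on UNIV (\<lambda>p :: (complex ^ 'n::finite) \<times> (complex ^ 'n). heat_kernel lam r (fst p) (snd p))"
  unfolding heat_kernel_def heat_kernel1_def by (intro continuous_intros) (use assms in auto)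

lemma heat_kernel_pairing_measurable:
  fixes F \<rho> :: "complex ^ 'n::finite \<Rightarrow> complex"
  assumes F: "integrable lborel F" and \<rho>: "integrable lborel \<rho>" and r: "r < 1"
  shows "(\<lambda>p. F (fst p) * cnj (\<rho> (snd p)) * heat_kernel lam r (fst p) (snd p)) \<in> borel_measurable (lborel \<Otimes>\<^sub>M lborel)"
proof -
  have "integrable lborel (\<lambda>w. cnj (\<rho> w))" using \<rho> by simp
  from integrable_pair_product[OF F this]
  have i: "(\<lambda>p. F (fst p) * cnj (\<rho> (snd p))) \<in> borel_measurable (lborel \<Otimes>\<^sub>M lborel)" by (rule borel_measurable_integrable)
  have "(\<lambda>p :: (complex ^ 'n) \<times> (complex ^ 'n). heat_kernel lam r (fst p) (snd p)) \<in> borel_measurable (lborel \<Otimes>\<^sub>M lborel)"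
    unfolding lborel_prod using borel_measurable_continuous_onI[OF heat_kernel_continuous[OF r]] by simp
  with i show ?thesis by (rule borel_measurable_times)
qed

lemma cmod_heat_kernel_pairing_le:
  fixes F \<rho> :: "complex ^ 'n::finite \<Rightarrow> complex"
  assumes F: "integrable lborel F" and \<rho>: "integrable lborel \<rho>" and d: "d > 0" and r: "0 \<le> r" "r < 1"
    and sep: "\<And>z w. F z \<noteq> 0 \<Longrightarrow> \<rho> w \<noteq> 0 \<Longrightarrow> norm (z - w) \<ge> d"
  shows "cmod (LINT p|(lborel \<Otimes>\<^sub>M lborel). F (fst p) * cnj (\<rho> (snd p)) * heat_kernel lam r (fst p) (snd p))
    \<le> (LINT p|(lborel \<Otimes>\<^sub>M lborel). cmod (F (fst p) * cnj (\<rho> (snd p))))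
      * (exp (- (\<bar>lam\<bar> * d\<^sup>2 / 4 / (1 - r))) / (1 - r) ^ CARD('n))"
proof -
  define E where "E = exp (- (\<bar>lam\<bar> * d\<^sup>2 / 4 / (1 - r))) / (1 - r) ^ CARD('n)"
  have E: "E \<ge> 0" using r by (simp add: E_def)
  have "integrable lborel (\<lambda>w. cnj (\<rho> w))" using \<rho> by simp
  from integrable_pair_product[OF F this]
  have H: "integrable (lborel \<Otimes>\<^sub>M lborel) (\<lambda>p. cmod (F (fst p) * cnj (\<rho> (snd p))) * E)" by simp
  have le: "cmod (F z * cnj (\<rho> w) * heat_kernel lam r z w) \<le> cmod (F z * cnj (\<rho> w)) * E" for z w
  proof (cases "F z = 0 \<or> \<rho> w = 0")
    case True
    then show ?thesis by auto
  next
    case False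
    then have "d \<le> norm (z - w)" using sep by blast
    then have "d\<^sup>2 \<le> (norm (z - w))\<^sup>2" using d by (intro power_mono) auto
    then have "1 * d\<^sup>2 \<le> (1 + r) * (norm (z - w))\<^sup>2" using r by (intro mult_mono) auto
    then have "\<bar>lam\<bar> / (4 * (1 - r)) * (1 * d\<^sup>2) \<le> \<bar>lam\<bar> / (4 * (1 - r)) * ((1 + r) * (norm (z - w))\<^sup>2)"
      using r by (intro mult_left_mono) auto
    moreover have "\<bar>lam\<bar> / (4 * (1 - r)) * (1 * d\<^sup>2) = \<bar>lam\<bar> * d\<^sup>2 / 4 / (1 - r)"
      "\<bar>lam\<bar> / (4 * (1 - r)) * ((1 + r) * (norm (z - w))\<^sup>2) = \<bar>lam\<bar> * (1 + r) / (4 * (1 - r)) * (norm (z - w))\<^sup>2"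
      by (simp_all only: mult_1_left times_divide_eq_left times_divide_eq_right divide_divide_eq_left mult.assoc)
    ultimately have "exp (- (\<bar>lam\<bar> * (1 + r) / (4 * (1 - r)) * (norm (z - w))\<^sup>2)) \<le> exp (- (\<bar>lam\<bar> * d\<^sup>2 / 4 / (1 - r)))"
      by (simp only: exp_le_cancel_iff neg_le_iff_le)
    then have "cmod (heat_kernel lam r z w) \<le> E"
      unfolding cmod_heat_kernel[OF r(2)] E_def by (rule divide_right_mono) (use r in simp)
    then show ?thesis unfolding norm_mult[of "F z * cnj (\<rho> w)"] by (rule mult_left_mono) simp
  qed
  have "cmod (LINT p|(lborel \<Otimes>\<^sub>M lborel). F (fst p) * cnj (\<rho> (snd p)) * heat_kernel lam r (fst p) (snd p))
      \<le> (LINT p|(lborel \<Otimes>\<^sub>M lborel). cmod (F (fst p) * cnj (\<rho> (snd p))) * E)"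
    by (rule norm_integral_le_integral[OF H heat_kernel_pairing_measurable[OF F \<rho> r(2)] le])
  then show ?thesis unfolding integral_mult_left_zero E_def .
qed

text \<open>
  With \<open>r = exp (- 2 \<tau> |\<lambda>|)\<close> the weights \<open>exp (- \<tau> \<mu>\<^sub>\<alpha>)\<close> are a constant times \<open>r\<^bsup>|\<alpha>|\<^esup>\<close>, which identifies
  the Laplace transform of the pairing with an Abel sum.  Its flatness comes from the distance \<open>d\<close> of
  the supports, the two decay hypotheses from \<open>F\<close> and \<open>\<rho>\<close> respectively.
\<close>

lemma heat_kernel_pairing_vanishes:
  fixes F \<rho> :: "complex ^ 'n::finite \<Rightarrow> complex" and \<Theta> :: "real \<Rightarrow> real"
  assumes lam: "lam \<noteq> 0" and F: "integrable lborel F" and \<rho>: "integrable lborel \<rho>"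
    and nonneg: "\<And>t. t \<ge> 0 \<Longrightarrow> \<Theta> t \<ge> 0" and anti: "antimono_on {0..} \<Theta>"
    and diverge: "(\<integral>\<^sup>+ t\<in>{1..}. ennreal (\<Theta> t / t) \<partial>lborel) = \<infinity>"
    and C: "C \<ge> 0"
    and decay: "\<And>\<alpha>. (l2_norm (weyl lam F (scaled_hermite lam \<alpha>)))\<^sup>2
      \<le> C * exp (- 2 * \<Theta> (sqrt (hermite_eigenvalue lam \<alpha>)) * sqrt (hermite_eigenvalue lam \<alpha>))"
    and AD: "A \<ge> 0" "D \<ge> 0"
    and smooth: "\<And>\<alpha> k. hermite_eigenvalue lam \<alpha> ^ k * l2_norm (weyl lam \<rho> (scaled_hermite lam \<alpha>))
      \<le> A * D ^ k * (fact (2 * k))\<^sup>2 * (\<Prod>j\<in>UNIV. 1 / (2 * real (\<alpha> $ j) + 1)\<^sup>2)"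
    and d: "d > 0" and sep: "\<And>z w. F z \<noteq> 0 \<Longrightarrow> \<rho> w \<noteq> 0 \<Longrightarrow> norm (z - w) \<ge> d"
  shows "(LINT p|(lborel \<Otimes>\<^sub>M lborel). F (fst p) * cnj (\<rho> (snd p)) * heat_kernel lam (exp (- 2 * \<bar>lam\<bar>)) (fst p) (snd p)) = 0"
proof -
  define M where "M = (count_space UNIV :: (nat ^ 'n) measure)"
  define \<Phi> where "\<Phi> = (scaled_hermite lam :: nat ^ 'n \<Rightarrow> _)"
  define h where "h \<alpha> = l2_inner (weyl lam F (\<Phi> \<alpha>)) (weyl lam \<rho> (\<Phi> \<alpha>))" for \<alpha>
  define X where "X \<alpha> = sqrt (hermite_eigenvalue lam \<alpha>)" for \<alpha> :: "nat ^ 'n"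
  define s where "s \<alpha> = (\<Prod>j\<in>UNIV. 1 / (2 * real (\<alpha> $ j) + 1)\<^sup>2)" for \<alpha> :: "nat ^ 'n"
  define P where "P r = (LINT p|(lborel \<Otimes>\<^sub>M lborel). F (fst p) * cnj (\<rho> (snd p)) * heat_kernel lam r (fst p) (snd p))" for r
  define I where "I = (LINT p|(lborel \<Otimes>\<^sub>M lborel). cmod (F (fst p) * cnj (\<rho> (snd p))))"
  have I: "I \<ge> 0" unfolding I_def by (rule Bochner_Integration.integral_nonneg) simp
  have \<mu>: "hermite_eigenvalue lam \<alpha> > 0" for \<alpha> :: "nat ^ 'n"
  proof -
    have "2 * (\<Sum>j\<in>UNIV. \<alpha> $ j) + CARD('n) > 0" using zero_less_card_finite[where 'a = 'n] by linarith
    then show ?thesis unfolding hermite_eigenvalue_def using lam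
      by (intro mult_pos_pos) (simp_all only: of_nat_0_less_iff zero_less_abs_iff not_False_eq_True)
  qed
  then have X: "X \<alpha> > 0" for \<alpha> by (simp add: X_def)
  have X2: "(X \<alpha>)\<^sup>2 = hermite_eigenvalue lam \<alpha>" for \<alpha>
    unfolding X_def by (rule real_sqrt_pow2[OF less_imp_le[OF \<mu>]])
  have \<Phi>_L2: "\<Phi> \<alpha> \<in> L2" for \<alpha> unfolding \<Phi>_def by (rule scaled_hermite_L2[OF lam])
  have s: "s \<alpha> \<ge> 0" for \<alpha> unfolding s_def by (intro prod_nonneg) simp
  have s_int: "integrable M s"
  proof -
    have "integrable (count_space UNIV) (\<lambda>k. 1 / (2 * real k + 1)\<^sup>2)"
      using summable_reciprocal_odd_squares by (simp add: integrable_count_space_nat_iff)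
    then have "integrable M (\<lambda>\<alpha>. \<Prod>j\<in>UNIV. (\<lambda>k. 1 / (2 * real k + 1)\<^sup>2) (\<alpha> $ j))"
      unfolding M_def by (rule integrable_multiindex_prod)
    then show ?thesis unfolding s_def .
  qed
  have norm_F: "l2_norm (weyl lam F (\<Phi> \<alpha>)) \<le> sqrt C * exp (- \<Theta> (X \<alpha>) * X \<alpha>)" for \<alpha>
  proof -
    have "(exp (- \<Theta> (X \<alpha>) * X \<alpha>))\<^sup>2 = exp (- 2 * \<Theta> (X \<alpha>) * X \<alpha>)"
      by (simp only: exp_double[symmetric]) (simp add: mult.assoc)
    then have "(sqrt C * exp (- \<Theta> (X \<alpha>) * X \<alpha>))\<^sup>2 = C * exp (- 2 * \<Theta> (X \<alpha>) * X \<alpha>)"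
      using C by (simp only: power_mult_distrib real_sqrt_pow2)
    then have "(l2_norm (weyl lam F (\<Phi> \<alpha>)))\<^sup>2 \<le> (sqrt C * exp (- \<Theta> (X \<alpha>) * X \<alpha>))\<^sup>2"
      using decay[of \<alpha>] unfolding \<Phi>_def X_def by (simp only:)
    then show ?thesis by (rule power2_le_imp_le) (use C in simp)
  qed
  have h_le: "cmod (h \<alpha>) \<le> sqrt C * exp (- \<Theta> (X \<alpha>) * X \<alpha>) * l2_norm (weyl lam \<rho> (\<Phi> \<alpha>))" for \<alpha>
    unfolding h_def
    using mult_right_mono[OF norm_F[of \<alpha>] l2_norm_nonneg[of "weyl lam \<rho> (\<Phi> \<alpha>)"]]
      cmod_l2_inner_le[OF weyl_L2[OF F \<Phi>_L2[of \<alpha>]] weyl_L2[OF \<rho> \<Phi>_L2[of \<alpha>]], of lam lam]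
    by linarith
  define \<sigma> where "\<sigma> \<alpha> = sqrt C * A * s \<alpha>" for \<alpha>
  have ingham: "cmod (h \<alpha>) \<le> exp (- \<Theta> (X \<alpha>) * X \<alpha>) * \<sigma> \<alpha>" for \<alpha>
  proof -
    have "sqrt C * exp (- \<Theta> (X \<alpha>) * X \<alpha>) * l2_norm (weyl lam \<rho> (\<Phi> \<alpha>)) \<le> sqrt C * exp (- \<Theta> (X \<alpha>) * X \<alpha>) * (A * s \<alpha>)"
      using smooth[of \<alpha> 0] C by (intro mult_left_mono) (simp_all add: \<Phi>_def s_def)
    then show ?thesis using h_le[of \<alpha>] unfolding \<sigma>_def by (simp add: mult_ac)
  qed
  have gevrey: "X \<alpha> ^ (2 * k) * cmod (h \<alpha>) \<le> 1 * D ^ k * (fact (2 * k))\<^sup>2 * \<sigma> \<alpha>" for \<alpha> k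
  proof -
    have "\<Theta> (X \<alpha>) * X \<alpha> \<ge> 0" using nonneg[of "X \<alpha>"] X[of \<alpha>] by simp
    then have "exp (- \<Theta> (X \<alpha>) * X \<alpha>) \<le> 1" by simp
    then have "sqrt C * exp (- \<Theta> (X \<alpha>) * X \<alpha>) * l2_norm (weyl lam \<rho> (\<Phi> \<alpha>)) \<le> sqrt C * 1 * l2_norm (weyl lam \<rho> (\<Phi> \<alpha>))"
      using C by (intro mult_right_mono mult_left_mono l2_norm_nonneg) auto
    then have "cmod (h \<alpha>) \<le> sqrt C * l2_norm (weyl lam \<rho> (\<Phi> \<alpha>))" using h_le[of \<alpha>] by simp
    then have "X \<alpha> ^ (2 * k) * cmod (h \<alpha>) \<le> X \<alpha> ^ (2 * k) * (sqrt C * l2_norm (weyl lam \<rho> (\<Phi> \<alpha>)))"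
      by (rule mult_left_mono) (use X[of \<alpha>] in simp)
    also have "\<dots> = sqrt C * (hermite_eigenvalue lam \<alpha> ^ k * l2_norm (weyl lam \<rho> (\<Phi> \<alpha>)))"
      unfolding power_mult X2 by (simp only: mult_ac)
    also have "\<dots> \<le> sqrt C * (A * D ^ k * (fact (2 * k))\<^sup>2 * s \<alpha>)"
      using smooth[of \<alpha> k] C unfolding \<Phi>_def s_def by (intro mult_left_mono) auto
    also have "\<dots> = 1 * D ^ k * (fact (2 * k))\<^sup>2 * \<sigma> \<alpha>" unfolding \<sigma>_def by (simp only: mult_ac mult_1_left)
    finally show ?thesis .
  qed
  have transform: "(LINT \<alpha>|M. of_real (exp (- \<tau> * (X \<alpha>)\<^sup>2)) * h \<alpha>)
      = of_real (exp (- \<tau> * (real CARD('n) * \<bar>lam\<bar>))) * P (exp (- 2 * \<tau> * \<bar>lam\<bar>))" if \<tau>: "\<tau> > 0" for \<tau>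
  proof -
    define r where "r = exp (- 2 * \<tau> * \<bar>lam\<bar>)"
    have r: "0 \<le> r" "r < 1" using \<tau> lam by (simp_all add: r_def)
    have eq: "of_real (exp (- \<tau> * (X \<alpha>)\<^sup>2)) * h \<alpha>
        = of_real (exp (- \<tau> * (real CARD('n) * \<bar>lam\<bar>))) * (of_real (r ^ (\<Sum>j\<in>UNIV. \<alpha> $ j)) * h \<alpha>)" for \<alpha>
    proof -
      define N where "N = (\<Sum>j\<in>UNIV. \<alpha> $ j)"
      have "- \<tau> * (X \<alpha>)\<^sup>2 = - \<tau> * (real CARD('n) * \<bar>lam\<bar>) + real N * (- 2 * \<tau> * \<bar>lam\<bar>)"
        unfolding X2 hermite_eigenvalue_def N_def[symmetric] by (simp add: algebra_simps)
      then have "exp (- \<tau> * (X \<alpha>)\<^sup>2) = exp (- \<tau> * (real CARD('n) * \<bar>lam\<bar>)) * r ^ N"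
        unfolding r_def exp_of_nat_mult[symmetric] exp_add[symmetric] by (simp only:)
      then show ?thesis unfolding N_def by (simp only: of_real_mult mult.assoc)
    qed
    show ?thesis
      unfolding eq integral_mult_right_zero r_def[symmetric]
      unfolding M_def h_def \<Phi>_def abel_sum_l2_inner_weyl[OF lam F \<rho> r] P_def ..
  qed
  have flat: "((\<lambda>\<tau>. (LINT \<alpha>|M. of_real (exp (- \<tau> * (X \<alpha>)\<^sup>2)) * h \<alpha>) / of_real (\<tau> ^ k)) \<longlongrightarrow> 0) (at_right 0)" for k
  proof -
    \<comment> \<open>this power of \<open>1 - r\<close> pays for the singularity of the heat kernel, for the division by
      \<open>\<tau>\<^sup>k\<close>, and leaves one factor \<open>\<tau>\<close>\<close>
    define m where "m = CARD('n) + k + 1"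
    define c where "c = \<bar>lam\<bar> * d\<^sup>2 / 4"
    have c: "c > 0" using lam d by (simp add: c_def)
    define K where "K = I * (fact m / c ^ m) * (2 * \<bar>lam\<bar>) ^ (k + 1)"
    have le: "cmod ((LINT \<alpha>|M. of_real (exp (- \<tau> * (X \<alpha>)\<^sup>2)) * h \<alpha>) / of_real (\<tau> ^ k)) \<le> K * \<tau>" if \<tau>: "\<tau> > 0" for \<tau>
    proof -
      define r where "r = exp (- 2 * \<tau> * \<bar>lam\<bar>)"
      have r: "0 \<le> r" "r < 1" using \<tau> lam by (simp_all add: r_def)
      have r2: "1 - r \<le> 2 * \<bar>lam\<bar> * \<tau>" using exp_ge_add_one_self[of "- 2 * \<tau> * \<bar>lam\<bar>"] by (simp add: r_def mult_ac)
      have "exp (- (c / (1 - r))) / (1 - r) ^ CARD('n) \<le> fact m / (c / (1 - r)) ^ m / (1 - r) ^ CARD('n)"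
        using r c by (intro divide_right_mono exp_neg_le_fact) simp_all
      also have "\<dots> = fact m / c ^ m * (1 - r) ^ (k + 1)"
      proof -
        have "(1 - r) ^ m = (1 - r) ^ (k + 1) * (1 - r) ^ CARD('n)" by (simp add: m_def power_add mult_ac)
        then show ?thesis using r c by (simp add: power_divide)
      qed
      also have "\<dots> \<le> fact m / c ^ m * (2 * \<bar>lam\<bar> * \<tau>) ^ (k + 1)"
        using r r2 c by (intro mult_left_mono power_mono) auto
      finally have E: "exp (- (c / (1 - r))) / (1 - r) ^ CARD('n) \<le> fact m / c ^ m * (2 * \<bar>lam\<bar> * \<tau>) ^ (k + 1)" .
      have "cmod (P r) \<le> I * (exp (- (c / (1 - r))) / (1 - r) ^ CARD('n))"
        unfolding P_def I_def c_def by (rule cmod_heat_kernel_pairing_le[OF F \<rho> d r sep])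
      also have "\<dots> \<le> I * (fact m / c ^ m * (2 * \<bar>lam\<bar> * \<tau>) ^ (k + 1))" by (rule mult_left_mono[OF E I])
      also have "\<dots> = K * \<tau> * \<tau> ^ k" unfolding K_def by (simp only: power_mult_distrib power_add power_one_right mult_ac)
      finally have P: "cmod (P r) \<le> K * \<tau> * \<tau> ^ k" .
      have "cmod (LINT \<alpha>|M. of_real (exp (- \<tau> * (X \<alpha>)\<^sup>2)) * h \<alpha>) = exp (- \<tau> * (real CARD('n) * \<bar>lam\<bar>)) * cmod (P r)"
        unfolding transform[OF \<tau>] r_def[symmetric] norm_mult norm_of_real by simp
      also have "\<dots> \<le> 1 * cmod (P r)" using \<tau> by (intro mult_right_mono) auto
      also have "\<dots> \<le> K * \<tau> * \<tau> ^ k" using P by simp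
      finally show ?thesis using \<tau> by (simp add: norm_divide norm_power divide_le_eq)
    qed
    have ev: "\<forall>\<^sub>F \<tau> in at_right 0. norm ((LINT \<alpha>|M. of_real (exp (- \<tau> * (X \<alpha>)\<^sup>2)) * h \<alpha>) / of_real (\<tau> ^ k)) \<le> K * \<tau>"
      by (rule eventually_mono[OF eventually_at_right_less]) (rule le)
    have "((\<lambda>\<tau>. K * \<tau>) \<longlongrightarrow> K * 0) (at_right 0)" by (intro tendsto_intros)
    then have "((\<lambda>\<tau>. K * \<tau>) \<longlongrightarrow> 0) (at_right 0)" by simp
    with ev show ?thesis by (rule Lim_null_comparison)
  qed
  have "(LINT \<alpha>|M. of_real (exp (- 1 * (X \<alpha>)\<^sup>2)) * h \<alpha>) = 0"
  proof (rule flat_laplace_transform_vanishes[where \<Theta> = \<Theta> and \<sigma> = \<sigma> and A = 1 and D = D])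
    show "sigma_finite_measure M" unfolding M_def by (rule sigma_finite_measure_count_space)
    show "h \<in> borel_measurable M" "X \<in> borel_measurable M" by (simp_all add: M_def)
    show "integrable M \<sigma>" unfolding \<sigma>_def by (intro integrable_mult_right s_int)
    show "\<sigma> \<alpha> \<ge> 0" for \<alpha> using s[of \<alpha>] C AD by (simp add: \<sigma>_def)
    show "cmod (h \<alpha>) \<le> exp (- \<Theta> (X \<alpha>) * X \<alpha>) * \<sigma> \<alpha>" for \<alpha> by (rule ingham)
    show "X \<alpha> ^ (2 * k) * cmod (h \<alpha>) \<le> 1 * D ^ k * (fact (2 * k))\<^sup>2 * \<sigma> \<alpha>" for \<alpha> k by (rule gevrey)
    show "((\<lambda>\<tau>. (LINT \<alpha>|M. of_real (exp (- \<tau> * (X \<alpha>)\<^sup>2)) * h \<alpha>) / of_real (\<tau> ^ k)) \<longlongrightarrow> 0) (at_right 0)" for k by (rule flat)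
  qed (use nonneg anti diverge X AD in auto)
  then have "of_real (exp (- 1 * (real CARD('n) * \<bar>lam\<bar>))) * P (exp (- 2 * 1 * \<bar>lam\<bar>)) = 0"
    using transform[of 1] by (simp only: zero_less_one)
  then show ?thesis by (simp add: P_def)
qed

lemma cmod_twist: "cmod (twist lam w) = 1"
  unfolding twist_def prod_norm[symmetric] norm_exp_i_times by simp

lemma continuous_nonneg_integral_pos:
  fixes B :: "'a::euclidean_space \<Rightarrow> real"
  assumes B: "continuous_on UNIV B" "\<And>w. B w \<ge> 0" "integrable lborel B" and pos: "B w0 > 0"
  shows "(LINT w|lborel. B w) > 0"
proof -
  have "(LINT w|lborel. B w) \<noteq> 0"
  proof
    assume "(LINT w|lborel. B w) = 0"
    then have ae: "AE w in lborel. B w = 0" using integral_nonneg_eq_0_iff_AE[OF B(3)] B(2) by simp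
    have "open {w. B w \<noteq> 0}" using B(1) by (intro open_Collect_neq continuous_intros)
    then have "{w. B w \<noteq> 0} \<in> sets lborel" by simp
    then have "{w. B w \<noteq> 0} \<in> null_sets lborel" using ae by (simp add: AE_iff_null)
    then have "negligible {w. B w \<noteq> 0}" unfolding negligible_iff_null_sets by (rule null_sets_completionI)
    moreover have "w0 \<in> {w. B w \<noteq> 0}" using pos by simp
    ultimately show False using open_not_negligible[OF \<open>open {w. B w \<noteq> 0}\<close>] by blast
  qed
  moreover have "(LINT w|lborel. B w) \<ge> 0" using B(2) by (intro Bochner_Integration.integral_nonneg) simp
  ultimately show ?thesis by simp
qed

lemma heat_transform_isCont:
  fixes F :: "complex ^ 'n::finite \<Rightarrow> complex"
  assumes F: "integrable lborel F" and r: "0 \<le> r" "r < 1"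
  shows "isCont (\<lambda>w. LINT z|lborel. F z * heat_kernel lam r z w) w0"
  unfolding continuous_at_sequentially comp_def
proof (intro allI impI)
  fix x :: "nat \<Rightarrow> complex ^ 'n" assume x: "x \<longlonglongrightarrow> w0"
  have [measurable]: "F \<in> borel_measurable borel" using borel_measurable_integrable[OF F] by simp
  have hk: "continuous_on UNIV (\<lambda>z. heat_kernel lam r z w)" for w :: "complex ^ 'n"
    using continuous_on_compose2[OF heat_kernel_continuous[OF r(2)], of UNIV "\<lambda>z. (z, w)" lam] by (simp add: continuous_on_Pair)
  have hk_meas: "(\<lambda>z. heat_kernel lam r z w) \<in> borel_measurable borel" for w :: "complex ^ 'n"
    by (rule borel_measurable_continuous_onI[OF hk])
  have hk_le: "cmod (heat_kernel lam r z w) \<le> 1 / (1 - r) ^ CARD('n)" for z w :: "complex ^ 'n"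
    unfolding cmod_heat_kernel[OF r(2)] using r by (intro divide_right_mono) auto
  show "(\<lambda>n. LINT z|lborel. F z * heat_kernel lam r z (x n)) \<longlonglongrightarrow> (LINT z|lborel. F z * heat_kernel lam r z w0)"
  proof (rule integral_dominated_convergence[where w = "\<lambda>z. cmod (F z) * (1 / (1 - r) ^ CARD('n))"])
    show "(\<lambda>z. F z * heat_kernel lam r z w0) \<in> borel_measurable lborel"
      "(\<lambda>z. F z * heat_kernel lam r z (x n)) \<in> borel_measurable lborel" for n
      using hk_meas by simp_all
    show "integrable lborel (\<lambda>z. cmod (F z) * (1 / (1 - r) ^ CARD('n)))" using F by simp
    show "AE z in lborel. (\<lambda>n. F z * heat_kernel lam r z (x n)) \<longlonglongrightarrow> F z * heat_kernel lam r z w0"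
    proof (intro AE_I2 tendsto_mult_left)
      fix z :: "complex ^ 'n"
      have "isCont (\<lambda>p. heat_kernel lam r (fst p) (snd p)) (z, w0)"
        using heat_kernel_continuous[OF r(2), where 'n = 'n] by (simp add: continuous_on_eq_continuous_at)
      moreover have "(\<lambda>n. (z, x n)) \<longlonglongrightarrow> (z, w0)" using x by (intro tendsto_Pair tendsto_const)
      ultimately have "(\<lambda>n. heat_kernel lam r (fst (z, x n)) (snd (z, x n))) \<longlonglongrightarrow> heat_kernel lam r (fst (z, w0)) (snd (z, w0))"
        by (rule isCont_tendsto_compose)
      then show "(\<lambda>n. heat_kernel lam r z (x n)) \<longlonglongrightarrow> heat_kernel lam r z w0" by simp
    qed
    show "AE z in lborel. norm (F z * heat_kernel lam r z (x n)) \<le> cmod (F z) * (1 / (1 - r) ^ CARD('n))" for n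
      unfolding norm_mult by (intro AE_I2 mult_left_mono hk_le) simp
  qed
qed

text \<open>
  If the transform were nonzero at \<open>w0\<close>, then its product with the phase \<open>twist\<close> would stay within a
  half-plane near \<open>w0\<close>, and the integral against a nonnegative bump supported there could not vanish.
\<close>

lemma heat_transform_vanishes:
  fixes F :: "complex ^ 'n::finite \<Rightarrow> complex" and \<Theta> :: "real \<Rightarrow> real"
  assumes lam: "lam \<noteq> 0" and F: "integrable lborel F"
    and nonneg: "\<And>t. t \<ge> 0 \<Longrightarrow> \<Theta> t \<ge> 0" and anti: "antimono_on {0..} \<Theta>"
    and diverge: "(\<integral>\<^sup>+ t\<in>{1..}. ennreal (\<Theta> t / t) \<partial>lborel) = \<infinity>"
    and C: "C \<ge> 0"
    and decay: "\<And>\<alpha>. (l2_norm (weyl lam F (scaled_hermite lam \<alpha>)))\<^sup>2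
      \<le> C * exp (- 2 * \<Theta> (sqrt (hermite_eigenvalue lam \<alpha>)) * sqrt (hermite_eigenvalue lam \<alpha>))"
    and U: "open U" "w0 \<in> U" and vanish: "\<And>z. z \<in> U \<Longrightarrow> F z = 0"
  shows "(LINT z|lborel. F z * heat_kernel lam (exp (- 2 * \<bar>lam\<bar>)) z w0) = 0"
proof (rule ccontr)
  define r where "r = exp (- 2 * \<bar>lam\<bar>)"
  have r: "0 \<le> r" "r < 1" using lam by (simp_all add: r_def)
  define \<Psi> where "\<Psi> w = (LINT z|lborel. F z * heat_kernel lam r z w)" for w
  define q where "q w = twist lam w * \<Psi> w" for w
  assume "(LINT z|lborel. F z * heat_kernel lam (exp (- 2 * \<bar>lam\<bar>)) z w0) \<noteq> 0"
  then have "\<Psi> w0 \<noteq> 0" by (simp add: \<Psi>_def r_def)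
  moreover have "twist lam w0 \<noteq> 0" using cmod_twist[of lam w0] by force
  ultimately have q0: "q w0 \<noteq> 0" by (simp add: q_def)
  have twist_cont: "continuous_on UNIV (twist lam :: complex ^ 'n \<Rightarrow> complex)"
    unfolding twist_def[abs_def] by (intro continuous_intros) auto
  have "isCont q w0"
    unfolding q_def \<Psi>_def using twist_cont heat_transform_isCont[OF F r]
    by (intro continuous_mult) (simp_all add: continuous_on_eq_continuous_at)
  moreover have "cmod (q w0) / 2 > 0" using q0 by simp
  ultimately have "\<exists>e1>0. \<forall>w. dist w w0 < e1 \<longrightarrow> dist (q w) (q w0) < cmod (q w0) / 2"
    unfolding continuous_at_eps_delta by blast
  then obtain e1 where e1: "e1 > 0" "\<And>w. dist w w0 < e1 \<Longrightarrow> dist (q w) (q w0) < cmod (q w0) / 2" by blast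
  obtain e2 where e2: "e2 > 0" "ball w0 e2 \<subseteq> U" using U open_contains_ball by blast
  define e where "e = min e1 e2"
  have e: "e > 0" using e1(1) e2(1) by (simp add: e_def)
  \<comment> \<open>the polydisc of radius \<open>2 \<delta>\<close> around \<open>w0\<close> then lies in the ball of radius \<open>e / 2\<close>\<close>
  define \<delta> where "\<delta> = e / (4 * real CARD('n))"
  have \<delta>: "\<delta> > 0" using e zero_less_card_finite[where 'a = 'n] by (simp add: \<delta>_def)
  obtain \<rho> B A D where \<rho>: "integrable lborel \<rho>" and \<rho>_eq: "\<And>w. cnj (\<rho> w) = of_real (B w) * twist lam w"
    and B: "\<And>w. B w \<ge> 0" "B w0 > 0" "continuous_on UNIV B" and far: "\<And>w j. cmod (w $ j - w0 $ j) \<ge> 2 * \<delta> \<Longrightarrow> B w = 0"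
    and AD: "A \<ge> 0" "D \<ge> 0" and smooth: "\<And>\<alpha> k. hermite_eigenvalue lam \<alpha> ^ k * l2_norm (weyl lam \<rho> (scaled_hermite lam \<alpha>))
      \<le> A * D ^ k * (fact (2 * k))\<^sup>2 * (\<Prod>j\<in>UNIV. 1 / (2 * real (\<alpha> $ j) + 1)\<^sup>2)"
    by (rule test_function_exists[OF lam \<delta>, of w0]) (rule that)
  have near: "norm (w - w0) \<le> e / 2" if "B w \<noteq> 0" for w
  proof -
    have coord: "cmod (w $ j - w0 $ j) \<le> 2 * \<delta>" for j
    proof (rule ccontr)
      assume "\<not> cmod (w $ j - w0 $ j) \<le> 2 * \<delta>"
      then have "2 * \<delta> \<le> cmod (w $ j - w0 $ j)" by simp
      then have "B w = 0" by (rule far)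
      with that show False by contradiction
    qed
    have "norm (w - w0) \<le> (\<Sum>j\<in>UNIV. cmod (w $ j - w0 $ j))"
      unfolding norm_vec_def vector_minus_component by (rule L2_set_le_sum) simp
    also have "\<dots> \<le> (\<Sum>j\<in>(UNIV :: 'n set). 2 * \<delta>)" by (intro sum_mono coord)
    also have "\<dots> = e / 2" using zero_less_card_finite[where 'a = 'n] by (simp add: \<delta>_def)
    finally show ?thesis .
  qed
  have \<rho>_norm: "cmod (\<rho> w) = B w" for w
    using arg_cong[OF \<rho>_eq[of w], of cmod] B(1)[of w] by (simp add: norm_mult cmod_twist)
  have sep: "norm (z - w) \<ge> e / 2" if z: "F z \<noteq> 0" and w: "\<rho> w \<noteq> 0" for z w
  proof -
    have "z \<notin> ball w0 e2" using vanish e2(2) z by blast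
    then have "norm (z - w0) \<ge> e" by (simp add: e_def dist_norm norm_minus_commute)
    moreover have "B w \<noteq> 0" using w \<rho>_norm[of w] by auto
    then have "norm (w - w0) \<le> e / 2" by (rule near)
    moreover have "norm (z - w0) \<le> norm (z - w) + norm (w - w0)"
      using norm_triangle_ineq[of "z - w" "w - w0"] by simp
    ultimately show ?thesis by simp
  qed
  have B_int: "integrable lborel B"
  proof -
    have "integrable lborel (\<lambda>w. cmod (\<rho> w))" using \<rho> by simp
    then show ?thesis unfolding \<rho>_norm .
  qed
  define H where "H p = F (fst p) * cnj (\<rho> (snd p)) * heat_kernel lam r (fst p) (snd p)" for p
  have H_int: "integrable (lborel \<Otimes>\<^sub>M lborel) H"
  proof -
    have "integrable lborel (\<lambda>w. cnj (\<rho> w))" using \<rho> by simp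
    from integrable_pair_product[OF F this]
    have i: "integrable (lborel \<Otimes>\<^sub>M lborel) (\<lambda>p. F (fst p) * cnj (\<rho> (snd p)))" .
    then have "integrable (lborel \<Otimes>\<^sub>M lborel) (\<lambda>p. cmod (F (fst p) * cnj (\<rho> (snd p))) * (1 / (1 - r) ^ CARD('n)))" by simp
    then show ?thesis
    proof (rule Bochner_Integration.integrable_bound)
      show "H \<in> borel_measurable (lborel \<Otimes>\<^sub>M lborel)"
        unfolding H_def by (rule heat_kernel_pairing_measurable[OF F \<rho> r(2)])
      have "cmod (heat_kernel lam r z w) \<le> 1 / (1 - r) ^ CARD('n)" for z w :: "complex ^ 'n"
        unfolding cmod_heat_kernel[OF r(2)] using r by (intro divide_right_mono) auto
      then have le: "norm (H p) \<le> cmod (F (fst p) * cnj (\<rho> (snd p))) * (1 / (1 - r) ^ CARD('n))" for p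
        unfolding H_def norm_mult[of "F (fst p) * cnj (\<rho> (snd p))"] by (intro mult_left_mono) auto
      show "AE p in lborel \<Otimes>\<^sub>M lborel. norm (H p) \<le> norm (cmod (F (fst p) * cnj (\<rho> (snd p))) * (1 / (1 - r) ^ CARD('n)))"
      proof (intro AE_I2)
        fix p
        show "norm (H p) \<le> norm (cmod (F (fst p) * cnj (\<rho> (snd p))) * (1 / (1 - r) ^ CARD('n)))"
          using le[of p] unfolding real_norm_def by (rule order_trans[OF _ abs_ge_self])
      qed
    qed
  qed
  then have H_int': "integrable (lborel \<Otimes>\<^sub>M lborel) (\<lambda>(z, w). H (z, w))" by simp
  have slice: "(LINT z|lborel. H (z, w)) = of_real (B w) * q w" for w
  proof -
    have "H (z, w) = of_real (B w) * twist lam w * (F z * heat_kernel lam r z w)" for z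
      unfolding H_def \<rho>_eq fst_conv snd_conv by (simp only: mult_ac)
    then show ?thesis unfolding q_def \<Psi>_def by (simp only: integral_mult_right_zero mult.assoc)
  qed
  have Bq_int: "integrable lborel (\<lambda>w. of_real (B w) * q w)"
    using lborel_pair.integrable_snd[OF H_int'] unfolding slice .
  have "(LINT w|lborel. of_real (B w) * q w) = (LINT p|(lborel \<Otimes>\<^sub>M lborel). H p)"
    using lborel_pair.integral_snd[OF H_int'] unfolding slice by simp
  also have "\<dots> = 0"
    unfolding H_def r_def
    by (rule heat_kernel_pairing_vanishes[OF lam F \<rho> nonneg anti diverge C decay AD smooth _ sep]) (use e in simp_all)
  finally have zero: "(LINT w|lborel. of_real (B w) * q w) = 0" .
  have "(LINT w|lborel. B w * ((cmod (q w0))\<^sup>2 / 2)) \<le> (LINT w|lborel. Re (of_real (B w) * q w * cnj (q w0)))"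
  proof (rule integral_mono)
    show "integrable lborel (\<lambda>w. B w * ((cmod (q w0))\<^sup>2 / 2))" using B_int by simp
    show "integrable lborel (\<lambda>w. Re (of_real (B w) * q w * cnj (q w0)))"
      by (intro integrable_Re integrable_mult_left Bq_int)
    fix w
    show "B w * ((cmod (q w0))\<^sup>2 / 2) \<le> Re (of_real (B w) * q w * cnj (q w0))"
    proof (cases "B w = 0")
      case False
      then have "dist w w0 < e1" using near[OF False] e by (simp add: dist_norm e_def)
      then have "cmod (q w - q w0) \<le> cmod (q w0) / 2" using e1(2) by (simp add: dist_norm less_imp_le)
      then have "cmod (q w - q w0) * cmod (q w0) \<le> cmod (q w0) / 2 * cmod (q w0)" by (rule mult_right_mono) simp
      then have "cmod ((q w - q w0) * cnj (q w0)) \<le> (cmod (q w0))\<^sup>2 / 2"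
        by (simp add: norm_mult power2_eq_square)
      then have "\<bar>Re ((q w - q w0) * cnj (q w0))\<bar> \<le> (cmod (q w0))\<^sup>2 / 2"
        using abs_Re_le_cmod[of "(q w - q w0) * cnj (q w0)"] by linarith
      moreover have "Re (q w * cnj (q w0)) = Re ((q w - q w0) * cnj (q w0)) + Re (q w0 * cnj (q w0))"
        by (simp add: algebra_simps)
      moreover have "Re (q w0 * cnj (q w0)) = (cmod (q w0))\<^sup>2" unfolding cmod_power2 by (simp add: power2_eq_square)
      ultimately have "(cmod (q w0))\<^sup>2 / 2 \<le> Re (q w * cnj (q w0))" by linarith
      then have "B w * ((cmod (q w0))\<^sup>2 / 2) \<le> B w * Re (q w * cnj (q w0))" by (rule mult_left_mono) (rule B(1))
      also have "\<dots> = Re (of_real (B w) * (q w * cnj (q w0)))" by simp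
      finally show ?thesis by (simp only: mult.assoc)
    qed simp
  qed
  also have "\<dots> = Re (LINT w|lborel. of_real (B w) * q w * cnj (q w0))"
    by (intro integral_Re integrable_mult_left Bq_int)
  also have "\<dots> = 0" unfolding integral_mult_left_zero zero by simp
  finally have "(LINT w|lborel. B w) * ((cmod (q w0))\<^sup>2 / 2) \<le> 0" by simp
  moreover have "(LINT w|lborel. B w) > 0" by (rule continuous_nonneg_integral_pos[OF B(3,1) B_int B(2)])
  moreover have "(cmod (q w0))\<^sup>2 / 2 > 0" using q0 by simp
  ultimately show False using mult_pos_pos not_less by blast
qed

lemma central_fourier_vanishes:
  fixes f :: "'n::finite heis \<Rightarrow> complex" and \<Theta> :: "real \<Rightarrow> real"
  assumes lam: "lam \<noteq> 0" and f: "integrable lborel f"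
    and nonneg: "\<And>t. t \<ge> 0 \<Longrightarrow> \<Theta> t \<ge> 0" and anti: "antimono_on {0..} \<Theta>"
    and diverge: "(\<integral>\<^sup>+ t\<in>{1..}. ennreal (\<Theta> t / t) \<partial>lborel) = \<infinity>"
    and C: "C \<ge> 0"
    and le: "l2_op_le (\<lambda>\<phi>. l2_adjoint (group_fourier f lam) (group_fourier f lam \<phi>))
        (\<lambda>\<phi> \<xi>. of_real C * hermite_calculus (\<lambda>s. of_real (exp (- 2 * \<Theta> (sqrt s) * sqrt s))) lam \<phi> \<xi>)"
    and U: "open U" "w0 \<in> U" and vanish: "AE z in lborel. z \<in> U \<longrightarrow> central_fourier f lam z = 0"
  shows "AE z in lborel. central_fourier f lam z = 0"
proof -
  define F where "F z = (if z \<in> U then 0 else central_fourier f lam z)" for z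
  have cf: "integrable lborel (central_fourier f lam)" by (rule integrable_central_fourier[OF f])
  have [measurable]: "U \<in> sets borel" using U(1) by simp
  have [measurable]: "central_fourier f lam \<in> borel_measurable borel" using borel_measurable_integrable[OF cf] by simp
  have F_meas [measurable]: "F \<in> borel_measurable borel" unfolding F_def by measurable
  have F_eq: "AE z in lborel. F z = central_fourier f lam z"
    using vanish by eventually_elim (simp add: F_def)
  have F: "integrable lborel F"
    by (rule Bochner_Integration.integrable_bound[OF cf]) (auto simp: F_def)
  have weyl_eq: "weyl lam F (scaled_hermite lam \<alpha>) = group_fourier f lam (scaled_hermite lam \<alpha>)" for \<alpha> :: "nat ^ 'n"
  proof -
    obtain c where c: "\<And>\<xi>. cmod (scaled_hermite lam \<alpha> \<xi>) \<le> c" using scaled_hermite_bounded by blast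
    have m [measurable]: "scaled_hermite lam \<alpha> \<in> borel_measurable borel"
      by (intro borel_measurable_continuous_onI continuous_intros)
    have "weyl lam F (scaled_hermite lam \<alpha>) \<xi> = weyl lam (central_fourier f lam) (scaled_hermite lam \<alpha>) \<xi>" for \<xi>
      unfolding weyl_def
    proof (rule integral_cong_AE)
      show "AE z in lborel. F z * schroedinger lam (z, 0) (scaled_hermite lam \<alpha>) \<xi> = central_fourier f lam z * schroedinger lam (z, 0) (scaled_hermite lam \<alpha>) \<xi>"
        using F_eq by eventually_elim simp
    qed measurable
    then show ?thesis unfolding group_fourier_eq_weyl[OF f m c] by (intro ext)
  qed
  have decay: "(l2_norm (weyl lam F (scaled_hermite lam \<alpha>)))\<^sup>2
      \<le> C * exp (- 2 * \<Theta> (sqrt (hermite_eigenvalue lam \<alpha>)) * sqrt (hermite_eigenvalue lam \<alpha>))" for \<alpha> :: "nat ^ 'n"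
    unfolding weyl_eq by (rule group_fourier_scaled_hermite_decay[OF f lam le])
  have "AE z in lborel. F z = 0"
  proof (rule AE_zero_if_heat_transform_vanishes[OF lam F _ _ U])
    show "0 < exp (- 2 * \<bar>lam\<bar>)" "exp (- 2 * \<bar>lam\<bar>) < 1" using lam by simp_all
    show "(LINT z|lborel. F z * heat_kernel lam (exp (- 2 * \<bar>lam\<bar>)) z w) = 0" if "w \<in> U" for w
      by (rule heat_transform_vanishes[OF lam F nonneg anti diverge C decay U(1) that]) (simp_all add: F_def)
  qed
  then show ?thesis using F_eq by eventually_elim simp
qed

section \<open>The theorem\<close>

text \<open>
  The Fourier transform of \<open>f\<close> at \<open>(w, s)\<close> is that of its partial transform at \<open>s\<close>.  The excluded
  value \<open>s = 0\<close> is reached by continuity.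
\<close>

lemma AE_zero_if_central_fourier_vanishes:
  fixes f :: "'n::finite heis \<Rightarrow> complex"
  assumes f: "integrable lborel f" and zero: "\<And>lam. lam \<noteq> 0 \<Longrightarrow> AE z in lborel. central_fourier f lam z = 0"
  shows "AE g in lborel. f g = 0"
proof (rule fourier_uniqueness[OF f])
  fix v :: "'n heis"
  obtain w s0 where v: "v = (w, s0)" by (cases v)
  have [measurable]: "f \<in> borel_measurable borel" using borel_measurable_integrable[OF f] by simp
  define e where "e s g = iexp ((w, s) \<bullet> g)" for s :: real and g :: "'n heis"
  have e_meas [measurable]: "e s \<in> borel_measurable borel" for s
    unfolding e_def[abs_def] by (intro borel_measurable_continuous_onI continuous_intros)
  have e_norm: "cmod (e s g) = 1" for s g unfolding e_def by (rule norm_exp_i_times)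
  have nonzero: "(LINT g|lborel. e s g * f g) = 0" if s: "s \<noteq> 0" for s
  proof -
    have "integrable lborel (\<lambda>g. e s g * f g)"
      using f by (rule integrable_unimodular_times) (simp_all add: e_norm)
    then have i: "integrable (lborel \<Otimes>\<^sub>M lborel) (\<lambda>(z, t). e s (z, t) * f (z, t))"
      unfolding lborel_prod by (simp add: case_prod_unfold)
    have split: "e s (z, t) * f (z, t) = iexp (w \<bullet> z) * (iexp (s * t) * f (z, t))" for z t
    proof -
      have "e s (z, t) = iexp (w \<bullet> z) * iexp (s * t)"
        unfolding e_def inner_Pair exp_add[symmetric] by (simp add: distrib_left)
      then show ?thesis by (simp only: mult.assoc)
    qed
    have "(LINT g|lborel. e s g * f g) = (LINT g|(lborel \<Otimes>\<^sub>M lborel). (case g of (z, t) \<Rightarrow> e s (z, t) * f (z, t)))"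
      unfolding lborel_prod by (simp add: case_prod_unfold)
    also have "\<dots> = (LINT z|lborel. (LINT t|lborel. e s (z, t) * f (z, t)))"
      by (rule lborel_pair.integral_fst[OF i, symmetric])
    also have "\<dots> = (LINT z|lborel. iexp (w \<bullet> z) * central_fourier f s z)"
      unfolding split integral_mult_right_zero central_fourier_def ..
    also have "\<dots> = 0"
      by (rule integral_eq_zero_AE, rule AE_mp[OF zero[OF s]]) simp
    finally show ?thesis .
  qed
  show "(LINT x|lborel. iexp (v \<bullet> x) * f x) = 0"
  proof (cases "s0 = 0")
    case False
    show ?thesis using nonzero[OF False] unfolding e_def v .
  next
    case True
    have "(\<lambda>n. LINT g|lborel. e (inverse (real (Suc n))) g * f g) \<longlonglongrightarrow> (LINT g|lborel. e 0 g * f g)"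
    proof (rule integral_dominated_convergence[where w = "\<lambda>g. cmod (f g)"])
      show "integrable lborel (\<lambda>g. cmod (f g))" using f by simp
      show "AE g in lborel. (\<lambda>n. e (inverse (real (Suc n))) g * f g) \<longlonglongrightarrow> e 0 g * f g"
        unfolding e_def by (intro AE_I2 tendsto_intros LIMSEQ_inverse_real_of_nat)
      show "AE g in lborel. norm (e (inverse (real (Suc n))) g * f g) \<le> cmod (f g)" for n
        by (intro AE_I2) (simp add: norm_mult e_norm)
    qed measurable
    moreover have "(LINT g|lborel. e (inverse (real (Suc n))) g * f g) = 0" for n by (rule nonzero) simp
    ultimately have "(\<lambda>n::nat. 0) \<longlonglongrightarrow> (LINT g|lborel. e 0 g * f g)" by simp
    then have "(LINT g|lborel. e 0 g * f g) = 0" by (simp add: LIMSEQ_const_iff)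
    then show ?thesis unfolding e_def v True .
  qed
qed

theorem theorem1p5:
  fixes \<Theta> :: "real \<Rightarrow> real"
    and f :: "'n::finite heis \<Rightarrow> complex"
  assumes "\<And>t. t \<ge> 0 \<Longrightarrow> \<Theta> t \<ge> 0"
    and "antimono_on {0..} \<Theta>"
    and "(\<Theta> \<longlongrightarrow> 0) at_top"
    and "(\<integral>\<^sup>+ t\<in>{1..}. ennreal (\<Theta> t / t) \<partial>lborel) = \<infinity>"
    and "integrable lborel f"
    and "\<exists>C>0. \<forall>lam. lam \<noteq> 0 \<longrightarrow>
      l2_op_le (\<lambda>\<phi>. l2_adjoint (group_fourier f lam) (group_fourier f lam \<phi>))
        (\<lambda>\<phi> \<xi>. of_real C *
          hermite_calculus (\<lambda>s. of_real (exp (- 2 * \<Theta> (sqrt s) * sqrt s))) lam \<phi> \<xi>)"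
    and "\<And>lam. lam \<noteq> 0 \<Longrightarrow> \<exists>U. open U \<and> U \<noteq> {} \<and>
      (AE z in lborel. z \<in> U \<longrightarrow> central_fourier f lam z = 0)"
  shows "AE g in lborel. f g = 0"
proof (rule AE_zero_if_central_fourier_vanishes[OF assms(5)])
  fix lam :: real assume lam: "lam \<noteq> 0"
  obtain C where C: "C > 0" and le: "l2_op_le (\<lambda>\<phi>. l2_adjoint (group_fourier f lam) (group_fourier f lam \<phi>))
        (\<lambda>\<phi> \<xi>. of_real C *
          hermite_calculus (\<lambda>s. of_real (exp (- 2 * \<Theta> (sqrt s) * sqrt s))) lam \<phi> \<xi>)"
    using assms(6) lam by blast
  obtain U w0 where U: "open U" "w0 \<in> U" "AE z in lborel. z \<in> U \<longrightarrow> central_fourier f lam z = 0"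
    using assms(7)[OF lam] by blast
  show "AE z in lborel. central_fourier f lam z = 0"
    by (rule central_fourier_vanishes[OF lam assms(5,1,2,4) less_imp_le[OF C] le U])
qed

end
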